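(* Let $(R,\mathfrak m)$ be a Cohen-Macaulay $F$-injective Noetherian local ring of prime characteristic $p$. Then $\mathcal{A}(R)=\mathcal{C}(R)$.
   Context: For a Noetherian local ring $(A,\mathfrak n)$ of prime characteristic $p$, the Frobenius $r\mapsto r^p$ acts on $A$ and its localizations, hence on the Čech complex of a system of parameters, and so induces a natural Frobenius action $F$ (an additive map with $F(rm)=r^pF(m)$) on each local cohomology module $H^i_{\mathfrak n}(A)$. $A$ is $F$-injective if $F$ is injective on $H^i_{\mathfrak n}(A)$ for all $i$. For an Artinian $A$-module $M$ with Frobenius action $F$ and socle $S=\{x\in M:\mathfrak n x=0\}$, put $F^e(S)=\{F^e(m):m\in S\}$. $M$ is $F$-unstable if there exists $N>0$ with $S\cap F^e(S)=0$ for all $e\ge N$ (the zero module is $F$-unstable), and $F$-stable otherwise. The ring $A$ is $F$-unstable if $H^i_{\mathfrak n}(A)$ is $F$-unstable for every $i$, and $F$-stable otherwise; if $A$ is Cohen-Macaulay of dimension $d$, $A$ is $F$-stable iff $H^d_{\mathfrak n}(A)$ is $F$-stable. If $A$ contains a coefficient field $k$ (a subfield mapping isomorphically onto $A/\mathfrak n$), the stable part of $M$ is $M_s=\bigcap_{j\ge1}\langle F^j(M)\rangle_k$, where $\langle F^j(M)\rangle_k$ is the $k$-span of $F^j(M)=\{F^j(m):m\in M\}$; $\dim_k M_s$ does not depend on the choice of $k$. $\mathcal A(R)=\{P\in\mathrm{Spec}(R): R_P \text{ is } F\text{-stable}\}$. $\mathcal C(R)=\{P\in\mathrm{Spec}(R):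 \text{there exists } h \text{ such that } H^h_{P\widehat{R_P}}(\widehat{R_P})_s\ne 0\}$, where $\widehat{R_P}$ is the completion of the local ring $R_P$ and the stable part is taken with respect to a coefficient field of $\widehat{R_P}$. *)

theory Defs
  imports "HOL-Computational_Algebra.Primes" "HOL-Library.Extended_Nat"
    "HOL-Algebra.Ring_Divisibility" "HOL-Algebra.Subrings"
    "HOL-Algebra.Ideal_Product" "HOL-Algebra.QuotRing" "HOL-Algebra.Module"
begin

section \<open>Local rings\<close>

definition local_ring :: "('a, 'm) ring_scheme \<Rightarrow> bool" where
  "local_ring A \<longleftrightarrow> cring A \<and> (\<exists>!M. maximalideal M A)"

definition max_ideal :: "('a, 'm) ring_scheme \<Rightarrow> 'a set" where
  "max_ideal A = (THE M. maximalideal M A)"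

definition noetherian_local_ring :: "('a, 'm) ring_scheme \<Rightarrow> bool" where
  "noetherian_local_ring A \<longleftrightarrow> local_ring A \<and> noetherian_ring A"

text \<open>The kernel of the map from the integers to \<open>A\<close> is generated by \<open>p\<close>.\<close>

definition has_characteristic :: "('a, 'm) ring_scheme \<Rightarrow> nat \<Rightarrow> bool" where
  "has_characteristic A p \<longleftrightarrow> (\<forall>n::nat. [n] \<cdot>\<^bsub>A\<^esub> \<one>\<^bsub>A\<^esub> = \<zero>\<^bsub>A\<^esub> \<longleftrightarrow> p dvd n)"

definition krull_dim :: "('a, 'm) ring_scheme \<Rightarrow> enat" where
  "krull_dim A = Sup {enat n | n. \<exists>Q :: nat \<Rightarrow> 'a set.
     (\<forall>i\<le>n. primeideal (Q i) A) \<and> (\<forall>i<n. Q i \<subset> Q (Suc i))}"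

definition regular_sequence :: "('a, 'm) ring_scheme \<Rightarrow> 'a list \<Rightarrow> bool" where
  "regular_sequence A xs \<longleftrightarrow> set xs \<subseteq> carrier A \<and> Idl\<^bsub>A\<^esub> (set xs) \<noteq> carrier A \<and>
     (\<forall>i<length xs. \<forall>a\<in>carrier A.
        xs ! i \<otimes>\<^bsub>A\<^esub> a \<in> Idl\<^bsub>A\<^esub> (set (take i xs)) \<longrightarrow> a \<in> Idl\<^bsub>A\<^esub> (set (take i xs)))"

definition local_depth :: "('a, 'm) ring_scheme \<Rightarrow> enat" where
  "local_depth A = Sup {enat (length xs) | xs. regular_sequence A xs \<and> set xs \<subseteq> max_ideal A}"

definition cohen_macaulay_local_ring :: "('a, 'm) ring_scheme \<Rightarrow> bool" where
  "cohen_macaulay_local_ring A \<longleftrightarrow> noetherian_local_ring A \<and> local_depth A = krull_dim A"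

definition system_of_parameters :: "('a, 'm) ring_scheme \<Rightarrow> 'a list \<Rightarrow> bool" where
  "system_of_parameters A xs \<longleftrightarrow>
     set xs \<subseteq> max_ideal A \<and> enat (length xs) = krull_dim A \<and>
     {a \<in> carrier A. \<exists>k::nat. a [^]\<^bsub>A\<^esub> k \<in> Idl\<^bsub>A\<^esub> (set xs)} = max_ideal A"


section \<open>Localization\<close>

text \<open>Here \<open>D\<close> is a multiplicative subset of \<open>A\<close>. A fraction is an equivalence class of pairs
  (numerator, denominator). The unions in the definitions below are over sets that all coincide.\<close>

definition frac_rel :: "('a, 'm) ring_scheme \<Rightarrow> 'a set \<Rightarrow> (('a \<times> 'a) \<times> ('a \<times> 'a)) set" where
  "frac_rel A D = {((r, s), (r', s')). r \<in> carrier A \<and> r' \<in> carrier A \<and> s \<in> D \<and> s' \<in> D \<and>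
     (\<exists>t\<in>D. t \<otimes>\<^bsub>A\<^esub> (s' \<otimes>\<^bsub>A\<^esub> r) = t \<otimes>\<^bsub>A\<^esub> (s \<otimes>\<^bsub>A\<^esub> r'))}"

definition fraction :: "('a, 'm) ring_scheme \<Rightarrow> 'a set \<Rightarrow> 'a \<Rightarrow> 'a \<Rightarrow> ('a \<times> 'a) set" where
  "fraction A D r s = frac_rel A D `` {(r, s)}"

definition localization :: "('a, 'm) ring_scheme \<Rightarrow> 'a set \<Rightarrow> ('a \<times> 'a) set ring" where
  "localization A D =
     \<lparr>carrier = (carrier A \<times> D) // frac_rel A D,
      mult = (\<lambda>U V. \<Union>u\<in>U. \<Union>v\<in>V. fraction A D (fst u \<otimes>\<^bsub>A\<^esub> fst v) (snd u \<otimes>\<^bsub>A\<^esub> snd v)),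
      one = fraction A D \<one>\<^bsub>A\<^esub> \<one>\<^bsub>A\<^esub>,
      zero = fraction A D \<zero>\<^bsub>A\<^esub> \<one>\<^bsub>A\<^esub>,
      add = (\<lambda>U V. \<Union>u\<in>U. \<Union>v\<in>V.
               fraction A D (snd v \<otimes>\<^bsub>A\<^esub> fst u \<oplus>\<^bsub>A\<^esub> snd u \<otimes>\<^bsub>A\<^esub> fst v)
                 (snd u \<otimes>\<^bsub>A\<^esub> snd v))\<rparr>"

definition localization_at_prime :: "('a, 'm) ring_scheme \<Rightarrow> 'a set \<Rightarrow> ('a \<times> 'a) set ring" where
  "localization_at_prime A P = localization A (carrier A - P)"

text \<open>The canonical map into the localization at a larger multiplicative set \<open>E\<close>.\<close>

definition frac_map :: "('a, 'm) ring_scheme \<Rightarrow> 'a set \<Rightarrow> ('a \<times> 'a) set \<Rightarrow> ('a \<times> 'a) set" where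
  "frac_map A E U = (\<Union>u\<in>U. fraction A E (fst u) (snd u))"


section \<open>Completion\<close>

text \<open>The inverse limit of the rings \<open>A / I\<^sup>n\<close>: an element is a sequence of cosets of the
  powers of \<open>I\<close>, and the coset at \<open>n + 1\<close> maps to the coset at \<open>n\<close> iff it is contained in it.\<close>

definition adic_completion :: "('a, 'm) ring_scheme \<Rightarrow> 'a set \<Rightarrow> (nat \<Rightarrow> 'a set) ring" where
  "adic_completion A I = (let Q = (\<lambda>n::nat. A Quot (I [^]\<^bsub>ideals_set A\<^esub> n)) in
     \<lparr>carrier = {f. \<forall>n. f n \<in> carrier (Q n) \<and> f (Suc n) \<subseteq> f n},
      mult = (\<lambda>f g n. f n \<otimes>\<^bsub>Q n\<^esub> g n),
      one = (\<lambda>n. \<one>\<^bsub>Q n\<^esub>),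
      zero = (\<lambda>n. \<zero>\<^bsub>Q n\<^esub>),
      add = (\<lambda>f g n. f n \<oplus>\<^bsub>Q n\<^esub> g n)\<rparr>)"

definition completion :: "('a, 'm) ring_scheme \<Rightarrow> (nat \<Rightarrow> 'a set) ring" where
  "completion A = adic_completion A (max_ideal A)"


section \<open>The Cech complex and local cohomology\<close>

text \<open>The multiplicative set generated by the \<open>x\<^sub>j\<close> with \<open>j \<in> J\<close>. Inverting it is the same as
  inverting the single element \<open>\<Prod>j\<in>J. x\<^sub>j\<close>; with this choice the denominators for \<open>J\<close> are
  denominators for every larger index set, so that \<^const>\<open>frac_map\<close> is defined between them.\<close>

definition monomials :: "('a, 'm) ring_scheme \<Rightarrow> 'a list \<Rightarrow> nat set \<Rightarrow> 'a set" where
  "monomials A xs J = {\<Otimes>\<^bsub>A\<^esub>j\<in>J. xs ! j [^]\<^bsub>A\<^esub> e j | e :: nat \<Rightarrow> nat. True}"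

definition cech_ring :: "('a, 'm) ring_scheme \<Rightarrow> 'a list \<Rightarrow> nat set \<Rightarrow> ('a \<times> 'a) set ring" where
  "cech_ring A xs J = localization A (monomials A xs J)"

definition cech_index :: "'a list \<Rightarrow> nat \<Rightarrow> nat set set" where
  "cech_index xs i = {J. J \<subseteq> {..<length xs} \<and> card J = i}"

text \<open>In this and the following module records, the ring multiplication and unit carry no meaning.\<close>

definition cech_module ::
  "('a, 'm) ring_scheme \<Rightarrow> 'a list \<Rightarrow> nat \<Rightarrow> ('a, nat set \<Rightarrow> ('a \<times> 'a) set) module" where
  "cech_module A xs i =
     \<lparr>carrier = (\<Pi>\<^sub>E J\<in>cech_index xs i. carrier (cech_ring A xs J)),
      mult = undefined,
      one = undefined,
      zero = (\<lambda>J\<in>cech_index xs i. \<zero>\<^bsub>cech_ring A xs J\<^esub>),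
      add = (\<lambda>c c'. \<lambda>J\<in>cech_index xs i. c J \<oplus>\<^bsub>cech_ring A xs J\<^esub> c' J),
      smult = (\<lambda>a c. \<lambda>J\<in>cech_index xs i.
                 fraction A (monomials A xs J) a \<one>\<^bsub>A\<^esub> \<otimes>\<^bsub>cech_ring A xs J\<^esub> c J)\<rparr>"

definition cech_d ::
  "('a, 'm) ring_scheme \<Rightarrow> 'a list \<Rightarrow> nat \<Rightarrow>
     (nat set \<Rightarrow> ('a \<times> 'a) set) \<Rightarrow> (nat set \<Rightarrow> ('a \<times> 'a) set)" where
  "cech_d A xs i c = (\<lambda>J\<in>cech_index xs (Suc i).
     \<Oplus>\<^bsub>cech_ring A xs J\<^esub>j\<in>J.
       (let y = frac_map A (monomials A xs J) (c (J - {j}))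
        in if even (card {l\<in>J. l < j}) then y else \<ominus>\<^bsub>cech_ring A xs J\<^esub> y))"

definition cech_cocycles ::
  "('a, 'm) ring_scheme \<Rightarrow> 'a list \<Rightarrow> nat \<Rightarrow> (nat set \<Rightarrow> ('a \<times> 'a) set) set" where
  "cech_cocycles A xs i =
     {c \<in> carrier (cech_module A xs i). cech_d A xs i c = \<zero>\<^bsub>cech_module A xs (Suc i)\<^esub>}"

definition cech_coboundaries ::
  "('a, 'm) ring_scheme \<Rightarrow> 'a list \<Rightarrow> nat \<Rightarrow> (nat set \<Rightarrow> ('a \<times> 'a) set) set" where
  "cech_coboundaries A xs i = (case i of
       0 \<Rightarrow> {\<zero>\<^bsub>cech_module A xs 0\<^esub>}
     | Suc k \<Rightarrow> cech_d A xs k ` carrier (cech_module A xs k))"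

definition cech_class ::
  "('a, 'm) ring_scheme \<Rightarrow> 'a list \<Rightarrow> nat \<Rightarrow>
     (nat set \<Rightarrow> ('a \<times> 'a) set) \<Rightarrow> (nat set \<Rightarrow> ('a \<times> 'a) set) set" where
  "cech_class A xs i c = cech_coboundaries A xs i +>\<^bsub>cech_module A xs i\<^esub> c"

definition cech_cohomology ::
  "('a, 'm) ring_scheme \<Rightarrow> 'a list \<Rightarrow> nat \<Rightarrow> ('a, (nat set \<Rightarrow> ('a \<times> 'a) set) set) module" where
  "cech_cohomology A xs i =
     \<lparr>carrier = cech_class A xs i ` cech_cocycles A xs i,
      mult = undefined,
      one = undefined,
      zero = cech_coboundaries A xs i,
      add = (\<lambda>U V. U <+>\<^bsub>cech_module A xs i\<^esub> V),
      smult = (\<lambda>a U. \<Union>c\<in>U. cech_class A xs i (a \<odot>\<^bsub>cech_module A xs i\<^esub> c))\<rparr>"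

text \<open>In a ring of characteristic \<open>p\<close>, the Frobenius \<open>y \<mapsto> y\<^sup>p\<close> of each localization commutes with
  the differentials.\<close>

definition cech_frobenius ::
  "nat \<Rightarrow> ('a, 'm) ring_scheme \<Rightarrow> 'a list \<Rightarrow> nat \<Rightarrow>
     (nat set \<Rightarrow> ('a \<times> 'a) set) \<Rightarrow> (nat set \<Rightarrow> ('a \<times> 'a) set)" where
  "cech_frobenius p A xs i c = (\<lambda>J\<in>cech_index xs i. c J [^]\<^bsub>cech_ring A xs J\<^esub> p)"

definition cech_cohomology_frobenius ::
  "nat \<Rightarrow> ('a, 'm) ring_scheme \<Rightarrow> 'a list \<Rightarrow> nat \<Rightarrow>
     (nat set \<Rightarrow> ('a \<times> 'a) set) set \<Rightarrow> (nat set \<Rightarrow> ('a \<times> 'a) set) set" where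
  "cech_cohomology_frobenius p A xs i U = (\<Union>c\<in>U. cech_class A xs i (cech_frobenius p A xs i c))"

text \<open>Local cohomology with support in the maximal ideal of a Noetherian local ring. Up to an
  isomorphism compatible with the Frobenius actions, it does not depend on the system of
  parameters.\<close>

definition chosen_parameters :: "('a, 'm) ring_scheme \<Rightarrow> 'a list" where
  "chosen_parameters A = (SOME xs. system_of_parameters A xs)"

definition local_cohomology ::
  "('a, 'm) ring_scheme \<Rightarrow> nat \<Rightarrow> ('a, (nat set \<Rightarrow> ('a \<times> 'a) set) set) module" where
  "local_cohomology A i = cech_cohomology A (chosen_parameters A) i"

definition local_cohomology_frobenius ::
  "nat \<Rightarrow> ('a, 'm) ring_scheme \<Rightarrow> nat \<Rightarrow>
     (nat set \<Rightarrow> ('a \<times> 'a) set) set \<Rightarrow> (nat set \<Rightarrow> ('a \<times> 'a) set) set" where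
  "local_cohomology_frobenius p A i = cech_cohomology_frobenius p A (chosen_parameters A) i"


section \<open>F-injectivity and F-stability\<close>

definition F_injective :: "nat \<Rightarrow> ('a, 'm) ring_scheme \<Rightarrow> bool" where
  "F_injective p A \<longleftrightarrow>
     (\<forall>i. inj_on (local_cohomology_frobenius p A i) (carrier (local_cohomology A i)))"

definition socle :: "('a, 'm) ring_scheme \<Rightarrow> ('a, 'b, 'n) module_scheme \<Rightarrow> 'b set" where
  "socle A M = {x \<in> carrier M. \<forall>a\<in>max_ideal A. a \<odot>\<^bsub>M\<^esub> x = \<zero>\<^bsub>M\<^esub>}"

definition F_unstable_module ::
  "('a, 'm) ring_scheme \<Rightarrow> ('a, 'b, 'n) module_scheme \<Rightarrow> ('b \<Rightarrow> 'b) \<Rightarrow> bool" where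
  "F_unstable_module A M F \<longleftrightarrow>
     (\<exists>N>0. \<forall>e\<ge>N. socle A M \<inter> (F ^^ e) ` socle A M = {\<zero>\<^bsub>M\<^esub>})"

definition F_unstable :: "nat \<Rightarrow> ('a, 'm) ring_scheme \<Rightarrow> bool" where
  "F_unstable p A \<longleftrightarrow>
     (\<forall>i. F_unstable_module A (local_cohomology A i) (local_cohomology_frobenius p A i))"

abbreviation F_stable :: "nat \<Rightarrow> ('a, 'm) ring_scheme \<Rightarrow> bool" where
  "F_stable p A \<equiv> \<not> F_unstable p A"


section \<open>Stable parts\<close>

definition coefficient_field :: "'a set \<Rightarrow> ('a, 'm) ring_scheme \<Rightarrow> bool" where
  "coefficient_field K A \<longleftrightarrow> subfield K A \<and>
     (\<lambda>x. max_ideal A +>\<^bsub>A\<^esub> x) \<in> ring_iso (A\<lparr>carrier := K\<rparr>) (A Quot (max_ideal A))"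

definition field_span ::
  "('a, 'm) ring_scheme \<Rightarrow> 'a set \<Rightarrow> ('a, 'b, 'n) module_scheme \<Rightarrow> 'b set \<Rightarrow> 'b set" where
  "field_span A K M B = \<Inter>{V. submodule V (A\<lparr>carrier := K\<rparr>) M \<and> B \<subseteq> V}"

definition stable_part ::
  "('a, 'm) ring_scheme \<Rightarrow> 'a set \<Rightarrow> ('a, 'b, 'n) module_scheme \<Rightarrow> ('b \<Rightarrow> 'b) \<Rightarrow> 'b set" where
  "stable_part A K M F = (\<Inter>j\<in>{1..}. field_span A K M ((F ^^ j) ` carrier M))"


section \<open>The two loci\<close>

definition F_stable_locus :: "nat \<Rightarrow> ('a, 'm) ring_scheme \<Rightarrow> 'a set set" where
  "F_stable_locus p R = {P. primeideal P R \<and> F_stable p (localization_at_prime R P)}"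

text \<open>Coefficient fields exist by Cohen's structure theorem, and whether a stable part vanishes
  does not depend on the coefficient field.\<close>

definition nonzero_stable_part_locus :: "nat \<Rightarrow> ('a, 'm) ring_scheme \<Rightarrow> 'a set set" where
  "nonzero_stable_part_locus p R = {P. primeideal P R \<and>
     (let A = completion (localization_at_prime R P) in
      \<exists>K. coefficient_field K A \<and>
        (\<exists>h. stable_part A K (local_cohomology A h) (local_cohomology_frobenius p A h)
               \<noteq> {\<zero>\<^bsub>local_cohomology A h\<^esub>}))}"

end

theory Submission
 imports Defs
begin

no_notation Sum_Type.Plus (infixr "<+>" 65)

text \<open>For a system of parameters \<open>x\<close> of a Cohen-Macaulay ring \<open>A\<close> of dimension \<open>d\<close>, the top local cohomology is the direct limit of
 the rings \<open>A / (x\<^sub>1\<^sup>N, \<dots>, x\<^sub>d\<^sup>N)\<close> along injective maps. Hence F-injectivity says that parameter ideals are Frobenius closed, and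
 F-stability that for every \<open>e\<close> there is a socle element \<open>a\<close> of \<open>A / (x)\<close> such that the maximal ideal multiplies \<open>a\<^sup>q\<close> into
 \<open>(x\<^sub>1\<^sup>q, \<dots>, x\<^sub>d\<^sup>q)\<close>, \<open>q = p\<^sup>e\<close>. Both conditions can be tested modulo a power of the maximal ideal, so they pass to the
 completion, and F-injectivity also localizes. Over a complete ring, a nonzero stable part yields a socle element all of whose Frobenius
 images lie in the socle, through a Groebner-like flag of the cohomology module; conversely, the descending chain condition
 on the socle produces nonzero elements of the stable part.\<close>

section \<open>Ideals and primes in Noetherian rings\<close>

text \<open>\<open>F\<close> is injective on the cohomology but need not be surjective, and the
  residue field need not be perfect. The spans that define the stable part are therefore a
  descending chain of \<open>K\<close>-spaces, possibly of infinite dimension, that need not be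
  submodules over the ring, and no chain condition applies to them. The remedy is to compute with
  pairs \<open>(J, u)\<close> that stand for a formal preimage of \<open>u\<close> under
  \<open>F ^^ J\<close>. An element of the stable part yields such preimages with any prescribed
  number of Frobenius images in the socle, but with a \<open>J\<close> that depends on this number.
  To make one pair serve for all numbers, each pair receives a leading step in a flag indexed by
  monomials and hyperplanes. Dickson's lemma leaves finitely many leading steps, and pairs with the
  same final leading step agree up to a scalar. All comparisons of parameter ideals rest on one
  device: two systems of parameters are linked by replacing one entry at a time, and a replacement
  embeds one parameter quotient into another by a multiplication that is compatible with Frobenius.
  These quotients appear only through membership in ideals.\<close>

context cring
begin

abbreviation carr ("\<R>") where "\<R> \<equiv> carrier R"

lemma idealI':
 assumes "I\<subseteq>\<R>" "\<zero>\<in>I" "\<And>a b. a\<in>I ==> b\<in>I ==> a\<oplus>b\<in>I"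
  "\<And>a r. a\<in>I ==> r\<in>\<R> ==> r\<otimes>a\<in>I" shows "ideal I R"
proof (rule idealI)
 show "ring R" by (rule ring_axioms)
 show "subgroup I (add_monoid R)"
 proof (rule add.subgroupI)
  show "I\<subseteq>\<R>" by fact
  show "I\<noteq>{}" using assms(2) by blast
  show "\<ominus> a\<in>I" if "a\<in>I" for a
  proof -
   have "a\<in>\<R>" using that assms(1) by blast
   hence "\<ominus> a = (\<ominus> \<one>)\<otimes>a" by algebra
   thus ?thesis using assms(4)[OF that, of "\<ominus> \<one>"] by simp
  qed
  show "a\<oplus>b\<in>I" if "a\<in>I" "b\<in>I" for a b using that assms(3) by simp
 qed
 show "x\<otimes>a\<in>I" if "a\<in>I" "x\<in>\<R>" for a x using that assms(4) by simp
 show "a\<otimes>x\<in>I" if "a\<in>I" "x\<in>\<R>" for a x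
 proof -
  have "a\<in>\<R>" using that assms(1) by blast
  thus ?thesis using that assms(4)[OF that] m_comm by simp
 qed
qed

lemma idl_carr: "ideal I R ==> a\<in>I ==> a\<in>\<R>" using ideal.Icarr by metis
lemma idl_sub: "ideal I R ==> I\<subseteq>\<R>" using idl_carr by blast
lemma idl_zero: "ideal I R ==> \<zero>\<in>I" by (simp add: additive_subgroup.zero_closed ideal.axioms(1))
lemma idl_add: "ideal I R ==> a\<in>I ==> b\<in>I ==> a\<oplus>b\<in>I" by (simp add: additive_subgroup.a_closed ideal.axioms(1))
lemma idl_l: "ideal I R ==> a\<in>I ==> r\<in>\<R> ==> r\<otimes>a\<in>I" by (rule ideal.I_l_closed)
lemma idl_r: "ideal I R ==> a\<in>I ==> r\<in>\<R> ==> a\<otimes>r\<in>I" by (rule ideal.I_r_closed)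
lemma idl_neg: "ideal I R ==> a\<in>I ==> \<ominus>a\<in>I" by (simp add: additive_subgroup.a_inv_closed ideal.axioms(1))
lemma idl_minus: "ideal I R ==> a\<in>I ==> b\<in>I ==> a\<ominus>b\<in>I" by (simp add: idl_add idl_neg minus_eq)
lemma idl_cancel: "ideal I R ==> a\<oplus>b\<in>I ==> b\<in>I ==> a\<in>\<R> ==> a\<in>I"
 using idl_minus[of I "a\<oplus>b" b] idl_carr by (simp add: minus_eq a_assoc r_neg)
lemma idl_cancel_minus: "ideal I R ==> a\<ominus>b\<in>I ==> b\<in>I ==> a\<in>\<R> ==> a\<in>I"
 using idl_add[of I "a\<ominus>b" b] idl_carr by (simp add: minus_eq a_assoc l_neg)
lemma idl_one: "ideal I R ==> \<one>\<in>I ==> I = \<R>" by (rule ideal.one_imp_carrier)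
lemma idl_pow: "ideal I R ==> a\<in>I ==> n > 0 ==> a[^](n::nat)\<in>I" using idl_carr[of I a] by (cases n) (auto intro: idl_l)
lemma idl_pow_ge: "ideal I R ==> a\<in>\<R> ==> a[^](m::nat)\<in>I ==> m\<le>n ==> a[^]n\<in>I"
 using idl_l[of I "a[^]m" "a[^](n - m)"] by (simp add: nat_pow_mult)

lemma primeD: "primeideal P R ==> a\<in>\<R> ==> b\<in>\<R> ==> a\<otimes>b\<in>P ==> a\<in>P \<or> b\<in>P" by (rule primeideal.I_prime)
lemma prime_ideal: "primeideal P R ==> ideal P R" by (simp add: primeideal_def)
lemma prime_one: "primeideal P R ==> \<one>\<notin>P" using idl_one primeideal.I_notcarr prime_ideal by auto
lemma prime_pow: "primeideal P R ==> a\<in>\<R> ==> a[^](n::nat)\<in>P ==> a\<in>P"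
proof (induction n)
 case 0 thus ?case using prime_one by simp
next
 case (Suc n) thus ?case using primeD[of P "a[^]n" a] by auto
qed

lemma local_ringI':
 assumes M: "ideal M R" "\<one>\<notin>M" and J: "\<And>J. ideal J R ==> \<one>\<notin>J ==> J\<subseteq>M"
 shows "maximalideal M R \<and> (\<forall>M'. maximalideal M' R \<longrightarrow> M' = M)"
proof
 show mM: "maximalideal M R"
 proof (rule maximalidealI[OF M(1)])
  show "\<R>\<noteq>M" using M(2) one_closed by auto
  show "J' = M \<or> J' = \<R>" if "ideal J' R" "M\<subseteq>J'" "J'\<subseteq>\<R>" for J' using J[OF that(1)] idl_one[OF that(1)] that(2) by blast
 qed
 show "\<forall>M'. maximalideal M' R \<longrightarrow> M' = M"
 proof (intro allI impI)
  fix M' assume M': "maximalideal M' R"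
  have Mi: "ideal M' R" using M' by (simp add: maximalideal_def)
  have "\<one>\<notin>M'" using idl_one[OF Mi] maximalideal.I_notcarr[OF M'] by auto
  hence "M'\<subseteq>M" by (rule J[OF Mi])
  hence "M = M' \<or> M = \<R>" using maximalideal.I_maximal[OF M' M(1)] idl_sub[OF M(1)] by simp
  thus "M' = M" using M(2) one_closed by auto
 qed
qed

lemma idl_mult_pow:
 assumes I: "ideal I R" and c: "r\<in>\<R>" "a\<in>\<R>" "r\<otimes>a[^]n\<in>I" and n: "n > (0::nat)" shows "(r\<otimes>a)[^]n\<in>I"
proof -
 obtain k where k: "n = Suc k" using n gr0_implies_Suc by auto
 have "r[^]k\<otimes>(r\<otimes>a[^]n)\<in>I" using idl_l[OF I c(3)] c(1) by simp
 thus ?thesis using c(1,2) unfolding k by (simp add: nat_pow_distrib m_ac)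
qed

text \<open>For \<open>P\<close> the whole ring this is the ideal generated by \<open>I\<close> and
  \<open>x\<close>. Coefficients confined to a prime occur in Nakayama's lemma, and coefficients
  confined to a power of the maximal ideal in convergent combinations.\<close>

definition adjm where "adjm I P x = {i\<oplus>r\<otimes>x | i r. i\<in>I \<and> r\<in>P}"
abbreviation adj where "adj I x\<equiv>adjm I (\<R>) x"

lemma adjm_ideal:
 assumes "ideal I R" "ideal P R" "x\<in>\<R>" shows "ideal (adjm I P x) R"
proof (rule idealI')
 note c = idl_carr[OF assms(1)] idl_carr[OF assms(2)]
 show "adjm I P x\<subseteq>\<R>" using c assms(3) by (auto simp: adjm_def)
 show "\<zero>\<in>adjm I P x" unfolding adjm_def using idl_zero assms by (auto intro!: exI[of _ "\<zero>"])
 fix a assume "a\<in>adjm I P x"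
 then obtain i r where a: "i\<in>I" "r\<in>P" "a = i\<oplus>r\<otimes>x" by (auto simp: adjm_def)
 note [simp] = c(1)[OF a(1)] c(2)[OF a(2)] assms(3)
 { fix b assume "b\<in>adjm I P x"
  then obtain j s where b: "j\<in>I" "s\<in>P" "b = j\<oplus>s\<otimes>x" by (auto simp: adjm_def)
  note [simp] = c(1)[OF b(1)] c(2)[OF b(2)]
  have "i\<in>\<R>" "j\<in>\<R>" "r\<in>\<R>" "s\<in>\<R>" "x\<in>\<R>" by auto
  hence "(i\<oplus>r\<otimes>x)\<oplus>(j\<oplus>s\<otimes>x) = (i\<oplus>j)\<oplus>(r\<oplus>s)\<otimes>x" by algebra
  thus "a\<oplus>b\<in>adjm I P x" unfolding adjm_def using a b assms idl_add by blast }
 { fix b assume b: "b\<in>\<R>"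
  have "i\<in>\<R>" "r\<in>\<R>" "x\<in>\<R>" by auto
  hence "b\<otimes>(i\<oplus>r\<otimes>x) = b\<otimes>i\<oplus>(b\<otimes>r)\<otimes>x" using b by algebra
  thus "b\<otimes>a\<in>adjm I P x" unfolding adjm_def using a b assms idl_l by blast }
qed

lemmas adj_ideal = adjm_ideal[OF _ oneideal]

lemma adjm_sub: "ideal I R ==> ideal P R ==> x\<in>\<R> ==> I\<subseteq>adjm I P x"
proof
 fix i assume a: "ideal I R" "ideal P R" "x\<in>\<R>" "i\<in>I"
 have "i = i\<oplus>\<zero>\<otimes>x" using a idl_carr by simp
 thus "i\<in>adjm I P x" unfolding adjm_def using a idl_zero by blast
qed
lemma adj_self:
 assumes a: "ideal I R" "x\<in>\<R>" shows "x\<in>adj I x"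
proof -
 from a have "x = \<zero>\<oplus>\<one>\<otimes>x" by simp
 thus "x\<in>adj I x" unfolding adjm_def using a idl_zero by blast
qed
lemma adj_least: "ideal J R ==> I\<subseteq>J ==> x\<in>J ==> adj I x\<subseteq>J" by (auto simp: adjm_def intro!: idl_add idl_l)
lemma adjm_mono: "I\<subseteq>J ==> adjm I P x\<subseteq>adjm J P x" unfolding adjm_def by blast
lemma adjD: "a\<in>adj I x ==> \<exists>i\<in>I. \<exists>r\<in>\<R>. a = i\<oplus>r\<otimes>x" by (auto simp: adjm_def)
lemma Idl_insert: "S\<subseteq>\<R> ==> x\<in>\<R> ==> Idl (insert x S) = adj (Idl S) x"
proof
 assume a: "S\<subseteq>\<R>" "x\<in>\<R>"
 note i = genideal_ideal[OF a(1)]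
 show "Idl (insert x S)\<subseteq>adj (Idl S) x"
  using genideal_minimal[OF adj_ideal[OF i a(2)]] adj_self[OF i a(2)] adjm_sub[OF i oneideal a(2)] genideal_self[OF a(1)] by simp
 show "adj (Idl S) x\<subseteq>Idl (insert x S)"
  using adj_least[of "Idl (insert x S)" "Idl S" x] a genideal_ideal genideal_self[of "insert x S"] subset_Idl_subset[of "insert x S" S] by auto
qed
lemma Idl_empty: "Idl {} = {\<zero>}" using genideal_minimal[OF zeroideal, of "{}"] idl_zero[OF genideal_ideal[of "{}"]] by auto

lemma Idl_ideal_eq: "ideal I R ==> Idl I = I" using genideal_minimal genideal_self[of I] idl_sub by blast

section \<open>Prime avoidance\<close>

lemma prime_not_subset_finite:
 assumes "primeideal Q R" "finite \<I>" "\<And>I. I\<in>\<I> ==> ideal I R \<and> \<not> I\<subseteq>Q"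
 shows "\<exists>z\<in>\<R>. z\<notin>Q \<and> (\<forall>I\<in>\<I>. z\<in>I)" using assms(2,3)
proof (induction)
 case empty thus ?case using prime_one[OF assms(1)] by auto
next
 case (insert I \<I>)
 then obtain z where z: "z\<in>\<R>" "z\<notin>Q" "\<forall>I\<in>\<I>. z\<in>I" by blast
 obtain y where y: "y\<in>I" "y\<notin>Q" "ideal I R" using insert.prems by blast
 have yc: "y\<in>\<R>" using y idl_carr by blast
 have "z\<otimes>y\<notin>Q" using primeD[OF assms(1) z(1) yc] z y by blast
 moreover have "z\<otimes>y\<in>J" if "J\<in>insert I \<I>" for J using that y z insert.prems idl_l idl_r[of J z y] yc by auto
 ultimately show ?case using z yc by blast
qed

text \<open>If the element found so far lies in the new prime, add to it an element of
  \<open>J\<close> and of all the other primes that is outside the new one. It exists because in an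
  antichain no other prime is contained in the new one.\<close>

lemma prime_avoidance_antichain:
 assumes "finite \<Q>" "\<And>Q. Q\<in>\<Q> ==> primeideal Q R \<and> \<not> J\<subseteq>Q" "ideal J R"
  "\<And>Q Q'. Q\<in>\<Q> ==> Q'\<in>\<Q> ==> Q\<subseteq>Q' ==> Q = Q'" shows "\<exists>y\<in>J. \<forall>Q\<in>\<Q>. y\<notin>Q" using assms(1,2,4)
proof (induction)
 case empty thus ?case using idl_zero[OF assms(3)] by blast
next
 case (insert Q \<Q>)
 obtain y where y: "y\<in>J" "\<forall>Q\<in>\<Q>. y\<notin>Q" using insert.IH[OF insert.prems(1,2)] by auto
 show ?case
 proof (cases "y\<in>Q")
  case False thus ?thesis using y by blast
 next
  case True
  have "\<exists>z\<in>\<R>. z\<notin>Q \<and> (\<forall>I\<in>insert J \<Q>. z\<in>I)"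
  proof (rule prime_not_subset_finite)
   show "primeideal Q R" using insert.prems by blast
   show "finite (insert J \<Q>)" using insert.hyps by blast
   show "ideal I R \<and> \<not> I\<subseteq>Q" if "I\<in>insert J \<Q>" for I
    using that insert.prems(1)[of Q] insert.prems(1)[of I] insert.prems(2) insert.hyps(2) prime_ideal assms(3) by auto
  qed
  then obtain z where z: "z\<in>\<R>" "z\<notin>Q" "\<forall>I\<in>insert J \<Q>. z\<in>I" by blast
  have "y\<oplus>z\<in>J" using y z idl_add[OF assms(3)] by blast
  moreover have "y\<oplus>z\<notin>P" if "P\<in>insert Q \<Q>" for P
  proof
   assume a: "y\<oplus>z\<in>P"
   have P: "ideal P R" using that insert.prems(1) prime_ideal by blast
   have yc: "y\<in>\<R>" using y idl_carr[OF assms(3)] by blast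
   show False
   proof (cases "P = Q")
    case True
    have "z\<oplus>y\<in>Q" using a True a_comm[OF yc z(1)] by simp
    thus False using idl_cancel[OF P[unfolded True], of z y] \<open>y \<in> Q\<close> z by blast
   next
    case False
    hence "z\<in>P" "y\<notin>P" using that z y by auto
    thus False using idl_cancel[OF P a] yc by blast
   qed
  qed
  ultimately show ?thesis by blast
 qed
qed

lemma prime_avoidance:
 assumes "finite \<Q>" "\<And>Q. Q\<in>\<Q> ==> primeideal Q R \<and> \<not> J\<subseteq>Q" "ideal J R"
 shows "\<exists>y\<in>J. \<forall>Q\<in>\<Q>. y\<notin>Q"
proof -
 define \<M> where "\<M> = {Q\<in>\<Q>. \<forall>Q'\<in>\<Q>. Q\<subseteq>Q' \<longrightarrow> Q = Q'}"
 have "\<exists>y\<in>J. \<forall>Q\<in>\<M>. y\<notin>Q"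
 proof (rule prime_avoidance_antichain)
  show "finite \<M>" using assms(1) by (simp add: \<M>_def)
  show "primeideal Q R \<and> \<not> J\<subseteq>Q" if "Q\<in>\<M>" for Q using that assms(2) by (simp add: \<M>_def)
  show "Q = Q'" if "Q\<in>\<M>" "Q'\<in>\<M>" "Q\<subseteq>Q'" for Q Q' using that by (simp add: \<M>_def)
 qed (rule assms(3))
 then obtain y where y: "y\<in>J" "\<forall>Q\<in>\<M>. y\<notin>Q" by blast
 have "y\<notin>Q" if Q: "Q\<in>\<Q>" for Q
 proof -
  obtain M where "M\<in>\<Q>" "Q\<subseteq>M" "\<forall>Q'\<in>\<Q>. M\<subseteq>Q' \<longrightarrow> M = Q'"
   using finite_has_maximal2[OF assms(1) Q] by metis
  moreover hence "M\<in>\<M>" by (simp add: \<M>_def)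
  ultimately show ?thesis using y(2) by blast
 qed
 thus ?thesis using y(1) by blast
qed

text \<open>The contraction of the extension of \<open>I\<close> to the localization at
  \<open>P\<close>. With it local arguments stay inside \<open>R\<close> and compare ideals of one
  fixed ring.\<close>

definition sat where "sat P I = {a\<in>\<R>. \<exists>t\<in>\<R> - P. t\<otimes>a\<in>I}"

lemma sat_ideal:
 assumes "primeideal P R" "ideal I R" shows "ideal (sat P I) R"
proof (rule idealI')
 show "sat P I\<subseteq>\<R>" by (auto simp: sat_def)
 show "\<zero>\<in>sat P I" using prime_one[OF assms(1)] idl_zero[OF assms(2)] by (auto simp: sat_def)
 fix a assume "a\<in>sat P I"
 then obtain t where t: "t\<in>\<R>" "t\<notin>P" "t\<otimes>a\<in>I" and a: "a\<in>\<R>" by (auto simp: sat_def)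
 { fix b assume "b\<in>sat P I"
  then obtain s where s: "s\<in>\<R>" "s\<notin>P" "s\<otimes>b\<in>I" and b: "b\<in>\<R>" by (auto simp: sat_def)
  have "(t\<otimes>s)\<otimes>(a\<oplus>b) = s\<otimes>(t\<otimes>a)\<oplus>t\<otimes>(s\<otimes>b)" using t(1) s(1) a b by algebra
  moreover have "\<dots>\<in>I" using idl_add[OF assms(2)] idl_l[OF assms(2)] t s by blast
  moreover have "t\<otimes>s\<in>\<R> - P" using primeD[OF assms(1)] t s by auto
  ultimately show "a\<oplus>b\<in>sat P I" using a b unfolding sat_def by (intro CollectI conjI bexI[of _ "t\<otimes>s"]) auto }
 { fix r assume r: "r\<in>\<R>"
  have "t\<otimes>(r\<otimes>a) = r\<otimes>(t\<otimes>a)" using t(1) r a by algebra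
  thus "r\<otimes>a\<in>sat P I" using idl_l[OF assms(2) t(3) r] t r a unfolding sat_def by (intro CollectI conjI bexI[of _ t]) auto }
qed

lemma sat_sub: "primeideal P R ==> ideal I R ==> I\<subseteq>sat P I"
 using prime_one[of P] idl_carr[of I] unfolding sat_def by (auto intro!: bexI[of _ \<one>])
lemma sat_mono: "I\<subseteq>J ==> sat P I\<subseteq>sat P J" unfolding sat_def by blast
lemma sat_sat:
 assumes h: "primeideal P R" "ideal I R" "t\<in>\<R> - P" "a\<in>\<R>" "t\<otimes>a\<in>sat P I" shows "a\<in>sat P I"
proof -
 from h obtain s where s: "s\<in>\<R> - P" "s\<otimes>(t\<otimes>a)\<in>I" by (auto simp: sat_def)
 have "s\<otimes>t\<in>\<R> - P" using primeD h s by auto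
 moreover have "(s\<otimes>t)\<otimes>a\<in>I" using s h by (simp add: m_assoc)
 ultimately show ?thesis using h unfolding sat_def by blast
qed

section \<open>Minimal primes and chains of primes\<close>

definition minimal_prime where
 "minimal_prime A P \<longleftrightarrow> primeideal P R \<and> A\<subseteq>P \<and> (\<forall>Q. primeideal Q R \<and> A\<subseteq>Q \<and> Q\<subseteq>P \<longrightarrow> Q = P)"

lemma minimal_primeD: "minimal_prime A P ==> primeideal Q R ==> A\<subseteq>Q ==> Q\<subseteq>P ==> Q = P" unfolding minimal_prime_def by blast

definition prime_chain where
 "prime_chain Q l \<longleftrightarrow> (\<forall>i\<le>l. primeideal (Q i) R) \<and> (\<forall>i<l. Q i\<subset>Q (Suc i))" for Q :: "nat\<Rightarrow>'a set"

text \<open>This bounds the dimension of \<open>R\<close> modulo the ideal generated by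
  \<open>A\<close>. A bound makes sense before the dimension is known to be finite.\<close>

definition dim_le where
 "dim_le A n \<longleftrightarrow> (\<forall>Q l. prime_chain Q l \<longrightarrow> A\<subseteq>Q 0 \<longrightarrow> l\<le>n)"

lemma prime_chain_mono: "prime_chain Q l ==> i\<le>j ==> j\<le>l ==> Q i\<subseteq>Q j"
proof (induction j)
 case (Suc j) thus ?case by (cases "i = Suc j") (auto simp: prime_chain_def dest!: spec[of _ j])
qed simp

end

section \<open>Noetherian rings: existence and finiteness of minimal primes\<close>

locale noeth_cring = cring + noetherian_ring
begin

lemma noeth_max:
 assumes "\<S>\<noteq>{}" "\<And>I. I\<in>\<S> ==> ideal I R" shows "\<exists>M\<in>\<S>. \<forall>J\<in>\<S>. M\<subseteq>J \<longrightarrow> J = M"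
proof (rule subset_Zorn)
 fix C assume C: "subset.chain \<S> C"
 show "\<exists>U\<in>\<S>. \<forall>X\<in>C. X\<subseteq>U"
 proof (cases "C = {}")
  case True thus ?thesis using assms(1) by blast
 next
  case False
  have "subset.chain {I. ideal I R} C" using C assms(2) unfolding pred_on.chain_def by blast
  hence "\<Union>C\<in>C" using ideal_chain_is_trivial False by blast
  moreover have "C\<subseteq>\<S>" using C unfolding pred_on.chain_def by simp
  ultimately show ?thesis by (intro bexI[of _ "\<Union>C"]) auto
 qed
qed

lemma noeth_maxP:
 assumes "Q I" "\<And>I. Q I ==> ideal I R"
 obtains M where "Q M" "\<And>J. Q J ==> M\<subseteq>J ==> J = M"
proof -
 have "\<exists>M\<in>Collect Q. \<forall>J\<in>Collect Q. M\<subseteq>J \<longrightarrow> J = M" by (rule noeth_max) (use assms in auto)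
 thus ?thesis using that by auto
qed

lemma noeth_induct [consumes 1, case_names step]:
 assumes "ideal I R" "\<And>I. ideal I R ==> (\<And>J. ideal J R ==> I\<subset>J ==> P J) ==> P I" shows "P I"
proof (rule ccontr)
 assume "\<not> P I"
 define T where "T J \<longleftrightarrow> ideal J R \<and> \<not> P J" for J
 have "T I" using assms(1) \<open>\<not> P I\<close> by (simp add: T_def)
 moreover have "\<And>J. T J ==> ideal J R" by (simp add: T_def)
 ultimately obtain M where TM: "T M" and max: "\<And>J. T J ==> M\<subseteq>J ==> J = M" using noeth_maxP by metis
 have M: "ideal M R" "\<not> P M" using TM by (simp_all add: T_def)
 have "P J" if "ideal J R" "M\<subset>J" for J using max[of J] that unfolding T_def by blast
 thus False using assms(2) M by blast
qed

text \<open>An ideal maximal among those above \<open>I\<close> that miss \<open>S\<close> is prime.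
  Adjoining \<open>a\<close> or \<open>b\<close> from outside makes it meet \<open>S\<close>; if the
  product of \<open>a\<close> and \<open>b\<close> were in the ideal, the product of the two meeting
  elements would lie both in \<open>S\<close> and in the ideal.\<close>

lemma prime_disjoint:
 assumes "ideal I R" "S\<subseteq>\<R>" "\<one>\<in>S" "\<And>a b. a\<in>S ==> b\<in>S ==> a\<otimes>b\<in>S" "I\<inter>S = {}"
 shows "\<exists>P. primeideal P R \<and> I\<subseteq>P \<and> P\<inter>S = {}"
proof -
 define T where "T P \<longleftrightarrow> ideal P R \<and> I\<subseteq>P \<and> P\<inter>S = {}" for P
 have "T I" using assms(1,5) by (simp add: T_def)
 moreover have "\<And>P. T P ==> ideal P R" by (simp add: T_def)
 ultimately obtain P where TP: "T P" and max: "\<And>J. T J ==> P\<subseteq>J ==> J = P" using noeth_maxP by metis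
 have P: "ideal P R" "I\<subseteq>P" "P\<inter>S = {}" using TP by (simp_all add: T_def)
 have meet: "\<exists>i\<in>P. \<exists>r\<in>\<R>. i\<oplus>r\<otimes>a\<in>S" if "a\<in>\<R>" "a\<notin>P" for a
 proof -
  have "\<not> T (adj P a)" using max adjm_sub[OF P(1) oneideal that(1)] adj_self[OF P(1) that(1)] that(2) by metis
  moreover have "I\<subseteq>adj P a" using P(2) adjm_sub[OF P(1) oneideal that(1)] by (rule order_trans)
  ultimately have "adj P a\<inter>S\<noteq>{}" using adj_ideal[OF P(1) that(1)] by (simp add: T_def)
  thus ?thesis by (auto simp: adjm_def)
 qed
 have "primeideal P R"
 proof (rule primeidealI[OF P(1) is_cring])
  show "\<R>\<noteq>P" using P(3) assms(3) by blast
  fix a b assume ab: "a\<in>\<R>" "b\<in>\<R>" "a\<otimes>b\<in>P"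
  show "a\<in>P \<or> b\<in>P"
  proof (rule ccontr)
   assume "\<not> ?thesis"
   then obtain i r j s where h: "i\<in>P" "r\<in>\<R>" "i\<oplus>r\<otimes>a\<in>S" "j\<in>P" "s\<in>\<R>" "j\<oplus>s\<otimes>b\<in>S"
    using meet ab by meson
   have c: "i\<in>\<R>" "j\<in>\<R>" using h idl_carr[OF P(1)] by auto
   have "(i\<oplus>r\<otimes>a)\<otimes>(j\<oplus>s\<otimes>b) = (j\<oplus>s\<otimes>b)\<otimes>i\<oplus>((r\<otimes>a)\<otimes>j\<oplus>(r\<otimes>s)\<otimes>(a\<otimes>b))"
    using c h(2,5) ab(1,2) by algebra
   moreover have "(j\<oplus>s\<otimes>b)\<otimes>i\<in>P" "(r\<otimes>a)\<otimes>j\<in>P" "(r\<otimes>s)\<otimes>(a\<otimes>b)\<in>P"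
    using h c ab idl_l[OF P(1)] by auto
   hence "(j\<oplus>s\<otimes>b)\<otimes>i\<oplus>((r\<otimes>a)\<otimes>j\<oplus>(r\<otimes>s)\<otimes>(a\<otimes>b))\<in>P"
    using idl_add[OF P(1)] by simp
   ultimately show False using assms(4)[OF h(3,6)] P(3) by auto
  qed
 qed
 thus ?thesis using P by blast
qed

text \<open>Otherwise the products of an element outside \<open>P\<close> with a power of
  \<open>a\<close> form a multiplicative set that misses the ideal, and a prime avoiding this set
  lies in \<open>P\<close> but does not contain \<open>a\<close>.\<close>

lemma minimal_prime_nilp:
 assumes "minimal_prime A P" "a\<in>P" shows "\<exists>s\<in>\<R> - P. \<exists>n::nat. s\<otimes>a[^]n\<in>Idl A"
proof (rule ccontr)
 assume n: "\<not> ?thesis"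
 have P: "primeideal P R" "A\<subseteq>P" using assms by (auto simp: minimal_prime_def)
 note Pi = prime_ideal[OF P(1)]
 have Ac: "A\<subseteq>\<R>" using P(2) idl_sub[OF Pi] by blast
 have ac: "a\<in>\<R>" using assms(2) idl_carr[OF Pi] by blast
 define S where "S = {s\<otimes>a[^]n | s n. s\<in>\<R> - P \<and> n\<in>(UNIV::nat set)}"
 have "\<exists>Q. primeideal Q R \<and> Idl A\<subseteq>Q \<and> Q\<inter>S = {}"
 proof (rule prime_disjoint)
  show "ideal (Idl A) R" using genideal_ideal[OF Ac] .
  show "S\<subseteq>\<R>" using ac by (auto simp: S_def)
  have "\<one> = \<one>\<otimes>a[^](0::nat)" by simp
  thus "\<one>\<in>S" unfolding S_def using prime_one[OF P(1)] by blast
  fix x y assume "x\<in>S" "y\<in>S"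
  then obtain s m t n where h: "s\<in>\<R> - P" "t\<in>\<R> - P" "x = s\<otimes>a[^](m::nat)" "y = t\<otimes>a[^](n::nat)" unfolding S_def by blast
  have "s\<otimes>a[^]m\<otimes>(t\<otimes>a[^]n) = (s\<otimes>t)\<otimes>a[^](m + n)" using h ac by (simp add: nat_pow_mult[symmetric] m_ac)
  moreover have "s\<otimes>t\<in>\<R> - P" using h primeD[OF P(1)] by auto
  ultimately show "x\<otimes>y\<in>S" unfolding S_def h by blast
 next
  show "Idl A\<inter>S = {}" using n unfolding S_def by blast
 qed
 then obtain Q where Q: "primeideal Q R" "Idl A\<subseteq>Q" "Q\<inter>S = {}" by blast
 have "Q\<subseteq>P"
 proof
  fix s assume s: "s\<in>Q"
  have sc: "s\<in>\<R>" using s idl_carr[OF prime_ideal[OF Q(1)]] by blast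
  have "s = s\<otimes>a[^](0::nat)" using sc by simp
  thus "s\<in>P" using Q(3) s sc unfolding S_def by blast
 qed
 hence "Q = P" using minimal_primeD[OF assms(1) Q(1)] Q(2) genideal_self[OF Ac] by blast
 moreover have "a = \<one>\<otimes>a[^](1::nat)" using ac by simp
 hence "a\<in>S" unfolding S_def using prime_one[OF P(1)] by blast
 ultimately show False using Q(3) assms(2) by blast
qed

text \<open>Noetherian induction: if \<open>I\<close> is proper and not prime, two elements outside
  \<open>I\<close> have their product in \<open>I\<close>. Every prime above \<open>I\<close>
  contains one of them, so the covers of the two enlarged ideals together serve for
  \<open>I\<close>.\<close>

lemma finite_prime_cover:
 assumes "ideal I R"
 shows "\<exists>\<Q>. finite \<Q> \<and> (\<forall>Q\<in>\<Q>. primeideal Q R \<and> I\<subseteq>Q) \<and> (\<forall>P. primeideal P R \<and> I\<subseteq>P \<longrightarrow> (\<exists>Q\<in>\<Q>. Q\<subseteq>P))"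
 using assms
proof (induction rule: noeth_induct)
 case (step I)
 show ?case
 proof (cases "primeideal I R")
  case True thus ?thesis by (intro exI[of _ "{I}"]) auto
 next
  case False
  show ?thesis
  proof (cases "I = \<R>")
   case True
   hence "\<not> (primeideal P R \<and> I\<subseteq>P)" for P using prime_one by blast
   thus ?thesis by (intro exI[of _ "{}"]) blast
  next
   case notcarr: False
   then obtain a b where ab: "a\<in>\<R>" "b\<in>\<R>" "a\<otimes>b\<in>I" "a\<notin>I" "b\<notin>I"
    using False primeidealI[OF step.hyps is_cring] by auto
   have less: "I\<subset>adj I x" if "x\<in>\<R>" "x\<notin>I" for x
    using adjm_sub[OF step.hyps oneideal that(1)] adj_self[OF step.hyps that(1)] that(2) by blast
   have ide: "ideal (adj I a) R" "ideal (adj I b) R" using adj_ideal step.hyps ab by auto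
   obtain \<A> where A: "finite \<A>" "\<forall>Q\<in>\<A>. primeideal Q R \<and> adj I a\<subseteq>Q" "\<forall>P. primeideal P R \<and> adj I a\<subseteq>P \<longrightarrow> (\<exists>Q\<in>\<A>. Q\<subseteq>P)"
    using step.IH[OF ide(1) less[OF ab(1,4)]] by blast
   obtain \<B> where B: "finite \<B>" "\<forall>Q\<in>\<B>. primeideal Q R \<and> adj I b\<subseteq>Q" "\<forall>P. primeideal P R \<and> adj I b\<subseteq>P \<longrightarrow> (\<exists>Q\<in>\<B>. Q\<subseteq>P)"
    using step.IH[OF ide(2) less[OF ab(2,5)]] by blast
   have "\<exists>Q\<in>\<A>\<union>\<B>. Q\<subseteq>P" if P: "primeideal P R" "I\<subseteq>P" for P
   proof -
    have "a\<in>P \<or> b\<in>P" using primeD[OF P(1) ab(1,2)] ab(3) P(2) by blast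
    hence "adj I a\<subseteq>P \<or> adj I b\<subseteq>P" using adj_least[OF prime_ideal[OF P(1)] P(2)] by blast
    thus ?thesis using A(3) B(3) P(1) by (meson UnCI)
   qed
   moreover have "\<forall>Q\<in>\<A>\<union>\<B>. primeideal Q R \<and> I\<subseteq>Q" using A(2) B(2) less[OF ab(1,4)] less[OF ab(2,5)] by blast
   ultimately show ?thesis using A(1) B(1) by (intro exI[of _ "\<A>\<union>\<B>"]) blast
  qed
 qed
qed

lemma finite_minimal_primes:
 assumes "ideal I R" shows "finite {P. minimal_prime I P}"
proof -
 obtain \<Q> where Q: "finite \<Q>" "\<forall>Q\<in>\<Q>. primeideal Q R \<and> I\<subseteq>Q" "\<forall>P. primeideal P R \<and> I\<subseteq>P \<longrightarrow> (\<exists>Q\<in>\<Q>. Q\<subseteq>P)"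
  using finite_prime_cover[OF assms] by blast
 have "{P. minimal_prime I P}\<subseteq>\<Q>"
 proof
  fix P assume "P\<in>{P. minimal_prime I P}"
  hence mP: "minimal_prime I P" by simp
  hence "primeideal P R \<and> I\<subseteq>P" by (simp add: minimal_prime_def)
  then obtain Q where "Q\<in>\<Q>" "Q\<subseteq>P" using Q(3) by auto
  moreover hence "Q = P" using minimal_primeD[OF mP, of Q] Q(2) by simp
  ultimately show "P\<in>\<Q>" by simp
 qed
 thus ?thesis using Q(1) finite_subset by blast
qed

lemma minimal_prime_below:
 assumes "ideal I R" "primeideal P R" "I\<subseteq>P" shows "\<exists>Q. minimal_prime I Q \<and> Q\<subseteq>P"
proof -
 obtain \<Q> where Q: "finite \<Q>" "\<forall>Q\<in>\<Q>. primeideal Q R \<and> I\<subseteq>Q" "\<forall>P. primeideal P R \<and> I\<subseteq>P \<longrightarrow> (\<exists>Q\<in>\<Q>. Q\<subseteq>P)"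
  using finite_prime_cover[OF assms(1)] by blast
 then obtain Q0 where Q0: "Q0\<in>\<Q>" "Q0\<subseteq>P" using assms by auto
 then obtain M where M: "M\<in>\<Q>" "M\<subseteq>Q0" "\<forall>Q\<in>\<Q>. Q\<subseteq>M \<longrightarrow> M = Q" using finite_has_minimal2[OF Q(1), of Q0] by auto
 have "minimal_prime I M" unfolding minimal_prime_def
 proof (intro conjI allI impI)
  show "primeideal M R" "I\<subseteq>M" using M(1) Q(2) by auto
  fix P' assume P': "primeideal P' R \<and> I\<subseteq>P' \<and> P'\<subseteq>M"
  then obtain Q' where Q': "Q'\<in>\<Q>" "Q'\<subseteq>P'" using Q(3) by auto
  hence "M = Q'" using M(3) P' by (meson order_trans)
  thus "P' = M" using P' Q' by simp
 qed
 moreover have "M\<subseteq>P" using M(2) Q0(2) by (rule order_trans)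
 ultimately show ?thesis by auto
qed

text \<open>Nakayama's lemma at \<open>P\<close> without a choice of generators. Take a saturated
  ideal \<open>K\<close> above \<open>N'\<close>, maximal among those that do not contain
  \<open>N\<close>. For \<open>a\<close> in \<open>N\<close> outside \<open>K\<close>, localization
  makes \<open>N\<close> cyclic modulo \<open>K\<close> with generator \<open>a\<close>, so
  \<open>P\<close> times \<open>N\<close> lies in the saturation of \<open>K + P a\<close>. Then
  \<open>H\<close> puts a multiple of \<open>a\<close> there, and \<open>a\<close> falls into
  \<open>K\<close>. In \<open>H\<close> the ideal \<open>N' + P N\<close> is represented by all
  ideals \<open>L\<close> above it, which spares forming it.\<close>

lemma nakayama_sat:
 assumes P: "primeideal P R" and N: "ideal N R" "ideal N' R"
  and H: "\<And>L a. ideal L R ==> N'\<subseteq>L ==> (\<And>x c. x\<in>P ==> c\<in>N ==> x\<otimes>c\<in>L) ==> a\<in>N ==>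
   \<exists>t\<in>\<R> - P. t\<otimes>a\<in>L" shows "N\<subseteq>sat P N'"
proof (rule ccontr)
 assume "\<not> ?thesis"
 define \<S> where "\<S> = {K. ideal K R \<and> N'\<subseteq>K \<and> (\<forall>t\<in>\<R> - P. \<forall>a\<in>\<R>. t\<otimes>a\<in>K \<longrightarrow> a\<in>K) \<and> \<not> N\<subseteq>K}"
 have "sat P N'\<in>\<S>" unfolding \<S>_def mem_Collect_eq
  using sat_ideal[OF P N(2)] sat_sub[OF P N(2)] sat_sat[OF P N(2)] \<open>\<not> N \<subseteq> sat P N'\<close> by simp
 moreover have "\<And>I. I\<in>\<S> ==> ideal I R" by (simp add: \<S>_def)
 ultimately have "\<exists>M\<in>\<S>. \<forall>J\<in>\<S>. M\<subseteq>J \<longrightarrow> J = M" using noeth_max[of \<S>] by fast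
 then obtain K where "K\<in>\<S>" and max: "\<And>J. J\<in>\<S> ==> K\<subseteq>J ==> J = K" by blast
 hence K: "ideal K R" "N'\<subseteq>K" "\<And>t a. t\<in>\<R> - P ==> a\<in>\<R> ==> t\<otimes>a\<in>K ==> a\<in>K" "\<not> N\<subseteq>K"
  by (auto simp: \<S>_def)
 note Pi = prime_ideal[OF P]
 obtain a where a: "a\<in>N" "a\<notin>K" using K(4) by (meson subsetI)
 have ac: "a\<in>\<R>" by (rule idl_carr[OF N(1) a(1)])
 note aK = adj_ideal[OF K(1) ac]
 have NK: "N\<subseteq>sat P (adj K a)"
 proof (rule ccontr)
  assume h: "\<not> ?thesis"
  have "K\<subseteq>sat P (adj K a)" using adjm_sub[OF K(1) oneideal ac] sat_sub[OF P aK] by (rule order_trans)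
  moreover have "N'\<subseteq>sat P (adj K a)" using K(2) calculation by (rule order_trans)
  hence "sat P (adj K a)\<in>\<S>" unfolding \<S>_def mem_Collect_eq using sat_ideal[OF P aK] sat_sat[OF P aK] h by metis
  ultimately have "sat P (adj K a) = K" using max by metis
  thus False using a(2) adj_self[OF K(1) ac] sat_sub[OF P aK] by (metis subsetD)
 qed
 define L where "L = sat P (adjm K P a)"
 note aP = adjm_ideal[OF K(1) Pi ac]
 have L: "ideal L R" unfolding L_def by (rule sat_ideal[OF P aP])
 have KL: "K\<subseteq>L" unfolding L_def using adjm_sub[OF K(1) Pi ac] sat_sub[OF P aP] by (rule order_trans)
 have PL: "x\<otimes>c\<in>L" if x: "x\<in>P" and c: "c\<in>N" for x c
 proof -
  have cc: "c\<in>\<R>" "x\<in>\<R>" using x c idl_carr[OF N(1)] idl_carr[OF Pi] by auto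
  from c NK obtain t k r where t: "t\<in>\<R>" "t\<notin>P" "k\<in>K" "r\<in>\<R>" "t\<otimes>c = k\<oplus>r\<otimes>a"
   by (force simp: sat_def adjm_def)
  have kc: "k\<in>\<R>" using t idl_carr[OF K(1)] by blast
  have "t\<otimes>(x\<otimes>c) = x\<otimes>(t\<otimes>c)" using t(1) cc by algebra
  also have "\<dots> = x\<otimes>k\<oplus>(x\<otimes>r)\<otimes>a" unfolding t(5) using t(1,4) cc kc ac by algebra
  also have "\<dots>\<in>adjm K P a" unfolding adjm_def mem_Collect_eq using idl_l[OF K(1) t(3) cc(2)] idl_r[OF Pi x t(4)] by metis
  finally show ?thesis unfolding L_def sat_def mem_Collect_eq using t(1,2) cc by (metis DiffI m_closed)
 qed
 obtain t where t: "t\<in>\<R> - P" "t\<otimes>a\<in>L" using H[OF L order_trans[OF K(2) KL] PL a(1)] by metis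
 then obtain s k x where s: "s\<in>\<R> - P" "k\<in>K" "x\<in>P" "s\<otimes>(t\<otimes>a) = k\<oplus>x\<otimes>a"
  unfolding L_def sat_def adjm_def by blast
 have c: "s\<in>\<R>" "t\<in>\<R>" "x\<in>\<R>" "k\<in>\<R>" using s t idl_carr[OF K(1)] idl_carr[OF Pi] by auto
 \<comment> \<open>The multiplier \<open>s t - x\<close> plays the role of the unit
   \<open>1 - x\<close> of the usual argument: it is outside \<open>P\<close> since \<open>x\<close>
   is in \<open>P\<close> and \<open>s t\<close> is not.\<close>
 have "(s\<otimes>t\<ominus>x)\<otimes>a = s\<otimes>(t\<otimes>a)\<ominus>x\<otimes>a" using c ac by algebra
 also have "\<dots> = k" unfolding s(4) using c ac by algebra
 finally have 1: "(s\<otimes>t\<ominus>x)\<otimes>a\<in>K" using s by simp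
 have "s\<otimes>t\<ominus>x\<notin>P"
 proof
  assume "s\<otimes>t\<ominus>x\<in>P"
  hence "s\<otimes>t\<in>P" using idl_cancel_minus[OF Pi _ s(3)] c by simp
  thus False using primeD[OF P c(1,2)] s t by simp
 qed
 hence "s\<otimes>t\<ominus>x\<in>\<R> - P" using c by simp
 from K(3)[OF this ac 1] show False using a(2) by contradiction
qed

end

no_notation Sum_Type.Plus (infixr \<open><+>\<close> 65)

section \<open>Chain conditions at a minimal prime and Krull's height theorem\<close>

context noeth_cring
begin

lemma idl_sumI:
 assumes a: "ideal I R" "ideal J R" shows "I\<subseteq>I <+> J \<and> J\<subseteq>I <+> J \<and> ideal (I <+> J) R"
proof -
 have "I\<union>J\<subseteq>\<R>" using idl_sub[OF a(1)] idl_sub[OF a(2)] by simp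
 hence "I\<union>J\<subseteq>I <+> J" using union_genideal[OF a] genideal_self by metis
 thus ?thesis using add_ideals[OF a] by simp
qed

lemma idl_sumD: "a\<in>I <+> J ==> \<exists>i\<in>I. \<exists>j\<in>J. a = i\<oplus>j" by (auto simp: set_add_def')

lemma idl_sum_least: "ideal K R ==> I\<subseteq>K ==> J\<subseteq>K ==> I <+> J\<subseteq>K" by (auto simp: set_add_def' intro!: idl_add)

lemma idl_sum_mono: "I\<subseteq>I' ==> I <+> J\<subseteq>I' <+> J" by (auto simp: set_add_def')

text \<open>A colon ideal of \<open>I\<close> by an element outside \<open>I\<close>, maximal among
  such, is prime. It lies below \<open>P\<close> because \<open>I\<close> is saturated, so the
  minimality of \<open>P\<close> over \<open>I\<close> makes it equal to \<open>P\<close>.\<close>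

lemma associated_socle:
 assumes P: "primeideal P R" and I: "ideal I R" "I\<subseteq>P"
  "\<And>t a. t\<in>\<R> - P ==> a\<in>\<R> ==> t\<otimes>a\<in>I ==> a\<in>I"
  and min: "\<And>Q. primeideal Q R ==> I\<subseteq>Q ==> Q\<subseteq>P ==> Q = P"
 shows "\<exists>s\<in>\<R> - I. \<forall>x\<in>P. x\<otimes>s\<in>I"
proof -
 define T where "T K \<longleftrightarrow> (\<exists>s\<in>\<R> - I. K = {x\<in>\<R>. s\<otimes>x\<in>I})" for K
 have "\<one>\<notin>I" using prime_one[OF P] I(2) by auto
 hence "T {x\<in>\<R>. \<one>\<otimes>x\<in>I}" unfolding T_def by (intro bexI[of _ \<one>]) auto
 moreover have Tid: "\<And>K. T K ==> ideal K R" unfolding T_def using ideal.helper_max_prime[OF I(1) is_cring] by auto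
 ultimately obtain K where TK: "T K" and max: "\<And>J. T J ==> K\<subseteq>J ==> J = K" using noeth_maxP[of T] by auto
 obtain s where s: "s\<in>\<R>" "s\<notin>I" "K = {x\<in>\<R>. s\<otimes>x\<in>I}" using TK unfolding T_def by auto
 have "primeideal K R"
 proof (rule primeidealI[OF Tid[OF TK] is_cring])
  have "\<one>\<notin>K" using s by simp
  thus "\<R>\<noteq>K" by auto
  fix a b assume ab: "a\<in>\<R>" "b\<in>\<R>" "a\<otimes>b\<in>K"
  show "a\<in>K \<or> b\<in>K"
  proof (cases "b\<in>K")
   case False
   hence nb: "s\<otimes>b\<in>\<R> - I" using s ab by simp
   hence "T {x\<in>\<R>. (s\<otimes>b)\<otimes>x\<in>I}" (is "T ?K") unfolding T_def by auto
   moreover have "K\<subseteq>?K"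
   proof
    fix x assume x: "x\<in>K"
    hence x: "x\<in>\<R>" "s\<otimes>x\<in>I" using s by auto
    have "s\<otimes>b\<otimes>x = b\<otimes>(s\<otimes>x)" using x(1) s(1) ab(2) by algebra
    thus "x\<in>?K" using x idl_l[OF I(1) x(2) ab(2)] by simp
   qed
   ultimately have "?K = K" by (rule max)
   moreover have "s\<otimes>b\<otimes>a = s\<otimes>(a\<otimes>b)" using ab(1,2) s(1) by algebra
   hence "a\<in>?K" using ab s by simp
   ultimately show ?thesis by simp
  qed simp
 qed
 moreover have "I\<subseteq>K" using idl_l[OF I(1) _ s(1)] idl_carr[OF I(1)] s(3) by auto
 moreover have "K\<subseteq>P"
 proof
  fix x assume "x\<in>K"
  hence x: "x\<in>\<R>" "s\<otimes>x\<in>I" using s by auto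
  have "x\<otimes>s\<in>I" using x s(1) m_comm by simp
  thus "x\<in>P" using I(3)[of x s] s(1,2) x(1) by auto
 qed
 ultimately have "K = P" by (rule min)
 hence "x\<otimes>s\<in>I" if "x\<in>P" for x using that s m_comm by auto
 thus ?thesis using s(1,2) by (intro bexI[of _ s]) auto
qed

text \<open>Modulo \<open>I\<close> the localization at \<open>P\<close> is Artinian. Noetherian
  induction on \<open>I\<close>: after saturating, adjoin an element \<open>s\<close> that
  \<open>P\<close> multiplies into \<open>I\<close>, and saturate to \<open>I'\<close>. Either every
  \<open>J n\<close> contains \<open>I'\<close> and the hypothesis for \<open>I'\<close> applies, or
  \<open>s\<close> is missing from some point on and the hypothesis is applied to the sums of
  \<open>J n\<close> with \<open>I'\<close>.\<close>

lemma dcc_sat: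
 assumes P: "primeideal P R" and "ideal I R" and min: "\<And>Q. primeideal Q R ==> I\<subseteq>Q ==> Q\<subseteq>P ==> Q = P"
  and J: "\<And>n. ideal (J n) R" "\<And>n. I\<subseteq>J n" "\<And>n. J (Suc n)\<subseteq>J n"
  "\<And>n t a. t\<in>\<R> - P ==> a\<in>\<R> ==> t\<otimes>a\<in>J n ==> a\<in>J n" shows "\<exists>n0. \<forall>n\<ge>n0. J n = J n0"
 using assms(2-)
proof (induction I arbitrary: J rule: noeth_induct)
 case (step I)
 note Jm = lift_Suc_antimono_le[of J, OF step.prems(4)]
 show ?case
 proof (cases "sat P I = I")
  case False
  have sI: "ideal (sat P I) R" "I\<subset>sat P I" using sat_ideal[OF P step.hyps] sat_sub[OF P step.hyps] False by auto
  show ?thesis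
  proof (rule step.IH[OF sI])
   show "Q = P" if "primeideal Q R" "sat P I\<subseteq>Q" "Q\<subseteq>P" for Q using step.prems(1)[OF that(1) _ that(3)] that(2) sI by auto
   show "sat P I\<subseteq>J n" for n
   proof
    fix a assume "a\<in>sat P I"
    then obtain t where "t\<in>\<R> - P" "a\<in>\<R>" "t\<otimes>a\<in>I" by (auto simp: sat_def)
    thus "a\<in>J n" using step.prems(5) step.prems(3)[of n] by auto
   qed
  qed (use step.prems in auto)
 next
  case satI: True
  have Isat: "a\<in>I" if "t\<in>\<R> - P" "a\<in>\<R>" "t\<otimes>a\<in>I" for t a
  proof -
   have "a\<in>sat P I" unfolding sat_def using that by auto
   thus ?thesis using satI by simp
  qed
  show ?thesis
  proof (cases "I\<subseteq>P")
   case False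
   then obtain t where t: "t\<in>I" "t\<notin>P" by auto
   have tc: "t\<in>\<R> - P" using t idl_carr[OF step.hyps] by simp
   have "a\<in>I" if "a\<in>\<R>" for a using Isat[OF tc that] idl_r[OF step.hyps t(1) that] by simp
   hence "J n = \<R>" for n using step.prems(3) idl_sub[OF step.prems(2)[of n]] by auto
   thus ?thesis by simp
  next
   case True
   have "\<exists>s\<in>\<R> - I. \<forall>x\<in>P. x\<otimes>s\<in>I" by (rule associated_socle[OF P step.hyps True]) (fact Isat, fact step.prems(1))
   then obtain s where s: "s\<in>\<R>" "s\<notin>I" "\<And>x. x\<in>P ==> x\<otimes>s\<in>I" by auto
   note aI = adj_ideal[OF step.hyps s(1)]
   define I' where "I' = sat P (adj I s)"
   have I': "ideal I' R" unfolding I'_def by (rule sat_ideal[OF P aI])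
   have aI': "adj I s\<subseteq>I'" unfolding I'_def by (rule sat_sub[OF P aI])
   have II': "I\<subseteq>I'" using adjm_sub[OF step.hyps oneideal s(1)] aI' by (rule order_trans)
   have sI': "s\<in>I'" using adj_self[OF step.hyps s(1)] aI' by auto
   hence lt: "I\<subset>I'" using II' s(2) by auto
   have leI': "I'\<subseteq>K" if "ideal K R" "I\<subseteq>K" "s\<in>K" "\<And>t a. t\<in>\<R> - P ==> a\<in>\<R> ==> t\<otimes>a\<in>K ==> a\<in>K" for K
   proof
    fix a assume "a\<in>I'"
    then obtain t where "t\<in>\<R> - P" "a\<in>\<R>" "t\<otimes>a\<in>adj I s" by (auto simp: I'_def sat_def)
    thus "a\<in>K" using that(4)[of t a] adj_least[OF that(1,2,3)] by auto
   qed
   have min': "Q = P" if "primeideal Q R" "I'\<subseteq>Q" "Q\<subseteq>P" for Q using step.prems(1)[OF that(1) order_trans[OF II' that(2)] that(3)] .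
   show ?thesis
   proof (cases "\<forall>n. I'\<subseteq>J n")
    case True
    show ?thesis by (rule step.IH[OF I' lt min']) (use step.prems True in auto)
   next
    case False
    then obtain n1 where n1: "\<not> I'\<subseteq>J n1" by auto
    have sJ: "s\<notin>J n1" using leI' step.prems(2,3,5) n1 by metis
    \<comment> \<open>From \<open>n1\<close> on, \<open>J n\<close> meets \<open>I'\<close> only in
      \<open>I\<close>, because \<open>I'\<close> is simple modulo \<open>I\<close> after
      localization. So a descending \<open>J n\<close> is determined by its sum with
      \<open>I'\<close>, as in the modular law.\<close>
    define L where "L n = sat P (J n <+> I')" for n
    note sm = idl_sumI[OF step.prems(2) I']
    have "\<exists>n0. \<forall>n\<ge>n0. L n = L n0"
    proof (rule step.IH[OF I' lt min'])
     show "ideal (L n) R" for n unfolding L_def using sm[of n] by (intro sat_ideal[OF P]) simp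
     show "I'\<subseteq>L n" for n unfolding L_def using sm[of n] sat_sub[OF P, of "J n <+> I'"] by auto
     show "L (Suc n)\<subseteq>L n" for n unfolding L_def by (intro sat_mono idl_sum_mono step.prems)
     show "a\<in>L n" if "t\<in>\<R> - P" "a\<in>\<R>" "t\<otimes>a\<in>L n" for t a n
      using sat_sat[OF P _ that(1,2), of "J n <+> I'"] sm[of n] that(3) unfolding L_def by simp
    qed
    then obtain n0 where n0: "\<And>n. n\<ge>n0 ==> L n = L n0" by auto
    define N where "N = max n0 n1"
    have "J n = J N" if nN: "n\<ge>N" for n
    proof
     show "J n\<subseteq>J N" by (rule Jm[OF nN])
     show "J N\<subseteq>J n"
     proof
      fix a assume a: "a\<in>J N"
      have ac: "a\<in>\<R>" by (rule idl_carr[OF step.prems(2) a])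
      have "a\<in>L N" unfolding L_def using sm a sat_sub[OF P, of "J N <+> I'"] by auto
      hence "a\<in>L n" using n0[of n] n0[of N] nN by (simp add: N_def)
      then obtain t where t: "t\<in>\<R> - P" "t\<otimes>a\<in>J n <+> I'" unfolding L_def sat_def by auto
      obtain j i where ji: "j\<in>J n" "i\<in>I'" "t\<otimes>a = j\<oplus>i" using idl_sumD[OF t(2)] by auto
      have jN: "j\<in>J N" using ji(1) Jm[OF nN] by (rule subsetD[rotated])
      have c: "j\<in>\<R>" "i\<in>\<R>" "t\<in>\<R>" using ji t idl_carr[OF I'] idl_carr[OF step.prems(2)[of n]] by auto
      have "i\<oplus>j\<in>J N" using idl_l[OF step.prems(2) a c(3)] ji(3) a_comm[OF c(1,2)] by simp
      hence iN: "i\<in>J N" using idl_cancel[OF step.prems(2) _ jN c(2)] by simp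
      have "i\<in>I"
      proof -
       obtain t' i' r where h: "t'\<in>\<R> - P" "i'\<in>I" "r\<in>\<R>" "t'\<otimes>i = i'\<oplus>r\<otimes>s"
        using ji(2) unfolding I'_def sat_def adjm_def by auto
       have i'c: "i'\<in>\<R>" by (rule idl_carr[OF step.hyps h(2)])
       show ?thesis
       proof (cases "r\<in>P")
        case True
        hence "t'\<otimes>i\<in>I" using h idl_add[OF step.hyps h(2) s(3)] by simp
        thus ?thesis using Isat h(1) c(2) by simp
       next
        case False
        have t'c: "t'\<in>\<R>" using h by simp
        have i'N: "i'\<in>J N" using h(2) step.prems(3) by auto
        have "t'\<otimes>i\<in>J N" using idl_l[OF step.prems(2) iN t'c] .
        hence "r\<otimes>s\<oplus>i'\<in>J N" using h(4) a_comm[OF i'c, of "r\<otimes>s"] h(3) s(1) by simp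
        hence "r\<otimes>s\<in>J N" using idl_cancel[OF step.prems(2) _ i'N] h(3) s(1) by simp
        hence "s\<in>J N" using step.prems(5) False h(3) s(1) by simp
        moreover have "J N\<subseteq>J n1" using Jm by (simp add: N_def)
        ultimately show ?thesis using sJ by auto
       qed
      qed
      hence "i\<in>J n" using step.prems(3) by auto
      hence "t\<otimes>a\<in>J n" using ji idl_add[OF step.prems(2) ji(1)] by simp
      thus "a\<in>J n" by (rule step.prems(5)[OF t(1) ac])
     qed
    qed
    thus ?thesis by auto
   qed
  qed
 qed
qed

text \<open>The symbolic powers of \<open>Q\<close> in the ring modulo \<open>Q0\<close>, pulled
  back to \<open>R\<close>.\<close>

fun sympow where
 "sympow Q Q0 0 = \<R>"
| "sympow Q Q0 (Suc n) = sat Q (Q0 <+> ideal_prod R Q (sympow Q Q0 n))"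

text \<open>Krull's argument modulo \<open>Q0\<close>: the symbolic powers of \<open>Q\<close>
  enlarged by \<open>y\<close> stabilise at \<open>P\<close> by the chain condition. Two
  applications of Nakayama then make a symbolic power vanish modulo \<open>Q0\<close>, although it
  contains a power of an element of \<open>Q\<close> outside \<open>Q0\<close>.\<close>

lemma principal_ideal_theorem:
 assumes Q0: "primeideal Q0 R" and Q: "primeideal Q R" and lt: "Q0\<subset>Q" "Q\<subset>P" and y: "y\<in>\<R>"
  and mp: "minimal_prime (insert y Q0) P" shows False
proof -
 have P: "primeideal P R" "y\<in>P" "Q0\<subseteq>P" using mp by (auto simp: minimal_prime_def)
 note Qi = prime_ideal[OF Q] and Q0i = prime_ideal[OF Q0] and Pi = prime_ideal[OF P(1)]
 have yQ: "y\<notin>Q"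
 proof
  assume "y\<in>Q"
  hence "Q = P" using minimal_primeD[OF mp Q] lt by auto
  thus False using lt by simp
 qed
 define T where "T = sympow Q Q0"
 have T0: "T 0 = \<R>" and TS: "T (Suc n) = sat Q (Q0 <+> ideal_prod R Q (T n))" for n by (simp_all add: T_def)
 have Ti: "ideal (T n) R" for n
 proof (induction n)
  case (Suc n) thus ?case unfolding TS using sat_ideal[OF Q] add_ideals[OF Q0i] ideal_prod_is_ideal[OF Qi] by simp
 qed (simp add: T0 oneideal)
 have pi: "ideal (ideal_prod R Q (T n)) R" for n by (rule ideal_prod_is_ideal[OF Qi Ti])
 note si = idl_sumI[OF Q0i pi]
 have Tsat: "a\<in>T n" if "t\<in>\<R> - Q" "a\<in>\<R>" "t\<otimes>a\<in>T n" for t a n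
 proof (cases n)
  case (Suc m) thus ?thesis using that sat_sat[OF Q, of "Q0 <+> ideal_prod R Q (T m)"] si TS[of m] by metis
 qed (use that T0 in simp)
 have Q0T: "Q0\<subseteq>T n" for n
 proof (cases n)
  case (Suc m)
  have "Q0\<subseteq>Q0 <+> ideal_prod R Q (T m)" using si by simp
  also have "\<dots>\<subseteq>T n" unfolding Suc TS using sat_sub[OF Q] si by simp
  finally show ?thesis .
 qed (use T0 idl_sub[OF Q0i] in simp)
 have Tdec: "T (Suc n)\<subseteq>T n" for n
 proof
  fix a assume "a\<in>T (Suc n)"
  then obtain t where t: "a\<in>\<R>" "t\<in>\<R> - Q" "t\<otimes>a\<in>Q0 <+> ideal_prod R Q (T n)" unfolding TS sat_def by auto
  have "ideal_prod R Q (T n)\<subseteq>T n" using ideal_prod_inter[OF Qi Ti[of n]] by simp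
  hence "Q0 <+> ideal_prod R Q (T n)\<subseteq>T n" by (rule idl_sum_least[OF Ti Q0T])
  thus "a\<in>T n" using Tsat[OF t(2,1)] t(3) by auto
 qed
 define J where "J n = sat P (adj (T n) y)" for n
 note ai = adj_ideal[OF Ti y]
 have Py: "insert y Q0\<subseteq>\<R>" using y idl_sub[OF Q0i] by simp
 have "\<exists>n0. \<forall>n\<ge>n0. J n = J n0"
 proof (rule dcc_sat[OF P(1) genideal_ideal[OF Py]])
  show "Q' = P" if "primeideal Q' R" "Idl (insert y Q0)\<subseteq>Q'" "Q'\<subseteq>P" for Q'
   using minimal_primeD[OF mp that(1) _ that(3)] genideal_self[OF Py] that(2) by auto
  show "ideal (J n) R" for n unfolding J_def by (rule sat_ideal[OF P(1) ai])
  show "Idl (insert y Q0)\<subseteq>J n" for n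
  proof (rule genideal_minimal)
   show "ideal (J n) R" unfolding J_def by (rule sat_ideal[OF P(1) ai])
   have "insert y Q0\<subseteq>adj (T n) y" using adj_self[OF Ti y] adjm_sub[OF Ti oneideal y, of n] Q0T by auto
   thus "insert y Q0\<subseteq>J n" unfolding J_def using sat_sub[OF P(1) ai] by (rule order_trans)
  qed
  show "J (Suc n)\<subseteq>J n" for n unfolding J_def by (intro sat_mono adjm_mono Tdec)
  show "a\<in>J n" if "t\<in>\<R> - P" "a\<in>\<R>" "t\<otimes>a\<in>J n" for t a n
   using sat_sat[OF P(1) ai that(1,2)] that(3) unfolding J_def by simp
 qed
 then obtain n where n: "J n = J (Suc n)" by (metis le_SucI order_refl)
 \<comment> \<open>Up to a multiplier, an element of \<open>T n\<close> is \<open>b + r y\<close>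
   with \<open>b\<close> in \<open>T (Suc n)\<close>. Since \<open>y\<close> is outside
   \<open>Q\<close> and \<open>T n\<close> is saturated at \<open>Q\<close>, the factor
   \<open>r\<close> is again in \<open>T n\<close>; so the element lies in
   \<open>T (Suc n) + P (T n)\<close>, as Nakayama at \<open>P\<close> requires.\<close>
 have 1: "T n\<subseteq>sat P (T (Suc n))"
 proof (rule nakayama_sat[OF P(1) Ti Ti])
  fix L a assume L: "ideal L R" "T (Suc n)\<subseteq>L" "\<And>x c. x\<in>P ==> c\<in>T n ==> x\<otimes>c\<in>L" and a: "a\<in>T n"
  have ac: "a\<in>\<R>" by (rule idl_carr[OF Ti a])
  have "a\<in>J n" unfolding J_def using a adjm_sub[OF Ti oneideal y, of n] sat_sub[OF P(1) ai, of n] by auto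
  hence "a\<in>J (Suc n)" using n by simp
  then obtain t b r where h: "t\<in>\<R> - P" "b\<in>T (Suc n)" "r\<in>\<R>" "t\<otimes>a = b\<oplus>r\<otimes>y"
   unfolding J_def sat_def adjm_def by auto
  have bc: "b\<in>\<R>" and tc: "t\<in>\<R>" using h idl_carr[OF Ti] by auto
  have bn: "b\<in>T n" using h(2) Tdec by auto
  have "r\<otimes>y\<oplus>b\<in>T n" using idl_l[OF Ti a tc] h(4) a_comm[OF bc, of "r\<otimes>y"] h(3) y by simp
  hence "r\<otimes>y\<in>T n" using idl_cancel[OF Ti _ bn] h(3) y by simp
  hence "r\<in>T n" using Tsat y yQ h(3) m_comm by simp
  hence "y\<otimes>r\<in>L" using L(3)[OF P(2)] by simp
  hence "b\<oplus>r\<otimes>y\<in>L" using idl_add[OF L(1)] L(2) h(2,3) y m_comm by auto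
  thus "\<exists>t\<in>\<R> - P. t\<otimes>a\<in>L" using h(1,4) by metis
 qed
 have Tn: "T n\<subseteq>T (Suc n)"
 proof
  fix a assume a: "a\<in>T n"
  then obtain t where "t\<in>\<R> - P" "a\<in>\<R>" "t\<otimes>a\<in>T (Suc n)" using 1 unfolding sat_def by auto
  thus "a\<in>T (Suc n)" using Tsat lt(2) by auto
 qed
 \<comment> \<open>Two consecutive symbolic powers agree, so Nakayama at \<open>Q\<close> makes them
   vanish modulo \<open>Q0\<close>.\<close>
 have "T n\<subseteq>sat Q Q0"
 proof (rule nakayama_sat[OF Q Ti Q0i])
  fix L a assume L: "ideal L R" "Q0\<subseteq>L" "\<And>x c. x\<in>Q ==> c\<in>T n ==> x\<otimes>c\<in>L" and a: "a\<in>T n"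
  have "ideal_prod R Q (T n)\<subseteq>L"
  proof
   fix s assume "s\<in>ideal_prod R Q (T n)" thus "s\<in>L" by (induction rule: ideal_prod.induct) (auto intro: L(3) idl_add[OF L(1)])
  qed
  hence "Q0 <+> ideal_prod R Q (T n)\<subseteq>L" by (rule idl_sum_least[OF L(1,2)])
  moreover have "a\<in>T (Suc n)" using a Tn by auto
  ultimately show "\<exists>t\<in>\<R> - Q. t\<otimes>a\<in>L" unfolding TS sat_def by auto
 qed
 moreover have "sat Q Q0\<subseteq>Q0"
 proof
  fix a assume "a\<in>sat Q Q0"
  then obtain t where t: "t\<in>\<R>" "t\<notin>Q" "a\<in>\<R>" "t\<otimes>a\<in>Q0" by (auto simp: sat_def)
  thus "a\<in>Q0" using primeD[OF Q0 t(1,3)] lt(1) by auto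
 qed
 ultimately have TQ0: "T n\<subseteq>Q0" by (rule order_trans)
 obtain q where q: "q\<in>Q" "q\<notin>Q0" using lt(1) by auto
 have qc: "q\<in>\<R>" by (rule idl_carr[OF Qi q(1)])
 have "q[^]n\<in>T n" for n
 proof (induction n)
  case (Suc n)
  have "q[^]Suc n = q\<otimes>q[^]n" using qc m_comm by simp
  also have "\<dots>\<in>ideal_prod R Q (T n)" using q(1) Suc by (rule ideal_prod.prod)
  finally have "q[^]Suc n\<in>Q0 <+> ideal_prod R Q (T n)" using si by auto
  thus ?case unfolding TS using sat_sub[OF Q] si[of n] by auto
 qed (simp add: T0)
 hence "q[^]n\<in>Q0" using TQ0 by auto
 thus False using prime_pow[OF Q0 qc] q(2) by simp
qed

text \<open>Insert a prime \<open>P'\<close> directly below \<open>P\<close> and pick a generator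
  \<open>x\<close> outside it. Then \<open>P\<close> is minimal over \<open>P'\<close> and
  \<open>x\<close>, so a multiple of a power of each other generator \<open>z\<close> is congruent
  modulo \<open>x\<close> to some \<open>p z\<close> in \<open>P'\<close>. The principal ideal
  theorem shows that \<open>P'\<close> is minimal over \<open>I\<close> and these elements, of which
  there is one fewer.\<close>

theorem height_theorem:
 assumes "minimal_prime (I\<union>set xs) P" "prime_chain Q l" "I\<subseteq>Q 0" "Q l = P" shows "l\<le>length xs" using assms
proof (induction "length xs" arbitrary: xs P Q l)
 case 0
 hence "minimal_prime I P" "primeideal (Q 0) R" by (simp_all add: prime_chain_def)
 hence "Q 0 = P" using minimal_primeD 0 prime_chain_mono[of Q l 0 l] by simp
 hence "l = 0" using 0 prime_chain_mono[of Q l "Suc 0" l] by (cases l) (auto simp: prime_chain_def)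
 thus ?case by simp
next
 case (Suc n)
 note mp = Suc.prems(1)
 have P: "primeideal P R" "I\<subseteq>P" "set xs\<subseteq>P" using mp by (auto simp: minimal_prime_def)
 note Pi = prime_ideal[OF P(1)]
 show ?case
 proof (cases l)
  case (Suc l')
  have Q': "primeideal (Q l') R" "Q l'\<subset>P" using Suc.prems(2,4) unfolding prime_chain_def Suc by auto
  \<comment> \<open>Maximality strictly below \<open>P\<close> is what makes \<open>P\<close>
    minimal over \<open>P'\<close> and one further element.\<close>
  define T where "T K \<longleftrightarrow> primeideal K R \<and> Q l'\<subseteq>K \<and> K\<subset>P" for K
  have "T (Q l')" using Q' by (simp add: T_def)
  moreover have "\<And>K. T K ==> ideal K R" unfolding T_def using prime_ideal by simp
  ultimately obtain P' where TP: "T P'" and max: "\<And>K. T K ==> P'\<subseteq>K ==> K = P'" using noeth_maxP by metis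
  have P': "primeideal P' R" "Q l'\<subseteq>P'" "P'\<subset>P" using TP by (simp_all add: T_def)
  note P'i = prime_ideal[OF P'(1)]
  have Ql': "Q 0\<subseteq>Q l'" using prime_chain_mono[OF Suc.prems(2), of 0 l'] Suc by simp
  have IP': "I\<subseteq>P'" using Suc.prems(3) Ql' P'(2) by auto
  have "\<not> set xs\<subseteq>P'" using minimal_primeD[OF mp P'(1)] IP' P'(3) by auto
  then obtain x where x: "x\<in>set xs" "x\<notin>P'" by auto
  have xP: "x\<in>P" using x P(3) by auto
  have xc: "x\<in>\<R>" by (rule idl_carr[OF Pi xP])
  have mpx: "minimal_prime (insert x P') P" unfolding minimal_prime_def
  proof (intro conjI allI impI)
   show "primeideal P R" "insert x P'\<subseteq>P" using P xP P' by auto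
   fix K assume K: "primeideal K R \<and> insert x P'\<subseteq>K \<and> K\<subseteq>P"
   show "K = P"
   proof (rule ccontr)
    assume "K\<noteq>P"
    hence "T K" using K P'(2) by (auto simp: T_def)
    hence "K = P'" using max K by simp
    thus False using K x by simp
   qed
  qed
  have ins: "insert x P'\<subseteq>\<R>" using xc idl_sub[OF P'i] by simp
  have ex: "\<exists>p. p\<in>P' \<and> (\<exists>s\<in>\<R> - P. \<exists>m::nat. \<exists>a\<in>\<R>. s\<otimes>z[^]m = p\<oplus>a\<otimes>x)" if z: "z\<in>set xs" for z
  proof -
   have "z\<in>P" using z P(3) by auto
   then obtain s m where sm: "s\<in>\<R> - P" "s\<otimes>z[^](m::nat)\<in>Idl (insert x P')" using minimal_prime_nilp[OF mpx] by metis
   have "Idl (insert x P') = adj P' x" using Idl_insert[OF idl_sub[OF P'i] xc] Idl_ideal_eq[OF P'i] by simp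
   thus ?thesis using sm adjD by metis
  qed
  define p where "p z = (SOME p. p\<in>P' \<and> (\<exists>s\<in>\<R> - P. \<exists>m::nat. \<exists>a\<in>\<R>. s\<otimes>z[^]m = p\<oplus>a\<otimes>x))" for z
  have p: "p z\<in>P'" "\<exists>s\<in>\<R> - P. \<exists>m::nat. \<exists>a\<in>\<R>. s\<otimes>z[^]m = p z\<oplus>a\<otimes>x" if "z\<in>set xs" for z
   using someI_ex[OF ex[OF that]] unfolding p_def by auto
  define xs' where "xs' = map p (remove1 x xs)"
  have len: "length xs' = n" using Suc.hyps(2) x by (simp add: xs'_def length_remove1)
  have xs'P: "set xs'\<subseteq>P'" using p(1) set_remove1_subset[of x xs] unfolding xs'_def by auto
  have mp': "minimal_prime (I\<union>set xs') P'" unfolding minimal_prime_def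
  proof (intro conjI allI impI)
   show "primeideal P' R" "I\<union>set xs'\<subseteq>P'" using P' IP' xs'P by auto
   fix K assume K: "primeideal K R \<and> I\<union>set xs'\<subseteq>K \<and> K\<subseteq>P'"
   show "K = P'"
   proof (rule ccontr)
    assume "K\<noteq>P'"
    hence lt: "K\<subset>P'" using K by auto
    \<comment> \<open>A prime that contains \<open>x\<close> and all \<open>p z\<close> contains a
      power of every \<open>z\<close>, up to a multiplier outside \<open>P\<close>, hence all of
      \<open>xs\<close>.\<close>
    have "minimal_prime (insert x K) P" unfolding minimal_prime_def
    proof (intro conjI allI impI)
     show "primeideal P R" "insert x K\<subseteq>P" using P xP P' K by auto
     fix K' assume K': "primeideal K' R \<and> insert x K\<subseteq>K' \<and> K'\<subseteq>P"
     note K'i = prime_ideal[of K']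
     have "set xs\<subseteq>K'"
     proof
      fix z assume z: "z\<in>set xs"
      show "z\<in>K'"
      proof (cases "z = x")
       case False
       hence "p z\<in>set xs'" using z by (auto simp: xs'_def)
       hence pz: "p z\<in>K'" using K K' by auto
       obtain s m a where h: "s\<in>\<R> - P" "a\<in>\<R>" "s\<otimes>z[^](m::nat) = p z\<oplus>a\<otimes>x" using p(2)[OF z] by auto
       have zc: "z\<in>\<R>" using z P(3) idl_carr[OF Pi] by auto
       have "s\<otimes>z[^]m\<in>K'" unfolding h(3) using idl_add[OF K'i pz] idl_l[OF K'i _ h(2), of x] K' by simp
       hence "z[^]m\<in>K'" using primeD[of K' s "z[^]m"] K' h(1) zc by auto
       thus ?thesis using prime_pow K' zc by simp
      qed (use K' in simp)
     qed
     thus "K' = P" using minimal_primeD[OF mp, of K'] K K' by auto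
    qed
    thus False using principal_ideal_theorem[OF _ P'(1) lt P'(3) xc] K by simp
   qed
  qed
  define Q'' where "Q'' i = (if i = l' then P' else Q i)" for i
  have "prime_chain Q'' l'" unfolding prime_chain_def
  proof (intro conjI allI impI)
   show "primeideal (Q'' i) R" if "i\<le>l'" for i using that Suc.prems(2) P' unfolding Q''_def prime_chain_def Suc by auto
   show "Q'' i\<subset>Q'' (Suc i)" if "i < l'" for i using that Suc.prems(2) P'(2) unfolding Q''_def prime_chain_def Suc
    by (auto dest!: spec[of _ i])
  qed
  moreover have "I\<subseteq>Q'' 0" using Suc.prems(3) IP' by (simp add: Q''_def)
  ultimately have "l'\<le>length xs'" using Suc.hyps(1)[of xs' P' Q'' l'] len mp' by (simp add: Q''_def)
  thus ?thesis using len Suc Suc.hyps(2) by simp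
 qed simp
qed

section \<open>Powers of ideals and Krull's intersection theorem\<close>

definition ipow where "ipow I n = I [^]\<^bsub>ideals_set R\<^esub> (n::nat)"

lemma ipow_0 [simp]: "ipow I 0 = \<R>" by (simp add: ipow_def ideals_set_def)
lemma ipow_Suc: "ipow I (Suc n) = ideal_prod R (ipow I n) I" by (simp add: ipow_def ideals_set_def)
lemma ipow_ideal: "ideal I R ==> ideal (ipow I n) R" by (induction n) (simp_all add: oneideal ipow_Suc ideal_prod_is_ideal)
lemma ipow_Suc_sub: "ideal I R ==> ipow I (Suc n)\<subseteq>ipow I n" using ideal_prod_inter[OF ipow_ideal, of I I n] by (simp add: ipow_Suc)
lemma ipow_antimono: "ideal I R ==> k\<le>n ==> ipow I n\<subseteq>ipow I k" using lift_Suc_antimono_le[of "ipow I", OF ipow_Suc_sub] by simp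
lemma ipow_1: "ideal I R ==> ipow I (Suc 0) = I"
proof
 assume I: "ideal I R"
 show "ipow I (Suc 0)\<subseteq>I" using ideal_prod_inter[OF oneideal I] by (simp add: ipow_Suc)
 show "I\<subseteq>ipow I (Suc 0)"
 proof
  fix x assume x: "x\<in>I"
  have "\<one>\<otimes>x\<in>ideal_prod R (\<R>) I" using ideal_prod.prod[OF one_closed x] by auto
  thus "x\<in>ipow I (Suc 0)" using idl_carr[OF I x] by (simp add: ipow_Suc)
 qed
qed

lemma ideal_prod_least:
 assumes "ideal K R" "\<And>a b. a\<in>I ==> b\<in>J ==> a\<otimes>b\<in>K" shows "ideal_prod R I J\<subseteq>K"
proof
 fix s assume "s\<in>ideal_prod R I J" thus "s\<in>K" by (induction rule: ideal_prod.induct) (auto intro: assms(2) idl_add[OF assms(1)])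
qed

lemma ipow_mult: "ideal I R ==> a\<in>ipow I m ==> b\<in>ipow I n ==> a\<otimes>b\<in>ipow I (m + n)"
proof (induction n arbitrary: b)
 case 0 thus ?case using idl_r[OF ipow_ideal] by simp
next
 case (Suc n)
 note i = ipow_ideal[OF Suc.prems(1)]
 have ac: "a\<in>\<R>" by (rule idl_carr[OF i Suc.prems(2)])
 have "ideal {b\<in>\<R>. a\<otimes>b\<in>ipow I (m + Suc n)} R" (is "ideal ?K R") using ideal.helper_max_prime[OF i is_cring ac] .
 hence "ideal_prod R (ipow I n) I\<subseteq>?K"
 proof (rule ideal_prod_least)
  fix b c assume bc: "b\<in>ipow I n" "c\<in>I"
  have c: "b\<in>\<R>" "c\<in>\<R>" using bc idl_carr[OF i] idl_carr[OF Suc.prems(1)] by auto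
  have "a\<otimes>b\<in>ipow I (m + n)" using Suc.IH[OF Suc.prems(1,2) bc(1)] .
  hence "a\<otimes>b\<otimes>c\<in>ipow I (m + Suc n)" using ideal_prod.prod[OF _ bc(2)] by (simp add: ipow_Suc)
  thus "b\<otimes>c\<in>?K" using ac c m_assoc by simp
 qed
 thus ?case using Suc.prems(3) unfolding ipow_Suc by auto
qed

lemma ipow_pow: "ideal I R ==> a\<in>I ==> a[^](n::nat)\<in>ipow I n"
proof (induction n)
 case (Suc n) thus ?case using ideal_prod.prod[of "a[^]n" "ipow I n" a I] by (simp add: ipow_Suc)
qed simp

text \<open>The binomial expansion of a power of \<open>L + R x\<close>, phrased with an arbitrary
  target ideal \<open>K\<close>. This form allows an induction that strips one factor at a time by
  passing to colon ideals of \<open>K\<close>.\<close>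

lemma ipow_adj:
 assumes L: "ideal L R" and x: "x\<in>\<R>"
 shows "ideal K R ==> (\<And>i c. i\<le>k ==> c\<in>ipow L (k - i) ==> x[^]i\<otimes>c\<in>K) ==> ipow (adj L x) k\<subseteq>K"
proof (induction k arbitrary: K)
 case 0
 have "c\<in>K" if "c\<in>\<R>" for c using 0(2)[of 0 c] that by simp
 thus ?case by auto
next
 case (Suc k)
 note col = ideal.helper_max_prime[OF Suc.prems(1) is_cring]
 show ?case unfolding ipow_Suc
 proof (rule ideal_prod_least[OF Suc.prems(1)])
  fix u v assume u: "u\<in>ipow (adj L x) k" and "v\<in>adj L x"
  then obtain l r where v: "l\<in>L" "r\<in>\<R>" "v = l\<oplus>r\<otimes>x" using adjD by metis
  have lc: "l\<in>\<R>" by (rule idl_carr[OF L v(1)])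
  have uc: "u\<in>\<R>" by (rule idl_carr[OF ipow_ideal[OF adj_ideal[OF L x]] u])
  have "ipow (adj L x) k\<subseteq>{c\<in>\<R>. l\<otimes>c\<in>K}"
  proof (rule Suc.IH[OF col[OF lc]])
   fix i c assume i: "i\<le>k" and c: "c\<in>ipow L (k - i)"
   have cc: "c\<in>\<R>" by (rule idl_carr[OF ipow_ideal[OF L] c])
   have "c\<otimes>l\<in>ipow L (Suc k - i)" using ideal_prod.prod[OF c v(1)] i by (simp add: Suc_diff_le ipow_Suc)
   hence "x[^]i\<otimes>(c\<otimes>l)\<in>K" using Suc.prems(2) i by simp
   moreover have "l\<otimes>(x[^]i\<otimes>c) = x[^]i\<otimes>(c\<otimes>l)" using lc cc nat_pow_closed[OF x, of i] by algebra
   ultimately show "x[^]i\<otimes>c\<in>{c\<in>\<R>. l\<otimes>c\<in>K}" using cc x by simp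
  qed
  hence 1: "l\<otimes>u\<in>K" using u by auto
  have "ipow (adj L x) k\<subseteq>{c\<in>\<R>. x\<otimes>c\<in>K}"
  proof (rule Suc.IH[OF col[OF x]])
   fix i c assume i: "i\<le>k" and c: "c\<in>ipow L (k - i)"
   have cc: "c\<in>\<R>" by (rule idl_carr[OF ipow_ideal[OF L] c])
   have "x[^]Suc i\<otimes>c\<in>K" using Suc.prems(2)[of "Suc i" c] i c by simp
   moreover have "x\<otimes>(x[^]i\<otimes>c) = x[^]Suc i\<otimes>c" using x cc by (simp add: m_ac)
   ultimately show "x[^]i\<otimes>c\<in>{c\<in>\<R>. x\<otimes>c\<in>K}" using cc x by simp
  qed
  hence 2: "x\<otimes>u\<in>K" using u by auto
  have "u\<otimes>v = l\<otimes>u\<oplus>r\<otimes>(x\<otimes>u)" unfolding v(3) using lc v(2) x uc by algebra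
  thus "u\<otimes>v\<in>K" using idl_add[OF Suc.prems(1) 1 idl_l[OF Suc.prems(1) 2 v(2)]] by simp
 qed
qed

text \<open>Pigeonhole over a finite set of generators of \<open>J\<close>: among
  \<open>n + s\<close> factors either \<open>x\<close> occurs \<open>s\<close> times or at least
  \<open>n\<close> factors come from the other generators.\<close>

lemma radical_power:
 assumes K: "ideal K R" and J: "ideal J R" and rad: "\<And>x. x\<in>J ==> \<exists>s::nat. x[^]s\<in>K" shows "\<exists>n. ipow J n\<subseteq>K"
proof -
 obtain A where A: "A\<subseteq>\<R>" "finite A" "J = Idl A" using finetely_gen[OF J] by auto
 have "B\<subseteq>A ==> \<exists>n. ipow (Idl B) n\<subseteq>K" for B
 proof (induction B rule: infinite_finite_induct)
  case (infinite B) thus ?case using A(2) finite_subset by auto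
 next
  case empty
  have "ipow {\<zero>} (Suc 0)\<subseteq>K" using ipow_1[OF zeroideal] idl_zero[OF K] by simp
  thus ?case unfolding Idl_empty by auto
 next
  case (insert x B)
  then obtain n where n: "ipow (Idl B) n\<subseteq>K" by auto
  have xc: "x\<in>\<R>" "B\<subseteq>\<R>" "x\<in>J" using insert.prems A genideal_self by auto
  obtain s :: nat where s: "x[^]s\<in>K" using rad[OF xc(3)] by auto
  note iB = genideal_ideal[OF xc(2)]
  have "ipow (adj (Idl B) x) (n + s)\<subseteq>K"
  proof (rule ipow_adj[OF iB xc(1) K])
   fix i c assume i: "i\<le>n + s" and c: "c\<in>ipow (Idl B) (n + s - i)"
   have cc: "c\<in>\<R>" by (rule idl_carr[OF ipow_ideal[OF iB] c])
   show "x[^]i\<otimes>c\<in>K"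
   proof (cases "s\<le>i")
    case True thus ?thesis using idl_r[OF K idl_pow_ge[OF K xc(1) s True] cc] by simp
   next
    case False
    hence "n\<le>n + s - i" by simp
    hence "c\<in>K" using c ipow_antimono[OF iB] n by auto
    thus ?thesis using idl_l[OF K] xc(1) by simp
   qed
  qed
  thus ?case unfolding Idl_insert[OF xc(2,1)] by auto
 qed
 thus ?thesis using A(3) by auto
qed

lemma acc:
 assumes "\<And>n::nat. ideal (f n) R" "\<And>n. f n\<subseteq>f (Suc n)" shows "\<exists>n0. \<forall>n\<ge>n0. f n = f n0"
proof -
 have "\<exists>M\<in>range f. \<forall>J\<in>range f. M\<subseteq>J \<longrightarrow> J = M" by (rule noeth_max) (use assms(1) in auto)
 then obtain n0 where n0: "\<And>n. f n0\<subseteq>f n ==> f n = f n0" by auto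
 thus ?thesis using lift_Suc_mono_le[of f, OF assms(2)] by metis
qed

text \<open>Take \<open>K\<close> maximal among the ideals with \<open>K \<inter> N = I + M N\<close>, where \<open>N\<close> is the intersection of
 the \<open>I + M\<^sup>n\<close>. Colon ideals of powers stabilise, so \<open>K\<close> contains a power of each element of \<open>M\<close>.\<close>
lemma krull_intersection_aux:
 assumes M: "ideal M R" and I: "ideal I R" and N: "N = {a. \<forall>n. a\<in>I <+> ipow M n}"
 shows "ideal N R \<and> N\<subseteq>I <+> ideal_prod R M N"
proof -
 note sm = idl_sumI[OF I ipow_ideal[OF M]]
 have smi: "ideal (I <+> ipow M n) R" for n using sm by simp
 have Ni: "ideal N R"
 proof (rule idealI')
  show "N\<subseteq>\<R>" using idl_carr[OF smi] N by auto
  show "\<zero>\<in>N" using idl_zero[OF smi] N by auto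
  show "a\<oplus>b\<in>N" if "a\<in>N" "b\<in>N" for a b using idl_add[OF smi] that N by auto
  show "r\<otimes>a\<in>N" if "a\<in>N" "r\<in>\<R>" for a r using idl_l[OF smi] that N by auto
 qed
 note MNi = ideal_prod_is_ideal[OF M Ni]
 define B where "B = I <+> ideal_prod R M N"
 have Bi: "ideal B R" and MB: "ideal_prod R M N\<subseteq>B" unfolding B_def using idl_sumI[OF I MNi] by auto
 have "I\<subseteq>N" using sm N by auto
 hence BN: "B\<subseteq>N" unfolding B_def using idl_sum_least[OF Ni] ideal_prod_inter[OF M Ni] by simp
 define T where "T K \<longleftrightarrow> ideal K R \<and> B\<subseteq>K \<and> K\<inter>N = B" for K
 have "T B" using Bi BN by (auto simp: T_def)
 moreover have "\<And>K. T K ==> ideal K R" by (simp add: T_def)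
 ultimately obtain K where TK: "T K" and max: "\<And>J. T J ==> K\<subseteq>J ==> J = K" using noeth_maxP by metis
 have K: "ideal K R" "B\<subseteq>K" "K\<inter>N = B" using TK by (simp_all add: T_def)
 have rad: "\<exists>s::nat. x[^]s\<in>K" if x: "x\<in>M" for x
 proof -
  have xc: "x\<in>\<R>" by (rule idl_carr[OF M x])
  define C where "C s = {c\<in>\<R>. x[^]s\<otimes>c\<in>K}" for s :: nat
  have "\<exists>n0. \<forall>n\<ge>n0. C n = C n0"
  proof (rule acc)
   show "ideal (C n) R" for n unfolding C_def using ideal.helper_max_prime[OF K(1) is_cring] xc by simp
   show "C n\<subseteq>C (Suc n)" for n
   proof
    fix c assume "c\<in>C n"
    hence c: "c\<in>\<R>" "x[^]n\<otimes>c\<in>K" by (auto simp: C_def)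
    have "x[^]Suc n\<otimes>c = x\<otimes>(x[^]n\<otimes>c)" using xc c(1) by (simp add: m_ac)
    thus "c\<in>C (Suc n)" using c(1) idl_l[OF K(1) c(2) xc] by (simp add: C_def)
   qed
  qed
  then obtain s where s: "C (Suc s) = C s" by (metis le_SucI order_refl)
  have xs: "x[^]s\<in>\<R>" using xc by simp
  note aK = adj_ideal[OF K(1) xs]
  have "T (adj K (x[^]s))" unfolding T_def
  proof (intro conjI)
   show "B\<subseteq>adj K (x[^]s)" using K(2) adjm_sub[OF K(1) oneideal xs] by (rule order_trans)
   show "adj K (x[^]s)\<inter>N = B"
   proof
    show "B\<subseteq>adj K (x[^]s)\<inter>N" using \<open>B \<subseteq> adj K (x [^] s)\<close> BN by simp
    show "adj K (x[^]s)\<inter>N\<subseteq>B"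
    proof
     fix b assume b: "b\<in>adj K (x[^]s)\<inter>N"
     then obtain k r where h: "k\<in>K" "r\<in>\<R>" "b = k\<oplus>r\<otimes>x[^]s" using adjD by (metis IntD1)
     have kc: "k\<in>\<R>" by (rule idl_carr[OF K(1) h(1)])
     have "x\<otimes>b\<in>K" using ideal_prod.prod[OF x, of b N] b MB K(2) by auto
     moreover have "x\<otimes>b = x[^]Suc s\<otimes>r\<oplus>x\<otimes>k" unfolding h(3) nat_pow_Suc using xc kc h(2) xs by algebra
     ultimately have "x[^]Suc s\<otimes>r\<oplus>x\<otimes>k\<in>K" by simp
     hence "x[^]Suc s\<otimes>r\<in>K" using idl_cancel[OF K(1) _ idl_l[OF K(1) h(1) xc]] xc h(2) by simp
     hence "r\<in>C (Suc s)" using h(2) by (simp add: C_def)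
     hence "r\<in>C s" by (simp only: s)
     hence "x[^]s\<otimes>r\<in>K" by (simp add: C_def)
     hence "b\<in>K" unfolding h(3) using idl_add[OF K(1) h(1)] m_comm[OF h(2) xs] by simp
     thus "b\<in>B" using b K(3) by auto
    qed
   qed
  qed (rule aK)
  hence "adj K (x[^]s) = K" using max adjm_sub[OF K(1) oneideal xs] by simp
  thus ?thesis using adj_self[OF K(1) xs] by auto
 qed
 then obtain n where n: "ipow M n\<subseteq>K" using radical_power[OF K(1) M] by auto
 have "I\<subseteq>K" using idl_sumI[OF I MNi] K(2) unfolding B_def by auto
 hence "I <+> ipow M n\<subseteq>K" using idl_sum_least[OF K(1)] n by simp
 hence "N\<subseteq>K" using N by auto
 hence "N\<subseteq>B" using K(3) by auto
 thus ?thesis using Ni by (simp add: B_def)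
qed

end

section \<open>Noetherian local rings\<close>

locale noeth_local = noeth_cring +
 fixes \<mm> assumes max_m: "maximalideal \<mm> R" and max_unique: "maximalideal M R ==> M = \<mm>"
begin

lemma m_prime: "primeideal \<mm> R" by (rule maximalideal_prime[OF max_m])
lemma m_ideal: "ideal \<mm> R" by (rule prime_ideal[OF m_prime])
lemma m_carr: "x\<in>\<mm> ==> x\<in>\<R>" by (rule idl_carr[OF m_ideal])
lemma m_sub: "\<mm>\<subseteq>\<R>" by (rule idl_sub[OF m_ideal])
lemma one_notin_m: "\<one>\<notin>\<mm>" by (rule prime_one[OF m_prime])

lemma proper_sub_m:
 assumes "ideal I R" "\<one>\<notin>I" shows "I\<subseteq>\<mm>"
proof -
 define T where "T K \<longleftrightarrow> ideal K R \<and> I\<subseteq>K \<and> \<one>\<notin>K" for K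
 have "T I" using assms by (simp add: T_def)
 moreover have "\<And>K. T K ==> ideal K R" by (simp add: T_def)
 ultimately obtain K where TK: "T K" and max: "\<And>J. T J ==> K\<subseteq>J ==> J = K" using noeth_maxP by metis
 have K: "ideal K R" "I\<subseteq>K" "\<one>\<notin>K" using TK by (simp_all add: T_def)
 have "maximalideal K R"
 proof (rule maximalidealI[OF K(1)])
  show "\<R>\<noteq>K" using K(3) one_closed by auto
  fix J assume J: "ideal J R" "K\<subseteq>J" "J\<subseteq>\<R>"
  show "J = K \<or> J = \<R>"
  proof (cases "\<one>\<in>J")
   case False
   hence "T J" using J K(2) by (auto simp: T_def)
   thus ?thesis using max J(2) by simp
  qed (use idl_one[OF J(1)] in simp)
 qed
 thus ?thesis using max_unique K(2) by simp
qed

lemma prime_sub_m: "primeideal Q R ==> Q\<subseteq>\<mm>" using proper_sub_m prime_ideal prime_one by simp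

lemma unit_inv:
 assumes "x\<in>\<R>" "x\<notin>\<mm>" shows "\<exists>y\<in>\<R>. y\<otimes>x = \<one>"
proof -
 have "\<not> PIdl x\<subseteq>\<mm>" using assms cgenideal_self by auto
 hence "\<one>\<in>PIdl x" using proper_sub_m[OF cgenideal_ideal[OF assms(1)]] by auto
 thus ?thesis unfolding cgenideal_def by auto
qed

lemma unit_cancel:
 assumes h: "x\<in>\<R>" "x\<notin>\<mm>" "ideal I R" "a\<in>\<R>" "x\<otimes>a\<in>I" shows "a\<in>I"
proof -
 obtain y where y: "y\<in>\<R>" "y\<otimes>x = \<one>" using unit_inv[OF h(1,2)] by auto
 have "y\<otimes>(x\<otimes>a) = a" using y h(1,4) by (simp flip: m_assoc)
 thus "a\<in>I" using idl_l[OF h(3,5) y(1)] by simp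
qed

lemma sat_m: "ideal I R ==> sat \<mm> I = I" using sat_sub[OF m_prime, of I] unit_cancel unfolding sat_def by auto

lemma nakayama:
 assumes "ideal N R" "ideal N' R"
  "\<And>L a. ideal L R ==> N'\<subseteq>L ==> (\<And>x c. x\<in>\<mm> ==> c\<in>N ==> x\<otimes>c\<in>L) ==> a\<in>N ==> a\<in>L"
 shows "N\<subseteq>N'"
proof -
 have "N\<subseteq>sat \<mm> N'"
 proof (rule nakayama_sat[OF m_prime assms(1,2)])
  fix L a assume "ideal L R" "N'\<subseteq>L" "\<And>x c. x\<in>\<mm> ==> c\<in>N ==> x\<otimes>c\<in>L" "a\<in>N"
  hence "a\<in>L" "a\<in>\<R>" using assms(3)[of L a] idl_carr by auto
  thus "\<exists>t\<in>\<R> - \<mm>. t\<otimes>a\<in>L" using one_notin_m by (intro bexI[of _ \<one>]) auto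
 qed
 thus ?thesis using sat_m[OF assms(2)] by simp
qed

text \<open>The auxiliary lemma puts the intersection \<open>N\<close> into \<open>I\<close> plus
  the maximal ideal times \<open>N\<close>; in a local ring Nakayama absorbs the second
  summand.\<close>

lemma krull_intersection:
 assumes I: "ideal I R" and a: "\<And>n. a\<in>I <+> ipow \<mm> n" shows "a\<in>I"
proof -
 define N where "N = {a. \<forall>n. a\<in>I <+> ipow \<mm> n}"
 have N: "ideal N R" "N\<subseteq>I <+> ideal_prod R \<mm> N" using krull_intersection_aux[OF m_ideal I N_def] by auto
 have "N\<subseteq>I"
 proof (rule nakayama[OF N(1) I])
  fix L a assume L: "ideal L R" "I\<subseteq>L" "\<And>x c. x\<in>\<mm> ==> c\<in>N ==> x\<otimes>c\<in>L" and a: "a\<in>N"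
  have "ideal_prod R \<mm> N\<subseteq>L" by (rule ideal_prod_least[OF L(1,3)])
  hence "I <+> ideal_prod R \<mm> N\<subseteq>L" using idl_sum_least[OF L(1,2)] by simp
  thus "a\<in>L" using a N(2) by auto
 qed
 thus ?thesis using a unfolding N_def by auto
qed

lemma dcc_primary:
 assumes "ideal I R" "\<And>Q. primeideal Q R ==> I\<subseteq>Q ==> Q = \<mm>"
  "\<And>n. ideal (J n) R" "\<And>n. I\<subseteq>J n" "\<And>n. J (Suc n)\<subseteq>J n" shows "\<exists>n0. \<forall>n\<ge>n0. J n = J n0"
proof (rule dcc_sat[where J = J, OF m_prime assms(1) _ assms(3,4,5)])
 show "Q = \<mm>" if "primeideal Q R" "I\<subseteq>Q" "Q\<subseteq>\<mm>" for Q by (rule assms(2)[OF that(1,2)])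
 show "a\<in>J n" if "t\<in>\<R> - \<mm>" "a\<in>\<R>" "t\<otimes>a\<in>J n" for t a n using unit_cancel[OF _ _ assms(3) that(2,3)] that(1) by simp
qed

lemma max_ideal_eq: "max_ideal R = \<mm>" unfolding max_ideal_def by (rule the_equality) (fact max_m max_unique)+

lemma noetherian_local: "noetherian_local_ring R"
 unfolding noetherian_local_ring_def local_ring_def using max_m max_unique is_cring noetherian_ring_axioms by blast

end

lemma noeth_local_of:
 assumes "noetherian_local_ring A" shows "noeth_local A (max_ideal A)"
proof -
 from assms have h: "cring A" "noetherian_ring A" "\<exists>!M. maximalideal M A" by (auto simp: noetherian_local_ring_def local_ring_def)
 have "maximalideal (max_ideal A) A" unfolding max_ideal_def by (rule theI'[OF h(3)])
 thus ?thesis unfolding noeth_local_def noeth_local_axioms_def noeth_cring_def using h by auto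
qed

section \<open>Systems of parameters and regular sequences\<close>

context noeth_local
begin

lemma prime_chain_to_m:
 assumes "prime_chain Q l" shows "\<exists>Q' l'. prime_chain Q' l' \<and> Q' 0 = Q 0 \<and> Q' l' = \<mm> \<and> l\<le>l'"
proof (cases "Q l = \<mm>")
 case False
 define Q' where "Q' i = (if i\<le>l then Q i else \<mm>)" for i
 have "Q l\<subset>\<mm>" using False prime_sub_m assms by (auto simp: prime_chain_def)
 hence "prime_chain Q' (Suc l)" using assms m_prime unfolding prime_chain_def Q'_def by (auto simp: less_Suc_eq)
 moreover have "Q' 0 = Q 0" "Q' (Suc l) = \<mm>" by (auto simp: Q'_def)
 ultimately show ?thesis by (metis le_SucI order_refl)
qed (use assms in auto)

text \<open>A chain above \<open>I\<close> can be prolonged to end in the maximal ideal, which is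
  minimal over \<open>I\<close> and \<open>xs\<close>, so the height theorem bounds it.\<close>

lemma dim_le_height:
 assumes "set xs\<subseteq>\<mm>" "\<And>Q. primeideal Q R ==> I\<subseteq>Q ==> set xs\<subseteq>Q ==> Q = \<mm>" shows "dim_le I (length xs)"
 unfolding dim_le_def
proof (intro allI impI)
 fix Q l assume Q: "prime_chain Q l" "I\<subseteq>Q 0"
 obtain Q' l' where Q': "prime_chain Q' l'" "Q' 0 = Q 0" "Q' l' = \<mm>" "l\<le>l'" using prime_chain_to_m[OF Q(1)] by auto
 have "Q 0\<subseteq>\<mm>" using prime_chain_mono[OF Q'(1), of 0 l'] Q' by simp
 hence "I\<union>set xs\<subseteq>\<mm>" using assms(1) Q(2) by auto
 hence "minimal_prime (I\<union>set xs) \<mm>" unfolding minimal_prime_def using assms(2) m_prime by (metis Un_subset_iff)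
 thus "l\<le>length xs" using height_theorem[OF _ Q'(1) _ Q'(3), of I xs] Q' Q(2) by simp
qed

section \<open>Dimension and partial systems of parameters\<close>

definition dim where "dim = the_enat (krull_dim R)"

lemma dim_le_finite: "\<exists>n. dim_le {} n"
proof -
 obtain A where A: "A\<subseteq>\<R>" "finite A" "\<mm> = Idl A" using finetely_gen[OF m_ideal] by auto
 obtain xs where xs: "set xs = A" using finite_list[OF A(2)] by auto
 have "dim_le {} (length xs)"
 proof (rule dim_le_height)
  show "set xs\<subseteq>\<mm>" using xs A genideal_self by simp
  show "Q = \<mm>" if "primeideal Q R" "set xs\<subseteq>Q" for Q
   using that genideal_minimal[OF prime_ideal[OF that(1)], of A] prime_sub_m xs A(3) by auto
 qed
 thus ?thesis by auto
qed

lemma krull_dim_dim: "krull_dim R = enat dim" and dim_le_iff: "dim_le {} n \<longleftrightarrow> dim\<le>n"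
 and dim_chain: "\<exists>Q. prime_chain Q dim"
proof -
 define S where "S = {n. \<exists>Q. prime_chain Q n}"
 have kd: "krull_dim R = Sup (enat ` S)" unfolding krull_dim_def S_def prime_chain_def by (rule arg_cong[of _ _ Sup]) auto
 obtain N where N: "dim_le {} N" using dim_le_finite by auto
 have SN: "n\<le>N" if "n\<in>S" for n using that N unfolding S_def dim_le_def by auto
 hence fin: "finite S" using finite_nat_set_iff_bounded_le by auto
 have "prime_chain (\<lambda>_. \<mm>) 0" using m_prime by (simp add: prime_chain_def)
 hence ne: "S\<noteq>{}" unfolding S_def by auto
 have mx: "Max S\<in>S" "\<And>n. n\<in>S ==> n\<le>Max S" using fin ne by auto
 have "Sup (enat ` S) = enat (Max S)" by (rule antisym) (use mx in \<open>auto intro!: Sup_least Sup_upper\<close>)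
 hence d: "dim = Max S" and k: "krull_dim R = enat (Max S)" using kd by (auto simp: dim_def)
 show "krull_dim R = enat dim" using d k by simp
 show "dim_le {} n \<longleftrightarrow> dim\<le>n" unfolding d dim_le_def using ne fin by (auto simp: S_def)
 show "\<exists>Q. prime_chain Q dim" using mx(1) d by (auto simp: S_def)
qed

text \<open>These are the initial segments of systems of parameters, by \<open>sop_prefix\<close>
  and \<open>psop_extend2\<close>. The bound on the remaining dimension allows them to be built one
  element at a time.\<close>

definition psop where
 "psop c \<longleftrightarrow> set c\<subseteq>\<mm> \<and> length c\<le>dim \<and> dim_le (set c) (dim - length c)"

definition sop where
 "sop c \<longleftrightarrow> set c\<subseteq>\<mm> \<and> length c = dim \<and> (\<forall>Q. primeideal Q R \<longrightarrow> set c\<subseteq>Q \<longrightarrow> Q = \<mm>)"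

lemma dim_le_0: "dim_le S 0 \<longleftrightarrow> (\<forall>Q. primeideal Q R \<longrightarrow> S\<subseteq>Q \<longrightarrow> Q = \<mm>)"
proof
 assume a: "dim_le S 0"
 show "\<forall>Q. primeideal Q R \<longrightarrow> S\<subseteq>Q \<longrightarrow> Q = \<mm>"
 proof (intro allI impI)
  fix Q assume Q: "primeideal Q R" "S\<subseteq>Q"
  hence "prime_chain (\<lambda>_. Q) 0" by (simp add: prime_chain_def)
  then obtain Q' l' where h: "prime_chain Q' l'" "Q' 0 = Q" "Q' l' = \<mm>" using prime_chain_to_m by metis
  hence "l'\<le>0" using a Q unfolding dim_le_def by simp
  thus "Q = \<mm>" using h by simp
 qed
next
 assume a: "\<forall>Q. primeideal Q R \<longrightarrow> S\<subseteq>Q \<longrightarrow> Q = \<mm>"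
 show "dim_le S 0" unfolding dim_le_def
 proof (intro allI impI)
  fix Q l assume Q: "prime_chain Q l" "S\<subseteq>Q 0"
  show "l\<le>0"
  proof (rule ccontr)
   assume "\<not> l\<le>0"
   hence "primeideal (Q 0) R" "primeideal (Q (Suc 0)) R" "Q 0\<subset>Q (Suc 0)" using Q by (auto simp: prime_chain_def)
   hence "Q 0 = \<mm>" "Q (Suc 0) = \<mm>" using a Q(2) by auto
   thus False using \<open>Q 0 \<subset> Q (Suc 0)\<close> by simp
  qed
 qed
qed

lemma psop_full: "psop c ==> length c = dim ==> sop c" unfolding psop_def sop_def using dim_le_0 by simp

lemma sop_prefix:
 assumes h: "sop (c @ x)" shows "psop c"
proof -
 have "dim_le (set c) (length x)" by (rule dim_le_height) (use h in \<open>auto simp: sop_def\<close>)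
 moreover have "dim - length c = length x" "length c\<le>dim" "set c\<subseteq>\<mm>" using h by (auto simp: sop_def)
 ultimately show ?thesis unfolding psop_def by simp
qed

lemma psop_Nil: "psop []" unfolding psop_def using dim_le_iff by simp

lemma psop_minimal_not_m:
 assumes "psop c" "length c < dim" "minimal_prime (Idl (set c)) Q" shows "\<not> \<mm>\<subseteq>Q"
proof
 assume "\<mm>\<subseteq>Q"
 have cc: "set c\<subseteq>\<R>" "set c\<subseteq>\<mm>" using assms(1) m_sub by (auto simp: psop_def)
 have "Q = \<mm>" using \<open>\<mm> \<subseteq> Q\<close> prime_sub_m assms(3) by (auto simp: minimal_prime_def)
 hence mp: "minimal_prime (Idl (set c)) \<mm>" using assms(3) by simp
 have "dim_le {} (length c)"
 proof (rule dim_le_height[OF cc(2)])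
  fix Q' assume Q': "primeideal Q' R" "set c\<subseteq>Q'"
  have "Idl (set c)\<subseteq>Q'" by (rule genideal_minimal[OF prime_ideal[OF Q'(1)] Q'(2)])
  thus "Q' = \<mm>" using minimal_primeD[OF mp Q'(1)] prime_sub_m[OF Q'(1)] by simp
 qed
 thus False using dim_le_iff assms(2) by simp
qed

text \<open>The condition \<open>av\<close> prolongs a chain of primes above \<open>c\<close> and
  \<open>x\<close> downwards by a prime above \<open>c\<close>, so the bound on chain lengths drops
  by one.\<close>

lemma psop_snocI:
 assumes c: "psop c" "length c < dim" and x: "x\<in>\<mm>"
  and av: "\<And>Q. primeideal Q R ==> set c\<subseteq>Q ==> x\<in>Q ==> \<exists>Q'. primeideal Q' R \<and> set c\<subseteq>Q' \<and> Q'\<subset>Q"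
 shows "psop (c @ [x])"
proof -
 have dl: "dim_le (set c) (dim - length c)" using c by (simp add: psop_def)
 have "dim_le (set (c @ [x])) (dim - length (c @ [x]))" unfolding dim_le_def
 proof (intro allI impI)
  fix Q l assume Q: "prime_chain Q l" "set (c @ [x])\<subseteq>Q 0"
  have "primeideal (Q 0) R" using Q(1) by (simp add: prime_chain_def)
  then obtain Q' where Q': "primeideal Q' R" "set c\<subseteq>Q'" "Q'\<subset>Q 0" using av[of "Q 0"] Q(2) by auto
  define Q'' where "Q'' i = (case i of 0\<Rightarrow>Q' | Suc j\<Rightarrow>Q j)" for i
  have "prime_chain Q'' (Suc l)" unfolding prime_chain_def Q''_def using Q' Q(1) by (auto split: nat.split simp: prime_chain_def)
  moreover have "set c\<subseteq>Q'' 0" using Q'(2) by (simp add: Q''_def)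
  ultimately have "Suc l\<le>dim - length c" using dl unfolding dim_le_def by simp
  thus "l\<le>dim - length (c @ [x])" by simp
 qed
 thus ?thesis unfolding psop_def using c x by (simp add: psop_def)
qed

lemma minimal_prime_avoid:
 assumes c: "set c\<subseteq>\<R>" and x: "\<And>Q. minimal_prime (Idl (set c)) Q ==> x\<notin>Q"
  and Q: "primeideal Q R" "set c\<subseteq>Q" "x\<in>Q" shows "\<exists>Q'. primeideal Q' R \<and> set c\<subseteq>Q' \<and> Q'\<subset>Q"
proof -
 obtain Q' where Q': "minimal_prime (Idl (set c)) Q'" "Q'\<subseteq>Q"
  using minimal_prime_below[OF genideal_ideal[OF c] Q(1) genideal_minimal[OF prime_ideal[OF Q(1)] Q(2)]] by auto
 have "x\<notin>Q'" using x[OF Q'(1)] .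
 moreover have "set c\<subseteq>Q'" "primeideal Q' R" using Q'(1) genideal_self[OF c] by (auto simp: minimal_prime_def)
 ultimately show ?thesis using Q' Q(3) by auto
qed

text \<open>Prime avoidance for all minimal primes over all members of \<open>C\<close> at once. Two
  members are needed to give two systems a common continuation; a proper subideal \<open>J\<close>
  is needed to stay inside a given prime.\<close>

lemma psop_extend_in:
 assumes C: "finite C" "\<And>c. c\<in>C ==> psop c \<and> length c < dim" and J: "ideal J R" "J\<subseteq>\<mm>"
  and JQ: "\<And>c Q. c\<in>C ==> minimal_prime (Idl (set c)) Q ==> \<not> J\<subseteq>Q" shows "\<exists>y\<in>J. \<forall>c\<in>C. psop (c @ [y])"
proof -
 have cc: "set c\<subseteq>\<R>" if "c\<in>C" for c using C(2)[OF that] m_sub by (auto simp: psop_def)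
 define \<Q> where "\<Q> = (\<Union>c\<in>C. {Q. minimal_prime (Idl (set c)) Q})"
 have "\<exists>y\<in>J. \<forall>Q\<in>\<Q>. y\<notin>Q"
 proof (rule prime_avoidance[OF _ _ J(1)])
  show "finite \<Q>" unfolding \<Q>_def using C(1) finite_minimal_primes genideal_ideal cc by (intro finite_UN_I) auto
  show "primeideal Q R \<and> \<not> J\<subseteq>Q" if "Q\<in>\<Q>" for Q using that JQ unfolding \<Q>_def by (auto simp: minimal_prime_def)
 qed
 then obtain y where y: "y\<in>J" "\<forall>Q\<in>\<Q>. y\<notin>Q" by auto
 have "psop (c @ [y])" if c: "c\<in>C" for c
 proof (rule psop_snocI)
  show "psop c" "length c < dim" "y\<in>\<mm>" using C(2)[OF c] y J by auto
  show "\<exists>Q'. primeideal Q' R \<and> set c\<subseteq>Q' \<and> Q'\<subset>Q" if "primeideal Q R" "set c\<subseteq>Q" "y\<in>Q" for Q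
   by (rule minimal_prime_avoid[OF cc[OF c] _ that]) (use y(2) c in \<open>auto simp: \<Q>_def\<close>)
 qed
 thus ?thesis using y(1) by auto
qed

lemma psop_extend2:
 assumes "psop c" "psop c'" "length c = length c'" "length c + n = dim" shows "\<exists>ys. length ys = n \<and> sop (c @ ys) \<and> sop (c' @ ys)"
 using assms
proof (induction n arbitrary: c c')
 case 0 thus ?case using psop_full by auto
next
 case (Suc n)
 have "\<exists>y\<in>\<mm>. \<forall>d\<in>{c, c'}. psop (d @ [y])" by (rule psop_extend_in) (use Suc.prems m_ideal psop_minimal_not_m in auto)
 then obtain y where y: "psop (c @ [y])" "psop (c' @ [y])" by auto
 obtain ys where "length ys = n" "sop ((c @ [y]) @ ys)" "sop ((c' @ [y]) @ ys)" using Suc.IH[OF y] Suc.prems by auto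
 thus ?case by (intro exI[of _ "y # ys"]) auto
qed

text \<open>A chain of single replacements leads from \<open>x\<close> to \<open>z\<close>. Choose
  \<open>ys\<close> that completes both the segment with the first entry of \<open>x\<close> and the
  one with the first entry of \<open>z\<close>. Induction changes the rest of \<open>x\<close> into
  \<open>ys\<close>, one exchange replaces the first entry, and induction changes \<open>ys\<close>
  into the rest of \<open>z\<close>. Permutations bring the entry to be exchanged to the
  end.\<close>

lemma sop_connect:
 assumes perm: "\<And>xs ys. \<Phi> xs ==> mset xs = mset ys ==> \<Phi> ys"
  and exch: "\<And>l u v. \<Phi> (l @ [u]) ==> sop (l @ [u]) ==> sop (l @ [v]) ==> \<Phi> (l @ [v])" and "sop x" "sop z" "\<Phi> x" shows "\<Phi> z"
proof -
 have sop_perm: "sop xs ==> mset xs = mset ys ==> sop ys" for xs ys using mset_eq_setD[of xs ys] mset_eq_length[of xs ys] by (auto simp: sop_def)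
 have "length x = n ==> length z = n ==> sop (c @ x) ==> sop (c @ z) ==> \<Phi> (c @ x) ==> \<Phi> (c @ z)" for n c x z
 proof (induction n arbitrary: c x z)
  case (Suc n)
  obtain x1 x' z1 z' where xz: "x = x1 # x'" "z = z1 # z'" using Suc.prems(1,2) by (metis length_Suc_conv)
  have p: "psop (c @ [x1])" "psop (c @ [z1])" using Suc.prems(3,4) xz sop_prefix sop_prefix[of "c @ [z1]" z'] by auto
  have "length (c @ [x1]) + n = dim" using Suc.prems(1,3) unfolding sop_def by simp
  then obtain ys where ys: "length ys = n" "sop ((c @ [x1]) @ ys)" "sop ((c @ [z1]) @ ys)" using psop_extend2[OF p] by auto
  have "\<Phi> ((c @ [x1]) @ ys)" by (rule Suc.IH[OF _ ys(1) _ ys(2)]) (use Suc.prems xz in auto)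
  hence "\<Phi> ((c @ ys) @ [x1])" by (rule perm) simp
  moreover have "sop ((c @ ys) @ [x1])" "sop ((c @ ys) @ [z1])" by (rule sop_perm[OF ys(2)], simp) (rule sop_perm[OF ys(3)], simp)
  ultimately have "\<Phi> ((c @ ys) @ [z1])" by (rule exch)
  hence "\<Phi> ((c @ [z1]) @ ys)" by (rule perm) simp
  moreover have "length z' = n" "sop ((c @ [z1]) @ z')" using Suc.prems xz by auto
  ultimately have "\<Phi> ((c @ [z1]) @ z')" using Suc.IH[OF ys(1) _ ys(3)] by simp
  thus ?case using xz by simp
 qed simp
 from this[of x dim z "[]"] show ?thesis using assms by (simp add: sop_def)
qed

text \<open>At the maximal ideal the multiplier supplied by \<open>minimal_prime_nilp\<close> is a
  unit and can be cancelled.\<close>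

lemma sop_pow:
 assumes "sop c" "a\<in>\<mm>" shows "\<exists>n::nat. a[^]n\<in>Idl (set c)"
proof -
 have c: "set c\<subseteq>\<R>" using assms(1) m_sub by (auto simp: sop_def)
 note i = genideal_ideal[OF c]
 have ac: "a\<in>\<R>" by (rule m_carr[OF assms(2)])
 have "minimal_prime (set c) \<mm>" using assms(1) m_prime unfolding minimal_prime_def sop_def by metis
 then obtain s n where "s\<in>\<R> - \<mm>" "s\<otimes>a[^](n::nat)\<in>Idl (set c)" using minimal_prime_nilp assms(2) by metis
 hence "a[^]n\<in>Idl (set c)" using unit_cancel[OF _ _ i, of s "a[^]n"] ac by simp
 thus ?thesis by auto
qed

section \<open>Regular sequences\<close>

definition nzd where "nzd I x \<longleftrightarrow> (\<forall>a\<in>\<R>. x\<otimes>a\<in>I \<longrightarrow> a\<in>I)"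

lemma nzdD: "nzd I x ==> a\<in>\<R> ==> x\<otimes>a\<in>I ==> a\<in>I" unfolding nzd_def by simp

definition regseq where
 "regseq xs \<longleftrightarrow> set xs\<subseteq>\<mm> \<and> (\<forall>i<length xs. nzd (Idl (set (take i xs))) (xs ! i))"

lemma regseq_iff:
 assumes a: "set xs\<subseteq>\<mm>" shows "regular_sequence R xs \<longleftrightarrow> regseq xs"
proof -
 have "Idl (set xs)\<subseteq>\<mm>" by (rule genideal_minimal[OF m_ideal a])
 hence "Idl (set xs)\<noteq>\<R>" using one_notin_m by auto
 thus ?thesis unfolding regular_sequence_def regseq_def nzd_def using a m_sub by auto
qed

lemma regseq_Nil: "regseq []" by (simp add: regseq_def)

lemma regseq_snoc: "regseq (xs @ [x]) \<longleftrightarrow> regseq xs \<and> x\<in>\<mm> \<and> nzd (Idl (set xs)) x"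
 unfolding regseq_def by (auto simp: nth_append)

lemma regseq_append: "regseq (xs @ ys) ==> regseq xs" by (induction ys rule: rev_induct) (simp_all add: regseq_snoc flip: append_assoc)

lemma nzd_pow: "x\<in>\<R> ==> nzd I x ==> nzd I (x[^](n::nat))"
proof (induction n)
 case (Suc n)
 hence IH: "nzd I (x[^]n)" by simp
 show ?case unfolding nzd_def
 proof (intro ballI impI)
  fix a assume a: "a\<in>\<R>" "x[^]Suc n\<otimes>a\<in>I"
  have "x[^]n\<otimes>(x\<otimes>a)\<in>I" using a Suc.prems(1) by (simp add: m_assoc)
  hence "x\<otimes>a\<in>I" using nzdD[OF IH, of "x\<otimes>a"] a(1) Suc.prems(1) by simp
  thus "a\<in>I" by (rule nzdD[OF Suc.prems(2) a(1)])
 qed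
qed (simp add: nzd_def)

text \<open>A nonzerodivisor modulo \<open>xs\<close> is in no minimal prime over \<open>xs\<close>,
  since elements of such a prime are nilpotent up to a multiplier outside it. So each further entry
  lowers the dimension.\<close>

lemma regseq_psop:
 "regseq xs ==> psop xs"
proof (induction xs rule: rev_induct)
 case Nil show ?case by (rule psop_Nil)
next
 case (snoc x xs)
 hence h: "psop xs" "x\<in>\<mm>" "nzd (Idl (set xs)) x" by (auto simp: regseq_snoc)
 have c: "set xs\<subseteq>\<R>" "x\<in>\<R>" using h m_sub by (auto simp: psop_def)
 have av: "\<exists>Q'. primeideal Q' R \<and> set xs\<subseteq>Q' \<and> Q'\<subset>Q" if Q: "primeideal Q R" "set xs\<subseteq>Q" "x\<in>Q" for Q
 proof (rule minimal_prime_avoid[OF c(1) _ Q])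
  fix Q' assume Q': "minimal_prime (Idl (set xs)) Q'"
  show "x\<notin>Q'"
  proof
   assume "x\<in>Q'"
   then obtain s n where s: "s\<in>\<R> - Q'" "s\<otimes>x[^](n::nat)\<in>Idl (Idl (set xs))" using minimal_prime_nilp[OF Q'] by metis
   have "s\<otimes>x[^]n\<in>Idl (set xs)" using s(2) Idl_ideal_eq[OF genideal_ideal[OF c(1)]] by simp
   hence "x[^]n\<otimes>s\<in>Idl (set xs)" using s c m_comm by simp
   hence "s\<in>Idl (set xs)" using nzdD[OF nzd_pow[OF c(2) h(3)]] s by simp
   thus False using s Q' by (auto simp: minimal_prime_def)
  qed
 qed
 have "length xs\<noteq>dim"
 proof
  assume "length xs = dim"
  hence "sop xs" using psop_full h(1) by simp
  moreover obtain Q' where "primeideal Q' R" "set xs\<subseteq>Q'" "Q'\<subset>\<mm>" using av[OF m_prime _ h(2)] h(1) by (auto simp: psop_def)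
  ultimately show False unfolding sop_def by auto
 qed
 hence "length xs < dim" using h(1) by (simp add: psop_def)
 thus ?case by (rule psop_snocI[OF h(1) _ h(2) av])
qed

text \<open>The colon ideal \<open>K\<close> of \<open>I\<close> by \<open>y\<close> lies in
  \<open>I\<close> plus \<open>x\<close> times \<open>K\<close>, so Nakayama gives that
  \<open>y\<close> is a nonzerodivisor modulo \<open>I\<close>. The other half is a computation with
  two representations of the same element.\<close>

lemma nzd_swap:
 assumes I: "ideal I R" "I\<subseteq>\<mm>" and xy: "x\<in>\<mm>" "y\<in>\<mm>" and n: "nzd I x" "nzd (adj I x) y"
 shows "nzd I y \<and> nzd (adj I y) x"
proof
 have c: "x\<in>\<R>" "y\<in>\<R>" using xy m_carr by auto
 show ny: "nzd I y"
 proof -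
  define K where "K = {a\<in>\<R>. y\<otimes>a\<in>I}"
  have K: "ideal K R" unfolding K_def by (rule ideal.helper_max_prime[OF I(1) is_cring c(2)])
  have "K\<subseteq>I"
  proof (rule nakayama[OF K I(1)])
   fix L a assume L: "ideal L R" "I\<subseteq>L" "\<And>x c. x\<in>\<mm> ==> c\<in>K ==> x\<otimes>c\<in>L" and a: "a\<in>K"
   have a': "a\<in>\<R>" "y\<otimes>a\<in>I" using a by (auto simp: K_def)
   have "a\<in>adj I x" using nzdD[OF n(2) a'(1)] a'(2) adjm_sub[OF I(1) oneideal c(1)] by auto
   then obtain i b where ib: "i\<in>I" "b\<in>\<R>" "a = i\<oplus>b\<otimes>x" using adjD by metis
   have ic: "i\<in>\<R>" by (rule idl_carr[OF I(1) ib(1)])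
   have "x\<otimes>(y\<otimes>b) = y\<otimes>a\<ominus>y\<otimes>i" unfolding ib(3) using c ic ib(2) by algebra
   also have "\<dots>\<in>I" using idl_minus[OF I(1) a'(2) idl_l[OF I(1) ib(1) c(2)]] .
   finally have "y\<otimes>b\<in>I" using nzdD[OF n(1)] c ib(2) by simp
   hence "b\<in>K" using ib(2) by (simp add: K_def)
   hence "x\<otimes>b\<in>L" by (rule L(3)[OF xy(1)])
   hence "b\<otimes>x\<in>L" using m_comm[OF c(1) ib(2)] by simp
   thus "a\<in>L" unfolding ib(3) using idl_add[OF L(1)] L(2) ib(1) by auto
  qed
  thus ?thesis unfolding nzd_def K_def by auto
 qed
 show "nzd (adj I y) x" unfolding nzd_def
 proof (intro ballI impI)
  fix a assume a: "a\<in>\<R>" "x\<otimes>a\<in>adj I y"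
  then obtain i b where ib: "i\<in>I" "b\<in>\<R>" "x\<otimes>a = i\<oplus>b\<otimes>y" using adjD by metis
  have ic: "i\<in>\<R>" by (rule idl_carr[OF I(1) ib(1)])
  have "x\<otimes>a\<ominus>i = y\<otimes>b" unfolding ib(3) using ic ib(2) c by algebra
  moreover have "x\<otimes>a\<ominus>i = (\<ominus> i)\<oplus>a\<otimes>x" using ic a(1) c by algebra
  ultimately have "y\<otimes>b = (\<ominus> i)\<oplus>a\<otimes>x" by simp
  hence "y\<otimes>b\<in>adj I x" unfolding adjm_def using idl_neg[OF I(1) ib(1)] a(1) by auto
  hence "b\<in>adj I x" by (rule nzdD[OF n(2) ib(2)])
  then obtain j e where je: "j\<in>I" "e\<in>\<R>" "b = j\<oplus>e\<otimes>x" using adjD by metis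
  have jc: "j\<in>\<R>" by (rule idl_carr[OF I(1) je(1)])
  have "x\<otimes>(a\<ominus>e\<otimes>y) = x\<otimes>a\<ominus>(e\<otimes>x)\<otimes>y" using c a(1) je(2) by algebra
  also have "\<dots> = i\<oplus>j\<otimes>y" unfolding ib(3) je(3) using ic jc je(2) c by algebra
  also have "\<dots>\<in>I" using idl_add[OF I(1) ib(1) idl_r[OF I(1) je(1) c(2)]] .
  finally have d: "a\<ominus>e\<otimes>y\<in>I" using nzdD[OF n(1)] a(1) je(2) c by simp
  have "a = (a\<ominus>e\<otimes>y)\<oplus>e\<otimes>y" using a(1) je(2) c by algebra
  thus "a\<in>adj I y" unfolding adjm_def using d je(2) by auto
 qed
qed

lemma regseq_swap:
 assumes "regseq (l @ [x, y])" shows "regseq (l @ [y, x])"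
proof -
 from assms have "regseq ((l @ [x]) @ [y])" by simp
 hence h: "regseq l" "x\<in>\<mm>" "y\<in>\<mm>" "nzd (Idl (set l)) x" "nzd (Idl (insert x (set l))) y" unfolding regseq_snoc by auto
 have l: "set l\<subseteq>\<R>" "set l\<subseteq>\<mm>" using h(1) m_sub by (auto simp: regseq_def)
 have c: "x\<in>\<R>" "y\<in>\<R>" using h m_carr by auto
 have "nzd (Idl (set l)) y \<and> nzd (adj (Idl (set l)) y) x"
  using nzd_swap[OF genideal_ideal[OF l(1)] genideal_minimal[OF m_ideal l(2)] h(2,3,4)] h(5) Idl_insert[OF l(1) c(1)] by simp
 hence "regseq ((l @ [y]) @ [x])" unfolding regseq_snoc using h Idl_insert[OF l(1) c(2)] by simp
 thus ?thesis by simp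
qed

lemma regseq_tail: "regseq (l @ r) ==> set l = set l' ==> regseq l' ==> regseq (l' @ r)"
proof (induction r rule: rev_induct)
 case (snoc x r)
 thus ?case unfolding append_assoc[symmetric] regseq_snoc by auto
qed simp

lemma regseq_swap': "regseq (l @ x # y # r) ==> regseq (l @ y # x # r)"
proof -
 assume h: "regseq (l @ x # y # r)"
 have "regseq (l @ [x, y])" using regseq_append h by simp
 hence "regseq (l @ [y, x])" by (rule regseq_swap)
 hence "regseq ((l @ [y, x]) @ r)" using regseq_tail[of "l @ [x, y]" r "l @ [y, x]"] h by auto
 thus ?thesis by simp
qed

lemma regseq_front: "regseq (l @ a @ y # b) ==> regseq (l @ y # a @ b)"
proof (induction a arbitrary: b rule: rev_induct)
 case (snoc x a)
 have "regseq ((l @ a) @ x # y # b)" using snoc.prems by simp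
 hence "regseq ((l @ a) @ y # x # b)" by (rule regseq_swap')
 thus ?case using snoc.IH by simp
qed simp

lemma regseq_perm: "mset xs = mset ys ==> regseq xs ==> regseq ys"
proof -
 have "mset xs = mset ys ==> regseq (l @ xs) ==> regseq (l @ ys)" for l
 proof (induction ys arbitrary: l xs)
  case (Cons y ys)
  have "y\<in>set xs" using mset_eq_setD[OF Cons.prems(1)] by simp
  then obtain a b where ab: "xs = a @ y # b" by (meson split_list)
  have "regseq ((l @ [y]) @ a @ b)" using regseq_front Cons.prems(2) ab by simp
  moreover have "mset (a @ b) = mset ys" using Cons.prems(1) ab by simp
  ultimately show ?case using Cons.IH[of "a @ b" "l @ [y]"] by simp
 qed simp
 from this[of "[]"] show "mset xs = mset ys ==> regseq xs ==> regseq ys" by simp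
qed

text \<open>The exponents may differ from entry to entry, because an exchange of one parameter
  brings in a power of the new one that is unrelated to the exponents of the others.\<close>

definition ispow where "ispow xs ys = list_all2 (\<lambda>x y. \<exists>e>0. y = x[^](e::nat)) xs ys"

lemma ispow_refl:
 assumes c: "set xs\<subseteq>\<R>" shows "ispow xs xs"
proof -
 have "\<exists>e>0. x = x[^](e::nat)" if "x\<in>set xs" for x
 proof (intro exI conjI)
  show "x = x[^]Suc 0" using that c by auto
 qed simp
 thus ?thesis unfolding ispow_def list_all2_same by simp
qed

lemma ispow_perm: "ispow xs ys ==> mset xs' = mset xs ==> \<exists>ys'. ispow xs' ys' \<and> mset ys' = mset ys"
 unfolding ispow_def by (rule list_all2_reorder_left_invariance)

lemma regseq_ispow: "ispow xs ys ==> regseq xs ==> regseq ys"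
proof -
 have "list_all2 (\<lambda>x y. \<exists>e>0. y = x[^](e::nat)) xs ys ==> regseq (l @ xs) ==> regseq (l @ ys)" for l
 proof (induction arbitrary: l rule: list_all2_induct)
  case (Cons x xs y ys)
  obtain e :: nat where e: "e > 0" "y = x[^]e" using Cons by auto
  have "regseq ((l @ xs) @ [x])" by (rule regseq_perm[OF _ Cons.prems]) simp
  hence h: "regseq (l @ xs)" "x\<in>\<mm>" "nzd (Idl (set (l @ xs))) x" unfolding regseq_snoc by auto
  hence "regseq ((l @ xs) @ [y])" unfolding regseq_snoc e(2) using nzd_pow[OF m_carr] idl_pow[OF m_ideal _ e(1)] by auto
  hence "regseq ((l @ [y]) @ xs)" by (rule regseq_perm[rotated]) simp
  thus ?case using Cons.IH[of "l @ [y]"] by simp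
 qed simp
 from this[of "[]"] show "ispow xs ys ==> regseq xs ==> regseq ys" by (simp add: ispow_def)
qed

lemma sop_ispow:
 assumes p: "ispow xs ys" and s: "sop xs" shows "sop ys"
proof -
 have nth: "length xs = length ys" "\<And>i. i < length xs ==> \<exists>e>0. ys ! i = xs ! i[^](e::nat)"
  using p by (auto simp: ispow_def list_all2_conv_all_nth)
 have xm: "set xs\<subseteq>\<mm>" using s by (simp add: sop_def)
 have "set ys\<subseteq>\<mm>"
 proof
  fix y assume "y\<in>set ys"
  then obtain i where i: "i < length xs" "y = ys ! i" using nth(1) by (auto simp: in_set_conv_nth)
  then obtain e :: nat where "e > 0" "y = xs ! i[^]e" using nth(2) by auto
  moreover have "xs ! i\<in>\<mm>" using xm i(1) by auto
  ultimately show "y\<in>\<mm>" using idl_pow[OF m_ideal] by metis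
 qed
 moreover have "Q = \<mm>" if Q: "primeideal Q R" "set ys\<subseteq>Q" for Q
 proof -
  have "set xs\<subseteq>Q"
  proof
   fix x assume "x\<in>set xs"
   then obtain i where i: "i < length xs" "x = xs ! i" by (auto simp: in_set_conv_nth)
   then obtain e :: nat where "ys ! i = x[^]e" using nth(2) by auto
   moreover have "ys ! i\<in>Q" using Q(2) i nth(1) by auto
   ultimately have "x[^]e\<in>Q" by simp
   moreover have "x\<in>\<R>" using xm i nth_mem[OF i(1)] m_carr by (metis subsetD)
   ultimately show "x\<in>Q" using prime_pow[OF Q(1)] by simp
  qed
  thus ?thesis using s Q(1) by (simp add: sop_def)
 qed
 ultimately show ?thesis using s nth(1) by (simp add: sop_def)
qed

lemma regseq_colon:
 assumes "regseq (l @ [u])" "c\<in>\<R>" "u[^]a\<otimes>c\<in>Idl (insert (u[^](a + b)) (set l))" shows "c\<in>Idl (insert (u[^](b::nat)) (set l))"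
proof -
 have h: "regseq l" "u\<in>\<mm>" "nzd (Idl (set l)) u" using assms(1) by (auto simp: regseq_snoc)
 have l: "set l\<subseteq>\<R>" and u: "u\<in>\<R>" using h m_sub by (auto simp: regseq_def)
 note I = genideal_ideal[OF l]
 have ub: "u[^]a\<in>\<R>" "u[^]b\<in>\<R>" "u[^](a + b)\<in>\<R>" using u by auto
 have ab: "u[^](a + b) = u[^]a\<otimes>u[^]b" using u by (simp add: nat_pow_mult)
 obtain i r where ir: "i\<in>Idl (set l)" "r\<in>\<R>" "u[^]a\<otimes>c = i\<oplus>r\<otimes>u[^](a + b)"
  using assms(3) adjD unfolding Idl_insert[OF l ub(3)] by metis
 have ic: "i\<in>\<R>" by (rule idl_carr[OF I ir(1)])
 have "u[^]a\<otimes>(c\<ominus>r\<otimes>u[^]b) = u[^]a\<otimes>c\<ominus>r\<otimes>u[^](a + b)" unfolding ab using ub(1,2) assms(2) ir(2) by algebra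
 also have "\<dots> = i" unfolding ir(3) using ic ir(2) ub(3) by algebra
 finally have "c\<ominus>r\<otimes>u[^]b\<in>Idl (set l)" using nzdD[OF nzd_pow[OF u h(3)], of "c\<ominus>r\<otimes>u[^]b" a] ir assms(2) ub by simp
 moreover have "c = (c\<ominus>r\<otimes>u[^]b)\<oplus>r\<otimes>u[^]b" using assms(2) ir(2) ub by algebra
 ultimately show ?thesis unfolding Idl_insert[OF l ub(2)] adjm_def using ir(2) by auto
qed

text \<open>Some power of \<open>u\<close> lies in the parameter ideal. The exponent is a successor
  so that this power is a legitimate substitute for \<open>u\<close> in a regular sequence.\<close>

lemma sop_exchange_rel:
 assumes "sop (l @ [v])" "u\<in>\<mm>"
 obtains n c i where "c\<in>\<R>" "i\<in>Idl (set l)" "u[^]Suc n = i\<oplus>c\<otimes>v"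
proof -
 have l: "set l\<subseteq>\<R>" and v: "v\<in>\<R>" using assms(1) m_sub by (auto simp: sop_def)
 have uc: "u\<in>\<R>" by (rule m_carr[OF assms(2)])
 obtain n :: nat where "u[^]n\<in>Idl (set (l @ [v]))" using sop_pow[OF assms] by auto
 moreover have "Idl (set (l @ [v])) = adj (Idl (set l)) v" using Idl_insert[OF l v] by simp
 ultimately have "u[^]Suc n\<in>adj (Idl (set l)) v" using idl_pow_ge[OF adj_ideal[OF genideal_ideal[OF l] v] uc] by (metis le_SucI order_refl)
 thus ?thesis using adjD that by metis
qed

text \<open>Modulo \<open>l\<close> the element \<open>v\<close> divides a power of the
  nonzerodivisor \<open>u\<close>, and divisors of nonzerodivisors are nonzerodivisors.\<close>

lemma regseq_exchange:
 assumes "regseq (l @ [u])" "sop (l @ [v])" shows "regseq (l @ [v])"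
proof -
 have h: "regseq l" "u\<in>\<mm>" "nzd (Idl (set l)) u" using assms(1) by (auto simp: regseq_snoc)
 have l: "set l\<subseteq>\<R>" and v: "v\<in>\<R>" "v\<in>\<mm>" using assms(2) m_sub by (auto simp: sop_def)
 note I = genideal_ideal[OF l]
 have u: "u\<in>\<R>" by (rule m_carr[OF h(2)])
 obtain n c i where nc: "c\<in>\<R>" "i\<in>Idl (set l)" "u[^]Suc n = i\<oplus>c\<otimes>v" using sop_exchange_rel[OF assms(2) h(2)] by metis
 have ic: "i\<in>\<R>" by (rule idl_carr[OF I nc(2)])
 have "nzd (Idl (set l)) v" unfolding nzd_def
 proof (intro ballI impI)
  fix a assume a: "a\<in>\<R>" "v\<otimes>a\<in>Idl (set l)"
  have "u[^]Suc n\<otimes>a = i\<otimes>a\<oplus>c\<otimes>(v\<otimes>a)" unfolding nc(3) using ic nc(1) v(1) a(1) by algebra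
  also have "\<dots>\<in>Idl (set l)" using idl_add[OF I idl_r[OF I nc(2) a(1)] idl_l[OF I a(2) nc(1)]] .
  finally show "a\<in>Idl (set l)" by (rule nzdD[OF nzd_pow[OF u h(3)] a(1)])
 qed
 thus ?thesis unfolding regseq_snoc using h v by simp
qed

section \<open>Cohen-Macaulay local rings in terms of parameters\<close>

definition CM where "CM \<longleftrightarrow> (\<exists>xs. regseq xs \<and> length xs = dim)"

text \<open>Regular sequences are partial systems of parameters, so their lengths are bounded by the
  dimension and the supremum in the depth is attained.\<close>

lemma CM_iff: "cohen_macaulay_local_ring R \<longleftrightarrow> CM"
proof -
 note nl = noetherian_local max_ideal_eq
 define S where "S = {length xs | xs. regseq xs}"
 have ld: "local_depth R = Sup (enat ` S)" unfolding local_depth_def S_def nl by (rule arg_cong[of _ _ Sup]) (use regseq_iff regseq_def in auto)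
 have Sd: "n\<le>dim" if "n\<in>S" for n using that regseq_psop unfolding S_def by (auto simp: psop_def)
 hence fin: "finite S" using finite_nat_set_iff_bounded_le by auto
 have ne: "S\<noteq>{}" unfolding S_def using regseq_Nil by auto
 have mx: "Max S\<in>S" "\<And>n. n\<in>S ==> n\<le>Max S" using fin ne by auto
 have "Sup (enat ` S) = enat (Max S)" by (rule antisym) (use mx in \<open>auto intro!: Sup_least Sup_upper\<close>)
 hence "cohen_macaulay_local_ring R \<longleftrightarrow> Max S = dim" unfolding cohen_macaulay_local_ring_def using nl ld krull_dim_dim by simp
 also have "\<dots> \<longleftrightarrow> dim\<in>S" using mx Sd by (metis order_antisym)
 also have "\<dots> \<longleftrightarrow> CM" unfolding S_def CM_def mem_Collect_eq by (rule ex_cong1) auto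
 finally show ?thesis .
qed

lemma CM_sop_exists: "CM ==> \<exists>xs. sop xs \<and> regseq xs" unfolding CM_def using regseq_psop psop_full by auto

lemma CM_sop_regseq: "CM ==> sop xs ==> regseq xs" using CM_sop_exists sop_connect[of regseq _ xs] regseq_perm regseq_exchange by metis

lemma sop_if_regseq:
 assumes reg: "regseq zs" and only: "\<And>Q. primeideal Q R ==> set zs\<subseteq>Q ==> Q = \<mm>" shows "CM \<and> sop zs"
proof -
 have zm: "set zs\<subseteq>\<mm>" using reg by (simp add: regseq_def)
 have "dim_le {} (length zs)" by (rule dim_le_height[OF zm]) (use only in auto)
 hence "dim\<le>length zs" using dim_le_iff by simp
 moreover have "length zs\<le>dim" using regseq_psop[OF reg] by (simp add: psop_def)
 ultimately have len: "length zs = dim" by simp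
 have cm: "CM" unfolding CM_def using reg len by auto
 have "sop zs" unfolding sop_def using zm len only by simp
 thus ?thesis using cm by simp
qed

lemma sop_iff: "system_of_parameters R xs \<longleftrightarrow> sop xs"
proof -
 note nl = max_ideal_eq
 have "{a\<in>\<R>. \<exists>k::nat. a[^]k\<in>Idl (set xs)} = \<mm> \<longleftrightarrow> (\<forall>Q. primeideal Q R \<longrightarrow> set xs\<subseteq>Q \<longrightarrow> Q = \<mm>)" (is "?A = _ \<longleftrightarrow> ?B")
  if s: "set xs\<subseteq>\<mm>" and len: "length xs = dim"
 proof
  assume A: "?A = \<mm>"
  show ?B
  proof (intro allI impI)
   fix Q assume Q: "primeideal Q R" "set xs\<subseteq>Q"
   have IQ: "Idl (set xs)\<subseteq>Q" by (rule genideal_minimal[OF prime_ideal[OF Q(1)] Q(2)])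
   have "\<mm>\<subseteq>Q"
   proof
    fix a assume "a\<in>\<mm>"
    then obtain k :: nat where "a\<in>\<R>" "a[^]k\<in>Idl (set xs)" using A by auto
    thus "a\<in>Q" using prime_pow[OF Q(1)] IQ by auto
   qed
   thus "Q = \<mm>" using prime_sub_m[OF Q(1)] by auto
  qed
 next
  assume ?B
  hence "sop xs" using s len by (simp add: sop_def)
  show "?A = \<mm>"
  proof
   show "\<mm>\<subseteq>?A" using sop_pow[OF \<open>sop xs\<close>] m_carr by auto
   show "?A\<subseteq>\<mm>" using genideal_minimal[OF m_ideal s] prime_pow[OF m_prime] by auto
  qed
 qed
 thus ?thesis unfolding system_of_parameters_def sop_def nl krull_dim_dim by auto
qed

lemma chosen_sop: "CM ==> sop (chosen_parameters R)"
 unfolding chosen_parameters_def using CM_sop_exists someI_ex[of "system_of_parameters R"] sop_iff by metis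

end

section \<open>Frobenius in prime characteristic\<close>

context cring
begin

lemma binomial_theorem:
 assumes a: "a\<in>\<R>" and b: "b\<in>\<R>"
 shows "(a\<oplus>b)[^](n::nat) = (\<Oplus>i\<in>{..n}. [(n choose i)] \<cdot> (a[^]i\<otimes>b[^](n - i)))"
proof (induction n)
 case 0 show ?case by simp
next
 case (Suc n)
 define f where "f i = [(n choose i)] \<cdot> (a[^]i\<otimes>b[^](n - i))" for i
 \<comment> \<open>Multiplication by \<open>a\<close> shifts the index by one. The value zero at
   index 0 lets both shifted and unshifted sums run over the same range, where Pascal's rule adds
   them.\<close>
 define g where "g i = [(if i = 0 then 0 else n choose (i - 1))] \<cdot> (a[^]i\<otimes>b[^](Suc n - i))" for i :: nat
 define h where "h i = [(n choose i)] \<cdot> (a[^]i\<otimes>b[^](Suc n - i))" for i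
 have cl [simp]: "f\<in>A\<rightarrow>\<R>" "g\<in>A\<rightarrow>\<R>" "h\<in>A\<rightarrow>\<R>" for A using a b by (auto simp: f_def g_def h_def)
 have cl' [simp]: "f i\<in>\<R>" "g i\<in>\<R>" "h i\<in>\<R>" for i using a b by (auto simp: f_def g_def h_def)
 have "(a\<oplus>b)[^]Suc n = (\<Oplus>i\<in>{..n}. f i)\<otimes>(a\<oplus>b)" using Suc by (simp add: f_def)
 also have "\<dots> = (\<Oplus>i\<in>{..n}. f i)\<otimes>a\<oplus>(\<Oplus>i\<in>{..n}. f i)\<otimes>b" using a b by (simp add: r_distr)
 also have "(\<Oplus>i\<in>{..n}. f i)\<otimes>a = (\<Oplus>i\<in>{..n}. f i\<otimes>a)" using a by (intro finsum_ldistr) auto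
 also have "\<dots> = (\<Oplus>i\<in>{..n}. g (Suc i))"
 proof (rule finsum_cong')
  fix i assume "i\<in>{..n}"
  have "a[^]i\<otimes>b[^](n - i)\<otimes>a = a[^]Suc i\<otimes>b[^](n - i)" using a b by (simp add: m_ac)
  thus "f i\<otimes>a = g (Suc i)" using a b unfolding f_def g_def by (simp add: add_pow_ldistr)
 qed auto
 also have "(\<Oplus>i\<in>{..n}. g (Suc i)) = (\<Oplus>i\<in>{..Suc n}. g i)"
 proof -
  have "g 0 = \<zero>" using b by (simp add: g_def)
  thus ?thesis using finsum_Suc2[of g n] by simp
 qed
 also have "(\<Oplus>i\<in>{..n}. f i)\<otimes>b = (\<Oplus>i\<in>{..n}. f i\<otimes>b)" using b by (intro finsum_ldistr) auto
 also have "\<dots> = (\<Oplus>i\<in>{..n}. h i)"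
 proof (rule finsum_cong')
  fix i assume "i\<in>{..n}"
  hence "a[^]i\<otimes>b[^](n - i)\<otimes>b = a[^]i\<otimes>b[^](Suc n - i)" using a b by (simp add: m_assoc Suc_diff_le)
  thus "f i\<otimes>b = h i" using a b unfolding f_def h_def by (simp add: add_pow_ldistr)
 qed auto
 also have "\<dots> = (\<Oplus>i\<in>{..Suc n}. h i)"
 proof -
  have "h (Suc n) = \<zero>" using b by (simp add: h_def binomial_eq_0)
  thus ?thesis by (simp add: finsum_closed)
 qed
 also have "(\<Oplus>i\<in>{..Suc n}. g i)\<oplus>(\<Oplus>i\<in>{..Suc n}. h i) = (\<Oplus>i\<in>{..Suc n}. g i\<oplus>h i)"
  by (intro finsum_addf[symmetric]) auto
 also have "\<dots> = (\<Oplus>i\<in>{..Suc n}. [(Suc n choose i)] \<cdot> (a[^]i\<otimes>b[^](Suc n - i)))"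
 proof (rule finsum_cong')
  fix i assume "i\<in>{..Suc n}"
  have "g i\<oplus>h i = [((if i = 0 then 0 else n choose (i - 1)) + (n choose i))] \<cdot> (a[^]i\<otimes>b[^](Suc n - i))"
   unfolding g_def h_def using a b by (intro add.nat_pow_mult) auto
  also have "(if i = 0 then 0 else n choose (i - 1)) + (n choose i) = Suc n choose i" by (cases i) auto
  finally show "g i\<oplus>h i = [(Suc n choose i)] \<cdot> (a[^]i\<otimes>b[^](Suc n - i))" .
 qed (use a b in auto)
 finally show ?case .
qed

end

locale char_p_cring = cring +
 fixes p :: nat assumes p_prime: "Factorial_Ring.prime p" and p_zero: "[p] \<cdot> \<one> = \<zero>"
begin

lemma p_gt_1: "1 < p" by (rule prime_gt_1_nat[OF p_prime])
lemma p_gt_0: "0 < p" by (rule prime_gt_0_nat[OF p_prime])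

lemma p_add_pow:
 assumes x: "x\<in>\<R>" shows "[(p * k)] \<cdot> x = \<zero>"
proof -
 have "[p] \<cdot> ([k] \<cdot> x) = ([p] \<cdot> \<one>)\<otimes>([k] \<cdot> x)" using x by (simp add: add_pow_ldistr)
 thus ?thesis using x by (simp add: p_zero add.nat_pow_pow mult.commute)
qed

lemma freshman:
 assumes a: "a\<in>\<R>" and b: "b\<in>\<R>" shows "(a\<oplus>b)[^]p = a[^]p\<oplus>b[^]p"
proof -
 \<comment> \<open>With \<open>p = n + 2\<close> the middle terms have the indices
   \<open>Suc i\<close> with \<open>i\<close> at most \<open>n\<close>, and the two end terms split
   off.\<close>
 define n where "n = p - 2"
 have n: "p = Suc (Suc n)" using p_gt_1 by (simp add: n_def)
 define f where "f i = [(p choose i)] \<cdot> (a[^]i\<otimes>b[^](p - i))" for i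
 have cl: "f\<in>A\<rightarrow>\<R>" for A using a b by (auto simp: f_def)
 have "f (Suc i) = \<zero>" if "i\<le>n" for i
 proof -
  have "p dvd (p choose Suc i)" using that n p_prime by (intro dvd_choose_prime) auto
  then obtain k where "p choose Suc i = p * k" by (rule dvdE)
  thus ?thesis unfolding f_def using a b by (simp add: p_add_pow)
 qed
 hence z: "(\<Oplus>i\<in>{..n}. f (Suc i)) = \<zero>" by (intro add.finprod_one_eqI) auto
 have "(a\<oplus>b)[^]p = (\<Oplus>i\<in>{..Suc (Suc n)}. f i)" unfolding f_def using binomial_theorem[OF a b, of p] n by simp
 also have "\<dots> = f p\<oplus>((\<Oplus>i\<in>{..n}. f (Suc i))\<oplus>f 0)" using finsum_Suc2[of f n] cl n by simp
 also have "\<dots> = a[^]p\<oplus>b[^]p" unfolding z using a b by (simp add: f_def)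
 finally show ?thesis .
qed

lemma freshman_pow:
 assumes a: "a\<in>\<R>" and b: "b\<in>\<R>" shows "(a\<oplus>b)[^](p ^ e) = a[^](p ^ e)\<oplus>b[^](p ^ e)"
proof (induction e)
 case (Suc e)
 have "(a\<oplus>b)[^](p ^ Suc e) = ((a\<oplus>b)[^](p ^ e))[^]p" using a b by (simp add: nat_pow_pow mult.commute)
 also have "\<dots> = (a[^](p ^ e))[^]p\<oplus>(b[^](p ^ e))[^]p" using Suc freshman a b by simp
 finally show ?case using a b by (simp add: nat_pow_pow mult.commute)
qed (use a b in simp)

lemma neg_pow:
 assumes a: "a\<in>\<R>" shows "(\<ominus> a)[^]p =\<ominus>(a[^]p)"
proof -
 have "(a\<oplus>\<ominus> a)[^]p = a[^]p\<oplus>(\<ominus> a)[^]p" using a freshman by simp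
 hence "a[^]p\<oplus>(\<ominus> a)[^]p = \<zero>" using a p_gt_0 by (simp add: r_neg nat_pow_zero)
 thus ?thesis using a by (metis a_inv_closed minus_equality nat_pow_closed a_comm)
qed

lemma minus_pow: "a\<in>\<R> ==> b\<in>\<R> ==> (a\<ominus>b)[^]p = a[^]p\<ominus>b[^]p" by (simp add: minus_eq freshman neg_pow)

lemma finsum_pow: "finite A ==> f\<in>A\<rightarrow>\<R> ==> (\<Oplus>i\<in>A. f i)[^]p = (\<Oplus>i\<in>A. f i[^]p)"
proof (induction A rule: finite_induct)
 case empty thus ?case using p_gt_0 by (simp add: nat_pow_zero)
next
 case (insert x A)
 have "f\<in>A\<rightarrow>\<R>" "(\<lambda>i. f i[^]p)\<in>A\<rightarrow>\<R>" "f x\<in>\<R>" using insert.prems by auto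
 thus ?case using insert by (simp add: freshman)
qed

end

section \<open>Localization\<close>

locale mult_set = cring +
 fixes D assumes D_sub: "D\<subseteq>carrier R" and D_one: "\<one>\<in>D" and D_mult: "s\<in>D ==> t\<in>D ==> s\<otimes>t\<in>D"
begin

abbreviation fr where "fr\<equiv>fraction R D"
abbreviation L where "L\<equiv>localization R D"

lemma D_carr: "s\<in>D ==> s\<in>\<R>" using D_sub by auto

lemma frac_equiv: "equiv (\<R>\<times>D) (frac_rel R D)"
proof (rule equivI)
 show "frac_rel R D\<subseteq>(\<R>\<times>D)\<times>\<R>\<times>D" by (auto simp: frac_rel_def)
 show "refl_on (\<R>\<times>D) (frac_rel R D)" unfolding refl_on_def frac_rel_def by auto
 show "sym (frac_rel R D)" unfolding sym_def frac_rel_def by force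
 show "trans (frac_rel R D)"
 proof (rule transI)
  fix x y z assume "(x, y)\<in>frac_rel R D" "(y, z)\<in>frac_rel R D"
  then obtain a s b t c u v w where h: "x = (a, s)" "y = (b, t)" "z = (c, u)"
   "a\<in>\<R>" "b\<in>\<R>" "c\<in>\<R>" "s\<in>D" "t\<in>D" "u\<in>D" "v\<in>D" "w\<in>D"
   "v\<otimes>(t\<otimes>a) = v\<otimes>(s\<otimes>b)" "w\<otimes>(u\<otimes>b) = w\<otimes>(t\<otimes>c)" by (auto simp: frac_rel_def)
  have k: "a\<in>\<R>" "b\<in>\<R>" "c\<in>\<R>" "s\<in>\<R>" "t\<in>\<R>" "u\<in>\<R>" "v\<in>\<R>" "w\<in>\<R>" using h D_carr by auto
  have "(v\<otimes>w\<otimes>t)\<otimes>(u\<otimes>a) = (w\<otimes>u)\<otimes>(v\<otimes>(t\<otimes>a))" using k by algebra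
  also have "\<dots> = (v\<otimes>s)\<otimes>(w\<otimes>(u\<otimes>b))" unfolding h(12) using k by algebra
  also have "\<dots> = (v\<otimes>w\<otimes>t)\<otimes>(s\<otimes>c)" unfolding h(13) using k by algebra
  finally have "(v\<otimes>w\<otimes>t)\<otimes>(u\<otimes>a) = (v\<otimes>w\<otimes>t)\<otimes>(s\<otimes>c)" .
  moreover have "v\<otimes>w\<otimes>t\<in>D" using h D_mult by simp
  ultimately show "(x, z)\<in>frac_rel R D" unfolding frac_rel_def h(1,3) using h by auto
 qed
qed

lemma fr_eq:
 assumes "a\<in>\<R>" "s\<in>D" "b\<in>\<R>" "t\<in>D"
 shows "fr a s = fr b t \<longleftrightarrow> (\<exists>v\<in>D. v\<otimes>(t\<otimes>a) = v\<otimes>(s\<otimes>b))"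
proof -
 have "fr a s = fr b t \<longleftrightarrow> ((a, s), (b, t))\<in>frac_rel R D"
  unfolding fraction_def by (rule eq_equiv_class_iff[OF frac_equiv]) (use assms in auto)
 thus ?thesis using assms by (simp add: frac_rel_def)
qed

lemma fr_eqI: "[|a\<in>\<R>; s\<in>D; b\<in>\<R>; t\<in>D; t\<otimes>a = s\<otimes>b|] ==> fr a s = fr b t" using fr_eq D_one by auto

lemma fr_cancel: "[|a\<in>\<R>; s\<in>D; t\<in>D|] ==> fr (t\<otimes>a) (t\<otimes>s) = fr a s"
proof (rule fr_eqI)
 assume h: "a\<in>\<R>" "s\<in>D" "t\<in>D"
 have "s\<in>\<R>" "t\<in>\<R>" using h D_carr by auto
 thus "s\<otimes>(t\<otimes>a) = t\<otimes>s\<otimes>a" using h(1) by algebra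
qed (use D_carr D_mult in auto)

lemma fr_carr: "a\<in>\<R> ==> s\<in>D ==> fr a s\<in>carrier L" unfolding localization_def fraction_def by (auto intro: quotientI)

lemma L_cases: assumes "x\<in>carrier L" obtains a s where "a\<in>\<R>" "s\<in>D" "x = fr a s"
 using assms unfolding localization_def fraction_def by (auto elim!: quotientE)

lemma fr_mem:
 assumes h: "a\<in>\<R>" "s\<in>D" "u\<in>fr a s" shows "\<exists>b t. u = (b, t) \<and> b\<in>\<R> \<and> t\<in>D \<and> fr b t = fr a s"
proof -
 obtain b t where u: "u = (b, t)" by (cases u)
 have r: "((a, s), (b, t))\<in>frac_rel R D" using h(3) by (simp add: u fraction_def)
 have "frac_rel R D `` {(a, s)} = frac_rel R D `` {(b, t)}" by (rule equiv_class_eq[OF frac_equiv r])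
 moreover have "b\<in>\<R>" "t\<in>D" using r by (auto simp: frac_rel_def)
 ultimately show ?thesis using u by (auto simp: fraction_def)
qed

lemma fr_self: "a\<in>\<R> ==> s\<in>D ==> (a, s)\<in>fr a s" unfolding fraction_def by (rule equiv_class_self[OF frac_equiv]) simp

text \<open>The operations of a localization are unions over all pairs of representatives; such a
  union collapses to its common value.\<close>

lemma UN2_const: "U\<noteq>{} ==> V\<noteq>{} ==> (\<And>u v. u\<in>U ==> v\<in>V ==> f u v = c) ==> (\<Union>u\<in>U. \<Union>v\<in>V. f u v) = c"
 by auto

lemma fr_mult:
 assumes "a\<in>\<R>" "s\<in>D" "b\<in>\<R>" "t\<in>D" shows "fr a s\<otimes>\<^bsub>L\<^esub>fr b t = fr (a\<otimes>b) (s\<otimes>t)"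
proof -
 have "(\<Union>u\<in>fr a s. \<Union>v\<in>fr b t. fr (fst u\<otimes>fst v) (snd u\<otimes>snd v)) = fr (a\<otimes>b) (s\<otimes>t)"
 proof (rule UN2_const)
  fix u v assume "u\<in>fr a s" "v\<in>fr b t"
  then obtain a' s' b' t' where h: "u = (a', s')" "v = (b', t')" "a'\<in>\<R>" "s'\<in>D" "b'\<in>\<R>" "t'\<in>D"
   "fr a' s' = fr a s" "fr b' t' = fr b t" using fr_mem assms by metis
  obtain x y where x: "x\<in>D" "x\<otimes>(s\<otimes>a') = x\<otimes>(s'\<otimes>a)" and y: "y\<in>D" "y\<otimes>(t\<otimes>b') = y\<otimes>(t'\<otimes>b)"
   using h fr_eq assms by auto
  have k: "s\<in>\<R>" "t\<in>\<R>" "s'\<in>\<R>" "t'\<in>\<R>" "x\<in>\<R>" "y\<in>\<R>" using assms h x y D_carr by auto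
  have "(x\<otimes>y)\<otimes>((s\<otimes>t)\<otimes>(a'\<otimes>b')) = (x\<otimes>(s\<otimes>a'))\<otimes>(y\<otimes>(t\<otimes>b'))" using k h(3,5) by algebra
  also have "\<dots> = (x\<otimes>y)\<otimes>((s'\<otimes>t')\<otimes>(a\<otimes>b))" unfolding x(2) y(2) using k assms(1,3) by algebra
  finally show "fr (fst u\<otimes>fst v) (snd u\<otimes>snd v) = fr (a\<otimes>b) (s\<otimes>t)" using fr_eq h assms D_mult x(1) y(1) by auto
 qed (use fr_self assms in auto)
 thus ?thesis by (simp add: localization_def)
qed

lemma fr_add:
 assumes "a\<in>\<R>" "s\<in>D" "b\<in>\<R>" "t\<in>D"
 shows "fr a s\<oplus>\<^bsub>L\<^esub>fr b t = fr (t\<otimes>a\<oplus>s\<otimes>b) (s\<otimes>t)"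
proof -
 have "(\<Union>u\<in>fr a s. \<Union>v\<in>fr b t. fr (snd v\<otimes>fst u\<oplus>snd u\<otimes>fst v) (snd u\<otimes>snd v)) = fr (t\<otimes>a\<oplus>s\<otimes>b) (s\<otimes>t)"
 proof (rule UN2_const)
  fix u v assume "u\<in>fr a s" "v\<in>fr b t"
  then obtain a' s' b' t' where h: "u = (a', s')" "v = (b', t')" "a'\<in>\<R>" "s'\<in>D" "b'\<in>\<R>" "t'\<in>D"
   "fr a' s' = fr a s" "fr b' t' = fr b t" using fr_mem assms by metis
  obtain x y where x: "x\<in>D" "x\<otimes>(s\<otimes>a') = x\<otimes>(s'\<otimes>a)" and y: "y\<in>D" "y\<otimes>(t\<otimes>b') = y\<otimes>(t'\<otimes>b)"
   using h fr_eq assms by auto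
  have k: "s\<in>\<R>" "t\<in>\<R>" "s'\<in>\<R>" "t'\<in>\<R>" "x\<in>\<R>" "y\<in>\<R>" using assms h x y D_carr by auto
  have "(x\<otimes>y)\<otimes>((s\<otimes>t)\<otimes>(t'\<otimes>a'\<oplus>s'\<otimes>b')) = (y\<otimes>t\<otimes>t')\<otimes>(x\<otimes>(s\<otimes>a'))\<oplus>(x\<otimes>s\<otimes>s')\<otimes>(y\<otimes>(t\<otimes>b'))"
   using k h(3,5) by algebra
  also have "\<dots> = (x\<otimes>y)\<otimes>((s'\<otimes>t')\<otimes>(t\<otimes>a\<oplus>s\<otimes>b))" unfolding x(2) y(2) using k assms(1,3) by algebra
  finally show "fr (snd v\<otimes>fst u\<oplus>snd u\<otimes>fst v) (snd u\<otimes>snd v) = fr (t\<otimes>a\<oplus>s\<otimes>b) (s\<otimes>t)"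
   using fr_eq h assms D_mult x(1) y(1) D_carr by auto
 qed (use fr_self assms in auto)
 thus ?thesis by (simp add: localization_def)
qed

lemma L_zero: "\<zero>\<^bsub>L\<^esub> = fr \<zero> \<one>" and L_one: "\<one>\<^bsub>L\<^esub> = fr \<one> \<one>"
 by (simp_all add: localization_def)

lemma fr_add_same:
 assumes "a\<in>\<R>" "s\<in>D" "b\<in>\<R>" shows "fr a s\<oplus>\<^bsub>L\<^esub>fr b s = fr (a\<oplus>b) s"
proof -
 have k: "s\<in>\<R>" using assms D_carr by auto
 have "s\<otimes>a\<oplus>s\<otimes>b = s\<otimes>(a\<oplus>b)" using k assms by algebra
 thus ?thesis using fr_add[OF assms assms(2)] fr_cancel assms by simp
qed

lemma fr_zero: "s\<in>D ==> fr \<zero> s = \<zero>\<^bsub>L\<^esub>" unfolding L_zero using D_one D_carr by (intro fr_eqI) auto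

sublocale L: cring L
proof (rule cringI)
 show "abelian_group L"
 proof (rule abelian_groupI)
  show "\<zero>\<^bsub>L\<^esub>\<in>carrier L" unfolding L_zero using fr_carr D_one by simp
  fix x assume "x\<in>carrier L"
  then obtain a s where x: "a\<in>\<R>" "s\<in>D" "x = fr a s" by (rule L_cases)
  have sc: "s\<in>\<R>" using x D_carr by auto
  show "\<zero>\<^bsub>L\<^esub>\<oplus>\<^bsub>L\<^esub>x = x" using fr_add_same[of \<zero> s a] fr_zero x by simp
  have "fr (\<ominus> a) s\<oplus>\<^bsub>L\<^esub>x = \<zero>\<^bsub>L\<^esub>" using fr_add_same x fr_zero by (simp add: l_neg)
  thus "\<exists>y\<in>carrier L. y\<oplus>\<^bsub>L\<^esub>x = \<zero>\<^bsub>L\<^esub>" using fr_carr x by (intro bexI[of _ "fr (\<ominus> a) s"]) auto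
  fix y assume "y\<in>carrier L"
  then obtain b t where y: "b\<in>\<R>" "t\<in>D" "y = fr b t" by (rule L_cases)
  have tc: "t\<in>\<R>" using y D_carr by auto
  show "x\<oplus>\<^bsub>L\<^esub>y\<in>carrier L" unfolding x(3) y(3) fr_add[OF x(1,2) y(1,2)] using x y sc tc D_mult by (intro fr_carr) auto
  have "t\<otimes>a\<oplus>s\<otimes>b = s\<otimes>b\<oplus>t\<otimes>a" "s\<otimes>t = t\<otimes>s" using x y sc tc by algebra+
  thus "x\<oplus>\<^bsub>L\<^esub>y = y\<oplus>\<^bsub>L\<^esub>x" unfolding x(3) y(3) fr_add[OF x(1,2) y(1,2)] fr_add[OF y(1,2) x(1,2)] by simp
  fix z assume "z\<in>carrier L"
  then obtain c u where z: "c\<in>\<R>" "u\<in>D" "z = fr c u" by (rule L_cases)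
  have uc: "u\<in>\<R>" using z D_carr by auto
  have "u\<otimes>(t\<otimes>a\<oplus>s\<otimes>b)\<oplus>(s\<otimes>t)\<otimes>c = (t\<otimes>u)\<otimes>a\<oplus>s\<otimes>(u\<otimes>b\<oplus>t\<otimes>c)" "s\<otimes>t\<otimes>u = s\<otimes>(t\<otimes>u)"
   using x(1) y(1) z(1) sc tc uc by algebra+
  thus "x\<oplus>\<^bsub>L\<^esub>y\<oplus>\<^bsub>L\<^esub>z = x\<oplus>\<^bsub>L\<^esub>(y\<oplus>\<^bsub>L\<^esub>z)"
   unfolding x(3) y(3) z(3) using x y z sc tc uc D_mult by (simp add: fr_add)
 qed
 show "comm_monoid L"
 proof (rule comm_monoidI)
  show "\<one>\<^bsub>L\<^esub>\<in>carrier L" unfolding L_one using fr_carr D_one by simp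
  fix x assume "x\<in>carrier L"
  then obtain a s where x: "a\<in>\<R>" "s\<in>D" "x = fr a s" by (rule L_cases)
  have sc: "s\<in>\<R>" using x D_carr by auto
  show "\<one>\<^bsub>L\<^esub>\<otimes>\<^bsub>L\<^esub>x = x" unfolding L_one x(3) using x D_one sc by (simp add: fr_mult)
  fix y assume "y\<in>carrier L"
  then obtain b t where y: "b\<in>\<R>" "t\<in>D" "y = fr b t" by (rule L_cases)
  have tc: "t\<in>\<R>" using y D_carr by auto
  show "x\<otimes>\<^bsub>L\<^esub>y\<in>carrier L" unfolding x(3) y(3) fr_mult[OF x(1,2) y(1,2)] using x y D_mult by (intro fr_carr) auto
  show "x\<otimes>\<^bsub>L\<^esub>y = y\<otimes>\<^bsub>L\<^esub>x" unfolding x(3) y(3) using x y sc tc by (simp add: fr_mult m_comm)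
  fix z assume "z\<in>carrier L"
  then obtain c u where z: "c\<in>\<R>" "u\<in>D" "z = fr c u" by (rule L_cases)
  have uc: "u\<in>\<R>" using z D_carr by auto
  show "x\<otimes>\<^bsub>L\<^esub>y\<otimes>\<^bsub>L\<^esub>z = x\<otimes>\<^bsub>L\<^esub>(y\<otimes>\<^bsub>L\<^esub>z)"
   unfolding x(3) y(3) z(3) using x y z sc tc uc D_mult by (simp add: fr_mult m_assoc)
 qed
 fix x y z assume "x\<in>carrier L" "y\<in>carrier L" "z\<in>carrier L"
 then obtain a s b t c u where x: "a\<in>\<R>" "s\<in>D" "x = fr a s" and y: "b\<in>\<R>" "t\<in>D" "y = fr b t"
  and z: "c\<in>\<R>" "u\<in>D" "z = fr c u" by (metis L_cases)
 have sc: "s\<in>\<R>" "t\<in>\<R>" "u\<in>\<R>" using x y z D_carr by auto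
 have e: "fr ((t\<otimes>a\<oplus>s\<otimes>b)\<otimes>c) (s\<otimes>t\<otimes>u) = fr ((t\<otimes>u)\<otimes>(a\<otimes>c)\<oplus>(s\<otimes>u)\<otimes>(b\<otimes>c)) ((s\<otimes>u)\<otimes>(t\<otimes>u))"
 proof (rule fr_eqI)
  show "s\<otimes>u\<otimes>(t\<otimes>u)\<otimes>((t\<otimes>a\<oplus>s\<otimes>b)\<otimes>c) = s\<otimes>t\<otimes>u\<otimes>(t\<otimes>u\<otimes>(a\<otimes>c)\<oplus>s\<otimes>u\<otimes>(b\<otimes>c))"
   using sc x(1) y(1) z(1) by algebra
 qed (use sc x y z D_mult in auto)
 show "(x\<oplus>\<^bsub>L\<^esub>y)\<otimes>\<^bsub>L\<^esub>z = x\<otimes>\<^bsub>L\<^esub>z\<oplus>\<^bsub>L\<^esub>y\<otimes>\<^bsub>L\<^esub>z"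
  unfolding x(3) y(3) z(3) using x y z sc D_mult e by (simp add: fr_add fr_mult)
qed

lemma fr_neg: "a\<in>\<R> ==> s\<in>D ==> \<ominus>\<^bsub>L\<^esub>fr a s = fr (\<ominus> a) s"
 using fr_add_same[of "\<ominus> a" s a] fr_zero fr_carr by (intro L.minus_equality) (auto simp: l_neg)

lemma D_pow: "s\<in>D ==> s[^](n::nat)\<in>D" by (induction n) (auto simp: D_one D_mult)

lemma fr_pow: "a\<in>\<R> ==> s\<in>D ==> fr a s[^]\<^bsub>L\<^esub>(n::nat) = fr (a[^]n) (s[^]n)"
 by (induction n) (simp_all add: L_one fr_mult D_pow)

lemma fr_finsum: "finite A ==> f\<in>A\<rightarrow>\<R> ==> s\<in>D ==> (\<Oplus>\<^bsub>L\<^esub>i\<in>A. fr (f i) s) = fr (\<Oplus>i\<in>A. f i) s"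
proof (induction A rule: finite_induct)
 case empty thus ?case by (simp add: fr_zero)
next
 case (insert x A)
 have "f\<in>A\<rightarrow>\<R>" "f x\<in>\<R>" "(\<lambda>i. fr (f i) s)\<in>A\<rightarrow>carrier L" "fr (f x) s\<in>carrier L"
  using insert.prems fr_carr by auto
 thus ?case using insert by (simp add: fr_add_same)
qed

end

lemma frac_map_fr:
 assumes "mult_set R D" "mult_set R E" "D\<subseteq>E" "a\<in>carrier R" "s\<in>D" shows "frac_map R E (fraction R D a s) = fraction R E a s"
proof -
 interpret D: mult_set R D by fact
 interpret E: mult_set R E by fact
 have "fraction R E (fst u) (snd u) = fraction R E a s" if u: "u\<in>fraction R D a s" for u
 proof -
  obtain b t where h: "u = (b, t)" "b\<in>carrier R" "t\<in>D" "fraction R D b t = fraction R D a s" using D.fr_mem[OF assms(4,5) u] by auto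
  have "t\<in>E" "s\<in>E" using h assms by auto
  thus ?thesis using h D.fr_eq E.fr_eq[of b t a s] assms by auto
 qed
 thus ?thesis unfolding frac_map_def using D.fr_self[OF assms(4,5)] by auto
qed

section \<open>The Koszul and Cech complexes of a regular sequence\<close>

context cring
begin

lemma finsum_in_ideal:
 assumes I: "ideal I R" shows "finite A ==> (\<And>j. j\<in>A ==> g j\<in>I) ==> (\<Oplus>j\<in>A. g j)\<in>I"
proof -
 show "finite A ==> (\<And>j. j\<in>A ==> g j\<in>I) ==> (\<Oplus>j\<in>A. g j)\<in>I"
 proof (induction A rule: finite_induct)
  case (insert x A)
  have "g\<in>A\<rightarrow>\<R>" "g x\<in>\<R>" using insert.prems idl_carr[OF I] by auto
  thus ?case using insert idl_add[OF I] by simp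
 qed (use idl_zero[OF I] in simp)
qed

lemma Idl_image_sum:
 assumes "finite A" "f\<in>A\<rightarrow>\<R>" "a\<in>Idl (f ` A)"
 shows "\<exists>c. (\<forall>j. c j\<in>\<R>) \<and> a = (\<Oplus>j\<in>A. c j\<otimes>f j)" using assms
proof (induction A arbitrary: a rule: finite_induct)
 case empty thus ?case by (auto simp: Idl_empty)
next
 case (insert x A)
 have f: "f ` A\<subseteq>\<R>" "f x\<in>\<R>" "f\<in>A\<rightarrow>\<R>" using insert.prems by auto
 have "a\<in>adj (Idl (f ` A)) (f x)" using insert.prems(2) Idl_insert[OF f(1,2)] by simp
 then obtain i r where ir: "i\<in>Idl (f ` A)" "r\<in>\<R>" "a = i\<oplus>r\<otimes>f x" using adjD by metis
 obtain c where c: "\<And>j. c j\<in>\<R>" "i = (\<Oplus>j\<in>A. c j\<otimes>f j)" using insert.IH[OF f(3) ir(1)] by auto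
 define c' where "c' = c(x := r)"
 have cf: "(\<lambda>j. c j\<otimes>f j)\<in>A\<rightarrow>\<R>" using c(1) f(3) by auto
 have "(\<Oplus>j\<in>A. c' j\<otimes>f j) = (\<Oplus>j\<in>A. c j\<otimes>f j)"
  by (rule finsum_cong') (use cf insert.hyps in \<open>auto simp: c'_def\<close>)
 moreover have "(\<lambda>j. c' j\<otimes>f j)\<in>A\<rightarrow>\<R>" using c(1) f(3) ir(2) by (auto simp: c'_def)
 ultimately have "(\<Oplus>j\<in>insert x A. c' j\<otimes>f j) = r\<otimes>f x\<oplus>i" using insert.hyps f(2) ir(2) by (simp add: c(2) c'_def)
 also have "\<dots> = a" using ir f(2) idl_carr[OF genideal_ideal[OF f(1)] ir(1)] by (simp add: a_comm)
 finally show ?case using c(1) ir(2) by (intro exI[of _ c']) (auto simp: c'_def)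
qed

definition eps where "eps K j = (\<ominus> \<one>)[^]card {l\<in>K. l < (j::nat)}"

lemma eps_carr [simp]: "eps K j\<in>\<R>" by (simp add: eps_def)

lemma neg_one_sq: "(\<ominus> \<one>)[^](n::nat)\<otimes>(\<ominus> \<one>)[^]n = \<one>"
proof (induction n)
 case (Suc n)
 have c: "(\<ominus> \<one>)[^]n\<in>\<R>" by simp
 hence "(\<ominus> \<one>)[^]n\<otimes>\<ominus> \<one>\<otimes>((\<ominus> \<one>)[^]n\<otimes>\<ominus> \<one>) = (\<ominus> \<one>)[^]n\<otimes>(\<ominus> \<one>)[^]n" by algebra
 thus ?case using Suc by simp
qed simp

lemma eps_sq: "a\<in>\<R> ==> eps K j\<otimes>(eps K j\<otimes>a) = a" using neg_one_sq unfolding eps_def by (simp flip: m_assoc)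

lemma sign_pow: "y\<in>\<R> ==> (if even n then y else\<ominus>y) = (\<ominus> \<one>)[^](n::nat)\<otimes>y"
proof (induction n)
 case (Suc n)
 have "(\<ominus> \<one>)[^]Suc n\<otimes>y =\<ominus>((\<ominus> \<one>)[^]n\<otimes>y)" using Suc.prems by (simp add: l_minus r_minus)
 also have "\<dots> =\<ominus>(if even n then y else\<ominus>y)" using Suc by simp
 also have "\<dots> = (if even (Suc n) then y else\<ominus>y)" using Suc.prems by simp
 finally show ?case by simp
qed simp

text \<open>The Koszul differential of the cochain \<open>a\<close> at the index set
  \<open>K\<close>. Cochains are total functions on index sets; in each degree only the values on
  sets of the right size matter.\<close>

definition kosz where "kosz y a K = (\<Oplus>j\<in>K. eps K j\<otimes>(y j\<otimes>a (K - {j})))" for y :: "nat\<Rightarrow>'a"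

lemma kosz_closed: "y\<in>K\<rightarrow>\<R> ==> (\<And>J. a J\<in>\<R>) ==> kosz y a K\<in>\<R>"
 unfolding kosz_def by (intro finsum_closed) (auto simp: Pi_def)

lemma eps_insert_lt: "finite K ==> j < d ==> eps (insert d K) j = eps K j"
 unfolding eps_def by (rule arg_cong[of _ _ "\<lambda>S. (\<ominus> \<one>)[^]card S"]) auto

lemma eps_top: "K\<subseteq>{..<d} ==> eps (insert d K) d = (\<ominus> \<one>)[^]card K"
 unfolding eps_def by (rule arg_cong[of _ _ "\<lambda>S. (\<ominus> \<one>)[^]card S"]) auto

text \<open>The Koszul complex is the mapping cone of multiplication by the last element. Since
  \<open>d\<close> exceeds all members of \<open>K\<close>, its presence does not change the other
  signs.\<close>

lemma kosz_insert_top: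
 assumes K: "K\<subseteq>{..<d}" and y: "y\<in>{..d}\<rightarrow>\<R>" and a: "\<And>J. a J\<in>\<R>"
 shows "kosz y a (insert d K) = kosz y (\<lambda>J. a (insert d J)) K\<oplus>(\<ominus> \<one>)[^]card K\<otimes>(y d\<otimes>a K)"
proof -
 have fin: "finite K" using K finite_subset by auto
 have dK: "d\<notin>K" using K by auto
 have yc: "y j\<in>\<R>" if "j\<in>insert d K" for j by (rule Pi_mem[OF y]) (use that K in auto)
 have "kosz y a (insert d K) = eps (insert d K) d\<otimes>(y d\<otimes>a (insert d K - {d})) \<oplus>
  (\<Oplus>j\<in>K. eps (insert d K) j\<otimes>(y j\<otimes>a (insert d K - {j})))" unfolding kosz_def using fin dK yc a by (intro finsum_insert) auto
 also have "(\<Oplus>j\<in>K. eps (insert d K) j\<otimes>(y j\<otimes>a (insert d K - {j}))) = kosz y (\<lambda>J. a (insert d J)) K"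
  unfolding kosz_def
 proof (rule finsum_cong')
  fix j assume j: "j\<in>K"
  have "insert d K - {j} = insert d (K - {j})" using j dK by auto
  thus "eps (insert d K) j\<otimes>(y j\<otimes>a (insert d K - {j})) = eps K j\<otimes>(y j\<otimes>a (insert d (K - {j})))"
   using eps_insert_lt[OF fin, of j d] j K by auto
 qed (use yc a in auto)
 also have "insert d K - {d} = K" using dK by auto
 finally show ?thesis using eps_top[OF K] yc a kosz_closed by (simp add: a_comm Pi_def)
qed

lemma kosz_lin:
 assumes "finite K" "y\<in>K\<rightarrow>\<R>" "\<And>J. a J\<in>\<R>" "\<And>J. b J\<in>\<R>" "c\<in>\<R>"
 shows "kosz y (\<lambda>J. a J\<oplus>c\<otimes>b J) K = kosz y a K\<oplus>c\<otimes>kosz y b K"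
proof -
 have "c\<otimes>kosz y b K = (\<Oplus>j\<in>K. c\<otimes>(eps K j\<otimes>(y j\<otimes>b (K - {j}))))" unfolding kosz_def
  by (intro finsum_rdistr) (use assms in \<open>auto simp: Pi_def\<close>)
 hence "kosz y a K\<oplus>c\<otimes>kosz y b K = (\<Oplus>j\<in>K. eps K j\<otimes>(y j\<otimes>a (K - {j}))\<oplus>c\<otimes>(eps K j\<otimes>(y j\<otimes>b (K - {j}))))"
  unfolding kosz_def using assms by (subst finsum_addf) (auto simp: Pi_def)
 also have "\<dots> = kosz y (\<lambda>J. a J\<oplus>c\<otimes>b J) K" unfolding kosz_def
 proof (rule finsum_cong')
  fix j assume "j\<in>K"
  hence yj: "y j\<in>\<R>" using assms(2) by auto
  show "eps K j\<otimes>(y j\<otimes>a (K - {j}))\<oplus>c\<otimes>(eps K j\<otimes>(y j\<otimes>b (K - {j}))) = eps K j\<otimes>(y j\<otimes>(a (K - {j})\<oplus>c\<otimes>b (K - {j})))"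
   using yj assms(3,4) assms(5) eps_carr[of K j] by algebra
 qed (use assms in \<open>auto simp: Pi_def\<close>)
 finally show ?thesis by simp
qed

lemma kosz_cong: "(\<And>j. j\<in>K ==> a (K - {j}) = b (K - {j})) ==> y\<in>K\<rightarrow>\<R> ==> (\<And>J. b J\<in>\<R>) ==> kosz y a K = kosz y b K"
 unfolding kosz_def by (intro finsum_cong') (auto simp: Pi_def)

lemma kosz_top_Idl:
 assumes y: "y\<in>{..<d}\<rightarrow>\<R>" and c: "c\<in>Idl (y ` {..<d})" shows "\<exists>b. (\<forall>J. b J\<in>\<R>) \<and> c = kosz y b {..<d}"
proof -
 obtain e where e: "\<And>j. e j\<in>\<R>" "c = (\<Oplus>j\<in>{..<d}. e j\<otimes>y j)" using Idl_image_sum[OF _ y c] by auto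
 \<comment> \<open>A set with \<open>d - 1\<close> members omits exactly one index, which the choice
   operator recovers. The sign is its own inverse and cancels the one in
   \<open>kosz\<close>.\<close>
 define b where "b J = (let j = (SOME j. j < d \<and> J = {..<d} - {j}) in eps {..<d} j\<otimes>e j)" for J
 have bj: "b ({..<d} - {j}) = eps {..<d} j\<otimes>e j" if "j < d" for j
 proof -
  have "(SOME k. k < d \<and> {..<d} - {j} = {..<d} - {k}) = j" by (rule some_equality) (use that in auto)
  thus ?thesis by (simp add: b_def)
 qed
 have "kosz y b {..<d} = (\<Oplus>j\<in>{..<d}. e j\<otimes>y j)" unfolding kosz_def
 proof (rule finsum_cong')
  fix j assume j: "j\<in>{..<d}"
  hence yj: "y j\<in>\<R>" using y by auto
  have "eps {..<d} j\<otimes>(y j\<otimes>b ({..<d} - {j})) = eps {..<d} j\<otimes>(eps {..<d} j\<otimes>(e j\<otimes>y j))"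
   using bj[of j] j yj e(1)[of j] by (simp add: m_ac)
  thus "eps {..<d} j\<otimes>(y j\<otimes>b ({..<d} - {j})) = e j\<otimes>y j" using eps_sq yj e(1) by simp
 qed (use e y in auto)
 moreover have "b J\<in>\<R>" for J using e(1) by (simp add: b_def Let_def)
 ultimately show ?thesis using e(2) by metis
qed

lemma kosz_in_Idl:
 assumes "finite K" "y\<in>K\<rightarrow>\<R>" "\<And>J. a J\<in>\<R>" shows "kosz y a K\<in>Idl (y ` K)"
proof -
 have yK: "y ` K\<subseteq>\<R>" using assms(2) by auto
 note I = genideal_ideal[OF yK]
 show ?thesis unfolding kosz_def
 proof (rule finsum_in_ideal[OF I assms(1)])
  fix j assume "j\<in>K"
  hence "y j\<in>Idl (y ` K)" using genideal_self[OF yK] by auto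
  thus "eps K j\<otimes>(y j\<otimes>a (K - {j}))\<in>Idl (y ` K)" using idl_l[OF I] idl_r[OF I] assms(3) by simp
 qed
qed

text \<open>Induction on the number of elements by the mapping cone. On sets without
  \<open>d\<close> the cycle is a boundary of \<open>b'\<close>; on sets with \<open>d\<close>, what
  is left after subtracting the contribution of \<open>b'\<close> is a cycle of the smaller complex,
  hence a boundary of \<open>b2\<close>.\<close>

theorem koszul_acyclic:
 assumes "y\<in>{..<d}\<rightarrow>\<R>" and "\<And>j r. j < d ==> r\<in>\<R> ==> y j\<otimes>r\<in>Idl (y ` {..<j}) ==> r\<in>Idl (y ` {..<j})"
  and "\<And>J. a J\<in>\<R>" "i < d" and "\<And>K. K\<subseteq>{..<d} ==> card K = Suc i ==> kosz y a K = \<zero>"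
 shows "\<exists>b. (\<forall>J. b J\<in>\<R>) \<and> (\<forall>J. J\<subseteq>{..<d} \<longrightarrow> card J = i \<longrightarrow> a J = kosz y b J)"
 using assms
proof (induction d arbitrary: a i)
 case (Suc d)
 have y: "y\<in>{..<d}\<rightarrow>\<R>" "y\<in>{..d}\<rightarrow>\<R>" "y d\<in>\<R>" using Suc.prems(1) by auto
 have yK: "y\<in>K\<rightarrow>\<R>" if "K\<subseteq>{..<d}" for K using y(1) that by auto
 note cyc = Suc.prems(5)
 have IH: "\<exists>b. (\<forall>J. b J\<in>\<R>) \<and> (\<forall>J. J\<subseteq>{..<d} \<longrightarrow> card J = k \<longrightarrow> e J = kosz y b J)"
  if "\<And>J. e J\<in>\<R>" "k < d" "\<And>K. K\<subseteq>{..<d} ==> card K = Suc k ==> kosz y e K = \<zero>" for e k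
  by (rule Suc.IH[OF y(1) _ that(1,2,3)]) (use Suc.prems(2) in auto)
 have "\<exists>b. (\<forall>J. b J\<in>\<R>) \<and> (\<forall>J. J\<subseteq>{..<d} \<longrightarrow> card J = i \<longrightarrow> a J = kosz y b J)"
 proof (cases "i < d")
  case True
  show ?thesis by (rule IH[OF Suc.prems(3) True]) (rule cyc, auto)
 next
  case False
  \<comment> \<open>In this degree the smaller complex imposes no cycle condition. The condition on
    the full set says that \<open>y d\<close> times the single value lies in the ideal of the other
    elements, and regularity removes \<open>y d\<close>.\<close>
  hence i: "i = d" using Suc.prems(4) by simp
  have Kd: "insert d {..<d} = {..<Suc d}" by auto
  have "\<zero> = kosz y a (insert d {..<d})" unfolding Kd using cyc i by simp
  also have "\<dots> = kosz y (\<lambda>J. a (insert d J)) {..<d}\<oplus>(\<ominus> \<one>)[^]d\<otimes>(y d\<otimes>a {..<d})"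
   using kosz_insert_top[OF order_refl y(2) Suc.prems(3)] by simp
  finally have z: "kosz y (\<lambda>J. a (insert d J)) {..<d}\<oplus>(\<ominus> \<one>)[^]d\<otimes>(y d\<otimes>a {..<d}) = \<zero>" by simp
  have yI: "y ` {..<d}\<subseteq>\<R>" using y(1) by auto
  note I = genideal_ideal[OF yI]
  define A where "A = kosz y (\<lambda>J. a (insert d J)) {..<d}"
  define B where "B = y d\<otimes>a {..<d}"
  define e where "e = (\<ominus> \<one>)[^]d"
  have Ai: "A\<in>Idl (y ` {..<d})" unfolding A_def by (rule kosz_in_Idl) (use y Suc.prems(3) in auto)
  have c: "A\<in>\<R>" "B\<in>\<R>" "e\<in>\<R>" using idl_carr[OF I Ai] y Suc.prems(3) by (auto simp: B_def e_def)
  have "e\<otimes>B\<oplus>A\<in>Idl (y ` {..<d})" using z a_comm c idl_zero[OF I] by (simp add: A_def B_def e_def)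
  hence "e\<otimes>B\<in>Idl (y ` {..<d})" using idl_cancel[OF I _ Ai] c by simp
  hence "e\<otimes>(e\<otimes>B)\<in>Idl (y ` {..<d})" using idl_l[OF I _ c(3)] by simp
  moreover have "e\<otimes>(e\<otimes>B) = B" using neg_one_sq c by (simp add: e_def flip: m_assoc)
  ultimately have "a {..<d}\<in>Idl (y ` {..<d})" using Suc.prems(2) Suc.prems(3) by (simp add: B_def)
  then obtain b where b: "\<forall>J. b J\<in>\<R>" "a {..<d} = kosz y b {..<d}" using kosz_top_Idl[OF y(1)] by auto
  have "J = {..<d}" if "J\<subseteq>{..<d}" "card J = i" for J using card_subset_eq[of "{..<d}" J] that i by simp
  thus ?thesis using b by auto
 qed
 then obtain b' where b': "\<And>J. b' J\<in>\<R>" "\<And>J. J\<subseteq>{..<d} ==> card J = i ==> a J = kosz y b' J" by auto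
 show ?case
 proof (cases i)
  case 0
  have "J = {}" if "J\<subseteq>{..<Suc d}" "card J = i" for J using that 0 finite_subset[OF that(1)] by simp
  thus ?thesis using b' 0 by (intro exI[of _ b']) auto
 next
  case (Suc k)
  define s where "s = (\<ominus> \<one>)[^]k"
  have s: "s\<in>\<R>" by (simp add: s_def)
  \<comment> \<open>The correction by \<open>b'\<close> carries the sign of the index
    \<open>d\<close> over a set with \<open>k\<close> members.\<close>
  define a2 where "a2 J = a (insert d J)\<oplus>(\<ominus> (s\<otimes>y d))\<otimes>b' J" for J
  have a2c: "a2 J\<in>\<R>" for J using Suc.prems(3) b'(1) s y(3) by (simp add: a2_def)
  have "\<exists>b. (\<forall>J. b J\<in>\<R>) \<and> (\<forall>J. J\<subseteq>{..<d} \<longrightarrow> card J = k \<longrightarrow> a2 J = kosz y b J)"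
  proof (rule IH[OF a2c])
   show "k < d" using Suc Suc.prems(4) by simp
   fix K assume K: "K\<subseteq>{..<d}" "card K = Suc k"
   have fin: "finite K" using K(1) finite_subset by auto
   have dK: "d\<notin>K" using K by auto
   have "kosz y a2 K = kosz y (\<lambda>J. a (insert d J)) K\<oplus>(\<ominus> (s\<otimes>y d))\<otimes>kosz y b' K"
    unfolding a2_def by (rule kosz_lin[OF fin yK[OF K(1)]]) (use Suc.prems(3) b'(1) s y(3) in auto)
   also have "kosz y b' K = a K" using b'(2) K Suc by simp
   finally have 1: "kosz y a2 K = kosz y (\<lambda>J. a (insert d J)) K\<oplus>(\<ominus> (s\<otimes>y d))\<otimes>a K" .
   have "kosz y a (insert d K) = \<zero>" by (rule cyc) (use K fin dK Suc in auto)
   hence 2: "kosz y (\<lambda>J. a (insert d J)) K\<oplus>(s\<otimes>\<ominus> \<one>)\<otimes>(y d\<otimes>a K) = \<zero>"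
    using kosz_insert_top[OF K(1) y(2) Suc.prems(3)] K(2) by (simp add: s_def)
   have "(s\<otimes>\<ominus> \<one>)\<otimes>(y d\<otimes>a K) = (\<ominus> (s\<otimes>y d))\<otimes>a K" using s y(3) Suc.prems(3) by algebra
   thus "kosz y a2 K = \<zero>" using 1 2 by simp
  qed
  then obtain b2 where b2: "\<And>J. b2 J\<in>\<R>" "\<And>J. J\<subseteq>{..<d} ==> card J = k ==> a2 J = kosz y b2 J" by auto
  define b where "b J = (if d\<in>J then b2 (J - {d}) else b' J)" for J
  have bc: "b J\<in>\<R>" for J using b2(1) b'(1) by (simp add: b_def)
  have "a J = kosz y b J" if J: "J\<subseteq>{..<Suc d}" "card J = i" for J
  proof (cases "d\<in>J")
   case False
   hence Jd: "J\<subseteq>{..<d}" using J(1) by (auto simp: less_Suc_eq)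
   have "kosz y b' J = kosz y b J" by (rule kosz_cong) (use False yK[OF Jd] bc in \<open>auto simp: b_def\<close>)
   thus ?thesis using b'(2)[OF Jd J(2)] by simp
  next
   case True
   define T where "T = J - {d}"
   have finJ: "finite J" using J(1) finite_subset by auto
   have T: "J = insert d T" "T\<subseteq>{..<d}" "card T = k" "d\<notin>T" using True J finJ Suc by (auto simp: T_def)
   have "kosz y b J = kosz y (\<lambda>J. b (insert d J)) T\<oplus>(\<ominus> \<one>)[^]card T\<otimes>(y d\<otimes>b T)"
    unfolding T(1) by (rule kosz_insert_top[OF T(2) y(2) bc])
   also have "kosz y (\<lambda>J. b (insert d J)) T = kosz y b2 T"
    by (rule kosz_cong) (use T yK[OF T(2)] b2(1) in \<open>auto simp: b_def insert_Diff_if\<close>)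
   also have "\<dots> = a2 T" using b2(2)[OF T(2,3)] by simp
   also have "b T = b' T" using T(4) by (simp add: b_def)
   also have "a2 T\<oplus>(\<ominus> \<one>)[^]card T\<otimes>(y d\<otimes>b' T) = a J" unfolding a2_def T(1) T(3) s_def[symmetric]
    using s y(3) b'(1)[of T] Suc.prems(3) by algebra
   finally show ?thesis by simp
  qed
  thus ?thesis using bc by auto
 qed
qed simp

end

section \<open>The Cech complex with uniform denominators\<close>

lemma module_image:
 fixes M (structure)
 assumes "module R P" and h: "carrier M = h ` carrier P" "\<zero> = h \<zero>\<^bsub>P\<^esub>" "\<And>x y. x\<in>carrier P ==> y\<in>carrier P ==> h x\<oplus>h y = h (x\<oplus>\<^bsub>P\<^esub>y)"
  "\<And>r x. r\<in>carrier R ==> x\<in>carrier P ==> r\<odot>h x = h (r\<odot>\<^bsub>P\<^esub>x)" shows "module R M"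
proof -
 interpret P: module R P by fact
 show ?thesis
 proof (rule moduleI)
  show "abelian_group M"
  proof (rule abelian_groupI)
   fix x assume "x\<in>carrier M"
   then obtain a where "a\<in>carrier P" "x = h a" using h(1) by auto
   thus "\<exists>y\<in>carrier M. y\<oplus>x = \<zero>" unfolding h(1,2) by (auto simp: h(3) P.l_neg intro!: bexI[of _ "\<ominus>\<^bsub>P\<^esub> a"])
  qed (auto simp: h P.a_ac)
 qed (auto simp: h P.smult_l_distr P.smult_r_distr P.smult_assoc1 P.R.is_cring)
qed

text \<open>Nonzerodivisors make the localizations faithful, so that a cochain with prescribed
  denominators determines its numerators.\<close>

locale cech = cring +
 fixes xs assumes xs_carr: "set xs\<subseteq>carrier R"
  and xs_nzd: "\<And>x a. x\<in>set xs ==> a\<in>carrier R ==> x\<otimes>a = \<zero> ==> a = \<zero>"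
begin

abbreviation mon where "mon\<equiv>monomials R xs"
abbreviation idx where "idx\<equiv>cech_index xs"
abbreviation C where "C\<equiv>cech_module R xs"
abbreviation B where "B\<equiv>cech_coboundaries R xs"
definition mpow where "mpow J N = (\<Otimes>j\<in>J. xs ! j[^](N::nat))"

lemma x_carr [simp]: "j < length xs ==> xs ! j\<in>\<R>" using xs_carr nth_mem by blast

lemma x_fun: "J\<subseteq>{..<length xs} ==> (\<lambda>j. xs ! j[^](e j :: nat))\<in>J\<rightarrow>\<R>" by auto

lemma idxD: "J\<in>idx i ==> J\<subseteq>{..<length xs} \<and> card J = i \<and> finite J" unfolding cech_index_def using finite_subset by auto

lemma idx_finite: "finite (idx i)" unfolding cech_index_def by (rule finite_subset[of _ "Pow {..<length xs}"]) auto

lemma idx_diff: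
 assumes h: "K\<in>idx (Suc i)" "j\<in>K" shows "K - {j}\<in>idx i"
proof -
 have K: "K\<subseteq>{..<length xs}" "card K = Suc i" "finite K" using idxD[OF h(1)] by auto
 have "card (K - {j}) = i" using K h(2) by simp
 moreover have "K - {j}\<subseteq>{..<length xs}" using K(1) by auto
 ultimately show ?thesis unfolding cech_index_def by simp
qed

lemma mpow_mon: "mpow J N\<in>mon J" unfolding monomials_def mpow_def by auto

lemma mon_mult_set: "J\<subseteq>{..<length xs} ==> mult_set R (mon J)"
proof
 assume J: "J\<subseteq>{..<length xs}"
 show "mon J\<subseteq>\<R>" unfolding monomials_def using x_fun[OF J] by auto
 have "\<one> = (\<Otimes>j\<in>J. xs ! j[^](0::nat))" by (rule finprod_one_eqI[symmetric]) simp
 thus "\<one>\<in>mon J" unfolding monomials_def mem_Collect_eq by (intro exI[of _ "\<lambda>_. 0"]) simp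
 fix s t assume "s\<in>mon J" "t\<in>mon J"
 then obtain e f :: "nat\<Rightarrow>nat" where s: "s = (\<Otimes>j\<in>J. xs ! j[^]e j)" and t: "t = (\<Otimes>j\<in>J. xs ! j[^]f j)"
  unfolding monomials_def by auto
 have "s\<otimes>t = (\<Otimes>j\<in>J. xs ! j[^]e j\<otimes>xs ! j[^]f j)" unfolding s t by (rule finprod_multf[symmetric]) (use x_fun[OF J] in auto)
 also have "\<dots> = (\<Otimes>j\<in>J. xs ! j[^](e j + f j))" by (rule finprod_cong') (use J in \<open>auto simp: nat_pow_mult subset_iff\<close>)
 finally show "s\<otimes>t\<in>mon J" unfolding monomials_def by auto
qed

lemma mpow_carr: "J\<subseteq>{..<length xs} ==> mpow J N\<in>\<R>" using mult_set.D_carr[OF mon_mult_set mpow_mon] .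

lemma mon_mono:
 assumes "J\<subseteq>K" "K\<subseteq>{..<length xs}" shows "mon J\<subseteq>mon K"
proof
 fix s assume "s\<in>mon J"
 then obtain e :: "nat\<Rightarrow>nat" where s: "s = (\<Otimes>j\<in>J. xs ! j[^]e j)" unfolding monomials_def by auto
 define f where "f j = (if j\<in>J then e j else 0)" for j
 have "s = (\<Otimes>j\<in>K. xs ! j[^]f j)" unfolding s
  by (rule finprod_mono_neutral_cong_left) (use assms finite_subset[OF assms(2)] in \<open>auto simp: f_def subset_iff\<close>)
 thus "s\<in>mon K" unfolding monomials_def by auto
qed

lemma mpow_mult:
 assumes J: "J\<subseteq>{..<length xs}" shows "mpow J M\<otimes>mpow J N = mpow J (M + N)"
proof -
 have "mpow J M\<otimes>mpow J N = (\<Otimes>j\<in>J. xs ! j[^]M\<otimes>xs ! j[^]N)"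
  unfolding mpow_def by (rule finprod_multf[symmetric]) (use x_fun[OF J] in auto)
 also have "\<dots> = mpow J (M + N)" unfolding mpow_def by (rule finprod_cong') (use J in \<open>auto simp: nat_pow_mult subset_iff\<close>)
 finally show ?thesis .
qed

lemma mpow_pow: "J\<subseteq>{..<length xs} ==> mpow J N[^](p::nat) = mpow J (N * p)"
proof (induction p)
 case 0
 have "mpow J 0 = \<one>" unfolding mpow_def by (rule finprod_one_eqI) simp
 thus ?case by simp
next
 case (Suc p) thus ?case using mpow_mult by (simp add: add.commute)
qed

lemma mon_dvd:
 assumes J: "J\<subseteq>{..<length xs}" and s: "s\<in>mon J" shows "\<exists>N. \<exists>t\<in>mon J. mpow J N = t\<otimes>s"
proof -
 obtain e :: "nat\<Rightarrow>nat" where s: "s = (\<Otimes>j\<in>J. xs ! j[^]e j)" using s unfolding monomials_def by auto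
 define N where "N = (\<Sum>j\<in>J. e j)"
 have fin: "finite J" using J finite_subset by auto
 have le: "e j\<le>N" if "j\<in>J" for j unfolding N_def using member_le_sum[OF that, of e] fin by simp
 define t where "t = (\<Otimes>j\<in>J. xs ! j[^](N - e j))"
 have "t\<otimes>s = (\<Otimes>j\<in>J. xs ! j[^](N - e j)\<otimes>xs ! j[^]e j)"
  unfolding s t_def by (rule finprod_multf[symmetric]) (use x_fun[OF J] in auto)
 also have "\<dots> = mpow J N" unfolding mpow_def by (rule finprod_cong') (use J le in \<open>auto simp: nat_pow_mult subset_iff\<close>)
 finally have "mpow J N = t\<otimes>s" by simp
 moreover have "t\<in>mon J" unfolding t_def monomials_def by auto
 ultimately show ?thesis by auto
qed

lemma mpow_step:
 assumes "J\<subseteq>{..<length xs}" "j\<in>J" shows "mpow J N = xs ! j[^]N\<otimes>mpow (J - {j}) N"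
proof -
 have "J = insert j (J - {j})" using assms(2) by auto
 hence "mpow J N = mpow (insert j (J - {j})) N" by simp
 also have "\<dots> = xs ! j[^]N\<otimes>mpow (J - {j}) N" unfolding mpow_def
  by (rule finprod_insert) (use assms finite_subset[OF assms(1)] in \<open>auto simp: subset_iff\<close>)
 finally show ?thesis .
qed

lemma xpow_nzd: "x\<in>set xs ==> a\<in>\<R> ==> x[^](n::nat)\<otimes>a = \<zero> ==> a = \<zero>"
proof (induction n)
 case (Suc n)
 have x: "x\<in>\<R>" using Suc.prems(1) xs_carr by auto
 have "x\<otimes>(x[^]n\<otimes>a) = \<zero>" using Suc.prems x by (simp add: m_ac)
 hence "x[^]n\<otimes>a = \<zero>" using xs_nzd[OF Suc.prems(1), of "x[^]n\<otimes>a"] x Suc.prems(2) by simp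
 thus ?case by (rule Suc.IH[OF Suc.prems(1,2)])
qed simp

lemma mon_nzd:
 assumes J: "J\<subseteq>{..<length xs}" and s: "s\<in>mon J" and a: "a\<in>\<R>" and z: "s\<otimes>a = \<zero>" shows "a = \<zero>"
proof -
 obtain e :: "nat\<Rightarrow>nat" where s: "s = (\<Otimes>j\<in>J. xs ! j[^]e j)" using s unfolding monomials_def by auto
 have "finite J" using J finite_subset by auto
 thus ?thesis using J a z unfolding s
 proof (induction J rule: finite_induct)
  case (insert j J)
  have c: "xs ! j[^]e j\<in>\<R>" "(\<lambda>j. xs ! j[^]e j)\<in>J\<rightarrow>\<R>" using insert.prems by auto
  have "(\<Otimes>j\<in>insert j J. xs ! j[^]e j) = xs ! j[^]e j\<otimes>(\<Otimes>j\<in>J. xs ! j[^]e j)"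
   by (rule finprod_insert[OF insert.hyps c(2,1)])
  hence "xs ! j[^]e j\<otimes>((\<Otimes>j\<in>J. xs ! j[^]e j)\<otimes>a) = \<zero>" using insert.prems c by (simp add: m_assoc)
  moreover have "xs ! j\<in>set xs" using insert.prems(1) by simp
  moreover have "(\<Otimes>j\<in>J. xs ! j[^]e j)\<otimes>a\<in>\<R>" using finprod_closed[OF c(2)] insert.prems(2) by simp
  ultimately have "(\<Otimes>j\<in>J. xs ! j[^]e j)\<otimes>a = \<zero>" using xpow_nzd by simp
  thus ?case using insert.IH insert.prems(1,2) by simp
 qed simp
qed

lemma mon_cancel:
 assumes J: "J\<subseteq>{..<length xs}" and s: "s\<in>mon J" and a: "a\<in>\<R>" "b\<in>\<R>" and z: "s\<otimes>a = s\<otimes>b" shows "a = b"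
proof -
 have sc: "s\<in>\<R>" using mult_set.D_carr[OF mon_mult_set[OF J] s] .
 have "s\<otimes>(a\<ominus>b) = s\<otimes>a\<ominus>s\<otimes>b" using sc a by algebra
 hence "s\<otimes>(a\<ominus>b) = \<zero>" using z sc a by simp
 hence "a\<ominus>b = \<zero>" using mon_nzd[OF J s] a by simp
 thus ?thesis using a by simp
qed

text \<open>Every Cech cochain has this form for large \<open>N\<close>. With \<open>N\<close>
  fixed, the Cech differential becomes the Koszul differential of the powers \<open>x_j^N\<close> on
  numerators.\<close>

definition frc where
 "frc i N a = (\<lambda>J\<in>idx i. fraction R (mon J) (a J) (mpow J N))"

definition fam where "fam a \<longleftrightarrow> (\<forall>J :: nat set. a J\<in>\<R>)"

lemma famD [simp]: "fam a ==> a J\<in>\<R>" by (simp add: fam_def)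
lemma fam_const: "a\<in>\<R> ==> fam (\<lambda>_. a)" by (simp add: fam_def)
lemma idx_ms: "J\<in>idx i ==> mult_set R (mon J)" using idxD mon_mult_set by simp

lemma frc_carr: "fam a ==> frc i N a\<in>carrier (C i)"
 unfolding cech_module_def frc_def cech_ring_def using mult_set.fr_carr[OF idx_ms _ mpow_mon] by auto

lemma frc_cong: "(\<And>J. J\<in>idx i ==> a J = b J) ==> frc i N a = frc i N b" unfolding frc_def by (rule restrict_ext) simp

lemma frc_eq:
 assumes "fam a" "fam b" shows "frc i N a = frc i N b \<longleftrightarrow> (\<forall>J\<in>idx i. a J = b J)"
proof
 assume e: "frc i N a = frc i N b"
 show "\<forall>J\<in>idx i. a J = b J"
 proof
  fix J assume J: "J\<in>idx i"
  hence Js: "J\<subseteq>{..<length xs}" using idxD by auto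
  interpret mult_set R "mon J" by (rule mon_mult_set[OF Js])
  have "fr (a J) (mpow J N) = fr (b J) (mpow J N)" using fun_cong[OF e, of J] J by (simp add: frc_def)
  then obtain v where v: "v\<in>mon J" "v\<otimes>(mpow J N\<otimes>a J) = v\<otimes>(mpow J N\<otimes>b J)" using fr_eq assms mpow_mon by auto
  have "mpow J N\<otimes>a J = mpow J N\<otimes>b J" using mon_cancel[OF Js v(1) _ _ v(2)] assms mpow_carr[OF Js] by simp
  thus "a J = b J" using mon_cancel[OF Js mpow_mon] assms by simp
 qed
qed (auto intro: frc_cong)

text \<open>The change of numerators when the denominators pass from exponent \<open>N\<close> to
  \<open>k + N\<close>. The value zero outside the index range keeps the result a family of ring
  elements.\<close>

definition lft :: "nat\<Rightarrow>(nat set\<Rightarrow>'a)\<Rightarrow>nat set\<Rightarrow>'a" where "lft k f J = (if J\<subseteq>{..<length xs} then mpow J k\<otimes>f J else \<zero>)"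

lemma lft_fam: "fam f ==> fam (lft k f)" using mpow_carr by (auto simp: lft_def fam_def)

lemma frc_lift: assumes "fam a" shows "frc i (k + N) (lft k a) = frc i N a" unfolding frc_def
proof (rule restrict_ext)
 fix J assume "J\<in>idx i"
 hence Js: "J\<subseteq>{..<length xs}" using idxD by auto
 interpret mult_set R "mon J" by (rule mon_mult_set[OF Js])
 show "fr (lft k a J) (mpow J (k + N)) = fr (a J) (mpow J N)" using fr_cancel[OF famD[OF assms] mpow_mon mpow_mon] Js mpow_mult by (simp add: lft_def)
qed

lemma C_cases: assumes "c\<in>carrier (C i)" shows "\<exists>N a. fam a \<and> c = frc i N a"
proof -
 have cP: "c\<in>(\<Pi>\<^sub>E J\<in>idx i. carrier (localization R (mon J)))" using assms by (simp add: cech_module_def cech_ring_def)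
 have "\<exists>N a. a\<in>\<R> \<and> c J = fraction R (mon J) a (mpow J N)" if J: "J\<in>idx i" for J
 proof -
  have Js: "J\<subseteq>{..<length xs}" using idxD[OF J] by auto
  interpret mult_set R "mon J" by (rule mon_mult_set[OF Js])
  have "c J\<in>carrier L" using cP J by auto
  then obtain a s where a: "a\<in>\<R>" "s\<in>mon J" "c J = fr a s" by (rule L_cases)
  obtain N t where t: "t\<in>mon J" "mpow J N = t\<otimes>s" using mon_dvd[OF Js a(2)] by auto
  have "c J = fr (t\<otimes>a) (mpow J N)" using a t fr_cancel by simp
  thus ?thesis using a t D_carr by blast
 qed
 then obtain N a where Na: "\<And>J. J\<in>idx i ==> a J\<in>\<R> \<and> c J = fraction R (mon J) (a J) (mpow J (N J))" by metis
 define M where "M = (\<Sum>J\<in>idx i. N J)"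
 have le: "N J\<le>M" if "J\<in>idx i" for J unfolding M_def using member_le_sum[OF that, of N] idx_finite by simp
 define b where "b J = (if J\<in>idx i then mpow J (M - N J)\<otimes>a J else \<zero>)" for J
 have b: "fam b" using Na mpow_carr idxD by (auto simp: b_def fam_def)
 have "c = frc i M b"
 proof (rule PiE_ext[OF cP])
  show "frc i M b\<in>(\<Pi>\<^sub>E J\<in>idx i. carrier (localization R (mon J)))" using frc_carr[OF b] by (simp add: cech_module_def cech_ring_def)
  fix J assume J: "J\<in>idx i"
  have Js: "J\<subseteq>{..<length xs}" using idxD[OF J] by auto
  interpret mult_set R "mon J" by (rule mon_mult_set[OF Js])
  show "c J = frc i M b J" using Na J fr_cancel[of "a J" "mpow J (N J)" "mpow J (M - N J)"] mpow_mon mpow_mult[OF Js, of "M - N J" "N J"] le[OF J] by (simp add: frc_def b_def)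
 qed
 thus ?thesis using b by blast
qed

lemma C_rep: assumes "c\<in>carrier (C i)" shows "\<exists>M. \<forall>N\<ge>M. \<exists>a. fam a \<and> c = frc i N a"
proof -
 obtain M a where a: "fam a" "c = frc i M a" using C_cases[OF assms] by auto
 have "c = frc i N (lft (N - M) a)" if "N\<ge>M" for N using frc_lift[OF a(1), of i "N - M" M] a(2) that by simp
 thus ?thesis using lft_fam[OF a(1)] by blast
qed

lemma C_zero: "\<zero>\<^bsub>C i\<^esub> = frc i N (\<lambda>_. \<zero>)"
 unfolding cech_module_def frc_def cech_ring_def using mult_set.fr_zero[OF idx_ms mpow_mon] by (auto intro!: restrict_ext)

lemma C_add: "fam a ==> fam b ==> frc i N a \<oplus>\<^bsub>C i\<^esub> frc i N b = frc i N (\<lambda>J. a J\<oplus>b J)"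
 unfolding cech_module_def frc_def cech_ring_def using mult_set.fr_add_same[OF idx_ms _ mpow_mon] by (auto intro!: restrict_ext)

lemma C_smult: assumes a: "fam a" and r: "r\<in>\<R>" shows "r \<odot>\<^bsub>C i\<^esub> frc i N a = frc i N (\<lambda>J. r\<otimes>a J)"
 unfolding cech_module_def frc_def cech_ring_def partial_object.simps module.simps
proof (rule restrict_ext)
 fix J assume J: "J\<in>idx i"
 then interpret mult_set R "mon J" by (rule idx_ms)
 show "fr r \<one>\<otimes>\<^bsub>L\<^esub>(\<lambda>J\<in>idx i. fraction R (mon J) (a J) (mpow J N)) J = fr (r\<otimes>a J) (mpow J N)"
  using fr_mult[OF r D_one famD[OF a] mpow_mon] D_carr[OF mpow_mon] J by simp
qed

lemma C_frob: assumes a: "fam a" shows "cech_frobenius p R xs i (frc i N a) = frc i (N * p) (\<lambda>J. a J[^]p)"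
 unfolding cech_frobenius_def frc_def cech_ring_def
proof (rule restrict_ext)
 fix J assume J: "J\<in>idx i"
 then interpret mult_set R "mon J" by (rule idx_ms)
 show "(\<lambda>J\<in>idx i. fraction R (mon J) (a J) (mpow J N)) J[^]\<^bsub>L\<^esub>p = fr (a J[^]p) (mpow J (N * p))"
  using fr_pow[OF famD[OF a] mpow_mon] mpow_pow idxD J by simp
qed

lemma C_common:
 assumes "c\<in>carrier (C i)" "c'\<in>carrier (C i)"
 obtains N a a' where "fam a" "fam a'" "c = frc i N a" "c' = frc i N a'"
 using C_rep[OF assms(1)] C_rep[OF assms(2)] max.cobounded1 max.cobounded2 by metis

lemma C_module: "module R (C i)"
proof (rule moduleI)
 have L: "cring (cech_ring R xs J)" if "J\<in>idx i" for J
 proof -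
  interpret mult_set R "mon J" by (rule idx_ms[OF that])
  show ?thesis unfolding cech_ring_def by (rule L.is_cring)
 qed
 show "cring R" by (rule is_cring)
 show "abelian_group (C i)"
 proof (rule abelian_groupI)
  show "\<zero>\<^bsub>C i\<^esub>\<in>carrier (C i)" unfolding C_zero[of i 0] by (intro frc_carr fam_const) simp
  fix x assume x: "x\<in>carrier (C i)"
  then obtain N a where a: "fam a" "x = frc i N a" using C_cases by metis
  show "\<zero>\<^bsub>C i\<^esub> \<oplus>\<^bsub>C i\<^esub> x = x" unfolding C_zero[of i N] a(2) using a(1) by (simp add: C_add fam_const)
  show "\<exists>y\<in>carrier (C i). y \<oplus>\<^bsub>C i\<^esub> x = \<zero>\<^bsub>C i\<^esub>" unfolding C_zero[of i N] a(2) using a(1)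
   by (intro bexI[of _ "frc i N (\<lambda>J.\<ominus>a J)"] frc_carr) (simp_all add: C_add fam_def l_neg)
  fix y assume y: "y\<in>carrier (C i)"
  then obtain N a b where ab: "fam a" "fam b" "x = frc i N a" "y = frc i N b" using C_common[OF x] by metis
  show "x \<oplus>\<^bsub>C i\<^esub> y\<in>carrier (C i)" using ab by (simp add: C_add frc_carr fam_def)
  show "x \<oplus>\<^bsub>C i\<^esub> y = y \<oplus>\<^bsub>C i\<^esub> x" using ab by (simp add: C_add a_comm)
  fix z assume z: "z\<in>carrier (C i)"
  show "x \<oplus>\<^bsub>C i\<^esub> y \<oplus>\<^bsub>C i\<^esub> z = x \<oplus>\<^bsub>C i\<^esub> (y \<oplus>\<^bsub>C i\<^esub> z)"
   using x y z cring.cring_simprules(7)[OF L] by (auto simp: cech_module_def PiE_iff intro!: restrict_ext)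
 qed
 fix r x assume r: "r\<in>\<R>" and x: "x\<in>carrier (C i)"
 then obtain N a where a: "fam a" "x = frc i N a" using C_cases by metis
 show "r \<odot>\<^bsub>C i\<^esub> x\<in>carrier (C i)" using a r by (simp add: C_smult frc_carr fam_def)
 { fix s assume s: "s\<in>\<R>"
  show "(r\<oplus>s) \<odot>\<^bsub>C i\<^esub> x = r \<odot>\<^bsub>C i\<^esub> x \<oplus>\<^bsub>C i\<^esub> s \<odot>\<^bsub>C i\<^esub> x" using a r s by (simp add: C_smult C_add fam_def l_distr)
  show "(r\<otimes>s) \<odot>\<^bsub>C i\<^esub> x = r \<odot>\<^bsub>C i\<^esub> (s \<odot>\<^bsub>C i\<^esub> x)" using a r s by (simp add: C_smult fam_def m_assoc) }
 { fix y assume y: "y\<in>carrier (C i)"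
  then obtain N a b where "fam a" "fam b" "x = frc i N a" "y = frc i N b" using C_common[OF x] by metis
  thus "r \<odot>\<^bsub>C i\<^esub> (x \<oplus>\<^bsub>C i\<^esub> y) = r \<odot>\<^bsub>C i\<^esub> x \<oplus>\<^bsub>C i\<^esub> r \<odot>\<^bsub>C i\<^esub> y" using r by (simp add: C_smult C_add fam_def r_distr) }
next
 fix x assume "x\<in>carrier (C i)"
 then obtain N a where "fam a" "x = frc i N a" using C_cases by metis
 thus "\<one> \<odot>\<^bsub>C i\<^esub> x = x" by (simp add: C_smult)
qed

interpretation M: module R "C i" for i by (rule C_module)

definition ddc where "ddc N a K = (if K\<subseteq>{..<length xs} then kosz (\<lambda>j. xs ! j[^](N::nat)) a K else \<zero>)"

lemma ddc_fam: "fam a ==> fam (ddc N a)" unfolding ddc_def fam_def using kosz_closed[OF x_fun, of _ a] by simp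

lemma ddc_zero: "ddc N (\<lambda>_. \<zero>) = (\<lambda>_. \<zero>)"
 unfolding ddc_def kosz_def by (rule ext) (auto intro!: add.finprod_one_eqI simp: subset_iff)

text \<open>Passing from \<open>K - {j}\<close> to \<open>K\<close> extends the fraction by the
  power \<open>x_j^N\<close>. All summands then have the same denominator, and the numerators add up
  with the Koszul signs.\<close>

lemma cech_d_frc:
 assumes a: "fam a" shows "cech_d R xs i (frc i N a) = frc (Suc i) N (ddc N a)" unfolding cech_d_def frc_def[of "Suc i"]
proof (rule restrict_ext)
 fix K assume K: "K\<in>idx (Suc i)"
 have Ks: "K\<subseteq>{..<length xs}" and fin: "finite K" using idxD[OF K] by auto
 interpret mult_set R "mon K" by (rule mon_mult_set[OF Ks])
 let ?S = "\<lambda>j. let y = frac_map R (mon K) (frc i N a (K - {j})) in if even (card {l\<in>K. l < j}) then y else\<ominus>\<^bsub>L\<^esub>y"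
 define g where "g j = eps K j\<otimes>(xs ! j[^]N\<otimes>a (K - {j}))" for j
 have gc: "g\<in>K\<rightarrow>\<R>" using a Ks by (auto simp: g_def)
 have "(\<Oplus>\<^bsub>L\<^esub>j\<in>K. ?S j) = (\<Oplus>\<^bsub>L\<^esub>j\<in>K. fr (g j) (mpow K N))"
 proof (rule L.finsum_cong')
  show "(\<lambda>j. fr (g j) (mpow K N))\<in>K\<rightarrow>carrier L" using gc fr_carr mpow_mon by (auto simp: Pi_def)
  fix j assume j: "j\<in>K"
  have jn: "j < length xs" using j Ks by auto
  have sub: "K - {j}\<subseteq>K" "K - {j}\<subseteq>{..<length xs}" using Ks by auto
  have "frac_map R (mon K) (frc i N a (K - {j})) = fr (a (K - {j})) (mpow (K - {j}) N)"
   using frac_map_fr[OF mon_mult_set[OF sub(2)] mult_set_axioms mon_mono[OF sub(1) Ks] famD[OF a] mpow_mon] idx_diff[OF K j] by (simp add: frc_def)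
  also have "\<dots> = fr (xs ! j[^]N\<otimes>a (K - {j})) (xs ! j[^]N\<otimes>mpow (K - {j}) N)"
  proof (rule fr_cancel[symmetric, OF famD[OF a]])
   show "mpow (K - {j}) N\<in>mon K" using mpow_mon mon_mono[OF sub(1) Ks] by auto
   have "xs ! j[^]N = mpow {j} N" unfolding mpow_def using jn by simp
   thus "xs ! j[^]N\<in>mon K" using mpow_mon mon_mono[of "{j}" K] j Ks by auto
  qed
  finally have e: "frac_map R (mon K) (frc i N a (K - {j})) = fr (xs ! j[^]N\<otimes>a (K - {j})) (mpow K N)" using mpow_step[OF Ks j] by simp
  show "?S j = fr (g j) (mpow K N)"
   unfolding e g_def eps_def Let_def using sign_pow[of "xs ! j[^]N\<otimes>a (K - {j})" "card {l\<in>K. l < j}"] fr_neg[OF _ mpow_mon] a jn by auto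
 qed simp
 also have "\<dots> = fr (\<Oplus>j\<in>K. g j) (mpow K N)" by (rule fr_finsum[OF fin gc mpow_mon])
 also have "(\<Oplus>j\<in>K. g j) = ddc N a K" unfolding ddc_def kosz_def g_def using Ks by simp
 finally show "(\<Oplus>\<^bsub>cech_ring R xs K\<^esub>j\<in>K. let y = frac_map R (mon K) (frc i N a (K - {j}))
   in if even (card {l\<in>K. l < j}) then y else \<ominus>\<^bsub>cech_ring R xs K\<^esub> y) = fr (ddc N a K) (mpow K N)" unfolding cech_ring_def .
qed

text \<open>In degree zero the Koszul sum over the empty set vanishes, so one formula covers the
  trivial coboundary as well.\<close>

lemma B_iff: "c\<in>B i \<longleftrightarrow> (\<exists>N b. fam b \<and> c = frc i N (ddc N b))"
proof (cases i)
 case 0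
 have "J = {}" if "J\<in>idx 0" for J using idxD[OF that] by auto
 hence "frc 0 N (ddc N b) = \<zero>\<^bsub>C 0\<^esub>" for N b unfolding C_zero[of 0 N] by (intro frc_cong) (force simp: ddc_def kosz_def)
 thus ?thesis unfolding 0 cech_coboundaries_def using fam_const[OF zero_closed] by auto
next
 case (Suc k)
 have "c\<in>B i \<longleftrightarrow> (\<exists>N b. fam b \<and> c = cech_d R xs k (frc k N b))"
  unfolding cech_coboundaries_def Suc using C_cases frc_carr[of _ k] by auto
 thus ?thesis unfolding Suc using cech_d_frc by metis
qed

lemma ddc_lift: assumes f: "fam f" shows "lft k (ddc n f) = ddc (k + n) (lft k f)"
proof
 fix K
 show "lft k (ddc n f) K = ddc (k + n) (lft k f) K"
 proof (cases "K\<subseteq>{..<length xs}")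
  case True
  note m = mpow_carr[OF True, of k]
  have "mpow K k\<otimes>kosz (\<lambda>j. xs ! j[^]n) f K = (\<Oplus>j\<in>K. mpow K k\<otimes>(eps K j\<otimes>(xs ! j[^]n\<otimes>f (K - {j}))))"
   unfolding kosz_def by (intro finsum_rdistr) (use finite_subset[OF True] m f True in auto)
  also have "\<dots> = kosz (\<lambda>j. xs ! j[^](k + n)) (lft k f) K" unfolding kosz_def
  proof (rule finsum_cong')
   fix j assume j: "j\<in>K"
   have s: "xs ! j\<in>\<R>" "K - {j}\<subseteq>{..<length xs}" using j True by auto
   have xk: "xs ! j[^]k\<in>\<R>" "xs ! j[^]n\<in>\<R>" using s by auto
   have "mpow K k\<otimes>(eps K j\<otimes>(xs ! j[^]n\<otimes>f (K - {j}))) = eps K j\<otimes>((xs ! j[^]k\<otimes>xs ! j[^]n)\<otimes>(mpow (K - {j}) k\<otimes>f (K - {j})))"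
    unfolding mpow_step[OF True j] using xk mpow_carr[OF s(2), of k] famD[OF f, of "K - {j}"] eps_carr by algebra
   thus "mpow K k\<otimes>(eps K j\<otimes>(xs ! j[^]n\<otimes>f (K - {j}))) = eps K j\<otimes>(xs ! j[^](k + n)\<otimes>lft k f (K - {j}))"
    using s by (simp add: lft_def nat_pow_mult)
  qed (use True lft_fam[OF f] in \<open>auto simp: subset_iff\<close>)
  finally show ?thesis by (simp add: lft_def ddc_def)
 qed (simp add: lft_def ddc_def)
qed

lemma B_rep: assumes "c\<in>B i" shows "\<exists>M. \<forall>N\<ge>M. \<exists>b. fam b \<and> c = frc i N (ddc N b)"
proof -
 obtain M b where b: "fam b" "c = frc i M (ddc M b)" using assms B_iff by auto
 have "c = frc i N (ddc N (lft (N - M) b))" if "N\<ge>M" for N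
  using frc_lift[of "ddc M b" i "N - M" M] ddc_fam[OF b(1)] ddc_lift[OF b(1), of "N - M" M] b(2) that by simp
 thus ?thesis using lft_fam[OF b(1)] by blast
qed

lemma B_add:
 assumes "c\<in>B i" "c'\<in>B i" "r\<in>\<R>" shows "c \<oplus>\<^bsub>C i\<^esub> r \<odot>\<^bsub>C i\<^esub> c'\<in>B i"
proof -
 obtain N a b where ab: "fam a" "fam b" "c = frc i N (ddc N a)" "c' = frc i N (ddc N b)"
  using B_rep[OF assms(1)] B_rep[OF assms(2)] max.cobounded1 max.cobounded2 by metis
 have "ddc N (\<lambda>J. a J\<oplus>r\<otimes>b J) = (\<lambda>J. ddc N a J\<oplus>r\<otimes>ddc N b J)"
  unfolding ddc_def using kosz_lin[OF finite_subset x_fun famD[OF ab(1)] famD[OF ab(2)] assms(3)] assms(3) by auto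
 hence "c \<oplus>\<^bsub>C i\<^esub> r \<odot>\<^bsub>C i\<^esub> c' = frc i N (ddc N (\<lambda>J. a J\<oplus>r\<otimes>b J))"
  unfolding ab(3,4) using ddc_fam[OF ab(1)] ddc_fam[OF ab(2)] assms(3) by (simp add: C_smult C_add fam_def)
 moreover have "fam (\<lambda>J. a J\<oplus>r\<otimes>b J)" using ab assms(3) by (simp add: fam_def)
 ultimately show ?thesis unfolding B_iff by auto
qed

lemma B_carr: "c\<in>B i ==> c\<in>carrier (C i)" unfolding B_iff using frc_carr ddc_fam by auto

lemma B_zero: "\<zero>\<^bsub>C i\<^esub>\<in>B i" unfolding B_iff C_zero[of i 0] using ddc_zero fam_const[OF zero_closed] by metis

text \<open>Frobenius is additive, and a sign equals its \<open>p\<close>-th power, also for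
  \<open>p = 2\<close>.\<close>

lemma ddc_frob:
 assumes "char_p_cring R p" and a: "fam a" shows "ddc (N * p) (\<lambda>J. a J[^]p) = (\<lambda>K. ddc N a K[^]p)"
proof
 fix K
 interpret char_p_cring R p by fact
 show "ddc (N * p) (\<lambda>J. a J[^]p) K = ddc N a K[^]p"
 proof (cases "K\<subseteq>{..<length xs}")
  case True
  have ep: "eps K j[^]p = eps K j" for j
  proof -
   have "\<ominus> \<one>[^]p =\<ominus>\<one>" using neg_pow by simp
   hence "(\<ominus> \<one>[^]p)[^]card {l\<in>K. l < j} = eps K j" unfolding eps_def by simp
   thus ?thesis unfolding eps_def by (simp add: nat_pow_pow mult.commute)
  qed
  define g where "g j = eps K j\<otimes>(xs ! j[^]N\<otimes>a (K - {j}))" for j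
  have gc: "g\<in>K\<rightarrow>\<R>" using a True by (auto simp: g_def)
  have "ddc N a K[^]p = (\<Oplus>j\<in>K. g j[^]p)" using finsum_pow[OF finite_subset[OF True] gc] True by (simp add: ddc_def kosz_def g_def)
  also have "\<dots> = kosz (\<lambda>j. xs ! j[^](N * p)) (\<lambda>J. a J[^]p) K" unfolding kosz_def
  proof (rule finsum_cong')
   fix j assume "j\<in>K"
   hence "xs ! j\<in>\<R>" using True by auto
   thus "g j[^]p = eps K j\<otimes>(xs ! j[^](N * p)\<otimes>a (K - {j})[^]p)" unfolding g_def using a ep by (simp add: nat_pow_distrib nat_pow_pow)
  qed (use a True in \<open>auto simp: subset_iff\<close>)
  finally show ?thesis using True by (simp add: ddc_def)
 qed (use p_gt_0 in \<open>simp add: ddc_def nat_pow_zero\<close>)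
qed

lemma B_frob:
 assumes "char_p_cring R p" "c\<in>B i" shows "cech_frobenius p R xs i c\<in>B i"
proof -
 obtain N b where b: "fam b" "c = frc i N (ddc N b)" using assms(2) B_iff by auto
 have "fam (\<lambda>J. b J[^]p)" using b(1) by (simp add: fam_def)
 moreover have "cech_frobenius p R xs i c = frc i (N * p) (ddc (N * p) (\<lambda>J. b J[^]p))"
  unfolding b(2) C_frob[OF ddc_fam[OF b(1)]] ddc_frob[OF assms(1) b(1)] ..
 ultimately show ?thesis unfolding B_iff by blast
qed

lemma frob_carr: "c\<in>carrier (C i) ==> cech_frobenius p R xs i c\<in>carrier (C i)" using C_cases[of c i] C_frob frc_carr by (force simp: fam_def)

lemma frob_add:
 assumes "char_p_cring R p" "c\<in>carrier (C i)" "c'\<in>carrier (C i)"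
 shows "cech_frobenius p R xs i (c \<oplus>\<^bsub>C i\<^esub> c') = cech_frobenius p R xs i c \<oplus>\<^bsub>C i\<^esub> cech_frobenius p R xs i c'"
proof -
 interpret char_p_cring R p by fact
 obtain N a b where "fam a" "fam b" "c = frc i N a" "c' = frc i N b" using C_common[OF assms(2,3)] by metis
 thus ?thesis by (simp add: C_add C_frob freshman fam_def)
qed

section \<open>Cohomology classes and the Frobenius on them\<close>

abbreviation cls where "cls\<equiv>cech_class R xs"

interpretation S: abelian_subgroup "B i" "C i" for i
proof (rule abelian_subgroupI3[OF additive_subgroupI M.abelian_group_axioms], rule M.add.subgroupI)
 show "B i\<subseteq>carrier (C i)" using B_carr by auto
 show "B i\<noteq>{}" using B_zero by auto
 fix a assume a: "a\<in>B i"
 show "\<ominus>\<^bsub>C i\<^esub> a\<in>B i" using B_add[OF B_zero a, of "\<ominus> \<one>"] B_carr[OF a] by (simp add: M.smult_l_minus)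
 fix b assume b: "b\<in>B i"
 show "a \<oplus>\<^bsub>C i\<^esub> b\<in>B i" using B_add[OF a b one_closed] B_carr[OF b] by simp
qed

lemma cls_eq: assumes h: "c\<in>carrier (C i)" "c'\<in>carrier (C i)" shows "cls i c = cls i c' \<longleftrightarrow> c' \<ominus>\<^bsub>C i\<^esub> c\<in>B i"
 unfolding cech_class_def using S.a_rcos_module[OF h] S.a_repr_independence'[OF _ h(1), of c'] S.a_rcos_self[OF h(2)] by (auto simp: a_minus_def)

lemma cls_mem: "c\<in>carrier (C i) ==> c'\<in>cls i c ==> c'\<in>carrier (C i) \<and> c \<ominus>\<^bsub>C i\<^esub> c'\<in>B i"
 using S.a_elemrcos_carrier S.a_repr_independence'[of c' i c] cls_eq[of c' i c] by (simp add: cech_class_def)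

text \<open>Operations on cohomology are unions over the representatives of a class; the union is a
  single class as soon as \<open>f\<close> respects coboundaries.\<close>

lemma cls_UN:
 assumes "c\<in>carrier (C i)" "\<And>c'. c'\<in>carrier (C i) ==> c \<ominus>\<^bsub>C i\<^esub> c'\<in>B i ==> f c'\<in>carrier (C i) \<and> f c \<ominus>\<^bsub>C i\<^esub> f c'\<in>B i" "f c\<in>carrier (C i)"
 shows "(\<Union>c'\<in>cls i c. cls i (f c')) = cls i (f c)"
proof (intro UN_constant_eq ballI)
 show "c\<in>cls i c" using S.a_rcos_self[OF assms(1)] by (simp add: cech_class_def)
 show "cls i (f c') = cls i (f c)" if "c'\<in>cls i c" for c' using cls_mem[OF assms(1) that] assms(2) cls_eq assms(3) by metis
qed

abbreviation H where "H\<equiv>cech_cohomology R xs"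

lemma H_add: "c\<in>carrier (C i) ==> c'\<in>carrier (C i) ==> cls i c \<oplus>\<^bsub>H i\<^esub> cls i c' = cls i (c \<oplus>\<^bsub>C i\<^esub> c')"
 by (simp add: cech_cohomology_def cech_class_def S.a_rcos_sum)

lemma H_zero: "c\<in>B i ==> cls i c = \<zero>\<^bsub>H i\<^esub>" by (simp add: cech_cohomology_def cech_class_def S.a_rcos_const)

lemma H_smult: assumes c: "c\<in>carrier (C i)" and r: "r\<in>\<R>" shows "r \<odot>\<^bsub>H i\<^esub> cls i c = cls i (r \<odot>\<^bsub>C i\<^esub> c)"
proof -
 have "r \<odot>\<^bsub>C i\<^esub> c \<ominus>\<^bsub>C i\<^esub> r \<odot>\<^bsub>C i\<^esub> c'\<in>B i" if "c'\<in>carrier (C i)" "c \<ominus>\<^bsub>C i\<^esub> c'\<in>B i" for c'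
  using B_add[OF B_zero that(2) r] c r that(1) by (simp add: a_minus_def M.smult_r_distr M.smult_r_minus)
 thus ?thesis using cls_UN c r by (simp add: cech_cohomology_def)
qed

lemma cls_frob:
 assumes p: "char_p_cring R p" and c: "c\<in>carrier (C i)" shows "cech_cohomology_frobenius p R xs i (cls i c) = cls i (cech_frobenius p R xs i c)"
 unfolding cech_cohomology_frobenius_def
proof (rule cls_UN[where f = "cech_frobenius p R xs i", OF c _ frob_carr[OF c]], intro conjI)
 let ?F = "cech_frobenius p R xs i"
 fix c' assume c': "c'\<in>carrier (C i)" "c \<ominus>\<^bsub>C i\<^esub> c'\<in>B i"
 note Fc = frob_carr[OF c] frob_carr[OF c'(1)] frob_carr[OF B_carr[OF c'(2)]]
 show "?F c'\<in>carrier (C i)" by (rule Fc)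
 have "c = (c \<ominus>\<^bsub>C i\<^esub> c') \<oplus>\<^bsub>C i\<^esub> c'" using c'(1) c by (simp add: a_minus_def M.a_assoc M.l_neg)
 hence "?F c = ?F (c \<ominus>\<^bsub>C i\<^esub> c') \<oplus>\<^bsub>C i\<^esub> ?F c'" using frob_add[OF p B_carr[OF c'(2)] c'(1)] by simp
 hence "?F c \<ominus>\<^bsub>C i\<^esub> ?F c' = ?F (c \<ominus>\<^bsub>C i\<^esub> c')" using Fc by (simp add: a_minus_def M.a_assoc M.r_neg)
 thus "?F c \<ominus>\<^bsub>C i\<^esub> ?F c'\<in>B i" using B_frob[OF p c'(2)] by simp
qed

lemma F_zero: "char_p_cring R p ==> cech_cohomology_frobenius p R xs i (\<zero>\<^bsub>H i\<^esub>) = \<zero>\<^bsub>H i\<^esub>"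
 using cls_frob[of p "\<zero>\<^bsub>C i\<^esub>" i] H_zero H_zero[OF B_frob[OF _ B_zero]] by simp

lemma H_zero_ops: "r\<in>\<R> ==> r \<odot>\<^bsub>H i\<^esub> \<zero>\<^bsub>H i\<^esub> = \<zero>\<^bsub>H i\<^esub>" "\<zero>\<^bsub>H i\<^esub> \<oplus>\<^bsub>H i\<^esub> \<zero>\<^bsub>H i\<^esub> = \<zero>\<^bsub>H i\<^esub>"
 using H_smult[of "\<zero>\<^bsub>C i\<^esub>" i r] H_add[of "\<zero>\<^bsub>C i\<^esub>" i "\<zero>\<^bsub>C i\<^esub>"] by (simp_all add: H_zero[OF B_zero])

text \<open>Below the top degree this is the acyclicity of the Koszul complex of the powers \<open>x\<^sub>j\<^sup>N\<close>, where \<open>x\<^sub>J\<^sup>N\<close> is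
 a common denominator of the components of a cocycle.\<close>
lemma H_trivial:
 assumes reg: "\<And>N j r. N > 0 ==> j < length xs ==> r\<in>\<R> ==> xs ! j[^]N\<otimes>r\<in>Idl ((\<lambda>j. xs ! j[^](N::nat)) ` {..<j}) ==>
   r\<in>Idl ((\<lambda>j. xs ! j[^]N) ` {..<j})" and i: "i\<noteq>length xs" shows "carrier (H i) = {\<zero>\<^bsub>H i\<^esub>}"
proof -
 have ZB: "c\<in>B i" if c: "c\<in>cech_cocycles R xs i" for c
 proof (cases "i < length xs")
  case False
  \<comment> \<open>Above degree \<open>length xs\<close> there are no index sets, and the cochain
    module is a single point.\<close>
  have "J\<notin>idx i" for J using idxD card_mono[of "{..<length xs}" J] i False by auto
  hence "x = \<zero>\<^bsub>C i\<^esub>" if "x\<in>carrier (C i)" for x using that unfolding cech_module_def by (auto simp: PiE_iff extensional_def)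
  thus ?thesis using c B_zero unfolding cech_cocycles_def by force
 next
  case True
  obtain M where M: "\<And>N. N\<ge>M ==> \<exists>a. fam a \<and> c = frc i N a" using C_rep[of c i] c unfolding cech_cocycles_def by auto
  \<comment> \<open>The successor makes the exponent positive; regularity is assumed for positive
    powers.\<close>
  define N where "N = Suc M"
  obtain a where a: "fam a" "c = frc i N a" using M[of N] by (auto simp: N_def)
  have "frc (Suc i) N (ddc N a) = frc (Suc i) N (\<lambda>_. \<zero>)" using c cech_d_frc[OF a(1)] a(2) C_zero by (simp add: cech_cocycles_def)
  hence dz: "\<forall>K\<in>idx (Suc i). ddc N a K = \<zero>" using frc_eq[OF ddc_fam[OF a(1)] fam_const[OF zero_closed]] by simp
  have "\<exists>b. (\<forall>J. b J\<in>\<R>) \<and> (\<forall>J. J\<subseteq>{..<length xs} \<longrightarrow> card J = i \<longrightarrow> a J = kosz (\<lambda>j. xs ! j[^]N) b J)"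
  proof (rule koszul_acyclic[OF x_fun[OF order_refl] _ famD[OF a(1)] True])
   show "r\<in>Idl ((\<lambda>j. xs ! j[^]N) ` {..<j})" if "j < length xs" "r\<in>\<R>" "xs ! j[^]N\<otimes>r\<in>Idl ((\<lambda>j. xs ! j[^]N) ` {..<j})" for j r
    by (rule reg[OF _ that]) (simp add: N_def)
   show "kosz (\<lambda>j. xs ! j[^]N) a K = \<zero>" if "K\<subseteq>{..<length xs}" "card K = Suc i" for K
    using dz that unfolding cech_index_def by (simp add: ddc_def)
  qed
  then obtain b where b: "fam b" "\<And>J. J\<subseteq>{..<length xs} ==> card J = i ==> a J = kosz (\<lambda>j. xs ! j[^]N) b J" unfolding fam_def by auto
  have "c = frc i N (ddc N b)" unfolding a(2) using b(2) idxD by (intro frc_cong) (simp add: ddc_def)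
  thus ?thesis unfolding B_iff using b(1) by auto
 qed
 have "cech_d R xs i (\<zero>\<^bsub>C i\<^esub>) = \<zero>\<^bsub>C (Suc i)\<^esub>"
  unfolding C_zero[of _ 0] cech_d_frc[OF fam_const[OF zero_closed]] ddc_zero ..
 hence "\<zero>\<^bsub>C i\<^esub>\<in>cech_cocycles R xs i" by (simp add: cech_cocycles_def)
 moreover have "cls i ` cech_cocycles R xs i\<subseteq>{\<zero>\<^bsub>H i\<^esub>}" using H_zero[OF ZB] by auto
 ultimately show ?thesis unfolding cech_cohomology_def by auto
qed

section \<open>The top cohomology as a direct limit\<close>

definition top where "top = {..<length xs}"
abbreviation d where "d\<equiv>length xs"
definition zeta where "zeta N a = cls d (frc d N (\<lambda>_. a))"
abbreviation Htop where "Htop\<equiv>H d"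
abbreviation Ftop where "Ftop p\<equiv>cech_cohomology_frobenius p R xs d"

lemma idx_top: "J\<in>idx d \<longleftrightarrow> J = top" using card_subset_eq[of "{..<d}" J] by (auto simp: cech_index_def top_def)

lemma top_sub: "top\<subseteq>{..<d}" by (simp add: top_def)

lemma carrier_H_top: "carrier Htop = cls d ` carrier (C d)"
proof -
 have "J\<notin>idx (Suc d)" for J using idxD card_mono[of "{..<d}" J] by auto
 hence "idx (Suc d) = {}" by auto
 hence "cech_d R xs d c = \<zero>\<^bsub>C (Suc d)\<^esub>" for c unfolding cech_d_def cech_module_def by auto
 thus ?thesis unfolding cech_cohomology_def cech_cocycles_def by simp
qed

lemma Htop_module: "module R Htop" using module_image[OF C_module[of d], of Htop "cls d"] carrier_H_top H_add H_smult H_zero by simp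

lemma zc: "a\<in>\<R> ==> frc d N (\<lambda>_. a)\<in>carrier (C d)" by (intro frc_carr fam_const)

lemma zeta_carr: "a\<in>\<R> ==> zeta N a\<in>carrier Htop" unfolding carrier_H_top zeta_def using zc by auto

lemma zeta_cases: assumes "x\<in>carrier Htop" shows "\<exists>M. \<forall>N\<ge>M. \<exists>a\<in>\<R>. x = zeta N a"
proof -
 obtain c where c: "c\<in>carrier (C d)" "x = cls d c" using assms unfolding carrier_H_top by auto
 obtain M where M: "\<And>N. N\<ge>M ==> \<exists>a. fam a \<and> c = frc d N a" using C_rep[OF c(1)] by auto
 have "frc d N a = frc d N (\<lambda>_. a top)" for N a by (rule frc_cong) (simp add: idx_top)
 thus ?thesis unfolding c(2) zeta_def using M famD by metis
qed

lemma zeta_common: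
 assumes "x\<in>carrier Htop" "y\<in>carrier Htop"
 obtains N a b where "N > 0" "a\<in>\<R>" "b\<in>\<R>" "x = zeta N a" "y = zeta N b"
proof -
 obtain M M' where "\<forall>N\<ge>M. \<exists>a\<in>\<R>. x = zeta N a" "\<forall>N\<ge>M'. \<exists>a\<in>\<R>. y = zeta N a" using assms zeta_cases by metis
 hence "\<exists>a\<in>\<R>. x = zeta (Suc (M + M')) a" "\<exists>a\<in>\<R>. y = zeta (Suc (M + M')) a" by auto
 thus ?thesis using that by blast
qed

lemma zeta_add: "a\<in>\<R> ==> b\<in>\<R> ==> zeta N a\<oplus>\<^bsub>Htop\<^esub>zeta N b = zeta N (a\<oplus>b)"
 unfolding zeta_def by (simp add: H_add zc C_add fam_const)

lemma zeta_smult: "a\<in>\<R> ==> r\<in>\<R> ==> r\<odot>\<^bsub>Htop\<^esub>zeta N a = zeta N (r\<otimes>a)"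
 unfolding zeta_def by (simp add: H_smult zc C_smult fam_const)

lemma zeta_frob: "char_p_cring R p ==> a\<in>\<R> ==> Ftop p (zeta N a) = zeta (N * p) (a[^]p)"
 unfolding zeta_def by (simp add: cls_frob zc C_frob fam_const)

lemma zeta_zero: "\<zero>\<^bsub>Htop\<^esub> = zeta N \<zero>" unfolding zeta_def C_zero[symmetric] by (rule H_zero[OF B_zero, symmetric])

lemma frc_lift_top: "a\<in>\<R> ==> frc d N (\<lambda>_. a) = frc d (k + N) (\<lambda>_. mpow top k\<otimes>a)"
 using frc_lift[OF fam_const, of a d k N, symmetric] frc_cong[of d "lft k (\<lambda>_. a)" "\<lambda>_. mpow top k\<otimes>a"] top_sub
 by (simp add: idx_top lft_def)

lemma zeta_lift: "a\<in>\<R> ==> zeta N a = zeta (k + N) (mpow top k\<otimes>a)" unfolding zeta_def using frc_lift_top by simp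

text \<open>A coboundary that represents the class may need denominators of a larger exponent
  \<open>M + N\<close>. Numerators can be compared there, and the top Koszul boundaries are the
  elements of the ideal.\<close>

lemma zeta_eq_zero:
 assumes a: "a\<in>\<R>"
 shows "zeta N a = \<zero>\<^bsub>Htop\<^esub> \<longleftrightarrow> (\<exists>M. mpow top M\<otimes>a\<in>Idl ((\<lambda>j. xs ! j[^](M + N)) ` top))" (is "_ \<longleftrightarrow> ?R")
proof -
 have "zeta N a = \<zero>\<^bsub>Htop\<^esub> \<longleftrightarrow> cls d (\<zero>\<^bsub>C d\<^esub>) = cls d (frc d N (\<lambda>_. a))"
  unfolding zeta_def using H_zero by auto
 also have "\<dots> \<longleftrightarrow> frc d N (\<lambda>_. a)\<in>B d" using cls_eq zc[OF a] by (simp add: a_minus_def M.minus_equality[of d "\<zero>\<^bsub>C d\<^esub>" "\<zero>\<^bsub>C d\<^esub>"])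
 also have "\<dots> \<longleftrightarrow> ?R"
 proof
  assume "frc d N (\<lambda>_. a)\<in>B d"
  then obtain M where "\<And>K. K\<ge>M ==> \<exists>b. fam b \<and> frc d N (\<lambda>_. a) = frc d K (ddc K b)" using B_rep by metis
  then obtain b where b: "fam b" "frc d N (\<lambda>_. a) = frc d (M + N) (ddc (M + N) b)" using le_add1 by metis
  have m: "mpow top M\<otimes>a\<in>\<R>" using mpow_carr[OF top_sub] a by simp
  have "mpow top M\<otimes>a = ddc (M + N) b top"
   using b(2) frc_eq[OF fam_const[OF m] ddc_fam[OF b(1)], of d "M + N"] idx_top unfolding frc_lift_top[OF a, of N M] by simp
  also have "\<dots>\<in>Idl ((\<lambda>j. xs ! j[^](M + N)) ` top)"
   using kosz_in_Idl[OF _ x_fun[OF top_sub] famD[OF b(1)], of "\<lambda>_. M + N"] by (simp add: ddc_def top_def)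
  finally show ?R by auto
 next
  assume ?R
  then obtain M where M: "mpow top M\<otimes>a\<in>Idl ((\<lambda>j. xs ! j[^](M + N)) ` top)" by auto
  obtain b where b: "fam b" "mpow top M\<otimes>a = kosz (\<lambda>j. xs ! j[^](M + N)) b top"
   using kosz_top_Idl[OF x_fun[OF order_refl] M[unfolded top_def]] unfolding top_def fam_def by auto
  have "frc d N (\<lambda>_. a) = frc d (M + N) (ddc (M + N) b)" unfolding frc_lift_top[OF a, of N M]
   by (rule frc_cong) (use b(2) top_sub in \<open>simp add: ddc_def idx_top\<close>)
  thus "frc d N (\<lambda>_. a)\<in>B d" unfolding B_iff using b(1) by auto
 qed
 finally show ?thesis .
qed

end

section \<open>F-injectivity and F-stability in terms of systems of parameters\<close>

locale noeth_local_p = noeth_local + char_p_cring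
begin

text \<open>Generators of the Frobenius power \<open>I^[q]\<close>, \<open>q = p^e\<close>, of the
  ideal generated by \<open>S\<close>.\<close>

definition fp where "fp e S = (\<lambda>x. x[^](p ^ e)) ` S"

lemma fp_carr: "S\<subseteq>\<R> ==> fp e S\<subseteq>\<R>" by (auto simp: fp_def)

lemma frob_ideal:
 assumes S: "S\<subseteq>\<R>" and a: "a\<in>Idl S" shows "a[^](p ^ e)\<in>Idl (fp e S)"
proof -
 note I = genideal_ideal[OF fp_carr[OF S], of e]
 have "p ^ e > 0" using p_gt_0 by simp
 hence "ideal {a\<in>\<R>. a[^](p ^ e)\<in>Idl (fp e S)} R"
  by (intro idealI') (auto simp: nat_pow_zero idl_zero[OF I] freshman_pow idl_add[OF I] nat_pow_distrib idl_l[OF I])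
 hence "Idl S\<subseteq>{a\<in>\<R>. a[^](p ^ e)\<in>Idl (fp e S)}"
  by (rule genideal_minimal) (use S genideal_self[OF fp_carr[OF S]] in \<open>auto simp: fp_def\<close>)
 thus ?thesis using a by auto
qed

text \<open>One predicate for all conditions that an exchange has to preserve: \<open>x\<close> is
  one for membership and Frobenius closure, and an element of the maximal ideal for socle
  conditions.\<close>

definition mem where "mem e S x a \<longleftrightarrow> x\<otimes>a[^](p ^ e)\<in>Idl (fp e S)"

text \<open>The element \<open>a\<close> represents a nonzero socle element modulo the parameter
  ideal whose Frobenius image is in the socle modulo the Frobenius power.\<close>

definition sigma where
 "sigma e S \<longleftrightarrow> (\<exists>a\<in>\<R>. \<not> mem 0 S \<one> a \<and> (\<forall>r\<in>\<mm>. mem 0 S r a \<and> mem e S r a))"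

definition FC where
 "FC S \<longleftrightarrow> (\<forall>a\<in>\<R>. a[^]p\<in>Idl ((\<lambda>x. x[^]p) ` S) \<longrightarrow> a\<in>Idl S)"

definition FI where "FI \<longleftrightarrow> (\<forall>xs. sop xs \<longrightarrow> FC (set xs))"

lemma fp_0: "S\<subseteq>\<R> ==> fp 0 S = S" by (force simp: fp_def)

lemma FC_mem: "S\<subseteq>\<R> ==> FC S \<longleftrightarrow> (\<forall>a\<in>\<R>. mem 1 S \<one> a \<longrightarrow> mem 0 S \<one> a)"
 by (simp add: FC_def mem_def fp_0) (simp add: fp_def)

text \<open>Modulo \<open>I\<close> one has \<open>w = c v\<close>. If \<open>c a\<close> is
  congruent to \<open>s w\<close>, then \<open>w (a - s v)\<close> is congruent to
  \<open>v (c a - s w)\<close>, hence zero, and the nonzerodivisor \<open>w\<close> can be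
  cancelled.\<close>

lemma exchange_iff:
 assumes I: "ideal I R" and c: "c\<in>\<R>" "i\<in>I" "v\<in>\<R>" "w = i\<oplus>c\<otimes>v" and w: "nzd I w" and a: "a\<in>\<R>"
 shows "c\<otimes>a\<in>adj I w \<longleftrightarrow> a\<in>adj I v"
proof
 have ic: "i\<in>\<R>" by (rule idl_carr[OF I c(2)])
 { assume "c\<otimes>a\<in>adj I w"
  then obtain j s where js: "j\<in>I" "s\<in>\<R>" "c\<otimes>a = j\<oplus>s\<otimes>w" using adjD by metis
  have jc: "j\<in>\<R>" by (rule idl_carr[OF I js(1)])
  have "w\<otimes>(a\<ominus>s\<otimes>v) = (a\<ominus>s\<otimes>v)\<otimes>i\<oplus>v\<otimes>(c\<otimes>a\<ominus>s\<otimes>(w\<ominus>i))" unfolding c(4) using ic a c js(2) by algebra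
  also have "c\<otimes>a\<ominus>s\<otimes>(w\<ominus>i) = j\<oplus>s\<otimes>i" unfolding js(3) c(4) using ic jc c js(2) by algebra
  also have "(a\<ominus>s\<otimes>v)\<otimes>i\<oplus>v\<otimes>(j\<oplus>s\<otimes>i)\<in>I" using idl_add[OF I] idl_l[OF I] c js a by simp
  finally have d: "a\<ominus>s\<otimes>v\<in>I" using nzdD[OF w] a js(2) c(3) by simp
  have "a = (a\<ominus>s\<otimes>v)\<oplus>s\<otimes>v" using a js(2) c(3) by algebra
  thus "a\<in>adj I v" unfolding adjm_def using d js(2) by auto }
 { assume "a\<in>adj I v"
  then obtain j t where jt: "j\<in>I" "t\<in>\<R>" "a = j\<oplus>t\<otimes>v" using adjD by metis
  have jc: "j\<in>\<R>" by (rule idl_carr[OF I jt(1)])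
  have "c\<otimes>a = (c\<otimes>j\<ominus>t\<otimes>i)\<oplus>t\<otimes>w" unfolding jt(3) c(4) using ic jc c(1,3) jt(2) by algebra
  moreover have "c\<otimes>j\<ominus>t\<otimes>i\<in>I" using idl_minus[OF I idl_l[OF I jt(1) c(1)] idl_l[OF I c(2) jt(2)]] .
  ultimately show "c\<otimes>a\<in>adj I w" unfolding adjm_def using jt(2) by auto }
qed

lemma pow_image_pow: "S\<subseteq>\<R> ==> (\<lambda>x. x[^](n::nat)) ` (\<lambda>x. x[^](m::nat)) ` S = (\<lambda>x. x[^](m * n)) ` S"
 unfolding image_image by (rule image_cong) (auto simp: nat_pow_pow)

definition pw where "pw N xs = map (\<lambda>x. x[^](N::nat)) xs"

lemma pw_ispow: "N > 0 ==> ispow xs (pw N xs)" unfolding ispow_def pw_def list_all2_map2 list_all2_same by auto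

text \<open>If \<open>w = i + c u\<close> with \<open>i \<in> I\<close>, multiplication by \<open>c\<close> embeds \<open>R / (I, u)\<close> into \<open>R / (I, w)\<close>. The same
 holds for the ideals generated by the powers \<open>p\<^sup>e\<close> of the generators.\<close>
lemma mem_exchange:
 assumes reg: "regseq (l @ [w])" and c: "c\<in>\<R>" "i\<in>Idl (set l)" "u\<in>\<R>" "w = i\<oplus>c\<otimes>u" and xa: "x\<in>\<R>" "a\<in>\<R>"
 shows "mem e (insert w (set l)) x (c\<otimes>a) \<longleftrightarrow> mem e (insert u (set l)) x a"
proof -
 have S: "set l\<subseteq>\<R>" and wc: "w\<in>\<R>" using reg m_sub by (auto simp: regseq_def)
 note Sp = fp_carr[OF S, of e]
 have ic: "i\<in>\<R>" by (rule idl_carr[OF genideal_ideal[OF S] c(2)])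
 have w: "w[^](p ^ e) = i[^](p ^ e)\<oplus>c[^](p ^ e)\<otimes>u[^](p ^ e)" unfolding c(4) using ic c by (simp add: freshman_pow nat_pow_distrib)
 have "regseq (pw (p ^ e) (l @ [w]))" by (rule regseq_ispow[OF pw_ispow reg]) (simp add: p_gt_0)
 hence "nzd (Idl (fp e (set l))) (w[^](p ^ e))" by (simp add: pw_def regseq_snoc fp_def)
 hence "c[^](p ^ e)\<otimes>(x\<otimes>a[^](p ^ e))\<in>adj (Idl (fp e (set l))) (w[^](p ^ e)) \<longleftrightarrow> x\<otimes>a[^](p ^ e)\<in>adj (Idl (fp e (set l))) (u[^](p ^ e))"
  using exchange_iff[OF genideal_ideal[OF Sp] _ frob_ideal[OF S c(2)] _ w] c xa by simp
 moreover have "c[^](p ^ e)\<otimes>(x\<otimes>a[^](p ^ e)) = x\<otimes>(c\<otimes>a)[^](p ^ e)" using c xa by (simp add: nat_pow_distrib m_ac)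
 ultimately show ?thesis using Idl_insert[OF Sp] wc c(3) by (simp add: mem_def fp_def)
qed

text \<open>An exchange compares a parameter with a power of another one, so the property carried
  through a chain of exchanges has to include all systems of powers.\<close>

definition FCall where "FCall xs \<longleftrightarrow> (\<forall>ys. ispow xs ys \<longrightarrow> FC (set ys))"

lemma ispow_snoc: "ispow (l @ [u]) ys \<longleftrightarrow> (\<exists>l' e. ys = l' @ [u[^](e::nat)] \<and> e > 0 \<and> ispow l l')"
proof
 assume "ispow (l @ [u]) ys"
 thus "\<exists>l' e. ys = l' @ [u[^](e::nat)] \<and> e > 0 \<and> ispow l l'" unfolding ispow_def list_all2_append1 list_all2_Cons1 by auto
next
 assume "\<exists>l' e. ys = l' @ [u[^](e::nat)] \<and> e > 0 \<and> ispow l l'"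
 thus "ispow (l @ [u]) ys" unfolding ispow_def by (auto intro!: list_all2_appendI)
qed

text \<open>Multiplication by \<open>c\<close> embeds the quotient by \<open>l'\<close> and
  \<open>v^f\<close> into the quotient by \<open>l'\<close> and a power of \<open>u\<close>,
  compatibly with Frobenius. Closedness is pulled back along this embedding.\<close>

lemma FCall_exchange:
 assumes "regseq (l @ [u])" "FCall (l @ [u])" "sop (l @ [u])" "sop (l @ [v])" shows "FCall (l @ [v])" unfolding FCall_def
proof (intro allI impI)
 fix ys assume ys: "ispow (l @ [v]) ys"
 then obtain l' f where l': "ys = l' @ [v[^](f::nat)]" "ispow l l'" using ispow_snoc by metis
 have sy: "sop ys" by (rule sop_ispow[OF ys assms(4)])
 have um: "u\<in>\<mm>" using assms(1) by (simp add: regseq_snoc)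
 obtain n c i where nc: "c\<in>\<R>" "i\<in>Idl (set l')" "u[^]Suc n = i\<oplus>c\<otimes>v[^]f" using sop_exchange_rel[OF sy[unfolded l'(1)] um] by metis
 have pw: "ispow (l @ [u]) (l' @ [u[^]Suc n])" unfolding ispow_snoc using l'(2) by blast
 note reg = regseq_ispow[OF pw assms(1)]
 have c: "set l'\<subseteq>\<R>" "v[^]f\<in>\<R>" "u[^]Suc n\<in>\<R>" using sy l'(1) m_sub m_carr[OF um] by (auto simp: sop_def)
 have "FC (insert (u[^]Suc n) (set l'))" using assms(2) pw unfolding FCall_def by fastforce
 moreover note ex = mem_exchange[OF reg nc(1,2) c(2) nc(3) one_closed]
 ultimately have "FC (insert (v[^]f) (set l'))" using c nc(1) FC_mem FC_mem[of "insert (v[^]f) (set l')"] ex[of _ 0] ex[of _ 1] by (metis One_nat_def insert_subset m_closed)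
 thus "FC (set ys)" by (simp add: l'(1))
qed

lemma FCall_perm: "FCall xs ==> mset xs = mset ys ==> FCall ys" unfolding FCall_def using ispow_perm[of ys _ xs] mset_eq_setD by metis

lemma FCall_connect:
 assumes "sop xs" "regseq xs" "FCall xs" "sop ys" shows "FCall ys"
proof -
 have "(\<lambda>xs. regseq xs \<and> FCall xs) ys"
 proof (rule sop_connect[of "\<lambda>xs. regseq xs \<and> FCall xs", OF _ _ assms(1,4)])
  show "regseq ys \<and> FCall ys" if "regseq xs \<and> FCall xs" "mset xs = mset ys" for xs ys using that regseq_perm FCall_perm by metis
  show "regseq (l @ [v]) \<and> FCall (l @ [v])" if "regseq (l @ [u]) \<and> FCall (l @ [u])" "sop (l @ [u])" "sop (l @ [v])" for l u v
   using that regseq_exchange FCall_exchange by metis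
 qed (use assms in simp)
 thus ?thesis by simp
qed

lemma FI_if_FCall:
 assumes h: "sop xs" "regseq xs" "FCall xs" shows "FI"
proof -
 have "FC (set ys)" if ys: "sop ys" for ys
 proof -
  have "FCall ys" by (rule FCall_connect[OF h ys])
  moreover have "ispow ys ys" using ys m_sub by (intro ispow_refl) (auto simp: sop_def)
  ultimately show ?thesis by (simp add: FCall_def)
 qed
 thus ?thesis by (simp add: FI_def)
qed

text \<open>Both quotients embed into the one by \<open>l\<close> and \<open>v^(n+1)\<close>: that
  of \<open>u\<close> by multiplication with \<open>c\<close>, that of \<open>v\<close> by
  multiplication with \<open>v^n\<close>. The image \<open>b\<close> of \<open>a\<close> is killed
  by \<open>v\<close>, so the colon rule makes it congruent to \<open>s v^n\<close>, and
  \<open>s\<close> is the required element for \<open>v\<close>.\<close>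

lemma sigma_exchange:
 assumes reg: "regseq (l @ [v])" and s: "sop (l @ [u])" "sigma e (insert u (set l))" shows "sigma e (insert v (set l))"
proof -
 have S: "set l\<subseteq>\<R>" and vm: "v\<in>\<mm>" and vc: "v\<in>\<R>" and uc: "u\<in>\<R>" using reg s(1) m_sub by (auto simp: regseq_def sop_def)
 note I = genideal_ideal[OF S]
 obtain n c i where nc: "c\<in>\<R>" "i\<in>Idl (set l)" "v[^]Suc n = i\<oplus>c\<otimes>u" using sop_exchange_rel[OF s(1) vm] by metis
 have vn: "v[^]n\<in>\<R>" "v[^]Suc n\<in>\<R>" using vc by auto
 let ?w = "v[^]Suc n"
 have "ispow (l @ [v]) (l @ [?w])" unfolding ispow_snoc using ispow_refl[OF S] by blast
 hence regw: "regseq (l @ [?w])" using reg by (rule regseq_ispow)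
 obtain a where a: "a\<in>\<R>" "\<not> mem 0 (insert u (set l)) \<one> a" "\<And>r. r\<in>\<mm> ==> mem 0 (insert u (set l)) r a \<and> mem e (insert u (set l)) r a"
  using s unfolding sigma_def by auto
 define b where "b = c\<otimes>a"
 have b: "b\<in>\<R>" using a(1) nc(1) by (simp add: b_def)
 have m: "mem e (insert ?w (set l)) x b \<longleftrightarrow> mem e (insert u (set l)) x a" if "x\<in>\<R>" for e x
  unfolding b_def by (rule mem_exchange[OF regw nc(1,2) uc nc(3) that a(1)])
 have "mem 0 (insert ?w (set l)) v b" using m[OF vc] a(3)[OF vm] by simp
 hence "v[^]Suc 0\<otimes>b\<in>Idl (insert (v[^](Suc 0 + n)) (set l))" using b S vc fp_0 by (simp add: mem_def)
 hence "b\<in>adj (Idl (set l)) (v[^]n)" using regseq_colon[OF reg b, of "Suc 0" n] Idl_insert[OF S vn(1)] by simp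
 then obtain j s where js: "j\<in>Idl (set l)" "s\<in>\<R>" "b = j\<oplus>s\<otimes>v[^]n" using adjD by metis
 have jc: "j\<in>\<R>" by (rule idl_carr[OF I js(1)])
 have "mem e (insert ?w (set l)) x b \<longleftrightarrow> mem e (insert v (set l)) x s" if x: "x\<in>\<R>" for e x
 proof -
  let ?q = "p ^ e" and ?J = "Idl (fp e (insert ?w (set l)))"
  have J: "ideal ?J R" using S vn by (intro genideal_ideal fp_carr) simp
  have "j\<in>Idl (insert ?w (set l))" using js(1) subset_Idl_subset[of "insert ?w (set l)" "set l"] S vn by auto
  hence "j[^]?q\<in>?J" using frob_ideal S vn by simp
  hence jJ: "x\<otimes>j[^]?q\<in>?J" by (rule idl_l[OF J _ x])
  have k: "x\<otimes>(v[^]n\<otimes>s)[^]?q\<in>\<R>" "x\<otimes>j[^]?q\<in>\<R>" using x js(2) vn jc by auto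
  have "x\<otimes>b[^]?q = x\<otimes>(v[^]n\<otimes>s)[^]?q\<oplus>x\<otimes>j[^]?q"
   unfolding js(3) using jc js(2) vn x by (simp add: freshman_pow r_distr a_comm m_comm)
  hence "mem e (insert ?w (set l)) x b \<longleftrightarrow> mem e (insert ?w (set l)) x (v[^]n\<otimes>s)"
   using idl_cancel[OF J _ jJ k(1)] idl_add[OF J _ jJ] by (auto simp: mem_def)
  also have "\<dots> \<longleftrightarrow> mem e (insert v (set l)) x s"
   by (rule mem_exchange[OF regw vn(1) idl_zero[OF I] vc _ x js(2)]) (use vc in simp)
  finally show ?thesis .
 qed
 thus ?thesis unfolding sigma_def using a m js(2) m_carr by (intro bexI[of _ s]) auto
qed

lemma sigma_connect:
 assumes CM "sop xs" "sop ys" "sigma e (set xs)" shows "sigma e (set ys)"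
proof (rule sop_connect[of "\<lambda>xs. sigma e (set xs)", OF _ _ assms(2,3,4)])
 show "sigma e (set ys)" if "sigma e (set xs)" "mset xs = mset ys" for xs ys using that mset_eq_setD by metis
 show "sigma e (set (l @ [v]))" if "sigma e (set (l @ [u]))" "sop (l @ [u])" "sop (l @ [v])" for l u v
  using sigma_exchange[OF CM_sop_regseq[OF assms(1) that(3)] that(2)] that(1) by simp
qed

section \<open>Parameter ideals with individual exponents\<close>

lemma regseq_carr: "regseq xs ==> j < length xs ==> xs ! j\<in>\<R>" using m_carr nth_mem unfolding regseq_def by (metis subsetD)

abbreviation pI where "pI xs e\<equiv>Idl ((\<lambda>j. xs ! j[^](e j :: nat)) ` {..<length xs})"

lemma pI_gens: "regseq xs ==> (\<lambda>j. xs ! j[^](e j :: nat)) ` {..<length xs}\<subseteq>\<R>" using regseq_carr by auto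
lemmas pI_ideal = genideal_ideal[OF pI_gens]
lemma pI_self: "regseq xs ==> j < length xs ==> xs ! j[^]e j\<in>pI xs e" using genideal_self[OF pI_gens] by auto

text \<open>The entry at position \<open>j\<close> is moved to the end by a permutation while the
  other entries are raised to their powers; \<open>regseq_colon\<close> then applies.\<close>

lemma var_colon:
 assumes reg: "regseq xs" and j: "j < length xs" and e: "\<And>i. e i > (0::nat)" and c: "c\<in>\<R>"
  and m: "xs ! j[^]a\<otimes>c\<in>pI xs (e(j := a + b))" shows "c\<in>pI xs (e(j := b))"
proof -
 let ?n = "length xs"
 define ks where "ks = [0..<j] @ [Suc j..<?n]"
 have up: "[0..<?n] = [0..<j] @ j # [Suc j..<?n]" using j by (metis upt_add_eq_append upt_conv_Cons less_imp_le le_add_diff_inverse zero_le)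
 have "mset xs = mset (map ((!) xs) [0..<?n])" by (simp add: map_nth)
 also have "\<dots> = mset (map ((!) xs) ks @ [xs ! j])" unfolding up ks_def by simp
 finally have "regseq (map ((!) xs) ks @ [xs ! j])" using regseq_perm[OF _ reg] by simp
 moreover have "ispow (map ((!) xs) ks @ [xs ! j]) (map (\<lambda>i. xs ! i[^]e i) ks @ [xs ! j[^]Suc 0])" unfolding ispow_snoc
 proof (intro exI conjI)
  show "ispow (map ((!) xs) ks) (map (\<lambda>i. xs ! i[^]e i) ks)" unfolding ispow_def list_all2_map1 list_all2_map2 list_all2_same using e by metis
  show "map (\<lambda>i. xs ! i[^]e i) ks @ [xs ! j[^]Suc 0] = map (\<lambda>i. xs ! i[^]e i) ks @ [xs ! j[^]Suc 0]" ..
 qed simp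
 ultimately have "regseq (map (\<lambda>i. xs ! i[^]e i) ks @ [xs ! j[^]Suc 0])" using regseq_ispow by metis
 moreover note regseq_carr[OF reg j]
 ultimately have r: "regseq (map (\<lambda>i. xs ! i[^]e i) ks @ [xs ! j])" by simp
 have sis: "set ks = {..<?n} - {j}" unfolding ks_def using j by auto
 have im: "(\<lambda>i. xs ! i[^]((e(j := k)) i)) ` {..<?n} = insert (xs ! j[^]k) (set (map (\<lambda>i. xs ! i[^]e i) ks))" for k :: nat
 proof -
  have "{..<?n} = insert j (set ks)" using sis j by auto
  moreover have "(\<lambda>i. xs ! i[^]((e(j := k)) i)) ` set ks = (\<lambda>i. xs ! i[^]e i) ` set ks" using sis by (intro image_cong) auto
  ultimately show ?thesis by simp
 qed
 show ?thesis using regseq_colon[OF r c] m unfolding im by simp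
qed

lemma var_iff:
 assumes reg: "regseq xs" and j: "j < length xs" and e: "\<And>i. e i > (0::nat)" and c: "c\<in>\<R>"
 shows "xs ! j[^]a\<otimes>c\<in>pI xs (e(j := a + b)) \<longleftrightarrow> c\<in>pI xs (e(j := b))"
proof
 let ?J = "pI xs (e(j := a + b))"
 note J = pI_ideal[OF reg, of "e(j := a + b)"] and xc = regseq_carr[OF reg] and self = pI_self[OF reg, of _ "e(j := a + b)"]
 have xa: "xs ! j[^]a\<in>\<R>" using xc[OF j] by simp
 have "pI xs (e(j := b))\<subseteq>{c\<in>\<R>. xs ! j[^]a\<otimes>c\<in>?J}"
 proof (rule genideal_minimal[OF ideal.helper_max_prime[OF J is_cring xa]], rule image_subsetI)
  fix i assume "i\<in>{..<length xs}"
  thus "xs ! i[^](e(j := b)) i\<in>{c\<in>\<R>. xs ! j[^]a\<otimes>c\<in>?J}"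
   using self[of i] xc[of i] idl_l[OF J _ xa] by (cases "i = j") (auto simp: nat_pow_mult)
 qed
 thus "xs ! j[^]a\<otimes>c\<in>?J" if "c\<in>pI xs (e(j := b))" using that by auto
qed (rule var_colon[OF assms])

text \<open>For \<open>S\<close> the set of all positions this is the injectivity of the maps in the
  direct system whose limit is the top cohomology.\<close>

lemma multi_iff:
 assumes reg: "regseq xs" and e: "\<And>i. e i > (0::nat)" and c: "c\<in>\<R>" and S: "S\<subseteq>{..<length xs}"
 shows "(\<Otimes>j\<in>S. xs ! j[^](m j :: nat))\<otimes>c\<in>pI xs (\<lambda>j. if j\<in>S then m j + e j else e j) \<longleftrightarrow> c\<in>pI xs e"
proof -
 have "finite S" using S finite_subset by auto
 thus ?thesis using S
 proof (induction S rule: finite_induct)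
  case empty thus ?case using c by simp
 next
  case (insert k S)
  have kn: "k < length xs" "S\<subseteq>{..<length xs}" using insert.prems by auto
  have xk: "xs ! k[^]m k\<in>\<R>" using regseq_carr[OF reg kn(1)] by simp
  have f: "(\<lambda>j. xs ! j[^]m j)\<in>S\<rightarrow>\<R>" using regseq_carr[OF reg] kn(2) by (auto simp: subset_iff)
  note fc = finprod_closed[OF f]
  define E where "E j = (if j\<in>S then m j + e j else e j)" for j
  have E: "\<And>j. (if j\<in>insert k S then m j + e j else e j) = (E(k := m k + e k)) j" "E(k := e k) = E" using insert.hyps(2) by (auto simp: E_def)
  have "(\<Otimes>j\<in>insert k S. xs ! j[^]m j)\<otimes>c = xs ! k[^]m k\<otimes>((\<Otimes>j\<in>S. xs ! j[^]m j)\<otimes>c)"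
   using finprod_insert[OF insert.hyps f xk] fc xk c by (simp add: m_assoc)
  hence "(\<Otimes>j\<in>insert k S. xs ! j[^]m j)\<otimes>c\<in>pI xs (E(k := m k + e k)) \<longleftrightarrow> (\<Otimes>j\<in>S. xs ! j[^]m j)\<otimes>c\<in>pI xs E"
   using var_iff[OF reg kn(1), of E "(\<Otimes>j\<in>S. xs ! j[^]m j)\<otimes>c" "m k" "e k"] e fc c unfolding E(2) by (simp add: E_def)
  thus ?case unfolding E(1) using insert.IH[OF kn(2)] unfolding E_def[symmetric] by simp
 qed
qed

lemma set_pw: "set (pw N xs) = (\<lambda>j. xs ! j[^]N) ` {..<length xs}"
proof -
 have "set xs = (\<lambda>j. xs ! j) ` {..<length xs}" by (auto simp: set_conv_nth)
 thus ?thesis by (simp add: pw_def image_image)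
qed

lemma pw_pow: "set xs\<subseteq>\<R> ==> (\<lambda>x. x[^]k) ` set (pw N xs) = set (pw (N * k) xs)" using pow_image_pow by (simp add: pw_def)

lemma ispow_fun:
 assumes h: "ispow xs ys" shows "\<exists>e. (\<forall>i. e i > (0::nat)) \<and> set ys = (\<lambda>j. xs ! j[^]e j) ` {..<length xs}"
proof -
 from h have len: "length ys = length xs" and "\<And>i. i < length xs ==> \<exists>e>0. ys ! i = xs ! i[^](e::nat)"
  by (auto simp: ispow_def list_all2_conv_all_nth)
 then obtain e where e: "\<And>i. i < length xs ==> e i > (0::nat) \<and> ys ! i = xs ! i[^]e i" by metis
 define f where "f i = (if i < length xs then e i else 1)" for i
 have "set ys = (\<lambda>j. ys ! j) ` {..<length xs}" using len by (auto simp: set_conv_nth)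
 also have "\<dots> = (\<lambda>j. xs ! j[^]f j) ` {..<length xs}" by (rule image_cong) (use e in \<open>auto simp: f_def\<close>)
 finally show ?thesis using e by (intro exI[of _ f]) (auto simp: f_def)
qed

text \<open>The monomial \<open>?P\<close> complementary to the exponents \<open>e\<close> embeds
  the quotient by arbitrary powers into the quotient by the \<open>N\<close>-th powers; its
  \<open>p\<close>-th power does the same for the Frobenius powers.\<close>

lemma FCall_if_uniform:
 assumes reg: "regseq xs" and u: "\<And>N. N > 0 ==> FC (set (pw N xs))" shows "FCall xs" unfolding FCall_def
proof (intro allI impI)
 fix ys assume "ispow xs ys"
 then obtain e where e: "\<And>i. e i > (0::nat)" "set ys = (\<lambda>j. xs ! j[^]e j) ` {..<length xs}" using ispow_fun by metis
 let ?n = "length xs"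
 have xc: "set xs\<subseteq>\<R>" using reg m_sub by (auto simp: regseq_def)
 \<comment> \<open>One more than the sum of the exponents dominates each of them and is positive
   even for an empty sequence.\<close>
 define N where "N = Suc (\<Sum>j<?n. e j)"
 define m where "m j = N - e j" for j
 have me: "m j + e j = N" if "j < ?n" for j using member_le_sum[of j "{..<?n}" e] that by (simp add: m_def N_def)
 let ?P = "\<Otimes>j\<in>{..<?n}. xs ! j[^]m j"
 have f: "(\<lambda>j. xs ! j[^](k j :: nat))\<in>{..<?n}\<rightarrow>\<R>" for k using regseq_carr[OF reg] by auto
 have Pc: "?P\<in>\<R>" by (rule finprod_closed[OF f])
 have pI: "pI xs (\<lambda>j. if j\<in>{..<?n} then m j * k + e j * k else e j * k) = Idl (set (pw (N * k) xs))" for k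
  unfolding set_pw by (intro arg_cong[of _ _ "genideal R"] image_cong) (use me in \<open>auto simp flip: add_mult_distrib\<close>)
 show "FC (set ys)" unfolding FC_def
 proof (intro ballI impI)
  fix a assume a: "a\<in>\<R>" "a[^]p\<in>Idl ((\<lambda>x. x[^]p) ` set ys)"
  have "(\<lambda>x. x[^]p) ` set ys = (\<lambda>j. xs ! j[^](e j * p)) ` {..<?n}"
   unfolding e(2) image_image by (rule image_cong) (use regseq_carr[OF reg] in \<open>auto simp: nat_pow_pow\<close>)
  hence "(\<Otimes>j\<in>{..<?n}. xs ! j[^](m j * p))\<otimes>a[^]p\<in>Idl (set (pw (N * p) xs))"
   using multi_iff[OF reg, of "\<lambda>j. e j * p" "a[^]p" "{..<?n}" "\<lambda>j. m j * p"] a pI e(1) p_gt_0 by simp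
  moreover have "(\<Otimes>j\<in>{..<?n}. xs ! j[^](m j * p)) = ?P[^]p"
  proof -
   have pf: "finite A ==> g\<in>A\<rightarrow>\<R> ==> (\<Otimes>j\<in>A. g j)[^]p = (\<Otimes>j\<in>A. g j[^]p)" for A :: "nat set" and g
   proof (induction A rule: finite_induct)
    case (insert x A)
    hence "g x\<in>\<R>" "g\<in>A\<rightarrow>\<R>" "(\<lambda>j. g j[^]p)\<in>A\<rightarrow>\<R>" by auto
    thus ?case using insert by (simp add: nat_pow_distrib finprod_closed)
   qed simp
   show ?thesis unfolding pf[OF finite_lessThan f] by (rule finprod_cong') (use f regseq_carr[OF reg] in \<open>auto simp: nat_pow_pow\<close>)
  qed
  ultimately have "(?P\<otimes>a)[^]p\<in>Idl ((\<lambda>x. x[^]p) ` set (pw N xs))" using Pc a(1) pw_pow[OF xc] by (simp add: nat_pow_distrib)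
  moreover have "FC (set (pw N xs))" by (rule u) (simp add: N_def)
  ultimately have "?P\<otimes>a\<in>Idl (set (pw N xs))" using Pc a(1) by (simp add: FC_def)
  thus "a\<in>Idl (set ys)" using multi_iff[of xs e a "{..<?n}" m, OF reg e(1) a(1) order_refl] pI[of 1] by (simp add: e(2))
 qed
qed

end

section \<open>Modules with an injective Frobenius action\<close>

locale frobenius_module = noeth_local_p R \<mm> p + module R M for R (structure) and \<mm> and p :: nat and M (structure) +
 fixes F
 assumes F_closed: "x\<in>carrier M ==> F x\<in>carrier M"
  and F_add: "x\<in>carrier M ==> y\<in>carrier M ==> F (x\<oplus>\<^bsub>M\<^esub>y) = F x\<oplus>\<^bsub>M\<^esub>F y"
  and F_smult: "r\<in>carrier R ==> x\<in>carrier M ==> F (r\<odot>\<^bsub>M\<^esub>x) = r[^]p\<odot>\<^bsub>M\<^esub>F x"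
  and F_inj: "x\<in>carrier M ==> F x = \<zero>\<^bsub>M\<^esub> ==> x = \<zero>\<^bsub>M\<^esub>"
begin

abbreviation madd (infixl "+." 65) where "x +. y\<equiv>x\<oplus>\<^bsub>M\<^esub>y"
abbreviation msmult (infixl "*." 70) where "r *. y\<equiv>r\<odot>\<^bsub>M\<^esub>y"
abbreviation mzero ("\<zero>\<^sub>M") where "\<zero>\<^sub>M\<equiv>\<zero>\<^bsub>M\<^esub>"

lemma F_zero: "F \<zero>\<^sub>M = \<zero>\<^sub>M"
proof -
 have "F (\<zero> *. \<zero>\<^sub>M) = \<zero>[^]p *. F \<zero>\<^sub>M" by (rule F_smult) auto
 thus ?thesis using F_closed p_gt_0 by (simp add: nat_pow_zero)
qed

lemma Fp_closed: "x\<in>carrier M ==> (F ^^ j) x\<in>carrier M" by (induction j) (auto intro: F_closed)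
lemma Fp_zero: "(F ^^ j) \<zero>\<^sub>M = \<zero>\<^sub>M" by (induction j) (auto simp: F_zero)
lemma Fp_add: "x\<in>carrier M ==> y\<in>carrier M ==> (F ^^ j) (x +. y) = (F ^^ j) x +. (F ^^ j) y" by (induction j) (simp_all add: F_add Fp_closed)
lemma Fp_smult: "r\<in>\<R> ==> x\<in>carrier M ==> (F ^^ j) (r *. x) = r[^](p ^ j) *. (F ^^ j) x"
 by (induction j) (simp_all add: F_smult Fp_closed nat_pow_pow mult.commute)
lemma Fp_inj: "x\<in>carrier M ==> (F ^^ j) x = \<zero>\<^sub>M ==> x = \<zero>\<^sub>M" by (induction j) (auto intro: F_inj Fp_closed)
lemma Fp_comp: "(F ^^ i) ((F ^^ j) x) = (F ^^ (i + j)) x" by (simp add: funpow_add)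

definition soc where "soc = {x\<in>carrier M. \<forall>r\<in>\<mm>. r *. x = \<zero>\<^sub>M}"

lemma socD: "x\<in>soc ==> x\<in>carrier M" "x\<in>soc ==> r\<in>\<mm> ==> r *. x = \<zero>\<^sub>M" by (auto simp: soc_def)

text \<open>Applying \<open>F\<close> another \<open>e - i\<close> times to \<open>r\<close> times
  the \<open>i\<close>-th image gives a multiple of the \<open>e\<close>-th image by a power of
  \<open>r\<close>, which vanishes; injectivity does the rest.\<close>

lemma soc_desc:
 assumes x: "x\<in>carrier M" "(F ^^ e) x\<in>soc" and i: "i\<le>e" shows "(F ^^ i) x\<in>soc" unfolding soc_def
proof (intro CollectI conjI ballI)
 show "(F ^^ i) x\<in>carrier M" by (rule Fp_closed[OF x(1)])
 fix r assume r: "r\<in>\<mm>"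
 show "r *. (F ^^ i) x = \<zero>\<^sub>M"
 proof (rule Fp_inj[of _ "e - i"])
  show "r *. (F ^^ i) x\<in>carrier M" using m_carr[OF r] Fp_closed[OF x(1)] by simp
  have "(F ^^ (e - i)) (r *. (F ^^ i) x) = r[^](p ^ (e - i)) *. (F ^^ e) x"
   unfolding Fp_smult[OF m_carr[OF r] Fp_closed[OF x(1)]] Fp_comp using i by simp
  also have "\<dots> = \<zero>\<^sub>M" by (rule socD(2)[OF x(2) idl_pow[OF m_ideal r]]) (simp add: p_gt_0)
  finally show "(F ^^ (e - i)) (r *. (F ^^ i) x) = \<zero>\<^sub>M" .
 qed
qed

text \<open>By \<open>soc_desc\<close> a return to the socle after \<open>k\<close> steps implies
  one after each smaller number of steps, so a single exponent \<open>e\<close> decides about all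
  larger ones.\<close>

lemma unstable_iff_socle: "F_unstable_module R M F \<longleftrightarrow> (\<exists>e. \<forall>u\<in>soc. (F ^^ e) u\<in>soc \<longrightarrow> u = \<zero>\<^sub>M)"
proof
 have soc: "socle R M = soc" by (simp add: socle_def soc_def max_ideal_eq)
 have "\<zero>\<^sub>M\<in>soc" using m_carr by (auto simp: soc_def)
 hence z0: "\<zero>\<^sub>M\<in>soc\<inter>(F ^^ e) ` soc" for e using Fp_zero by (auto intro!: image_eqI[of _ _ "\<zero>\<^sub>M"])
 { assume "F_unstable_module R M F"
  then obtain e where "soc\<inter>(F ^^ e) ` soc = {\<zero>\<^sub>M}" by (auto simp: F_unstable_module_def soc)
  thus "\<exists>e. \<forall>u\<in>soc. (F ^^ e) u\<in>soc \<longrightarrow> u = \<zero>\<^sub>M" using Fp_inj[OF socD(1)] by (intro exI[of _ e]) blast }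
 { assume "\<exists>e. \<forall>u\<in>soc. (F ^^ e) u\<in>soc \<longrightarrow> u = \<zero>\<^sub>M"
  then obtain e where e: "\<And>u. u\<in>soc ==> (F ^^ e) u\<in>soc ==> u = \<zero>\<^sub>M" by auto
  have "soc\<inter>(F ^^ k) ` soc = {\<zero>\<^sub>M}" if "k\<ge>e" for k using e soc_desc[OF socD(1) _ that] Fp_zero z0 by blast
  thus "F_unstable_module R M F" unfolding F_unstable_module_def soc by (intro exI[of _ "Suc e"]) auto }
qed

end

section \<open>The Cech cohomology of a system of parameters\<close>

locale sop_cech = noeth_local_p +
 fixes xs assumes reg: "regseq xs" and sp: "sop xs"
begin

sublocale cech R xs
proof
 show "set xs\<subseteq>\<R>" using reg m_sub by (auto simp: regseq_def)
 fix x a assume x: "x\<in>set xs" and a: "a\<in>\<R>" "x\<otimes>a = \<zero>"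
 obtain l r where "xs = l @ x # r" using x by (meson split_list)
 hence "regseq (([] @ [x]) @ l @ r)" using regseq_perm[OF _ reg, of "x # l @ r"] by simp
 hence "nzd (Idl (set [])) x" using regseq_append regseq_snoc by metis
 thus "a = \<zero>" using nzdD[of "Idl {}" x a] a Idl_empty by simp
qed

lemma cp: "char_p_cring R p" ..

interpretation M: module R Htop by (rule Htop_module)

text \<open>The auxiliary exponent of the general criterion cancels, since the direct system of a
  regular sequence has injective maps.\<close>

lemma zeta_zero_iff:
 assumes N: "N > 0" and a: "a\<in>\<R>" shows "zeta N a = \<zero>\<^bsub>Htop\<^esub> \<longleftrightarrow> a\<in>Idl (set (pw N xs))"
proof -
 have "(\<lambda>j. xs ! j[^](if j\<in>top then M + N else N)) ` {..<d} = (\<lambda>j. xs ! j[^](M + N)) ` top" for M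
  unfolding top_def by (rule image_cong) auto
 thus ?thesis unfolding zeta_eq_zero[OF a] using multi_iff[OF reg N a top_sub, of "\<lambda>_. _"] by (simp add: mpow_def set_pw)
qed

lemma H_trivial_regseq: assumes i: "i\<noteq>d" shows "carrier (H i) = {\<zero>\<^bsub>H i\<^esub>}"
proof (rule H_trivial[OF _ i])
 fix N j r assume h: "N > (0::nat)" "j < d" "r\<in>\<R>" "xs ! j[^]N\<otimes>r\<in>Idl ((\<lambda>j. xs ! j[^]N) ` {..<j})"
 have "regseq (pw N xs)" by (rule regseq_ispow[OF pw_ispow[OF h(1)] reg])
 hence "nzd (Idl (set (take j (pw N xs)))) (pw N xs ! j)" using h(2) by (simp add: regseq_def pw_def)
 moreover have "set (take j (pw N xs)) = (\<lambda>j. xs ! j[^]N) ` {..<j}"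
  unfolding pw_def take_map set_map using h(2) by (simp add: image_image lessThan_atLeast0 flip: nth_image)
 ultimately show "r\<in>Idl ((\<lambda>j. xs ! j[^]N) ` {..<j})" using nzdD h by (simp add: pw_def)
qed

lemma F_zero_pow: "(cech_cohomology_frobenius p R xs i ^^ e) (\<zero>\<^bsub>H i\<^esub>) = \<zero>\<^bsub>H i\<^esub>"
 by (induction e) (simp_all add: F_zero[OF cp])

lemma Ftop_closed: "x\<in>carrier Htop ==> Ftop p x\<in>carrier Htop" using zeta_common zeta_frob[OF cp] zeta_carr by (metis nat_pow_closed)

lemma Ftop_add: "x\<in>carrier Htop ==> y\<in>carrier Htop ==> Ftop p (x\<oplus>\<^bsub>Htop\<^esub>y) = Ftop p x\<oplus>\<^bsub>Htop\<^esub>Ftop p y"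
 using zeta_common[of x y] by (metis cp zeta_add zeta_frob freshman a_closed nat_pow_closed)

text \<open>The kernel of Frobenius at level \<open>N\<close> consists of the numerators whose
  \<open>p\<close>-th power lies in the ideal of the powers \<open>N p\<close>, so injectivity is
  closedness for uniform powers; \<open>FCall_if_uniform\<close> and exchange supply all other
  systems.\<close>

lemma Ftop_inj_iff: "inj_on (Ftop p) (carrier Htop) \<longleftrightarrow> FI"
proof
 have pN: "N * p > 0" if "N > 0" for N using that p_gt_0 by simp
 { assume inj: "inj_on (Ftop p) (carrier Htop)"
  have "FC (set (pw N xs))" if N: "N > 0" for N unfolding FC_def pw_pow[OF xs_carr]
  proof (intro ballI impI)
   fix a assume a: "a\<in>\<R>" "a[^]p\<in>Idl (set (pw (N * p) xs))"
   have "Ftop p (zeta N a) = Ftop p (\<zero>\<^bsub>Htop\<^esub>)" unfolding zeta_frob[OF cp a(1)] using zeta_zero_iff[OF pN[OF N], of "a[^]p"] a F_zero[OF cp] by simp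
   hence "zeta N a = \<zero>\<^bsub>Htop\<^esub>" using inj_onD[OF inj] zeta_carr[OF a(1)] M.zero_closed by metis
   thus "a\<in>Idl (set (pw N xs))" using zeta_zero_iff[OF N a(1)] by simp
  qed
  thus FI using FI_if_FCall[OF sp reg FCall_if_uniform[OF reg]] by simp }
 { assume FI: FI
  have ker: "x = \<zero>\<^bsub>Htop\<^esub>" if x: "x\<in>carrier Htop" "Ftop p x = \<zero>\<^bsub>Htop\<^esub>" for x
  proof -
   obtain N a where a: "N > 0" "a\<in>\<R>" "x = zeta N a" using zeta_common[OF x(1,1)] by metis
   have "a[^]p\<in>Idl (set (pw (N * p) xs))" using x(2) zeta_zero_iff[OF pN[OF a(1)], of "a[^]p"] a(2) unfolding a(3) zeta_frob[OF cp a(2)] by simp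
   moreover have "FC (set (pw N xs))" using FI sop_ispow[OF pw_ispow[OF a(1)] sp] by (simp add: FI_def)
   ultimately show ?thesis unfolding a(3) zeta_zero_iff[OF a(1,2)] FC_def pw_pow[OF xs_carr] using a(2) by simp
  qed
  show "inj_on (Ftop p) (carrier Htop)"
  proof (rule inj_onI)
   fix x y assume h: "x\<in>carrier Htop" "y\<in>carrier Htop" "Ftop p x = Ftop p y"
   have e: "(x\<ominus>\<^bsub>Htop\<^esub>y)\<oplus>\<^bsub>Htop\<^esub>y = x" using h by (simp add: a_minus_def M.a_assoc M.l_neg)
   hence "Ftop p (x\<ominus>\<^bsub>Htop\<^esub>y)\<oplus>\<^bsub>Htop\<^esub>Ftop p y = Ftop p y" using Ftop_add[of "x\<ominus>\<^bsub>Htop\<^esub>y" y] h by simp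
   hence "Ftop p (x\<ominus>\<^bsub>Htop\<^esub>y) = \<zero>\<^bsub>Htop\<^esub>" using h Ftop_closed by (simp add: M.add.l_cancel_one)
   hence "x\<ominus>\<^bsub>Htop\<^esub>y = \<zero>\<^bsub>Htop\<^esub>" using ker h by simp
   thus "x = y" using e h(2) by simp
  qed }
qed

lemma Htop_frobenius_module: assumes FI shows "frobenius_module R \<mm> p Htop (Ftop p)"
proof (intro frobenius_module.intro frobenius_module_axioms.intro Htop_module Ftop_closed Ftop_add)
 show "noeth_local_p R \<mm> p" ..
 show "Ftop p (r\<odot>\<^bsub>Htop\<^esub>x) = r[^]p\<odot>\<^bsub>Htop\<^esub>Ftop p x" if r: "r\<in>\<R>" and x: "x\<in>carrier Htop" for r x
 proof -
  obtain N a where "a\<in>\<R>" "x = zeta N a" using zeta_common[OF x x] by metis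
  thus ?thesis using r by (simp add: zeta_smult zeta_frob[OF cp] nat_pow_distrib)
 qed
 show "x = \<zero>\<^bsub>Htop\<^esub>" if "x\<in>carrier Htop" "Ftop p x = \<zero>\<^bsub>Htop\<^esub>" for x
  using inj_onD[OF Ftop_inj_iff[THEN iffD2, OF assms] _ that(1) M.zero_closed] that(2) F_zero[OF cp] by simp
qed

lemma zeta_frob_pow: "a\<in>\<R> ==> (Ftop p ^^ e) (zeta N a) = zeta (N * p ^ e) (a[^](p ^ e))"
 by (induction e) (simp_all add: zeta_frob[OF cp] nat_pow_pow mult_ac)

lemma unstable_top_iff:
 assumes FI shows "F_unstable_module R Htop (Ftop p) \<longleftrightarrow> \<not> (\<forall>e. sigma e (set xs))"
proof -
 interpret F: frobenius_module R \<mm> p Htop "Ftop p" by (rule Htop_frobenius_module[OF assms])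
 have mem: "r\<odot>\<^bsub>Htop\<^esub>(Ftop p ^^ e) (zeta N a) = \<zero>\<^bsub>Htop\<^esub> \<longleftrightarrow> mem e (set (pw N xs)) r a"
  if "N > 0" "a\<in>\<R>" "r\<in>\<R>" for N a r e
 proof -
  have "fp e (set (pw N xs)) = set (pw (N * p ^ e) xs)" using pw_pow[OF xs_carr] by (simp add: fp_def)
  moreover have "N * p ^ e > 0" using that(1) p_gt_0 by simp
  ultimately show ?thesis using that zeta_zero_iff by (simp add: zeta_frob_pow zeta_smult mem_def)
 qed
 have s: "(zeta N a\<noteq>\<zero>\<^bsub>Htop\<^esub> \<and> zeta N a\<in>F.soc \<and> (Ftop p ^^ e) (zeta N a)\<in>F.soc) \<longleftrightarrow>
   \<not> mem 0 (set (pw N xs)) \<one> a \<and> (\<forall>r\<in>\<mm>. mem 0 (set (pw N xs)) r a \<and> mem e (set (pw N xs)) r a)"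
  if "N > 0" "a\<in>\<R>" for N a e
  using mem[OF that, of \<one> 0] mem[OF that, of _ 0] mem[OF that, of _ e] zeta_carr[OF that(2)] F.Fp_closed m_carr by (auto simp: F.soc_def)
 have "(\<exists>u\<in>F.soc. u\<noteq>\<zero>\<^bsub>Htop\<^esub> \<and> (Ftop p ^^ e) u\<in>F.soc) \<longleftrightarrow> sigma e (set xs)" for e
 proof
  assume "\<exists>u\<in>F.soc. u\<noteq>\<zero>\<^bsub>Htop\<^esub> \<and> (Ftop p ^^ e) u\<in>F.soc"
  then obtain u where u: "u\<in>F.soc" "u\<noteq>\<zero>\<^bsub>Htop\<^esub>" "(Ftop p ^^ e) u\<in>F.soc" by auto
  obtain N a where a: "N > 0" "a\<in>\<R>" "u = zeta N a" using zeta_common F.socD(1)[OF u(1)] by metis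
  \<comment> \<open>The socle element may live at any level \<open>N\<close>; independence of
    \<open>sigma\<close> from the system of parameters leads back to \<open>xs\<close>
    itself.\<close>
  have "sigma e (set (pw N xs))" using s[OF a(1,2), of e] u a unfolding sigma_def by auto
  moreover have CM unfolding CM_def using reg sp by (auto simp: sop_def)
  ultimately show "sigma e (set xs)" using sigma_connect sop_ispow[OF pw_ispow[OF a(1)] sp] sp by metis
 next
  have "pw 1 xs = xs" unfolding pw_def using xs_carr by (intro map_idI) auto
  thus "\<exists>u\<in>F.soc. u\<noteq>\<zero>\<^bsub>Htop\<^esub> \<and> (Ftop p ^^ e) u\<in>F.soc" if "sigma e (set xs)"
   using that s[of 1 _ e] unfolding sigma_def by (metis zero_less_one)
 qed
 thus ?thesis unfolding F.unstable_iff_socle by blast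
qed

end

context noeth_local_p
begin

lemma sop_cech: "CM ==> sop xs ==> sop_cech R \<mm> p xs" using CM_sop_regseq by unfold_locales

lemma Finj_iff:
 assumes CM shows "F_injective p R \<longleftrightarrow> FI"
proof -
 interpret sop_cech R \<mm> p "chosen_parameters R" by (rule sop_cech[OF assms chosen_sop[OF assms]])
 have "inj_on (cech_cohomology_frobenius p R (chosen_parameters R) i) (carrier (H i))" if "i\<noteq>d" for i
  unfolding H_trivial_regseq[OF that] by simp
 thus ?thesis unfolding F_injective_def local_cohomology_def local_cohomology_frobenius_def Ftop_inj_iff[symmetric] by metis
qed

lemma Fstable_top:
 assumes CM and xs: "xs = chosen_parameters R"
 shows "F_stable p R \<longleftrightarrow> \<not> F_unstable_module R (cech_cohomology R xs (length xs)) (cech_cohomology_frobenius p R xs (length xs))"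
proof -
 interpret sop_cech R \<mm> p xs unfolding xs by (rule sop_cech[OF assms(1) chosen_sop[OF assms(1)]])
 have "F_unstable_module R (H i) (cech_cohomology_frobenius p R xs i)" if "i\<noteq>d" for i
 proof -
  have "socle R (H i) = {\<zero>\<^bsub>H i\<^esub>}" unfolding socle_def H_trivial_regseq[OF that] max_ideal_eq using H_zero_ops(1) m_carr by auto
  thus ?thesis unfolding F_unstable_module_def by (auto simp: F_zero_pow intro!: exI[of _ 1])
 qed
 thus ?thesis unfolding F_unstable_def local_cohomology_def local_cohomology_frobenius_def xs by metis
qed

lemma Fstable_iff:
 assumes CM FI and "sop ys" shows "F_stable p R \<longleftrightarrow> (\<forall>e. sigma e (set ys))"
proof -
 note sp = chosen_sop[OF assms(1)]
 have "sigma e (set (chosen_parameters R)) \<longleftrightarrow> sigma e (set ys)" for e using sigma_connect[OF assms(1)] sp assms(3) by metis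
 thus ?thesis unfolding Fstable_top[OF assms(1) refl] sop_cech.unstable_top_iff[OF sop_cech[OF assms(1) sp] assms(2)] by simp
qed

end

section \<open>Localization at a prime\<close>

context noeth_local_p
begin

text \<open>Take a longest partial system inside \<open>P\<close>. If \<open>P\<close> were not
  minimal over it, no minimal prime over it would contain \<open>P\<close>, and prime avoidance
  inside \<open>P\<close> would lengthen the system.\<close>

lemma psop_with_minimal_prime:
 assumes P: "primeideal P R" shows "\<exists>xs. psop xs \<and> set xs\<subseteq>P \<and> minimal_prime (Idl (set xs)) P"
proof -
 define T where "T xs \<longleftrightarrow> psop xs \<and> set xs\<subseteq>P" for xs
 have T0: "T []" unfolding T_def using psop_Nil by simp
 have Tb: "length xs\<le>dim" if "T xs" for xs using that by (simp add: T_def psop_def)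
 obtain xs where xs: "T xs" "\<And>ys. T ys ==> length ys\<le>length xs"
  using ex_has_greatest_nat[of T "[]" length "Suc dim", OF T0] Tb by (metis le_imp_less_Suc)
 have h: "psop xs" "set xs\<subseteq>P" using xs(1) by (auto simp: T_def)
 have xc: "set xs\<subseteq>\<R>" using h(1) m_sub by (auto simp: psop_def)
 have IP: "Idl (set xs)\<subseteq>P" by (rule genideal_minimal[OF prime_ideal[OF P] h(2)])
 show ?thesis
 proof (cases "minimal_prime (Idl (set xs)) P")
  case False
  have "length xs < dim"
  proof (rule ccontr)
   assume "\<not> length xs < dim"
   hence "sop xs" using Tb[OF xs(1)] psop_full[OF h(1)] by simp
   hence "Q = P" if "primeideal Q R" "Idl (set xs)\<subseteq>Q" for Q
    using order_trans[OF genideal_self[OF xc] that(2)] that(1) P h(2) unfolding sop_def by metis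
   thus False using False P IP unfolding minimal_prime_def by metis
  qed
  moreover have "\<not> P\<subseteq>Q" if Q: "minimal_prime (Idl (set xs)) Q" for Q
  proof
   assume "P\<subseteq>Q"
   hence "P = Q" by (rule minimal_primeD[OF Q P IP])
   thus False using False Q by simp
  qed
  ultimately have "\<exists>y\<in>P. \<forall>c\<in>{xs}. psop (c @ [y])"
   using psop_extend_in[of "{xs}" P] h(1) prime_ideal[OF P] prime_sub_m[OF P] by auto
  then obtain y where "y\<in>P" "psop (xs @ [y])" by auto
  hence "T (xs @ [y])" using h(2) by (simp add: T_def)
  thus ?thesis using xs(2)[of "xs @ [y]"] by simp
 qed (use h in auto)
qed

text \<open>The ideal generated by part of a system of parameters is the intersection of the ideals obtained
 by adding powers of the remaining parameters, so it inherits Frobenius closedness.\<close>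
lemma FC_psop:
 assumes FI: FI and sp: "sop (xs @ ys)" and M: "M > 0" shows "FC (set (pw M xs))" unfolding FC_def
proof (intro ballI impI)
 fix b assume b: "b\<in>\<R>" "b[^]p\<in>Idl ((\<lambda>x. x[^]p) ` set (pw M xs))"
 have sm: "set xs\<subseteq>\<mm>" "set ys\<subseteq>\<mm>" using sp by (auto simp: sop_def)
 have xc: "set (pw M xs)\<subseteq>\<R>" using sm m_sub by (auto simp: pw_def)
 note I = genideal_ideal[OF xc]
 show "b\<in>Idl (set (pw M xs))"
 proof (rule krull_intersection[OF I])
  fix n
  \<comment> \<open>A positive exponent keeps a system of parameters, and the \<open>N\<close>-th
    powers still lie in the \<open>n\<close>-th power of the maximal ideal.\<close>
  define N where "N = Suc n"
  have "ispow (xs @ ys) (pw M xs @ pw N ys)" unfolding ispow_def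
   by (rule list_all2_appendI) (use pw_ispow[of M xs] pw_ispow[of N ys] M in \<open>auto simp: ispow_def N_def\<close>)
  hence sp': "sop (pw M xs @ pw N ys)" using sop_ispow sp by metis
  have c: "set (pw M xs @ pw N ys)\<subseteq>\<R>" using sp' m_sub by (auto simp: sop_def)
  hence c': "(\<lambda>x. x[^]p) ` set (pw M xs @ pw N ys)\<subseteq>\<R>" by auto
  have "b[^]p\<in>Idl ((\<lambda>x. x[^]p) ` set (pw M xs @ pw N ys))"
   using b(2) subset_Idl_subset[OF c', of "(\<lambda>x. x[^]p) ` set (pw M xs)"] by auto
  moreover have "FC (set (pw M xs @ pw N ys))" using FI sp' unfolding FI_def by metis
  ultimately have bI: "b\<in>Idl (set (pw M xs @ pw N ys))" using b(1) unfolding FC_def by metis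
  note sm' = idl_sumI[OF I ipow_ideal[OF m_ideal], of n]
  have "set (pw N ys)\<subseteq>ipow \<mm> n"
  proof
   fix y assume "y\<in>set (pw N ys)"
   then obtain z where "z\<in>\<mm>" "y = z[^]N" using sm(2) by (auto simp: pw_def)
   hence "y\<in>ipow \<mm> N" using ipow_pow[OF m_ideal] by simp
   thus "y\<in>ipow \<mm> n" using ipow_antimono[OF m_ideal, of n N] by (auto simp: N_def)
  qed
  moreover have "set (pw M xs)\<subseteq>Idl (set (pw M xs))" by (rule genideal_self[OF xc])
  ultimately have "set (pw M xs @ pw N ys)\<subseteq>Idl (set (pw M xs)) <+> ipow \<mm> n" using sm' by auto
  hence "Idl (set (pw M xs @ pw N ys))\<subseteq>Idl (set (pw M xs)) <+> ipow \<mm> n" using genideal_minimal sm' by metis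
  thus "b\<in>Idl (set (pw M xs)) <+> ipow \<mm> n" using bI by auto
 qed
qed

end

section \<open>The ring of fractions at a prime\<close>

locale loc_prime = noeth_local_p +
 fixes P assumes P_prime: "primeideal P R"
begin

sublocale ms: mult_set R "\<R> - P"
proof
 show "\<one>\<in>\<R> - P" using prime_one[OF P_prime] by simp
 show "s\<otimes>t\<in>\<R> - P" if "s\<in>\<R> - P" "t\<in>\<R> - P" for s t using that primeD[OF P_prime, of s t] by auto
qed auto

abbreviation D where "D\<equiv>\<R> - P"
abbreviation f where "f a s\<equiv>fraction R D a s"
abbreviation A where "A\<equiv>localization R D"

lemma one_D: "\<one>\<in>D" by (rule ms.D_one)

lemma f_one_mult:
 assumes h: "a\<in>\<R>" "s\<in>D" shows "f s \<one>\<otimes>\<^bsub>A\<^esub>f a s = f a \<one>"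
proof -
 have "f s \<one>\<otimes>\<^bsub>A\<^esub>f a s = f (s\<otimes>a) (\<one>\<otimes>s)" using h one_D by (intro ms.fr_mult) auto
 also have "\<dots> = f (s\<otimes>a) (s\<otimes>\<one>)" using h by simp
 also have "\<dots> = f a \<one>" using h one_D by (intro ms.fr_cancel) auto
 finally show ?thesis .
qed

lemma f_split: "a\<in>\<R> ==> s\<in>D ==> f a s = f \<one> s\<otimes>\<^bsub>A\<^esub>f a \<one>" using ms.fr_mult one_D by simp

lemma contraction:
 assumes J: "ideal J A" shows "ideal {a\<in>\<R>. f a \<one>\<in>J} R"
proof (rule idealI')
 show "\<zero>\<in>{a\<in>\<R>. f a \<one>\<in>J}" using ms.L.idl_zero[OF J] ms.fr_zero[OF one_D] by simp
 show "a\<oplus>b\<in>{a\<in>\<R>. f a \<one>\<in>J}" if "a\<in>{a\<in>\<R>. f a \<one>\<in>J}" "b\<in>{a\<in>\<R>. f a \<one>\<in>J}" for a b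
  using that ms.L.idl_add[OF J, of "f a \<one>" "f b \<one>"] ms.fr_add_same one_D by simp
 show "r\<otimes>a\<in>{a\<in>\<R>. f a \<one>\<in>J}" if "a\<in>{a\<in>\<R>. f a \<one>\<in>J}" "r\<in>\<R>" for a r
  using that ms.L.idl_l[OF J, of "f a \<one>" "f r \<one>"] ms.fr_mult ms.fr_carr one_D by simp
qed auto

lemma mem_iff:
 assumes J: "ideal J A" and a: "a\<in>\<R>" "s\<in>D" shows "f a s\<in>J \<longleftrightarrow> f a \<one>\<in>J"
proof
 have sc: "s\<in>\<R>" using a by simp
 show "f a \<one>\<in>J" if "f a s\<in>J" using ms.L.idl_l[OF J that ms.fr_carr[OF sc one_D]] unfolding f_one_mult[OF a] .
 show "f a s\<in>J" if "f a \<one>\<in>J" using ms.L.idl_l[OF J that ms.fr_carr[OF one_closed a(2)]] unfolding f_split[OF a, symmetric] .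
qed

definition ext where "ext S = Idl\<^bsub>A\<^esub> ((\<lambda>x. f x \<one>) ` S)"

lemma ext_carr: "S\<subseteq>\<R> ==> (\<lambda>x. f x \<one>) ` S\<subseteq>carrier A" using ms.fr_carr one_D by auto

text \<open>The fractions with numerator in the saturation of the ideal already form an ideal that
  contains the generators.\<close>

lemma ext_mem:
 assumes S: "S\<subseteq>\<R>" and a: "a\<in>\<R>" "s\<in>D" shows "f a s\<in>ext S \<longleftrightarrow> (\<exists>t\<in>D. t\<otimes>a\<in>Idl S)"
proof
 note E = ms.L.genideal_ideal[OF ext_carr[OF S], folded ext_def]
 note I = genideal_ideal[OF S]
 note satI = sat_ideal[OF P_prime I]
 have sm: "sat P (Idl S) = {a\<in>\<R>. \<exists>t\<in>D. t\<otimes>a\<in>Idl S}" by (simp add: sat_def)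
 assume h: "f a s\<in>ext S"
 let ?K = "{f b t | b t. b\<in>sat P (Idl S) \<and> t\<in>D}"
 have "ideal ?K A"
 proof (rule ms.L.idealI')
  show "?K\<subseteq>carrier A" using ms.fr_carr idl_carr[OF satI] by auto
  show "\<zero>\<^bsub>A\<^esub>\<in>?K" using ms.fr_zero idl_zero[OF satI] one_D by auto
  fix x assume "x\<in>?K"
  then obtain b t where x: "b\<in>sat P (Idl S)" "t\<in>D" "x = f b t" by auto
  note bc = idl_carr[OF satI x(1)]
  { fix y assume "y\<in>?K"
   then obtain c u where y: "c\<in>sat P (Idl S)" "u\<in>D" "y = f c u" by auto
   note cc = idl_carr[OF satI y(1)]
   have "x\<oplus>\<^bsub>A\<^esub>y = f (u\<otimes>b\<oplus>t\<otimes>c) (t\<otimes>u)" unfolding x(3) y(3) by (rule ms.fr_add[OF bc x(2) cc y(2)])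
   moreover have "u\<otimes>b\<oplus>t\<otimes>c\<in>sat P (Idl S)" using idl_add[OF satI] idl_l[OF satI] x y by simp
   ultimately show "x\<oplus>\<^bsub>A\<^esub>y\<in>?K" using ms.D_mult[OF x(2) y(2)] by auto }
  { fix r assume "r\<in>carrier A"
   then obtain c u where y: "c\<in>\<R>" "u\<in>D" "r = f c u" by (rule ms.L_cases)
   have "r\<otimes>\<^bsub>A\<^esub>x = f (c\<otimes>b) (u\<otimes>t)" unfolding x(3) y(3) by (rule ms.fr_mult[OF y(1,2) bc x(2)])
   moreover have "c\<otimes>b\<in>sat P (Idl S)" using idl_l[OF satI x(1) y(1)] .
   ultimately show "r\<otimes>\<^bsub>A\<^esub>x\<in>?K" using ms.D_mult[OF y(2) x(2)] by auto }
 qed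
 moreover have "(\<lambda>x. f x \<one>) ` S\<subseteq>?K" using genideal_self[OF S] sat_sub[OF P_prime I] one_D by auto
 ultimately have "ext S\<subseteq>?K" unfolding ext_def by (rule ms.L.genideal_minimal)
 then obtain b t where b: "b\<in>sat P (Idl S)" "t\<in>D" "f a s = f b t" using h by auto
 note bc = idl_carr[OF satI b(1)]
 obtain v where v: "v\<in>D" "v\<otimes>(t\<otimes>a) = v\<otimes>(s\<otimes>b)" using b(3) ms.fr_eq[OF a bc b(2)] by auto
 have "v\<otimes>t\<otimes>a\<in>sat P (Idl S)" using v b(2) a(1) idl_l[OF satI idl_l[OF satI b(1)], of s v] a(2) by (simp add: m_assoc)
 hence "a\<in>sat P (Idl S)" using sat_sat[OF P_prime I ms.D_mult[OF v(1) b(2)] a(1)] by simp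
 thus "\<exists>t\<in>D. t\<otimes>a\<in>Idl S" by (simp add: sm)
next
 note E = ms.L.genideal_ideal[OF ext_carr[OF S], folded ext_def]
 assume "\<exists>t\<in>D. t\<otimes>a\<in>Idl S"
 then obtain t where t: "t\<in>D" "t\<otimes>a\<in>Idl S" by auto
 have "Idl S\<subseteq>{a\<in>\<R>. f a \<one>\<in>ext S}"
  by (rule genideal_minimal[OF contraction[OF E]]) (use S ms.L.genideal_self[OF ext_carr[OF S]] in \<open>auto simp: ext_def\<close>)
 hence "f (t\<otimes>a) \<one>\<in>ext S" using t by auto
 hence "f (t\<otimes>a) (t\<otimes>s)\<in>ext S" using mem_iff[OF E, of "t\<otimes>a" "t\<otimes>s"] t a ms.D_mult by simp
 thus "f a s\<in>ext S" using ms.fr_cancel[OF a t(1)] by simp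
qed

definition mA where "mA = {f a s | a s. a\<in>P \<and> s\<in>D}"

lemma P_carr: "a\<in>P ==> a\<in>\<R>" by (rule idl_carr[OF prime_ideal[OF P_prime]])

lemma mA_ext: "mA = ext P"
proof
 have PI: "Idl P = P" by (rule Idl_ideal_eq[OF prime_ideal[OF P_prime]])
 have Pc: "P\<subseteq>\<R>" using P_carr by auto
 note E = ms.L.genideal_ideal[OF ext_carr[OF Pc], folded ext_def]
 show "mA\<subseteq>ext P" unfolding mA_def using ext_mem[OF Pc] P_carr PI one_D by (auto intro!: bexI[of _ \<one>])
 show "ext P\<subseteq>mA"
 proof
  fix x assume x: "x\<in>ext P"
  obtain a s where a: "a\<in>\<R>" "s\<in>D" "x = f a s" using ms.L_cases[OF ms.L.idl_carr[OF E x]] by metis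
  obtain t where "t\<in>D" "t\<otimes>a\<in>P" using ext_mem[OF Pc a(1,2)] x a(3) PI by auto
  hence "a\<in>P" using primeD[OF P_prime, of t a] a(1) by auto
  thus "x\<in>mA" unfolding mA_def using a by auto
 qed
qed

lemma mA_mem:
 assumes a: "a\<in>\<R>" "s\<in>D" shows "f a s\<in>mA \<longleftrightarrow> a\<in>P"
proof
 have Pc: "P\<subseteq>\<R>" using P_carr by auto
 assume "f a s\<in>mA"
 then obtain t where "t\<in>D" "t\<otimes>a\<in>P" using ext_mem[OF Pc a] Idl_ideal_eq[OF prime_ideal[OF P_prime]] unfolding mA_ext by auto
 thus "a\<in>P" using primeD[OF P_prime, of t a] a(1) by auto
qed (use a in \<open>auto simp: mA_def\<close>)

lemma mA_ideal: "ideal mA A" unfolding mA_ext ext_def by (rule ms.L.genideal_ideal[OF ext_carr]) (use P_carr in auto)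

lemma A_proper:
 assumes "ideal J A" "\<one>\<^bsub>A\<^esub>\<notin>J" shows "J\<subseteq>mA"
proof
 fix x assume x: "x\<in>J"
 obtain a s where a: "a\<in>\<R>" "s\<in>D" "x = f a s" using ms.L_cases[OF ms.L.idl_carr[OF assms(1) x]] by metis
 have "a\<in>P"
 proof (rule ccontr)
  assume "a\<notin>P"
  hence aD: "a\<in>D" using a by simp
  have sc: "s\<in>\<R>" using a by simp
  have "f s a\<otimes>\<^bsub>A\<^esub>x = f (s\<otimes>a) (a\<otimes>s)" unfolding a(3) by (rule ms.fr_mult[OF sc aD a(1,2)])
  also have "\<dots> = \<one>\<^bsub>A\<^esub>" unfolding ms.L_one using a sc aD one_D ms.D_mult[OF aD a(2)] by (intro ms.fr_eqI) (auto simp: m_comm)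
  finally show False using assms(2) ms.L.idl_l[OF assms(1) x ms.fr_carr[OF sc aD]] by simp
 qed
 thus "x\<in>mA" unfolding mA_def using a by auto
qed

lemma one_mA: "\<one>\<^bsub>A\<^esub>\<notin>mA" unfolding ms.L_one using mA_mem prime_one[OF P_prime] by simp

lemma A_noeth_local: "noeth_local A mA"
proof -
 have noeth: "noetherian_ring A"
 proof (rule ms.L.noetherian_ringI)
  fix J assume J: "ideal J A"
  obtain S where S: "S\<subseteq>\<R>" "finite S" "{a\<in>\<R>. f a \<one>\<in>J} = Idl S" using finetely_gen[OF contraction[OF J]] by metis
  have "J = ext S"
  proof
   show "J\<subseteq>ext S"
   proof
    fix x assume x: "x\<in>J"
    obtain a s where a: "a\<in>\<R>" "s\<in>D" "x = f a s" using ms.L_cases[OF ms.L.idl_carr[OF J x]] by metis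
    have "a\<in>Idl S" unfolding S(3)[symmetric] using mem_iff[OF J a(1,2)] x a by simp
    thus "x\<in>ext S" unfolding a(3) ext_mem[OF S(1) a(1,2)] using a(1) one_D by (intro bexI[of _ \<one>]) simp_all
   qed
   have "(\<lambda>x. f x \<one>) ` S\<subseteq>J" using genideal_self[OF S(1)] unfolding S(3)[symmetric] by auto
   thus "ext S\<subseteq>J" unfolding ext_def by (rule ms.L.genideal_minimal[OF J])
  qed
  thus "\<exists>S\<subseteq>carrier A. finite S \<and> J = Idl\<^bsub>A\<^esub> S" unfolding ext_def using ext_carr[OF S(1)] S(2) by blast
 qed
 note ms.L.local_ringI'[OF mA_ideal one_mA A_proper]
 thus ?thesis by (intro noeth_local.intro noeth_cring.intro noeth_local_axioms.intro ms.L.is_cring noeth) auto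
qed

lemma A_char_p: "char_p_cring A p"
proof
 have "[n] \<cdot>\<^bsub>A\<^esub> f \<one> \<one> = f ([n] \<cdot> \<one>) \<one>" for n :: nat
 proof (induction n)
  case 0 show ?case using ms.fr_zero[OF one_D] by simp
 next
  case (Suc n)
  have "[n] \<cdot> \<one>\<in>\<R>" by simp
  thus ?case using Suc ms.fr_add_same one_D by simp
 qed
 thus "[p] \<cdot>\<^bsub>A\<^esub> \<one>\<^bsub>A\<^esub> = \<zero>\<^bsub>A\<^esub>" unfolding ms.L_one using p_zero ms.fr_zero[OF one_D] by simp
qed (rule p_prime)

sublocale AL: noeth_local_p A mA p unfolding noeth_local_p_def using A_noeth_local A_char_p by simp

lemma A_regseq:
 assumes reg: "regseq xs" and xP: "set xs\<subseteq>P" shows "AL.regseq (map (\<lambda>x. f x \<one>) xs)" unfolding AL.regseq_def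
proof (intro conjI allI impI)
 show "set (map (\<lambda>x. f x \<one>) xs)\<subseteq>mA" using xP one_D by (auto simp: mA_def)
 fix i assume i: "i < length (map (\<lambda>x. f x \<one>) xs)"
 have S: "set (take i xs)\<subseteq>\<R>" using set_take_subset[of i xs] reg m_sub by (auto simp: regseq_def)
 have e: "Idl\<^bsub>A\<^esub> (set (take i (map (\<lambda>x. f x \<one>) xs))) = ext (set (take i xs))" by (simp add: ext_def take_map)
 have xi: "xs ! i\<in>\<R>" using regseq_carr[OF reg] i by simp
 have nz: "nzd (Idl (set (take i xs))) (xs ! i)" using reg i by (simp add: regseq_def)
 show "AL.nzd (Idl\<^bsub>A\<^esub> (set (take i (map (\<lambda>x. f x \<one>) xs)))) (map (\<lambda>x. f x \<one>) xs ! i)" unfolding AL.nzd_def e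
 proof (intro ballI impI)
  fix y assume y: "y\<in>carrier A" "map (\<lambda>x. f x \<one>) xs ! i\<otimes>\<^bsub>A\<^esub>y\<in>ext (set (take i xs))"
  obtain a s where a: "a\<in>\<R>" "s\<in>D" "y = f a s" using ms.L_cases[OF y(1)] by metis
  have "map (\<lambda>x. f x \<one>) xs ! i\<otimes>\<^bsub>A\<^esub>y = f (xs ! i\<otimes>a) s" using i a xi one_D ms.fr_mult by simp
  then obtain t where t: "t\<in>D" "t\<otimes>(xs ! i\<otimes>a)\<in>Idl (set (take i xs))" using y(2) ext_mem[OF S _ a(2), of "xs ! i\<otimes>a"] xi a(1) by auto
  have tc: "t\<in>\<R>" using t by simp
  have "t\<otimes>(xs ! i\<otimes>a) = xs ! i\<otimes>(t\<otimes>a)" using tc xi a(1) by algebra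
  hence "t\<otimes>a\<in>Idl (set (take i xs))" using nzdD[OF nz, of "t\<otimes>a"] t(2) tc a(1) by simp
  thus "y\<in>ext (set (take i xs))" unfolding a(3) ext_mem[OF S a(1,2)] using t(1) by auto
 qed
qed

text \<open>A partial system of parameters over which \<open>P\<close> is minimal is regular, and
  its image is a regular sequence contained in no prime but the maximal one. It is therefore a
  system of parameters of the localization, and \<open>FC_psop\<close> descends closedness to
  it.\<close>

theorem A_CM_FI:
 assumes CM FI shows "AL.CM \<and> AL.FI"
proof -
 obtain xs where xs: "psop xs" "set xs\<subseteq>P" "minimal_prime (Idl (set xs)) P" using psop_with_minimal_prime[OF P_prime] by metis
 have xc: "set xs\<subseteq>\<R>" using xs(1) m_sub by (auto simp: psop_def)
 have "length xs + (dim - length xs) = dim" using xs(1) by (simp add: psop_def)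
 then obtain ys where sp: "sop (xs @ ys)" using psop_extend2[OF xs(1,1)] by auto
 have reg: "regseq xs" using CM_sop_regseq[OF assms(1) sp] regseq_append by metis
 define zs where "zs = map (\<lambda>x. f x \<one>) xs"
 have regz: "AL.regseq zs" unfolding zs_def by (rule A_regseq[OF reg xs(2)])
 \<comment> \<open>The contraction of such a prime lies between \<open>xs\<close> and
   \<open>P\<close>, so the minimality of \<open>P\<close> makes it equal to
   \<open>P\<close>.\<close>
 have only: "Q = mA" if Q: "primeideal Q A" "set zs\<subseteq>Q" for Q
 proof -
  note Qi = ms.L.prime_ideal[OF Q(1)]
  let ?q = "{a\<in>\<R>. f a \<one>\<in>Q}"
  have qQ: "primeideal ?q R"
  proof (rule primeidealI[OF contraction[OF Qi] is_cring])
   show "\<R>\<noteq>?q" using ms.L.prime_one[OF Q(1)] ms.L_one by auto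
   show "a\<in>?q \<or> b\<in>?q" if "a\<in>\<R>" "b\<in>\<R>" "a\<otimes>b\<in>?q" for a b
    using that ms.L.primeD[OF Q(1), of "f a \<one>" "f b \<one>"] ms.fr_carr one_D ms.fr_mult by auto
  qed
  have QA: "Q\<subseteq>mA" by (rule AL.prime_sub_m[OF Q(1)])
  have "?q\<subseteq>P" using QA mA_mem[OF _ one_D] by auto
  moreover have "set xs\<subseteq>?q" using Q(2) xc by (auto simp: zs_def)
  hence "Idl (set xs)\<subseteq>?q" by (rule genideal_minimal[OF prime_ideal[OF qQ]])
  ultimately have "?q = P" using minimal_primeD[OF xs(3) qQ] by simp
  moreover have "mA\<subseteq>Q"
  proof
   fix y assume "y\<in>mA"
   then obtain a s where a: "a\<in>P" "s\<in>D" "y = f a s" by (auto simp: mA_def)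
   hence "a\<in>?q" using calculation by simp
   thus "y\<in>Q" using mem_iff[OF Qi _ a(2)] a(3) by simp
  qed
  ultimately show ?thesis using QA by auto
 qed
 have cm: "AL.CM" and sz: "AL.sop zs" using AL.sop_if_regseq[OF regz only] by auto
 have pwf: "set (AL.pw N zs) = (\<lambda>x. f x \<one>) ` set (pw N xs)" for N
  unfolding AL.pw_def pw_def zs_def using xc ms.fr_pow[OF _ one_D] by (auto simp: image_image subset_iff)
 have pwc: "set (pw N xs)\<subseteq>\<R>" for N using xc by (auto simp: pw_def)
 have "AL.FC (set (AL.pw N zs))" if N: "N > 0" for N unfolding AL.FC_def
 proof (intro ballI impI)
  fix y assume y: "y\<in>carrier A" "y[^]\<^bsub>A\<^esub>p\<in>Idl\<^bsub>A\<^esub> ((\<lambda>x. x[^]\<^bsub>A\<^esub>p) ` set (AL.pw N zs))"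
  obtain a s where a: "a\<in>\<R>" "s\<in>D" "y = f a s" using ms.L_cases[OF y(1)] by metis
  have zc: "set zs\<subseteq>carrier A" using sz AL.m_sub by (auto simp: AL.sop_def)
  have "y[^]\<^bsub>A\<^esub>p\<in>ext (set (pw (N * p) xs))" using y(2)[unfolded AL.pw_pow[OF zc]] unfolding pwf ext_def .
  moreover have "y[^]\<^bsub>A\<^esub>p = f (a[^]p) (s[^]p)" unfolding a(3) by (rule ms.fr_pow[OF a(1,2)])
  ultimately obtain t where t: "t\<in>D" "t\<otimes>a[^]p\<in>Idl (set (pw (N * p) xs))"
   using ext_mem[OF pwc nat_pow_closed[OF a(1)] ms.D_pow[OF a(2)]] by auto
  have tc: "t\<in>\<R>" using t by simp
  \<comment> \<open>The denominator is absorbed into the numerator: a multiplier of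
    \<open>a^p\<close> may be replaced by its own \<open>p\<close>-th power.\<close>
  have "(t\<otimes>a)[^]p\<in>Idl (set (pw (N * p) xs))" by (rule idl_mult_pow[OF genideal_ideal[OF pwc] tc a(1) t(2) p_gt_0])
  hence "(t\<otimes>a)[^]p\<in>Idl ((\<lambda>x. x[^]p) ` set (pw N xs))" by (simp add: pw_pow[OF xc])
  hence "t\<otimes>a\<in>Idl (set (pw N xs))" using FC_psop[OF assms(2) sp N] tc a(1) by (simp add: FC_def)
  thus "y\<in>Idl\<^bsub>A\<^esub> (set (AL.pw N zs))" unfolding pwf ext_def[symmetric] a(3) ext_mem[OF pwc a(1,2)] using t(1) by auto
 qed
 hence "AL.FI" using AL.FI_if_FCall[OF sz regz AL.FCall_if_uniform[OF regz]] by simp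
 thus ?thesis using cm by simp
qed

end

section \<open>Completion of a Noetherian local ring\<close>

context cring
begin

text \<open>Cohen: an ideal that is maximal among those that are not finitely generated is prime.\<close>
lemma maximal_not_fg_prime:
 assumes P: "ideal P R" and max: "\<And>J. ideal J R ==> P\<subset>J ==> \<exists>S\<subseteq>\<R>. finite S \<and> J = Idl S"
  and nfg: "\<not> (\<exists>S\<subseteq>\<R>. finite S \<and> P = Idl S)"
 shows "primeideal P R" and "\<And>x. x\<in>\<R> - P ==> \<exists>S. finite S \<and> S\<subseteq>P \<and> P\<subseteq>adj (Idl S) x"
proof -
 \<comment> \<open>This is recorded as a separate conclusion because the completion will be shown
   Noetherian by expanding elements of \<open>P\<close> in powers of such an
   \<open>x\<close>.\<close>
 show fg: "\<exists>S. finite S \<and> S\<subseteq>P \<and> P\<subseteq>adj (Idl S) x" if x: "x\<in>\<R> - P" for x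
 proof -
  have xc: "x\<in>\<R>" using x by simp
  have "P\<subset>adj P x" using adjm_sub[OF P oneideal xc] adj_self[OF P xc] x by auto
  then obtain G where G: "G\<subseteq>\<R>" "finite G" "adj P x = Idl G" using max[OF adj_ideal[OF P xc]] by auto
  have "\<forall>g\<in>G. \<exists>i. i\<in>P \<and> (\<exists>r\<in>\<R>. g = i\<oplus>r\<otimes>x)" using genideal_self[OF G(1)] adjD[of _ P x] unfolding G(3)[symmetric] by blast
  then obtain s where s: "\<And>g. g\<in>G ==> s g\<in>P \<and> (\<exists>r\<in>\<R>. g = s g\<oplus>r\<otimes>x)" by metis
  have sP: "s ` G\<subseteq>P" using s by auto
  hence sc: "s ` G\<subseteq>\<R>" using idl_sub[OF P] by auto
  note I = genideal_ideal[OF sc]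
  have "G\<subseteq>adj (Idl (s ` G)) x"
  proof
   fix g assume g: "g\<in>G"
   obtain r where "r\<in>\<R>" "g = s g\<oplus>r\<otimes>x" using s[OF g] by auto
   moreover have "s g\<in>Idl (s ` G)" using genideal_self[OF sc] g by auto
   ultimately show "g\<in>adj (Idl (s ` G)) x" unfolding adjm_def by blast
  qed
  hence "Idl G\<subseteq>adj (Idl (s ` G)) x" by (rule genideal_minimal[OF adj_ideal[OF I xc]])
  hence "P\<subseteq>adj (Idl (s ` G)) x" using adjm_sub[OF P oneideal xc] G(3) by auto
  thus ?thesis using sP G(2) by blast
 qed
 show "primeideal P R"
 proof (rule primeidealI[OF P is_cring])
  show "\<R>\<noteq>P"
  proof
   assume "\<R> = P"
   moreover have "Idl {\<one>} = \<R>" using idl_one[OF genideal_ideal[of "{\<one>}"]] genideal_self[of "{\<one>}"] by auto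
   ultimately show False using nfg by (metis finite.emptyI finite.insertI empty_subsetI insert_subset one_closed)
  qed
  fix a b assume ab: "a\<in>\<R>" "b\<in>\<R>" "a\<otimes>b\<in>P"
  show "a\<in>P \<or> b\<in>P"
  proof (rule ccontr)
   assume n: "\<not> (a\<in>P \<or> b\<in>P)"
   obtain S where S: "finite S" "S\<subseteq>P" "P\<subseteq>adj (Idl S) a" using fg[of a] n ab(1) by auto
   have Sc: "S\<subseteq>\<R>" using S(2) idl_sub[OF P] by auto
   note I = genideal_ideal[OF Sc]
   have IP: "Idl S\<subseteq>P" by (rule genideal_minimal[OF P S(2)])
   define Q where "Q = {c\<in>\<R>. c\<otimes>a\<in>P}"
   have Q: "ideal Q R"
   proof (rule idealI')
    show "\<zero>\<in>Q" using ab(1) idl_zero[OF P] by (simp add: Q_def)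
    show "c\<oplus>d\<in>Q" if "c\<in>Q" "d\<in>Q" for c d using that ab(1) idl_add[OF P] by (simp add: Q_def l_distr)
    show "r\<otimes>c\<in>Q" if "c\<in>Q" "r\<in>\<R>" for c r using that ab(1) idl_l[OF P] by (simp add: Q_def m_assoc)
   qed (auto simp: Q_def)
   have "P\<subseteq>Q" using idl_r[OF P _ ab(1)] idl_carr[OF P] by (auto simp: Q_def)
   moreover have "b\<in>Q" using ab by (simp add: Q_def m_comm)
   ultimately obtain G where G: "G\<subseteq>\<R>" "finite G" "Q = Idl G" using max[OF Q] n by blast
   let ?G = "S\<union>(\<lambda>g. g\<otimes>a) ` G"
   have Gc: "?G\<subseteq>\<R>" using Sc G(1) ab(1) by auto
   note J = genideal_ideal[OF Gc]
   have "P = Idl ?G"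
   proof
    have "G\<subseteq>Q" using genideal_self[OF G(1)] G(3) by simp
    hence "?G\<subseteq>P" using S(2) by (auto simp: Q_def)
    thus "Idl ?G\<subseteq>P" by (rule genideal_minimal[OF P])
    show "P\<subseteq>Idl ?G"
    proof
     fix x assume x: "x\<in>P"
     obtain i r where ir: "i\<in>Idl S" "r\<in>\<R>" "x = i\<oplus>r\<otimes>a" using adjD S(3) x by blast
     have ic: "i\<in>\<R>" by (rule idl_carr[OF I ir(1)])
     have "r\<otimes>a\<oplus>i\<in>P" using x ir ic ab(1) a_comm by simp
     hence "r\<otimes>a\<in>P" using idl_cancel[OF P, of "r\<otimes>a" i] IP ir ab(1) by auto
     hence "r\<in>Idl G" using G(3) ir(2) by (auto simp: Q_def)
     moreover have "Idl G\<subseteq>{c\<in>\<R>. c\<otimes>a\<in>Idl ?G}"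
     proof (rule genideal_minimal)
      show "ideal {c\<in>\<R>. c\<otimes>a\<in>Idl ?G} R"
      proof (rule idealI')
       show "\<zero>\<in>{c\<in>\<R>. c\<otimes>a\<in>Idl ?G}" using ab(1) idl_zero[OF J] by simp
       show "c\<oplus>d\<in>{c\<in>\<R>. c\<otimes>a\<in>Idl ?G}" if "c\<in>{c\<in>\<R>. c\<otimes>a\<in>Idl ?G}" "d\<in>{c\<in>\<R>. c\<otimes>a\<in>Idl ?G}" for c d
        using that ab(1) idl_add[OF J] by (simp add: l_distr)
       show "r\<otimes>c\<in>{c\<in>\<R>. c\<otimes>a\<in>Idl ?G}" if "c\<in>{c\<in>\<R>. c\<otimes>a\<in>Idl ?G}" "r\<in>\<R>" for c r
        using that ab(1) idl_l[OF J] by (simp add: m_assoc)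
      qed auto
      show "G\<subseteq>{c\<in>\<R>. c\<otimes>a\<in>Idl ?G}" using G(1) genideal_self[OF Gc] by auto
     qed
     moreover have "i\<in>Idl ?G" using ir(1) subset_Idl_subset[OF Gc, of S] by auto
     ultimately show "x\<in>Idl ?G" unfolding ir(3) using idl_add[OF J] by blast
    qed
   qed
   thus False using nfg Gc S(1) G(2) by (metis finite_UnI finite_imageI)
  qed
 qed
qed

text \<open>Zorn's lemma gives an ideal maximal among those not finitely generated; the union of a
  chain qualifies, as finitely many generators would lie in one member. The extra finiteness that
  Cohen's argument yields is passed on to the hypothesis.\<close>

lemma noetherian_if_primes_fg:
 assumes "\<And>P. ideal P R ==> primeideal P R ==> (\<And>x. x\<in>\<R> - P ==> \<exists>S. finite S \<and> S\<subseteq>P \<and> P\<subseteq>adj (Idl S) x) ==>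
   \<exists>S\<subseteq>\<R>. finite S \<and> P = Idl S" shows "noetherian_ring R"
proof (rule noetherian_ringI)
 define bad where "bad = {J. ideal J R \<and> \<not> (\<exists>S\<subseteq>\<R>. finite S \<and> J = Idl S)}"
 fix I assume I: "ideal I R"
 show "\<exists>S\<subseteq>\<R>. finite S \<and> I = Idl S"
 proof (rule ccontr)
  assume "\<not> (\<exists>S\<subseteq>\<R>. finite S \<and> I = Idl S)"
  hence ne: "bad\<noteq>{}" using I by (auto simp: bad_def)
  have "\<exists>P\<in>bad. \<forall>X\<in>bad. P\<subseteq>X \<longrightarrow> X = P"
  proof (rule subset_Zorn_nonempty[OF ne])
   fix C assume C: "C\<noteq>{}" "subset.chain bad C"
   have sub: "C\<subseteq>bad" using C(2) by (simp add: subset.chain_def)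
   have ch: "subset.chain {I. ideal I R} C" using C(2) by (auto simp: subset.chain_def bad_def)
   have U: "ideal (\<Union>C) R" using chain_Union_is_ideal[OF ch] C(1) by simp
   have "\<not> (\<exists>S\<subseteq>\<R>. finite S \<and> \<Union>C = Idl S)"
   proof
    assume "\<exists>S\<subseteq>\<R>. finite S \<and> \<Union>C = Idl S"
    then obtain S where S: "S\<subseteq>\<R>" "finite S" "\<Union>C = Idl S" by auto
    have "S\<subseteq>\<Union>C" using genideal_self[OF S(1)] S(3) by simp
    then obtain J where J: "J\<in>C" "S\<subseteq>J" using finite_subset_Union_chain[OF S(2) _ C(1,2)] by metis
    have "ideal J R" using J(1) sub by (auto simp: bad_def)
    hence "Idl S\<subseteq>J" using genideal_minimal J(2) by simp
    hence "J = Idl S" using J(1) S(3) by auto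
    thus False using J(1) sub S(1,2) by (auto simp: bad_def)
   qed
   thus "\<Union>C\<in>bad" using U by (simp add: bad_def)
  qed
  then obtain P where P: "P\<in>bad" "\<And>X. X\<in>bad ==> P\<subseteq>X ==> X = P" by auto
  have Pi: "ideal P R" and nfg: "\<not> (\<exists>S\<subseteq>\<R>. finite S \<and> P = Idl S)" using P(1) by (auto simp: bad_def)
  have max: "\<exists>S\<subseteq>\<R>. finite S \<and> J = Idl S" if "ideal J R" "P\<subset>J" for J using P(2) that by (auto simp: bad_def)
  show False using assms[OF Pi maximal_not_fg_prime[OF Pi max nfg]] nfg by metis
 qed
qed

text \<open>The recursion along the list keeps one coefficient per generator, so that infinite sums
  of combinations can be formed coefficient by coefficient.\<close>

primrec lin where "lin [] C = {\<zero>}" | "lin (g # gs) C = adjm (lin gs C) C g"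

lemma lin_ideal: "ideal C R ==> set gs\<subseteq>\<R> ==> ideal (lin gs C) R" by (induction gs) (auto intro: adjm_ideal simp: zeroideal)

lemma lin_Idl:
 assumes C: "ideal C R" shows "set gs\<subseteq>\<R> ==> a\<in>C ==> b\<in>Idl (set gs) ==> a\<otimes>b\<in>lin gs C"
proof (induction gs arbitrary: b)
 case Nil thus ?case using Idl_empty idl_carr[OF C] by simp
next
 case (Cons g gs)
 have gc: "g\<in>\<R>" "set gs\<subseteq>\<R>" using Cons.prems by auto
 obtain i r where b: "i\<in>Idl (set gs)" "r\<in>\<R>" "b = i\<oplus>r\<otimes>g"
  using adjD Cons.prems(3) Idl_insert[OF gc(2,1)] by (metis list.simps(15))
 have c: "a\<in>\<R>" "i\<in>\<R>" using idl_carr[OF C Cons.prems(2)] idl_carr[OF genideal_ideal[OF gc(2)] b(1)] by auto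
 have "a\<otimes>b = a\<otimes>i\<oplus>(a\<otimes>r)\<otimes>g" unfolding b(3) using c gc(1) b(2) by algebra
 moreover have "a\<otimes>i\<in>lin gs C" by (rule Cons.IH[OF gc(2) Cons.prems(2) b(1)])
 moreover have "a\<otimes>r\<in>C" by (rule idl_r[OF C Cons.prems(2) b(2)])
 ultimately show ?case unfolding lin.simps adjm_def by blast
qed

lemma lin_carrier: "set gs\<subseteq>\<R> ==> lin gs (\<R>) = Idl (set gs)" by (induction gs) (auto simp: Idl_empty Idl_insert)

lemma lin_sub:
 assumes K: "ideal K R" and gs: "\<And>g c. g\<in>set gs ==> c\<in>C ==> c\<otimes>g\<in>K" shows "lin gs C\<subseteq>K" using gs
proof (induction gs)
 case Nil show ?case using idl_zero[OF K] by simp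
next
 case (Cons g gs)
 have "lin gs C\<subseteq>K" by (rule Cons.IH) (use Cons.prems in auto)
 thus ?case using idl_add[OF K] Cons.prems by (auto simp: adjm_def)
qed

end

section \<open>Coherent sequences of representatives\<close>

locale local_completion = noeth_local
begin

abbreviation pm where "pm\<equiv>ipow \<mm>"
abbreviation B where "B\<equiv>adic_completion R \<mm>"
abbreviation Badd (infixl "+." 65) where "x +. y\<equiv>x\<oplus>\<^bsub>B\<^esub>y"
abbreviation Bmult (infixl "*." 70) where "x *. y\<equiv>x\<otimes>\<^bsub>B\<^esub>y"
abbreviation Bminus (infixl "-." 65) where "x -. y\<equiv>x\<ominus>\<^bsub>B\<^esub>y"
definition coh where "coh a \<longleftrightarrow> (\<forall>n. a n\<in>\<R> \<and> a (Suc n)\<ominus>a n\<in>pm n)"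
definition bs where "bs a = (\<lambda>n. pm n +> a n)"
definition io where "io a = bs (\<lambda>_. a)"
text \<open>The kernel of the projection to the ring modulo \<open>pm n\<close>. It agrees with the
  power of the maximal ideal of the completion, but this needs the convergence argument behind
  \<open>M_ipow\<close>.\<close>

definition M where "M n = {f\<in>carrier B. f n = pm n}"

lemma pm_ideal: "ideal (pm n) R" by (rule ipow_ideal[OF m_ideal])
lemma pm_carr: "a\<in>pm n ==> a\<in>\<R>" by (rule idl_carr[OF pm_ideal])
lemma cohD: "coh a ==> a n\<in>\<R>" by (simp add: coh_def)

lemma coset_eq: "a\<in>\<R> ==> b\<in>\<R> ==> pm n +> a = pm n +> b \<longleftrightarrow> a\<ominus>b\<in>pm n"
 using quotient_eq_iff_same_a_r_cos[OF pm_ideal] by simp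

lemma coset_sub:
 assumes "a\<in>\<R>" "b\<in>\<R>" shows "pm (Suc n) +> a\<subseteq>pm n +> b \<longleftrightarrow> a\<ominus>b\<in>pm n"
proof
 assume "pm (Suc n) +> a\<subseteq>pm n +> b"
 moreover have "a\<in>pm (Suc n) +> a" using idl_zero[OF pm_ideal] assms by (auto simp: a_r_coset_def' intro!: bexI[of _ \<zero>])
 ultimately have "a\<in>pm n +> b" by auto
 then obtain h where h: "h\<in>pm n" "a = h\<oplus>b" by (auto simp: a_r_coset_def')
 hence "a\<ominus>b = h" using pm_carr assms by algebra
 thus "a\<ominus>b\<in>pm n" using h by simp
next
 assume h: "a\<ominus>b\<in>pm n"
 show "pm (Suc n) +> a\<subseteq>pm n +> b"
 proof
  fix x assume "x\<in>pm (Suc n) +> a"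
  then obtain y where y: "y\<in>pm (Suc n)" "x = y\<oplus>a" by (auto simp: a_r_coset_def')
  have "y\<in>pm n" using y(1) ipow_Suc_sub[OF m_ideal] by auto
  hence "y\<oplus>(a\<ominus>b)\<in>pm n" using h idl_add[OF pm_ideal] by simp
  moreover have "x = (y\<oplus>(a\<ominus>b))\<oplus>b" using y(2) pm_carr[OF y(1)] assms by algebra
  ultimately show "x\<in>pm n +> b" unfolding a_r_coset_def' by auto
 qed
qed

lemma B_mem: "f\<in>carrier B \<longleftrightarrow> (\<forall>n. (\<exists>x\<in>\<R>. f n = pm n +> x) \<and> f (Suc n)\<subseteq>f n)"
 by (simp add: adic_completion_def Let_def FactRing_def A_RCOSETS_def' ipow_def)

lemma B_carr_iff: "f\<in>carrier B \<longleftrightarrow> (\<exists>a. coh a \<and> f = bs a)"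
proof
 assume f: "f\<in>carrier B"
 have "\<exists>x. x\<in>\<R> \<and> f n = pm n +> x" for n using f unfolding B_mem by blast
 then obtain a where a: "\<And>n. a n\<in>\<R> \<and> f n = pm n +> a n" by metis
 have "f (Suc n)\<subseteq>f n" for n using f unfolding B_mem by blast
 hence "coh a" using a coset_sub by (simp add: coh_def)
 moreover have "f = bs a" using a by (auto simp: bs_def)
 ultimately show "\<exists>a. coh a \<and> f = bs a" by blast
next
 assume "\<exists>a. coh a \<and> f = bs a"
 then obtain a where a: "coh a" "f = bs a" by auto
 show "f\<in>carrier B" unfolding B_mem using coset_sub a by (auto simp: bs_def coh_def)
qed

lemma bs_carr: "coh a ==> bs a\<in>carrier B" using B_carr_iff by auto

lemma bs_eq: "coh a ==> coh b ==> bs a = bs b \<longleftrightarrow> (\<forall>n. a n\<ominus>b n\<in>pm n)"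
 using coset_eq cohD by (auto simp: bs_def fun_eq_iff)

lemma bs_add: "coh a ==> coh b ==> bs a +. bs b = bs (\<lambda>n. a n\<oplus>b n)"
 by (auto simp: adic_completion_def Let_def FactRing_def ipow_def[symmetric] bs_def
   abelian_subgroup.a_rcos_sum[OF abelian_subgroupI3[OF ideal.axioms(1)[OF pm_ideal] is_abelian_group] cohD cohD])

lemma bs_mult: "coh a ==> coh b ==> bs a *. bs b = bs (\<lambda>n. a n\<otimes>b n)"
 by (auto simp: adic_completion_def Let_def FactRing_def ipow_def[symmetric] bs_def ideal.rcoset_mult_add[OF pm_ideal cohD cohD])

lemma B_one: "\<one>\<^bsub>B\<^esub> = io \<one>" by (auto simp: adic_completion_def Let_def FactRing_def ipow_def[symmetric] bs_def io_def)

lemma pm_coset: "pm n +> x = pm n \<longleftrightarrow> x\<in>pm n" if "x\<in>\<R>"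
proof -
 have "pm n +> \<zero> = pm n" using pm_carr by (auto simp: a_r_coset_def')
 moreover have "x\<ominus>\<zero> = x" using that by algebra
 ultimately show ?thesis using coset_eq[OF that zero_closed] by metis
qed

lemma B_zero: "\<zero>\<^bsub>B\<^esub> = io \<zero>"
 using pm_coset idl_zero[OF pm_ideal] by (auto simp: adic_completion_def Let_def FactRing_def ipow_def[symmetric] bs_def io_def)

lemma coh_const: "a\<in>\<R> ==> coh (\<lambda>_. a)" using idl_zero[OF pm_ideal] by (simp add: coh_def r_neg a_minus_def)

lemma coh_add: assumes a: "coh a" and b: "coh b" shows "coh (\<lambda>n. a n\<oplus>b n)" unfolding coh_def
proof (intro allI conjI)
 fix n show "a n\<oplus>b n\<in>\<R>" using cohD a b by simp
 have "(a (Suc n)\<ominus>a n)\<oplus>(b (Suc n)\<ominus>b n)\<in>pm n" using a b idl_add[OF pm_ideal] by (simp add: coh_def)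
 moreover have "a (Suc n)\<oplus>b (Suc n)\<ominus>(a n\<oplus>b n) = (a (Suc n)\<ominus>a n)\<oplus>(b (Suc n)\<ominus>b n)"
  using cohD[OF a, of n] cohD[OF a, of "Suc n"] cohD[OF b, of n] cohD[OF b, of "Suc n"] by algebra
 ultimately show "a (Suc n)\<oplus>b (Suc n)\<ominus>(a n\<oplus>b n)\<in>pm n" by simp
qed

lemma coh_mult: assumes a: "coh a" and b: "coh b" shows "coh (\<lambda>n. a n\<otimes>b n)" unfolding coh_def
proof (intro allI conjI)
 fix n show "a n\<otimes>b n\<in>\<R>" using cohD a b by simp
 have "b n\<otimes>(a (Suc n)\<ominus>a n)\<oplus>a (Suc n)\<otimes>(b (Suc n)\<ominus>b n)\<in>pm n"
  using a b idl_add[OF pm_ideal idl_l[OF pm_ideal] idl_l[OF pm_ideal]] by (simp add: coh_def)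
 moreover have "a (Suc n)\<otimes>b (Suc n)\<ominus>(a n\<otimes>b n) = b n\<otimes>(a (Suc n)\<ominus>a n)\<oplus>a (Suc n)\<otimes>(b (Suc n)\<ominus>b n)"
  using cohD[OF a, of n] cohD[OF a, of "Suc n"] cohD[OF b, of n] cohD[OF b, of "Suc n"] by algebra
 ultimately show "a (Suc n)\<otimes>b (Suc n)\<ominus>(a n\<otimes>b n)\<in>pm n" by simp
qed

lemma coh_neg: assumes a: "coh a" shows "coh (\<lambda>n.\<ominus>a n)"
proof -
 have "(\<lambda>n.\<ominus>a n) = (\<lambda>n.\<ominus>\<one>\<otimes>a n)" using cohD[OF a] l_minus by auto
 thus ?thesis using coh_mult[OF coh_const a, of "\<ominus> \<one>"] by simp
qed

lemma B_cring: "cring B"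
proof (rule cringI)
 have cases: "P f" if "f\<in>carrier B" "\<And>a. coh a ==> P (bs a)" for P f using that B_carr_iff by auto
 note s = bs_add bs_mult coh_add coh_mult B_zero B_one io_def coh_const
 show "abelian_group B"
 proof (rule abelian_groupI)
  fix x y z assume x: "x\<in>carrier B" and y: "y\<in>carrier B" and z: "z\<in>carrier B"
  obtain a b c where a: "coh a" "x = bs a" "coh b" "y = bs b" "coh c" "z = bs c" using x y z B_carr_iff by metis
  note c = cohD[OF a(1)] cohD[OF a(3)] cohD[OF a(5)]
  show "x +. y\<in>carrier B" using a by (simp add: s bs_carr)
  show "x +. y +. z = x +. (y +. z)" using a c by (simp add: s a_assoc)
  show "x +. y = y +. x" using a c by (simp add: s a_comm)
  show "\<zero>\<^bsub>B\<^esub> +. x = x" using a c by (simp add: s)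
  show "\<exists>y\<in>carrier B. y +. x = \<zero>\<^bsub>B\<^esub>"
   by (rule bexI[of _ "bs (\<lambda>n.\<ominus>a n)"]) (use a c in \<open>simp_all add: s coh_neg bs_carr l_neg\<close>)
 qed (simp add: s bs_carr)
 show "comm_monoid B"
 proof (rule comm_monoidI)
  fix x y z assume x: "x\<in>carrier B" and y: "y\<in>carrier B" and z: "z\<in>carrier B"
  obtain a b c where a: "coh a" "x = bs a" "coh b" "y = bs b" "coh c" "z = bs c" using x y z B_carr_iff by metis
  note c = cohD[OF a(1)] cohD[OF a(3)] cohD[OF a(5)]
  show "x *. y\<in>carrier B" using a by (simp add: s bs_carr)
  show "x *. y *. z = x *. (y *. z)" using a c by (simp add: s m_assoc)
  show "x *. y = y *. x" using a c by (simp add: s m_comm)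
  show "\<one>\<^bsub>B\<^esub> *. x = x" using a c by (simp add: s)
 qed (simp add: s bs_carr)
 fix x y z assume x: "x\<in>carrier B" and y: "y\<in>carrier B" and z: "z\<in>carrier B"
 obtain a b c where a: "coh a" "x = bs a" "coh b" "y = bs b" "coh c" "z = bs c" using x y z B_carr_iff by metis
 note c = cohD[OF a(1)] cohD[OF a(3)] cohD[OF a(5)]
 show "(x +. y) *. z = x *. z +. y *. z" using a c by (simp add: s l_distr)
qed

sublocale B: cring B by (rule B_cring)

lemma bs_neg: assumes "coh a" shows "\<ominus>\<^bsub>B\<^esub> bs a = bs (\<lambda>n.\<ominus>a n)"
proof (rule B.minus_equality)
 show "bs (\<lambda>n.\<ominus>a n) +. bs a = \<zero>\<^bsub>B\<^esub>" using assms cohD by (simp add: bs_add coh_neg B_zero io_def l_neg)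
qed (use assms in \<open>simp_all add: bs_carr coh_neg\<close>)

lemma bs_minus: "coh a ==> coh b ==> bs a -. bs b = bs (\<lambda>n. a n\<ominus>b n)" by (simp add: bs_neg bs_add coh_neg a_minus_def)

lemma coh_minus: "coh a ==> coh b ==> coh (\<lambda>n. a n\<ominus>b n)" by (simp add: coh_add coh_neg a_minus_def)

lemma bs_M: "coh a ==> bs a\<in>M n \<longleftrightarrow> a n\<in>pm n"
 unfolding M_def using pm_coset cohD[of a n] bs_carr[of a] by (simp add: bs_def)

lemma M_cases:
 assumes f: "f\<in>M n" shows "\<exists>a. coh a \<and> f = bs a \<and> a n\<in>pm n"
proof -
 from f have "f\<in>carrier B" by (simp add: M_def)
 then obtain a where "coh a" "f = bs a" unfolding B_carr_iff by blast
 thus ?thesis using f bs_M by blast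
qed

lemma coh_le:
 assumes a: "coh a" and "n\<le>m" shows "a m\<ominus>a n\<in>pm n" using assms(2)
proof (induction m rule: dec_induct)
 case base show ?case using idl_zero[OF pm_ideal] cohD[OF a] by (simp add: r_neg a_minus_def)
next
 case (step m)
 have "a (Suc m)\<ominus>a m\<in>pm n" using a ipow_antimono[OF m_ideal step(1)] unfolding coh_def by auto
 hence "(a (Suc m)\<ominus>a m)\<oplus>(a m\<ominus>a n)\<in>pm n" using step(3) idl_add[OF pm_ideal] by simp
 moreover have "(a (Suc m)\<ominus>a m)\<oplus>(a m\<ominus>a n) = a (Suc m)\<ominus>a n" using cohD[OF a, of n] cohD[OF a, of m] cohD[OF a, of "Suc m"] by algebra
 ultimately show ?case by simp
qed

lemma M_ideal: "ideal (M n) B"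
proof (rule B.idealI')
 show "M n\<subseteq>carrier B" by (auto simp: M_def)
 show "\<zero>\<^bsub>B\<^esub>\<in>M n" unfolding B_zero io_def using bs_M[OF coh_const[OF zero_closed]] idl_zero[OF pm_ideal] by simp
 fix x assume x: "x\<in>M n"
 then obtain a where a: "coh a" "x = bs a" using B_carr_iff by (auto simp: M_def)
 hence an: "a n\<in>pm n" using x bs_M by simp
 { fix y assume y: "y\<in>M n"
  then obtain b where b: "coh b" "y = bs b" using B_carr_iff by (auto simp: M_def)
  thus "x +. y\<in>M n" using y a an bs_M by (simp add: bs_add coh_add idl_add[OF pm_ideal]) }
 { fix y assume y: "y\<in>carrier B"
  then obtain b where b: "coh b" "y = bs b" using B_carr_iff by auto
  thus "y *. x\<in>M n" using y a an bs_M by (simp add: bs_mult coh_mult idl_l[OF pm_ideal] cohD) }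
qed

lemma M_carr: "f\<in>M n ==> f\<in>carrier B" by (simp add: M_def)

lemma M_mult:
 assumes x: "x\<in>M m" and y: "y\<in>M n" shows "x *. y\<in>M (m + n)"
proof -
 obtain a b where a: "coh a" "x = bs a" "coh b" "y = bs b" using M_cases[OF x] M_cases[OF y] by auto
 have "a (m + n)\<in>pm m" if "coh a" "bs a\<in>M m" for a m n
  using coh_le[OF that(1), of m "m + n"] that bs_M idl_cancel_minus[OF pm_ideal] cohD by simp
 hence "a (m + n)\<in>pm m" "b (m + n)\<in>pm n" using a x y by (metis, metis add.commute)
 thus ?thesis using a ipow_mult[OF m_ideal] bs_M by (simp add: bs_mult coh_mult)
qed

lemma M_antimono:
 assumes "m\<le>n" shows "M n\<subseteq>M m"
proof
 fix x assume x: "x\<in>M n"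
 obtain a where a: "coh a" "x = bs a" using M_cases[OF x] by auto
 have "a n\<in>pm m" using bs_M a x ipow_antimono[OF m_ideal assms] by auto
 moreover have "\<ominus> (a n\<ominus>a m)\<in>pm m" using coh_le[OF a(1) assms] idl_neg[OF pm_ideal] by simp
 ultimately have "a n\<oplus>\<ominus> (a n\<ominus>a m)\<in>pm m" using idl_add[OF pm_ideal] by simp
 moreover have "a n\<oplus>\<ominus> (a n\<ominus>a m) = a m" using cohD[OF a(1), of n] cohD[OF a(1), of m] by algebra
 ultimately show "x\<in>M m" using a bs_M by simp
qed

lemma M_0: "M 0 = carrier B"
proof
 show "carrier B\<subseteq>M 0"
 proof
  fix f assume "f\<in>carrier B"
  then obtain a where a: "coh a" "f = bs a" unfolding B_carr_iff by blast
  show "f\<in>M 0" unfolding a(2) using a(1) cohD by (simp add: bs_M)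
 qed
qed (auto simp: M_def)

lemma M_sep: assumes "\<And>n. f\<in>M n" shows "f = \<zero>\<^bsub>B\<^esub>"
proof -
 obtain a where a: "coh a" "f = bs a" using M_cases[OF assms] by auto
 have "a n\<ominus>\<zero>\<in>pm n" for n using assms[of n] a bs_M cohD by (simp add: a_minus_def)
 thus ?thesis unfolding a(2) B_zero io_def using bs_eq[OF a(1) coh_const[OF zero_closed]] by simp
qed

lemma io_carr: "a\<in>\<R> ==> io a\<in>carrier B" by (simp add: io_def bs_carr coh_const)
lemma io_add: "a\<in>\<R> ==> b\<in>\<R> ==> io a +. io b = io (a\<oplus>b)" by (simp add: io_def bs_add coh_const)
lemma io_minus: "a\<in>\<R> ==> b\<in>\<R> ==> io a -. io b = io (a\<ominus>b)" by (simp add: io_def bs_minus coh_const)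
lemma io_mult: "a\<in>\<R> ==> b\<in>\<R> ==> io a *. io b = io (a\<otimes>b)" by (simp add: io_def bs_mult coh_const)
lemma io_pow: "a\<in>\<R> ==> io a[^]\<^bsub>B\<^esub>(n::nat) = io (a[^]n)" by (induction n) (simp_all add: B_one io_mult)
lemma io_M: "a\<in>\<R> ==> io a\<in>M n \<longleftrightarrow> a\<in>pm n" by (simp add: io_def bs_M coh_const)

lemma dense:
 assumes "f\<in>carrier B" shows "\<exists>a\<in>\<R>. f -. io a\<in>M n"
proof -
 obtain b where b: "coh b" "f = bs b" using assms B_carr_iff by blast
 have "f -. io (b n)\<in>M n" unfolding b(2) io_def using b(1) cohD[OF b(1), of n] idl_zero[OF pm_ideal]
  by (simp add: bs_minus bs_M coh_minus coh_const) (simp add: r_neg a_minus_def)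
 thus ?thesis using cohD[OF b(1)] by auto
qed

lemma cauchy:
 assumes s: "\<And>k. s k\<in>carrier B" "\<And>k. s (Suc k) -. s k\<in>M k" shows "\<exists>z\<in>carrier B. \<forall>N. z -. s N\<in>M N"
proof -
 have "\<exists>a. coh a \<and> s k = bs a" for k using s(1)[of k] unfolding B_carr_iff .
 then obtain c where c: "\<And>k. coh (c k)" "\<And>k. s k = bs (c k)" by metis
 note cc = cohD[OF c(1)]
 \<comment> \<open>The diagonal of the representing sequences represents the limit.\<close>
 define d where "d = (\<lambda>n. c n n)"
 have d: "coh d" unfolding coh_def
 proof (intro allI conjI)
  fix n show "d n\<in>\<R>" by (simp add: d_def cc)
  have "c (Suc n) n\<ominus>c n n\<in>pm n" using s(2) c by (simp add: bs_minus coh_minus bs_M)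
  hence "(c (Suc n) (Suc n)\<ominus>c (Suc n) n)\<oplus>(c (Suc n) n\<ominus>c n n)\<in>pm n" using c(1) idl_add[OF pm_ideal] by (simp add: coh_def)
  moreover have "(c (Suc n) (Suc n)\<ominus>c (Suc n) n)\<oplus>(c (Suc n) n\<ominus>c n n) = d (Suc n)\<ominus>d n" unfolding d_def
   using cc[of n n] cc[of "Suc n" n] cc by algebra
  ultimately show "d (Suc n)\<ominus>d n\<in>pm n" by simp
 qed
 have "bs d -. s N\<in>M N" for N
  unfolding c(2) using c(1) d idl_zero[OF pm_ideal] cc by (simp add: bs_minus coh_minus bs_M) (simp add: d_def cc r_neg a_minus_def)
 thus ?thesis using bs_carr[OF d] by auto
qed

end

section \<open>Complete filtered rings\<close>

locale complete_filtered_cring = cring +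
 fixes M :: "nat\<Rightarrow>'a set"
 assumes M_ideal: "ideal (M n) R" and M_0: "M 0 = carrier R" and M_antimono: "m\<le>n ==> M n\<subseteq>M m"
  and M_mult: "x\<in>M m ==> y\<in>M n ==> x\<otimes>y\<in>M (m + n)" and M_sep: "(\<And>n. f\<in>M n) ==> f = \<zero>"
  and cauchy: "(\<And>k. s k\<in>carrier R) ==> (\<And>k. s (Suc k)\<ominus>s k\<in>M k) ==> \<exists>z\<in>carrier R. \<forall>n. z\<ominus>s n\<in>M n"
begin

lemma M_carr: "f\<in>M n ==> f\<in>\<R>" by (rule idl_carr[OF M_ideal])

lemma M_pow: "x\<in>M 1 ==> x[^]k\<in>M k" for k :: nat by (induction k) (use M_mult[of "x[^]_" _ x 1] M_0 in simp_all)

lemma M_limit: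
 assumes "z\<in>\<R>" "\<And>n. n\<ge>n0 ==> s n\<in>M N" "\<And>n. z\<ominus>s n\<in>M n" shows "z\<in>M N"
proof -
 have "z\<ominus>s (max n0 N)\<in>M N" using assms(3) M_antimono[of N "max n0 N"] by auto
 moreover have "s (max n0 N)\<in>M N" by (rule assms(2)) simp
 ultimately show ?thesis by (rule idl_cancel_minus[OF M_ideal _ _ assms(1)])
qed

primrec psum where "psum h 0 = \<zero>" | "psum h (Suc n) = psum h n\<oplus>h n"

lemma psum_ideal: "ideal J R ==> (\<And>n. h n\<in>J) ==> psum h n\<in>J" by (induction n) (simp_all add: idl_zero idl_add)

lemma psum_limit:
 assumes h: "\<And>k. h k\<in>M (N + k)" shows "\<exists>z\<in>M N. \<forall>n. z\<ominus>psum h n\<in>M n"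
proof -
 have hN: "h k\<in>M N" for k using h M_antimono[of N "N + k"] by auto
 have p: "psum h n\<in>M N" for n by (rule psum_ideal[OF M_ideal hN])
 have "psum h (Suc k)\<ominus>psum h k\<in>M k" for k
 proof -
  have "psum h (Suc k)\<ominus>psum h k = h k" using M_carr[OF p[of k]] M_carr[OF hN[of k]] unfolding psum.simps by algebra
  thus ?thesis using h M_antimono[of k "N + k"] by auto
 qed
 then obtain z where z: "z\<in>\<R>" "\<And>n. z\<ominus>psum h n\<in>M n" using cauchy[of "psum h"] M_carr[OF p] by auto
 moreover have "z\<in>M N" by (rule M_limit[OF z(1) p z(2)])
 ultimately show ?thesis by auto
qed

text \<open>Each coefficient sequence is summed on its own, so the limit is a combination of the
  same finite list.\<close>

lemma lin_limit:
 assumes "set gs\<subseteq>\<R>" "\<And>k. h k\<in>lin gs (M (N + k))" shows "\<exists>z\<in>lin gs (M N). \<forall>n. z\<ominus>psum h n\<in>M n"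
 using assms
proof (induction gs arbitrary: h)
 case Nil
 hence h: "\<And>k. h k = \<zero>" by simp
 have "psum h n = \<zero>" for n by (induction n) (simp_all add: h)
 thus ?case using idl_zero[OF M_ideal] by (simp add: a_minus_def)
next
 case (Cons g gs)
 have gc: "g\<in>\<R>" "set gs\<subseteq>\<R>" using Cons.prems(1) by auto
 have "\<exists>y c. y\<in>lin gs (M (N + k)) \<and> c\<in>M (N + k) \<and> h k = y\<oplus>c\<otimes>g" for k
  using Cons.prems(2)[of k] unfolding lin.simps adjm_def by blast
 then obtain y c where y: "\<And>k. y k\<in>lin gs (M (N + k))" and c: "\<And>k. c k\<in>M (N + k)" and h: "\<And>k. h k = y k\<oplus>c k\<otimes>g" by metis
 obtain u where u: "u\<in>lin gs (M N)" "\<And>n. u\<ominus>psum y n\<in>M n" using Cons.IH[OF gc(2) y] by auto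
 obtain d where d: "d\<in>M N" "\<And>n. d\<ominus>psum c n\<in>M n" using psum_limit[OF c] by auto
 have yc: "y k\<in>\<R>" for k by (rule idl_carr[OF lin_ideal[OF M_ideal gc(2)] y])
 have cc: "c k\<in>\<R>" for k by (rule M_carr[OF c])
 have yn: "psum y n\<in>\<R>" "psum c n\<in>\<R>" for n by (rule psum_ideal[OF oneideal], simp add: yc cc)+
 have uc: "u\<in>\<R>" "d\<in>\<R>" using idl_carr[OF lin_ideal[OF M_ideal gc(2)] u(1)] M_carr[OF d(1)] by auto
 have e: "psum h n = psum y n\<oplus>psum c n\<otimes>g" for n
 proof (induction n)
  case 0 show ?case using gc by simp
 next
  case (Suc n)
  have "psum y n\<oplus>psum c n\<otimes>g\<oplus>(y n\<oplus>c n\<otimes>g) = psum y n\<oplus>y n\<oplus>(psum c n\<oplus>c n)\<otimes>g"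
   using yn yc[of n] cc[of n] gc(1) by algebra
  thus ?case using Suc h by simp
 qed
 have "u\<oplus>d\<otimes>g\<ominus>psum h n\<in>M n" for n
 proof -
  have "(u\<ominus>psum y n)\<oplus>(d\<ominus>psum c n)\<otimes>g = u\<oplus>d\<otimes>g\<ominus>psum h n" unfolding e using yn uc gc(1) by algebra
  moreover have "(u\<ominus>psum y n)\<oplus>(d\<ominus>psum c n)\<otimes>g\<in>M n" by (rule idl_add[OF M_ideal u(2) idl_r[OF M_ideal d(2) gc(1)]])
  ultimately show ?thesis by simp
 qed
 moreover have "u\<oplus>d\<otimes>g\<in>lin (g # gs) (M N)" using u(1) d(1) unfolding lin.simps adjm_def by blast
 ultimately show ?case by blast
qed

text \<open>Successive approximation: an element of \<open>S 0\<close> that can be approximated again and again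
 by combinations of \<open>gs\<close> with smaller and smaller coefficients is itself such a combination.\<close>
lemma approx:
 assumes gs: "set gs\<subseteq>\<R>" and S: "\<And>k. S k\<subseteq>M k"
  and step: "\<And>k h. h\<in>S k ==> \<exists>y\<in>lin gs (M (N + k)). h\<ominus>y\<in>S (Suc k)" shows "S 0\<subseteq>lin gs (M N)"
proof
 fix f assume f: "f\<in>S 0"
 have "\<exists>r. \<forall>k. (r k\<in>S k \<and> (k = 0 \<longrightarrow> r k = f)) \<and> r k\<ominus>r (Suc k)\<in>lin gs (M (N + k))"
 proof (rule dependent_nat_choice)
  show "\<exists>x. x\<in>S 0 \<and> (0 = (0::nat) \<longrightarrow> x = f)" using f by auto
  fix x k assume x: "x\<in>S k \<and> (k = 0 \<longrightarrow> x = f)"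
  then obtain y where y: "y\<in>lin gs (M (N + k))" "x\<ominus>y\<in>S (Suc k)" using step by metis
  have "x\<in>\<R>" "y\<in>\<R>" using S x M_carr idl_carr[OF lin_ideal[OF M_ideal gs] y(1)] by auto
  hence "x\<ominus>(x\<ominus>y) = y" by algebra
  thus "\<exists>y. (y\<in>S (Suc k) \<and> (Suc k = 0 \<longrightarrow> y = f)) \<and> x\<ominus>y\<in>lin gs (M (N + k))" using y by auto
 qed
 then obtain r where r: "\<And>k. r k\<in>S k" "r 0 = f" "\<And>k. r k\<ominus>r (Suc k)\<in>lin gs (M (N + k))" by auto
 have rM: "r k\<in>M k" for k using S r(1) by auto
 note rc = M_carr[OF rM]
 define h where "h k = r k\<ominus>r (Suc k)" for k
 have ps: "psum h n = f\<ominus>r n" for n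
 proof (induction n)
  case 0 show ?case using r(2) rc[of 0] by (simp add: r_neg a_minus_def)
 next
  case (Suc n)
  have "f\<ominus>r n\<oplus>(r n\<ominus>r (Suc n)) = f\<ominus>r (Suc n)" using rc[of 0] rc[of n] rc[of "Suc n"] unfolding r(2) by algebra
  thus ?case using Suc by (simp add: h_def)
 qed
 obtain z where z: "z\<in>lin gs (M N)" "\<And>n. z\<ominus>psum h n\<in>M n" using lin_limit[OF gs, of h N] r(3) unfolding h_def by auto
 have zc: "z\<in>\<R>" by (rule idl_carr[OF lin_ideal[OF M_ideal gs] z(1)])
 have fc: "f\<in>\<R>" using rc[of 0] r(2) by simp
 have "z\<ominus>f\<in>M n" for n
 proof -
  have "(z\<ominus>(f\<ominus>r n))\<ominus>r n\<in>M n" using z(2)[of n] idl_minus[OF M_ideal _ rM] unfolding ps by simp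
  moreover have "(z\<ominus>(f\<ominus>r n))\<ominus>r n = z\<ominus>f" using zc fc rc by algebra
  ultimately show ?thesis by simp
 qed
 hence "z\<ominus>f = \<zero>" by (rule M_sep)
 hence "z = f" using zc fc by simp
 thus "f\<in>lin gs (M N)" using z(1) by simp
qed

text \<open>With \<open>h = 1 - y x\<close> in \<open>M 1\<close> the geometric series in
  \<open>h\<close> converges to an inverse of \<open>y x\<close>.\<close>

lemma unit:
 assumes x: "x\<in>\<R>" "y\<in>\<R>" "\<one>\<ominus>y\<otimes>x\<in>M 1" shows "\<exists>z\<in>\<R>. z\<otimes>x = \<one>"
proof -
 define h where "h = \<one>\<ominus>y\<otimes>x"
 have hk: "h[^]n\<in>M n" for n :: nat using M_pow x(3) by (simp add: h_def)
 let ?s = "psum (\<lambda>k. h[^]k)"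
 obtain z where z: "z\<in>\<R>" "\<And>n. z\<ominus>?s n\<in>M n" using psum_limit[of "\<lambda>k. h[^]k" 0] hk M_0 by auto
 have c: "?s n\<in>\<R>" "h\<in>\<R>" "h[^]n\<in>\<R>" for n using psum_ideal[OF oneideal, of "\<lambda>k. h[^]k"] x by (auto simp: h_def)
 have s: "?s n\<otimes>(y\<otimes>x)\<oplus>h[^]n = \<one>" for n
 proof (induction n)
  case (Suc n)
  have "(?s n\<oplus>h[^]n)\<otimes>(y\<otimes>x)\<oplus>h[^]n\<otimes>(\<one>\<ominus>y\<otimes>x) = ?s n\<otimes>(y\<otimes>x)\<oplus>h[^]n" using c x(1,2) by algebra
  thus ?case using Suc by (simp add: h_def)
 qed (use x in simp)
 have "z\<otimes>(y\<otimes>x)\<ominus>\<one>\<in>M n" for n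
 proof -
  have "(z\<ominus>?s n)\<otimes>(y\<otimes>x)\<ominus>h[^]n\<in>M n" using idl_minus[OF M_ideal idl_r[OF M_ideal z(2)] hk] x by simp
  moreover have "(z\<ominus>?s n)\<otimes>(y\<otimes>x)\<ominus>h[^]n = z\<otimes>(y\<otimes>x)\<ominus>(?s n\<otimes>(y\<otimes>x)\<oplus>h[^]n)" using c z(1) x(1,2) by algebra
  ultimately show ?thesis using s by simp
 qed
 hence "z\<otimes>(y\<otimes>x)\<ominus>\<one> = \<zero>" by (rule M_sep)
 thus ?thesis using z(1) x by (intro bexI[of _ "z\<otimes>y"]) (simp_all add: m_assoc)
qed

text \<open>By Cohen's criterion only primes matter. For a prime other than \<open>M 1\<close> pick
  \<open>x\<close> in \<open>M 1\<close> outside it: modulo \<open>x\<close> it is generated by a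
  finite set \<open>S\<close>, and expansion in powers of \<open>x\<close> shows that
  \<open>S\<close> generates it outright.\<close>

lemma noetherian:
 assumes proper: "\<And>J. ideal J R ==> \<one>\<notin>J ==> J\<subseteq>M 1" and fs: "set fs\<subseteq>M 1" "M 1\<subseteq>lin fs (\<R>)"
 shows "noetherian_ring R"
proof (rule noetherian_if_primes_fg)
 fix P assume Pi: "ideal P R" and P: "primeideal P R"
  and fg: "\<And>x. x\<in>\<R> - P ==> \<exists>S. finite S \<and> S\<subseteq>P \<and> P\<subseteq>adj (Idl S) x"
 have PM: "P\<subseteq>M 1" by (rule proper[OF Pi prime_one[OF P]])
 have "\<exists>gs. set gs\<subseteq>P \<and> P\<subseteq>lin gs (\<R>)"
 proof (cases "P = M 1")
  case False
  then obtain x where x: "x\<in>M 1" "x\<notin>P" using PM by auto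
  note xc = M_carr[OF x(1)] and xk = M_pow[OF x(1)]
  obtain S where S: "finite S" "S\<subseteq>P" "P\<subseteq>adj (Idl S) x" using fg[of x] x xc by auto
  obtain gs where gs: "set gs = S" using S(1) finite_list by auto
  have gc: "set gs\<subseteq>\<R>" using gs S(2) idl_sub[OF Pi] by auto
  \<comment> \<open>The remainders after \<open>k\<close> rounds. In \<open>q = i + r x\<close> with
    \<open>i\<close> generated by \<open>S\<close>, primality puts \<open>r\<close> back into
    \<open>P\<close>, so the next remainder is \<open>x^(k+1) r\<close>.\<close>
  let ?S = "\<lambda>k::nat. {x[^]k\<otimes>q | q. q\<in>P}"
  have "?S 0\<subseteq>lin gs (M 0)"
  proof (rule approx[OF gc, where S = ?S])
   fix k :: nat
   show "?S k\<subseteq>M k" using idl_r[OF M_ideal xk] idl_carr[OF Pi] by blast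
   fix h assume "h\<in>?S k"
   then obtain q where q: "q\<in>P" "h = x[^]k\<otimes>q" by auto
   obtain i r where ir: "i\<in>Idl S" "r\<in>\<R>" "q = i\<oplus>r\<otimes>x" using adjD q(1) S(3) by blast
   have iP: "i\<in>P" using genideal_minimal[OF Pi S(2)] ir(1) by auto
   have c: "i\<in>\<R>" "x[^]k\<in>\<R>" using idl_carr[OF Pi iP] xc by auto
   have "q\<ominus>i = r\<otimes>x" unfolding ir(3) using c ir(2) xc by algebra
   hence "r\<in>P" using primeD[OF P ir(2) xc] x(2) idl_minus[OF Pi q(1) iP] by auto
   moreover have "h\<ominus>x[^]k\<otimes>i = (x[^]k\<otimes>x)\<otimes>r" unfolding q(2) ir(3) using c ir(2) xc by algebra
   moreover have "x[^]k\<otimes>i\<in>lin gs (M (0 + k))" using lin_Idl[OF M_ideal gc xk] ir(1) gs by simp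
   ultimately show "\<exists>y\<in>lin gs (M (0 + k)). h\<ominus>y\<in>?S (Suc k)" by auto
  qed
  moreover have "?S 0 = P" using idl_carr[OF Pi] by force
  ultimately show ?thesis using gs S(2) M_0 by auto
 qed (use fs in auto)
 then obtain gs where gs: "set gs\<subseteq>P" "P\<subseteq>lin gs (\<R>)" by auto
 have gc: "set gs\<subseteq>\<R>" using gs(1) idl_sub[OF Pi] by auto
 have "P = Idl (set gs)" using gs(2) genideal_minimal[OF Pi gs(1)] unfolding lin_carrier[OF gc] by auto
 thus "\<exists>S\<subseteq>\<R>. finite S \<and> P = Idl S" using gc by (intro exI[of _ "set gs"]) simp
qed

end

context local_completion
begin

sublocale BM: complete_filtered_cring B M
 by (intro complete_filtered_cring.intro complete_filtered_cring_axioms.intro B_cring M_ideal M_0 M_antimono M_mult M_sep cauchy)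

lemma io_lin: "set gs\<subseteq>\<R> ==> a\<in>lin gs (pm n) ==> io a\<in>B.lin (map io gs) (M n)"
proof (induction gs arbitrary: a)
 case Nil thus ?case by (simp add: B_zero)
next
 case (Cons g gs)
 obtain y c where a: "y\<in>lin gs (pm n)" "c\<in>pm n" "a = y\<oplus>c\<otimes>g" using Cons.prems(2) by (auto simp: adjm_def)
 have gc: "g\<in>\<R>" "set gs\<subseteq>\<R>" using Cons.prems(1) by auto
 have c: "y\<in>\<R>" "c\<in>\<R>" using idl_carr[OF lin_ideal[OF pm_ideal gc(2)] a(1)] pm_carr[OF a(2)] by auto
 have "io a = io y +. io c *. io g" using c gc by (simp add: a(3) io_add io_mult)
 moreover have "io c\<in>M n" using io_M c a(2) by simp
 moreover have "io y\<in>B.lin (map io gs) (M n)" by (rule Cons.IH[OF gc(2) a(1)])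
 ultimately show ?case unfolding B.lin.simps list.map B.adjm_def by blast
qed

text \<open>An element is approximated by one of \<open>R\<close>, which is a combination of the
  generators with coefficients one power lower. The error is one power higher, so the approximations
  can be summed.\<close>

lemma M_Suc_lin:
 assumes gs: "set gs\<subseteq>\<R>" "\<mm> = Idl (set gs)" shows "M (Suc N)\<subseteq>B.lin (map io gs) (M N)"
proof -
 have gc: "set (map io gs)\<subseteq>carrier B" using gs(1) io_carr by auto
 have "(\<lambda>k. M (Suc (N + k))) 0\<subseteq>B.lin (map io gs) (M N)"
 proof (rule BM.approx[OF gc])
  show "M (Suc (N + k))\<subseteq>M k" for k by (rule M_antimono) simp
  fix k h assume h: "h\<in>M (Suc (N + k))"
  obtain a where a: "a\<in>\<R>" "h -. io a\<in>M (Suc (Suc (N + k)))" using dense[OF M_carr[OF h]] by auto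
  have "h -. (h -. io a)\<in>M (Suc (N + k))" using B.idl_minus[OF M_ideal h] a(2) M_antimono[of "Suc (N + k)" "Suc (Suc (N + k))"] by auto
  moreover have "h -. (h -. io a) = io a" using M_carr[OF h] io_carr[OF a(1)] by algebra
  ultimately have "a\<in>pm (Suc (N + k))" using io_M[OF a(1)] by simp
  moreover have "pm (Suc (N + k))\<subseteq>lin gs (pm (N + k))" unfolding ipow_Suc
   by (rule ideal_prod_least[OF lin_ideal[OF pm_ideal gs(1)]]) (use lin_Idl[OF pm_ideal gs(1)] gs(2) in blast)
  ultimately have "io a\<in>B.lin (map io gs) (M (N + k))" using io_lin[OF gs(1)] by auto
  thus "\<exists>y\<in>B.lin (map io gs) (M (N + k)). h -. y\<in>M (Suc (N + Suc k))" using a(2) by auto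
 qed
 thus ?thesis by simp
qed

sublocale BL: noeth_local B "M 1"
proof -
 obtain gs where gs: "set gs\<subseteq>\<R>" "\<mm> = Idl (set gs)" using finetely_gen[OF m_ideal] finite_list by metis
 \<comment> \<open>An element outside \<open>M 1\<close> is congruent modulo \<open>M 1\<close> to
   the image of a unit of \<open>R\<close>, and \<open>BM.unit\<close> turns an inverse modulo
   \<open>M 1\<close> into an inverse.\<close>
 have "J\<subseteq>M 1" if J: "ideal J B" "\<one>\<^bsub>B\<^esub>\<notin>J" for J
 proof (rule subsetI, rule ccontr)
  fix f assume f: "f\<in>J" "f\<notin>M 1"
  note fc = B.idl_carr[OF J(1) f(1)]
  obtain a where a: "a\<in>\<R>" "f -. io a\<in>M 1" using dense[OF fc] by auto
  have "a\<notin>\<mm>" using f(2) B.idl_cancel_minus[OF M_ideal a(2) _ fc] io_M[OF a(1), of 1] ipow_1[OF m_ideal] by auto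
  then obtain b where b: "b\<in>\<R>" "b\<otimes>a = \<one>" using unit_inv a(1) by auto
  note c = fc io_carr[OF a(1)] io_carr[OF b(1)]
  have "\<ominus>\<^bsub>B\<^esub> (io b *. (f -. io a))\<in>M 1" by (rule B.idl_neg[OF M_ideal B.idl_l[OF M_ideal a(2) c(3)]])
  moreover have "\<ominus>\<^bsub>B\<^esub> (io b *. (f -. io a)) = io b *. io a -. io b *. f" using c by algebra
  moreover have "io b *. io a = \<one>\<^bsub>B\<^esub>" using a(1) b by (simp add: io_mult B_one)
  ultimately obtain z where "z\<in>carrier B" "z *. f = \<one>\<^bsub>B\<^esub>" using BM.unit[OF c(1,3)] by auto
  thus False using B.idl_l[OF J(1) f(1)] J(2) by metis
 qed
 note proper = this
 have gM: "set (map io gs)\<subseteq>M 1" using gs genideal_self io_M[of _ 1] ipow_1[OF m_ideal] by auto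
 have "noetherian_ring B" using BM.noetherian[OF proper gM] M_Suc_lin[OF gs, of 0] by (simp add: M_0)
 moreover have "\<one>\<^bsub>B\<^esub>\<notin>M 1" unfolding B_one io_M[OF one_closed] using one_notin_m ipow_1[OF m_ideal] by simp
 ultimately show "noeth_local B (M 1)" using B.local_ringI'[OF M_ideal _ proper] B_cring
  by (intro noeth_local.intro noeth_cring.intro noeth_local_axioms.intro) auto
qed

lemma M_ipow: "M n = BL.ipow (M 1) n"
proof (induction n)
 case 0 show ?case by (simp add: M_0)
next
 case (Suc n)
 obtain gs where gs: "set gs\<subseteq>\<R>" "\<mm> = Idl (set gs)" using finetely_gen[OF m_ideal] finite_list by metis
 have gM: "set (map io gs)\<subseteq>M 1" using gs genideal_self io_M[of _ 1] ipow_1[OF m_ideal] by auto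
 have "ideal_prod B (M n) (M 1)\<subseteq>M (Suc n)" by (rule BL.ideal_prod_least[OF M_ideal]) (use M_mult[of _ n _ 1] in simp)
 moreover have "B.lin (map io gs) (M n)\<subseteq>ideal_prod B (M n) (M 1)"
  by (rule B.lin_sub[OF B.ideal_prod_is_ideal[OF M_ideal M_ideal]]) (use gM in \<open>auto intro: ideal_prod.prod\<close>)
 ultimately show ?case unfolding BL.ipow_Suc Suc[symmetric] using M_Suc_lin[OF gs, of n] by auto
qed

end

context noeth_local
begin

lemma sop_power:
 assumes "sop xs" shows "\<exists>N. ipow \<mm> N\<subseteq>Idl (set xs)"
proof -
 have "set xs\<subseteq>\<R>" using assms m_sub by (auto simp: sop_def)
 thus ?thesis using radical_power[OF genideal_ideal m_ideal] sop_pow[OF assms] by metis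
qed

end

section \<open>Parameter ideals under completion\<close>

locale local_completion_p = local_completion + noeth_local_p
begin

definition iS where "iS S = Idl\<^bsub>B\<^esub> (io ` S)"

lemma io_sub: "S\<subseteq>\<R> ==> io ` S\<subseteq>carrier B" using io_carr by auto
lemma iS_ideal: "S\<subseteq>\<R> ==> ideal (iS S) B" unfolding iS_def by (rule B.genideal_ideal[OF io_sub])

definition near where "near n f a \<longleftrightarrow> f\<in>carrier B \<and> a\<in>\<R> \<and> f -. io a\<in>M n"

lemma nearD: "near n f a ==> f\<in>carrier B" "near n f a ==> a\<in>\<R>" by (simp_all add: near_def)

lemma near_io: "a\<in>\<R> ==> near n (io a) a" using io_carr B.idl_zero[OF M_ideal] by (simp add: near_def a_minus_def B.r_neg)

lemma near_ex: "f\<in>carrier B ==> \<exists>a. near n f a" using dense by (auto simp: near_def)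

lemma near_mono: "near n f a ==> m\<le>n ==> near m f a" using M_antimono by (auto simp: near_def)

lemma near_add:
 assumes "near n f a" "near n g b" shows "near n (f +. g) (a\<oplus>b)"
proof -
 have c: "f\<in>carrier B" "g\<in>carrier B" "a\<in>\<R>" "b\<in>\<R>" using assms nearD by auto
 have "(f -. io a) +. (g -. io b) = (f +. g) -. io (a\<oplus>b)" using c io_carr unfolding io_add[OF c(3,4), symmetric] by algebra
 thus ?thesis using assms B.idl_add[OF M_ideal, of "f -. io a" n "g -. io b"] by (simp add: near_def)
qed

lemma near_mult:
 assumes "near n f a" "near n g b" shows "near n (f *. g) (a\<otimes>b)"
proof -
 have c: "f\<in>carrier B" "g\<in>carrier B" "a\<in>\<R>" "b\<in>\<R>" using assms nearD by auto
 have "(f -. io a) *. g +. io a *. (g -. io b) = f *. g -. io (a\<otimes>b)" using c io_carr unfolding io_mult[OF c(3,4), symmetric] by algebra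
 moreover have "(f -. io a) *. g +. io a *. (g -. io b)\<in>M n"
  using B.idl_add[OF M_ideal B.idl_r[OF M_ideal] B.idl_l[OF M_ideal]] assms c io_carr by (simp add: near_def)
 ultimately show ?thesis using c by (simp add: near_def)
qed

lemma near_pow: "near n f a ==> near n (f[^]\<^bsub>B\<^esub>k) (a[^]k)" for k :: nat by (induction k) (simp_all add: near_mult B_one near_io)

lemma near_iff:
 assumes h: "near n f a" "b\<in>\<R>" shows "near n f b \<longleftrightarrow> a\<ominus>b\<in>pm n"
proof -
 from h have c: "f\<in>carrier B" "io a\<in>carrier B" "io b\<in>carrier B" "a\<in>\<R>" "f -. io a\<in>M n" using io_carr by (auto simp: near_def)
 have "(f -. io b) = (f -. io a) +. io (a\<ominus>b)" using c(1-3) unfolding io_minus[OF c(4) h(2), symmetric] by algebra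
 moreover have "(f -. io a) +. io (a\<ominus>b)\<in>M n \<longleftrightarrow> io (a\<ominus>b)\<in>M n"
  using B.idl_add[OF M_ideal c(5), of "io (a\<ominus>b)"] B.idl_cancel[OF M_ideal _ c(5), of "io (a\<ominus>b)"] B.a_comm[OF B.minus_closed[OF c(1,2)], of "io (a\<ominus>b)"]
   io_carr c(4) h(2) by auto
 ultimately show ?thesis using io_M c h(2) by (simp add: near_def)
qed

lemma near_M: "near n f a ==> f\<in>M n \<longleftrightarrow> a\<in>pm n"
 using near_iff[of n f a \<zero>] by (auto simp: near_def B_zero[symmetric] a_minus_def)

lemma iS_io:
 assumes S: "S\<subseteq>\<R>" and a: "a\<in>Idl S" shows "io a\<in>iS S"
proof -
 note J = iS_ideal[OF S]
 have "Idl S\<subseteq>{a\<in>\<R>. io a\<in>iS S}"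
 proof (rule genideal_minimal[OF idealI'])
  show "\<zero>\<in>{a\<in>\<R>. io a\<in>iS S}" using B.idl_zero[OF J] B_zero by simp
  show "S\<subseteq>{a\<in>\<R>. io a\<in>iS S}" using S B.genideal_self[OF io_sub[OF S]] by (auto simp: iS_def)
 qed (use B.idl_add[OF J] B.idl_l[OF J] io_carr in \<open>auto simp flip: io_add io_mult\<close>)
 thus ?thesis using a by auto
qed

lemma iS_approx:
 assumes S: "S\<subseteq>\<R>" and f: "f\<in>iS S" shows "\<exists>a\<in>Idl S. near n f a"
proof -
 note I = genideal_ideal[OF S]
 let ?K = "{f. \<exists>a\<in>Idl S. near n f a}"
 have "iS S\<subseteq>?K" unfolding iS_def
 proof (rule B.genideal_minimal[OF B.idealI'])
  show "\<zero>\<^bsub>B\<^esub>\<in>?K" using idl_zero[OF I] near_io B_zero by auto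
  show "f +. g\<in>?K" if "f\<in>?K" "g\<in>?K" for f g using that near_add idl_add[OF I] by blast
  show "g *. f\<in>?K" if "f\<in>?K" "g\<in>carrier B" for f g using that near_mult near_ex[of g n] nearD(2) idl_l[OF I] by blast
  show "io ` S\<subseteq>?K" using S genideal_self near_io by blast
 qed (auto simp: near_def)
 thus ?thesis using f by auto
qed

text \<open>Ideals of the Noetherian local ring \<open>B\<close> are closed, by Krull's intersection
  theorem.\<close>

lemma iS_closed:
 assumes S: "S\<subseteq>\<R>" and a: "\<And>n. \<exists>a\<in>Idl S. near n f a" shows "f\<in>iS S"
proof (rule BL.krull_intersection[OF iS_ideal[OF S]])
 fix n
 obtain a where a: "a\<in>Idl S" "f\<in>carrier B" "f -. io a\<in>M n" using a unfolding near_def by auto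
 have ac: "io a\<in>carrier B" by (rule io_carr[OF idl_carr[OF genideal_ideal[OF S] a(1)]])
 have "f = io a +. (f -. io a)" using a(2) ac by algebra
 thus "f\<in>iS S <+>\<^bsub>B\<^esub> BL.ipow (M 1) n" unfolding M_ipow[symmetric] set_add_def' using iS_io[OF S a(1)] a(3) by blast
qed

text \<open>All elements of \<open>R\<close> that approximate \<open>f\<close> to precision
  \<open>N\<close> are congruent modulo the ideal, so one of them decides.\<close>

lemma iS_iff:
 assumes S: "S\<subseteq>\<R>" and a: "near N f a" and N: "pm N\<subseteq>Idl S" shows "f\<in>iS S \<longleftrightarrow> a\<in>Idl S"
proof
 note I = genideal_ideal[OF S]
 have key: "b\<in>Idl S \<longleftrightarrow> a\<in>Idl S" if b: "near N f b" for b
 proof -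
  have "a\<ominus>b\<in>Idl S" "b = a\<ominus>(a\<ominus>b)" using near_iff[OF a, of b] b N nearD(2)[OF a] nearD(2)[OF b] by auto algebra
  thus ?thesis using idl_cancel_minus[OF I] idl_minus[OF I] nearD(2)[OF a] by metis
 qed
 show "f\<in>iS S ==> a\<in>Idl S" using iS_approx[OF S] key by metis
 assume aS: "a\<in>Idl S"
 show "f\<in>iS S"
 proof (rule iS_closed[OF S])
  fix n
  obtain b where b: "near (max n N) f b" using near_ex nearD(1)[OF a] by metis
  thus "\<exists>a\<in>Idl S. near n f a" using key near_mono[OF b, of N] near_mono[OF b, of n] aS by auto
 qed
qed

lemma B_char_p: "char_p_cring B p"
proof
 have "[n] \<cdot>\<^bsub>B\<^esub> io \<one> = io ([n] \<cdot> \<one>)" for n :: nat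
 proof (induction n)
  case 0 show ?case by (simp add: B_zero)
 next
  case (Suc n) thus ?case using io_add by simp
 qed
 thus "[p] \<cdot>\<^bsub>B\<^esub> \<one>\<^bsub>B\<^esub> = \<zero>\<^bsub>B\<^esub>" unfolding B_one using p_zero B_zero by simp
qed (rule p_prime)

sublocale BL: noeth_local_p B "M 1" p unfolding noeth_local_p_def using BL.noeth_local_axioms B_char_p by simp

lemma pI_power:
 assumes "sop xs" "\<And>j. e j > 0" shows "\<exists>N. pm N\<subseteq>pI xs e"
proof -
 have "ispow xs (map (\<lambda>j. xs ! j[^]e j) [0..<length xs])" unfolding ispow_def list_all2_conv_all_nth using assms(2) by auto
 thus ?thesis using sop_power sop_ispow assms(1) by (fastforce simp: lessThan_atLeast0)
qed

text \<open>The ideal of the first \<open>i\<close> parameters is not primary to the maximal ideal,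
  so high powers of the remaining ones are added. Membership can then be tested on an approximation
  in \<open>R\<close>, where \<open>x_i\<close> is cancelled; letting the powers grow removes them
  again.\<close>

lemma io_regseq:
 assumes CM: CM and sp: "sop xs" shows "BL.regseq (map io xs)" unfolding BL.regseq_def
proof (intro conjI allI impI)
 have reg: "regseq xs" by (rule CM_sop_regseq[OF CM sp])
 have xm: "set xs\<subseteq>\<mm>" using sp by (simp add: sop_def)
 have xc: "set xs\<subseteq>\<R>" using xm m_sub by auto
 show "set (map io xs)\<subseteq>M 1" using xm io_M ipow_1[OF m_ideal] m_carr by auto
 fix i assume "i < length (map io xs)"
 hence i: "i < length xs" by simp
 let ?S = "set (take i xs)"
 have Sc: "?S\<subseteq>\<R>" using set_take_subset[of i xs] xc by auto
 have xi: "xs ! i\<in>\<R>" using i xc by auto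
 note I = genideal_ideal[OF Sc]
 have S: "s\<in>?S \<longleftrightarrow> (\<exists>j<i. s = xs ! j)" for s using i by (auto simp: in_set_conv_nth)
 have e: "Idl\<^bsub>B\<^esub> (set (take i (map io xs))) = iS ?S" by (simp add: iS_def take_map)
 show "BL.nzd (Idl\<^bsub>B\<^esub> (set (take i (map io xs)))) (map io xs ! i)" unfolding BL.nzd_def e
 proof (intro ballI impI iS_closed[OF Sc])
  fix f n assume f: "f\<in>carrier B" "map io xs ! i *. f\<in>iS ?S"
  \<comment> \<open>The earlier parameters keep exponent one. The others get \<open>Suc n\<close>,
    which puts their powers into \<open>pm n\<close>; the entry \<open>i\<close> starts one higher
    because cancelling \<open>x_i\<close> lowers its exponent by one.\<close>
  define ex where "ex = (\<lambda>j. if j < i then 1 else Suc n)"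
  have e0: "ex j > 0" for j by (simp add: ex_def)
  let ?e = "ex(i := 1 + Suc n)" and ?T = "\<lambda>e. (\<lambda>j. xs ! j[^](e j :: nat)) ` {..<length xs}"
  have Tc: "?T e\<subseteq>\<R>" for e by (rule pI_gens[OF reg])
  have "?e j > 0" for j by (simp add: ex_def)
  then obtain N where N: "pm N\<subseteq>pI xs ?e" using pI_power[OF sp] by metis
  obtain a where a: "near (max n N) f a" using near_ex f(1) by metis
  have ac: "a\<in>\<R>" by (rule nearD(2)[OF a])
  have "xs ! j\<in>?T ?e" if "j < i" for j using that i regseq_carr[OF reg, of j] by (intro image_eqI[of _ _ j]) (simp_all add: ex_def)
  hence "?S\<subseteq>?T ?e" unfolding subset_iff S by metis
  hence "iS ?S\<subseteq>iS (?T ?e)" unfolding iS_def by (intro B.subset_Idl_subset[OF io_sub[OF Tc]]) auto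
  hence "io (xs ! i) *. f\<in>iS (?T ?e)" using f(2) i by auto
  hence "xs ! i\<otimes>a\<in>pI xs ?e" using iS_iff[OF Tc near_mult[OF near_io[OF xi] near_mono[OF a]] N] by simp
  hence "a\<in>pI xs (ex(i := Suc n))" using var_iff[where e = ex and a = 1 and b = "Suc n", OF reg i e0 ac] xi by simp
  moreover have "pI xs (ex(i := Suc n))\<subseteq>Idl ?S <+> pm n"
  proof (rule genideal_minimal[OF idl_sumI[OF I pm_ideal, THEN conjunct2, THEN conjunct2] image_subsetI])
   note s = idl_sumI[OF I pm_ideal, of n]
   fix j assume "j\<in>{..<length xs}"
   hence xj: "xs ! j\<in>\<mm>" "xs ! j\<in>\<R>" using xm xc by auto
   show "xs ! j[^]((ex(i := Suc n)) j)\<in>Idl ?S <+> pm n"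
   proof (cases "j < i")
    case True
    hence "xs ! j\<in>Idl ?S" using genideal_self[OF Sc] S by auto
    thus ?thesis using True xj s by (auto simp: ex_def)
   next
    case False
    have "xs ! j[^]Suc n\<in>pm n" using ipow_pow[OF m_ideal xj(1), of "Suc n"] ipow_antimono[OF m_ideal, of n "Suc n"] by auto
    thus ?thesis using False s by (auto simp: ex_def)
   qed
  qed
  ultimately obtain u v where u: "u\<in>Idl ?S" "v\<in>pm n" "a = u\<oplus>v" using idl_sumD by blast
  have c: "u\<in>\<R>" "v\<in>\<R>" using idl_carr[OF I u(1)] pm_carr[OF u(2)] by auto
  have "a\<ominus>u = v" unfolding u(3) using c by algebra
  hence "near n f u" using near_iff[OF near_mono[OF a], of n u] c(1) u(2) by simp
  thus "\<exists>a\<in>Idl ?S. near n f a" using u(1) by auto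
 qed
qed

lemma io_sop:
 assumes CM: CM and sp: "sop xs" shows "BL.CM \<and> BL.sop (map io xs)"
proof (rule BL.sop_if_regseq[OF io_regseq[OF assms]])
 fix Q assume Q: "primeideal Q B" "set (map io xs)\<subseteq>Q"
 have xc: "set xs\<subseteq>\<R>" using sp m_sub by (auto simp: sop_def)
 have sub: "iS (set xs)\<subseteq>Q" unfolding iS_def by (rule B.genideal_minimal[OF B.prime_ideal[OF Q(1)]]) (use Q(2) in auto)
 obtain N where N: "pm N\<subseteq>Idl (set xs)" using sop_power[OF sp] by auto
 have "M 1\<subseteq>Q"
 proof
  fix f assume f: "f\<in>M 1"
  have fN: "f[^]\<^bsub>B\<^esub>N\<in>M N" unfolding M_ipow[of N] by (rule BL.ipow_pow[OF M_ideal f])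
  obtain a where a: "near N (f[^]\<^bsub>B\<^esub>N) a" using near_ex M_carr[OF fN] by metis
  have "f[^]\<^bsub>B\<^esub>N\<in>iS (set xs)" using iS_iff[OF xc a N] near_M[OF a] fN N by auto
  thus "f\<in>Q" using sub B.prime_pow[OF Q(1) M_carr[OF f]] by blast
 qed
 thus "Q = M 1" using BL.prime_sub_m[OF Q(1)] by auto
qed

lemma io_pw: "set xs\<subseteq>\<R> ==> set (BL.pw N (map io xs)) = io ` set (pw N xs)" by (auto simp: BL.pw_def pw_def io_pow image_image subset_iff)

lemma io_image_pow: "S\<subseteq>\<R> ==> (\<lambda>x. x[^]\<^bsub>B\<^esub>(n::nat)) ` io ` S = io ` (\<lambda>x. x[^]n) ` S"
 by (auto simp: io_pow image_image subset_iff)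

lemma B_FI:
 assumes CM: CM and FI: FI shows "BL.FI"
proof -
 obtain xs where sp: "sop xs" using CM_sop_exists[OF CM] by auto
 have xc: "set xs\<subseteq>\<R>" using sp m_sub by (auto simp: sop_def)
 note reg = io_regseq[OF CM sp]
 have "BL.FC (set (BL.pw N (map io xs)))" if N: "N > 0" for N unfolding BL.FC_def
 proof (intro ballI impI)
  fix f assume f: "f\<in>carrier B" "f[^]\<^bsub>B\<^esub>p\<in>Idl\<^bsub>B\<^esub> ((\<lambda>x. x[^]\<^bsub>B\<^esub>p) ` set (BL.pw N (map io xs)))"
  have pc: "set (pw N xs)\<subseteq>\<R>" for N using xc by (auto simp: pw_def)
  have s: "sop (pw N xs)" if "N > 0" for N using sop_ispow[OF pw_ispow[OF that] sp] .
  have "N * p > 0" using N p_gt_0 by simp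
  then obtain T where T: "pm T\<subseteq>Idl (set (pw (N * p) xs))" using sop_power[OF s] by metis
  obtain T' where T': "pm T'\<subseteq>Idl (set (pw N xs))" using sop_power[OF s[OF N]] by metis
  obtain a where a: "near (max T T') f a" using near_ex f(1) by metis
  have "f[^]\<^bsub>B\<^esub>p\<in>iS (set (pw (N * p) xs))" using f(2) unfolding io_pw[OF xc] io_image_pow[OF pc] pw_pow[OF xc] iS_def .
  hence "a[^]p\<in>Idl (set (pw (N * p) xs))" using iS_iff[OF pc near_pow[OF near_mono[OF a]] T] by simp
  moreover have "FC (set (pw N xs))" using FI s[OF N] unfolding FI_def by metis
  ultimately have "a\<in>Idl (set (pw N xs))" using nearD(2)[OF a] unfolding FC_def pw_pow[OF xc] by blast
  thus "f\<in>Idl\<^bsub>B\<^esub> (set (BL.pw N (map io xs)))" using iS_iff[OF pc near_mono[OF a] T'] unfolding io_pw[OF xc] iS_def by simp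
 qed
 thus ?thesis using BL.FI_if_FCall[OF _ reg BL.FCall_if_uniform[OF reg]] io_sop[OF CM sp] by simp
qed

lemma sigma_completion:
 assumes sp: "sop xs" shows "BL.sigma e (io ` set xs) \<longleftrightarrow> sigma e (set xs)"
proof -
 have c: "set xs\<subseteq>\<R>" using sp m_sub by (auto simp: sop_def)
 have "\<exists>N. pm N\<subseteq>Idl (fp e (set xs))" for e
  using sop_power[OF sop_ispow[OF pw_ispow sp, of "p ^ e"]] p_gt_0 by (simp add: pw_def fp_def)
 then obtain N where N: "\<And>e. pm (N e)\<subseteq>Idl (fp e (set xs))" by metis
 \<comment> \<open>The precision dominates what both ideals require, and the successor makes it at
   least one, so that membership in the maximal ideal is visible too.\<close>
 define K where "K = Suc (N 0 + N e)"
 have K: "pm K\<subseteq>Idl (fp i (set xs))" if "i\<in>{0, e}" for i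
  by (rule order_trans[OF ipow_antimono[OF m_ideal] N]) (use that in \<open>auto simp: K_def\<close>)
 have mem: "BL.mem i (io ` set xs) g f \<longleftrightarrow> mem i (set xs) r a" if "near K g r" "near K f a" "i\<in>{0, e}" for i g r f a
 proof -
  have "BL.fp i (io ` set xs) = io ` fp i (set xs)" unfolding BL.fp_def fp_def by (rule io_image_pow[OF c])
  thus ?thesis using iS_iff[OF fp_carr[OF c] near_mult[OF that(1) near_pow[OF that(2)]] K[OF that(3)]] by (simp add: BL.mem_def mem_def iS_def)
 qed
 have m: "g\<in>M 1 \<longleftrightarrow> r\<in>\<mm>" if "near K g r" for g r
  using near_M[OF near_mono[OF that]] ipow_1[OF m_ideal] by (simp add: K_def)
 have one: "near K \<one>\<^bsub>B\<^esub> \<one>" unfolding B_one by (rule near_io) simp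
 have key: "(\<not> BL.mem 0 (io ` set xs) \<one>\<^bsub>B\<^esub> f \<and> (\<forall>r\<in>M 1. BL.mem 0 (io ` set xs) r f \<and> BL.mem e (io ` set xs) r f)) \<longleftrightarrow>
   (\<not> mem 0 (set xs) \<one> a \<and> (\<forall>r\<in>\<mm>. mem 0 (set xs) r a \<and> mem e (set xs) r a))" if a: "near K f a" for f a
 proof -
  have "(\<forall>r\<in>M 1. BL.mem i (io ` set xs) r f) \<longleftrightarrow> (\<forall>r\<in>\<mm>. mem i (set xs) r a)" if "i\<in>{0, e}" for i
  proof (intro iffI ballI)
   show "mem i (set xs) r a" if "\<forall>r\<in>M 1. BL.mem i (io ` set xs) r f" "r\<in>\<mm>" for r
    using that m[OF near_io[OF m_carr]] mem[OF near_io[OF m_carr] a \<open>i \<in> {0, e}\<close>] by blast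
   show "BL.mem i (io ` set xs) g f" if h: "\<forall>r\<in>\<mm>. mem i (set xs) r a" "g\<in>M 1" for g
   proof -
    obtain r where "near K g r" using near_ex[OF M_carr[OF h(2)]] by metis
    thus ?thesis using m mem[OF _ a \<open>i \<in> {0, e}\<close>] h by blast
   qed
  qed
  thus ?thesis using mem[OF one a, of 0] by blast
 qed
 show ?thesis unfolding BL.sigma_def sigma_def
 proof (intro iffI; elim bexE)
  fix f assume f: "f\<in>carrier B" "\<not> BL.mem 0 (io ` set xs) \<one>\<^bsub>B\<^esub> f \<and> (\<forall>r\<in>M 1. BL.mem 0 (io ` set xs) r f \<and> BL.mem e (io ` set xs) r f)"
  obtain a where "near K f a" using near_ex[OF f(1)] by metis
  thus "\<exists>a\<in>\<R>. \<not> mem 0 (set xs) \<one> a \<and> (\<forall>r\<in>\<mm>. mem 0 (set xs) r a \<and> mem e (set xs) r a)" using key f(2) nearD(2) by metis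
 next
  fix a assume a: "a\<in>\<R>" "\<not> mem 0 (set xs) \<one> a \<and> (\<forall>r\<in>\<mm>. mem 0 (set xs) r a \<and> mem e (set xs) r a)"
  show "\<exists>f\<in>carrier B. \<not> BL.mem 0 (io ` set xs) \<one>\<^bsub>B\<^esub> f \<and> (\<forall>r\<in>M 1. BL.mem 0 (io ` set xs) r f \<and> BL.mem e (io ` set xs) r f)"
   using key[OF near_io[OF a(1)]] a(2) io_carr[OF a(1)] by metis
 qed
qed

end

section \<open>Coefficient fields\<close>

context cring
begin

text \<open>A polynomial is a coefficient function \<open>c\<close> with a degree bound
  \<open>j\<close>: \<open>ev\<close> is the value of the terms below \<open>j\<close>, and
  \<open>dv\<close> that of their derivative. The truncated exponent in \<open>dv\<close> at index
  zero is harmless because its coefficient vanishes.\<close>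

primrec ev where "ev 0 c x = \<zero>" | "ev (Suc j) c x = ev j c x\<oplus>c j\<otimes>x[^]j"
primrec dv where "dv 0 c x = \<zero>" | "dv (Suc j) c x = dv j c x\<oplus>([j] \<cdot> c j)\<otimes>x[^](j - 1)"

lemma ev_mem: "subring C R ==> (\<And>i. c i\<in>C) ==> x\<in>C ==> ev j c x\<in>C"
proof (induction j)
 case (Suc j)
 have "x[^]i\<in>C" for i :: nat by (induction i) (use Suc.prems subringE in auto)
 thus ?case using Suc subringE(6,7)[OF Suc.prems(1)] by simp
qed (simp add: subringE)

lemma ev_carr: "(\<And>i. c i\<in>\<R>) ==> x\<in>\<R> ==> ev j c x\<in>\<R>" by (induction j) auto

lemma ev_ideal: "ideal I R ==> (\<And>i. i < j ==> c i\<in>I) ==> x\<in>\<R> ==> ev j c x\<in>I"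
 by (induction j) (auto simp: idl_zero intro!: idl_add idl_r)

lemma ev_add: "(\<And>i. c i\<in>\<R>) ==> (\<And>i. d i\<in>\<R>) ==> x\<in>\<R> ==> ev j c x\<oplus>ev j d x = ev j (\<lambda>i. c i\<oplus>d i) x"
proof (induction j)
 case (Suc j)
 have "ev j c x\<oplus>c j\<otimes>x[^]j\<oplus>(ev j d x\<oplus>d j\<otimes>x[^]j) = ev j c x\<oplus>ev j d x\<oplus>(c j\<oplus>d j)\<otimes>x[^]j"
  using ev_carr[OF Suc.prems(1,3), of j] ev_carr[OF Suc.prems(2,3), of j] Suc.prems(1) Suc.prems(2)[of j] nat_pow_closed[OF Suc.prems(3), of j] by algebra
 thus ?case using Suc by simp
qed simp

lemma ev_smult: "(\<And>i. c i\<in>\<R>) ==> e\<in>\<R> ==> x\<in>\<R> ==> e\<otimes>ev j c x = ev j (\<lambda>i. e\<otimes>c i) x"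
 by (induction j) (simp_all add: r_distr m_assoc ev_carr)

lemma ev_const: "d\<in>\<R> ==> x\<in>\<R> ==> ev (Suc j) (\<lambda>i. if i = 0 then d else \<zero>) x = d" by (induction j) simp_all

lemma ev_shift: "(\<And>i. c i\<in>\<R>) ==> x\<in>\<R> ==> x\<otimes>ev j c x = ev (Suc j) (\<lambda>i. case i of 0\<Rightarrow>\<zero> | Suc k\<Rightarrow>c k) x"
proof (induction j)
 case (Suc j)
 have "x\<otimes>(ev j c x\<oplus>c j\<otimes>x[^]j) = x\<otimes>ev j c x\<oplus>c j\<otimes>(x[^]j\<otimes>x)"
  using ev_carr[OF Suc.prems, of j] Suc.prems(1)[of j] nat_pow_closed Suc.prems(2) by algebra
 thus ?case using Suc by simp
qed simp

lemma pow_taylor: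
 assumes x: "x\<in>\<R>" and t: "t\<in>\<R>"
 shows "\<exists>w\<in>\<R>. (x\<oplus>t)[^](n::nat) = x[^]n\<oplus>t\<otimes>([n] \<cdot> (x[^](n - 1)))\<oplus>t\<otimes>t\<otimes>w"
proof (induction n)
 case 0 show ?case using t by (intro bexI[of _ \<zero>]) simp_all
next
 case (Suc n)
 then obtain w where w: "w\<in>\<R>" "(x\<oplus>t)[^]n = x[^]n\<oplus>t\<otimes>([n] \<cdot> (x[^](n - 1)))\<oplus>t\<otimes>t\<otimes>w" by auto
 define y z where "y = x[^]n" and "z = [n] \<cdot> (x[^](n - 1))"
 have c: "y\<in>\<R>" "z\<in>\<R>" using x by (auto simp: y_def z_def)
 have zx: "z\<otimes>x = [n] \<cdot> y"
 proof (cases n)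
  case (Suc k) thus ?thesis using x add_pow_ldistr[of "x[^]k" x n] by (simp add: y_def z_def)
 qed (use x in \<open>simp add: z_def\<close>)
 have "(x\<oplus>t)[^]Suc n = (y\<oplus>t\<otimes>z\<oplus>t\<otimes>t\<otimes>w)\<otimes>(x\<oplus>t)" using w(2) by (simp add: y_def z_def)
 also have "\<dots> = y\<otimes>x\<oplus>t\<otimes>(z\<otimes>x\<oplus>y)\<oplus>t\<otimes>t\<otimes>(z\<oplus>w\<otimes>(x\<oplus>t))" using c x t w(1) by algebra
 also have "\<dots> = x[^]Suc n\<oplus>t\<otimes>([Suc n] \<cdot> (x[^](Suc n - 1)))\<oplus>t\<otimes>t\<otimes>(z\<oplus>w\<otimes>(x\<oplus>t))" unfolding zx by (simp add: y_def)
 finally show ?case using c x t w(1) by blast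
qed

lemma ev_taylor:
 assumes c: "\<And>i. c i\<in>\<R>" and x: "x\<in>\<R>" and t: "t\<in>\<R>"
 shows "dv j c x\<in>\<R> \<and> (\<exists>w\<in>\<R>. ev j c (x\<oplus>t) = ev j c x\<oplus>t\<otimes>dv j c x\<oplus>t\<otimes>t\<otimes>w)"
proof (induction j)
 case 0 show ?case using t by (auto intro!: bexI[of _ \<zero>])
next
 case (Suc j)
 then obtain w where w: "w\<in>\<R>" "ev j c (x\<oplus>t) = ev j c x\<oplus>t\<otimes>dv j c x\<oplus>t\<otimes>t\<otimes>w" and d: "dv j c x\<in>\<R>" by auto
 obtain v where v: "v\<in>\<R>" "(x\<oplus>t)[^]j = x[^]j\<oplus>t\<otimes>([j] \<cdot> (x[^](j - 1)))\<oplus>t\<otimes>t\<otimes>v" using pow_taylor[OF x t] by blast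
 define y where "y = x[^](j - 1)"
 have y: "y\<in>\<R>" "x[^]j\<in>\<R>" "[j] \<cdot> y\<in>\<R>" using x by (auto simp: y_def)
 have e: "c j\<otimes>([j] \<cdot> y) = ([j] \<cdot> c j)\<otimes>y" using add_pow_ldistr[OF c[of j] y(1)] add_pow_rdistr[OF c[of j] y(1)] by simp
 have "ev (Suc j) c (x\<oplus>t) = (ev j c x\<oplus>c j\<otimes>x[^]j)\<oplus>t\<otimes>(dv j c x\<oplus>c j\<otimes>([j] \<cdot> y))\<oplus>t\<otimes>t\<otimes>(w\<oplus>c j\<otimes>v)"
  unfolding ev.simps w(2) v(2) y_def[symmetric] using ev_carr[OF c x, of j] d w(1) v(1) y c t by algebra
 thus ?case unfolding e using d w(1) v(1) y c t by (auto simp: y_def)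
qed

lemma dv_ev: "(\<And>i. c i\<in>\<R>) ==> x\<in>\<R> ==> dv (Suc j) c x = ev j (\<lambda>i. [Suc i] \<cdot> c (Suc i)) x" by (induction j) auto

end

context noeth_local
begin

definition coeff_set where
 "coeff_set K \<longleftrightarrow> subring K R \<and> K\<inter>\<mm> = {\<zero>} \<and> (\<forall>x\<in>\<R>. \<exists>c\<in>K. x\<ominus>c\<in>\<mm>)"

text \<open>Approximate the inverse in \<open>R\<close> by \<open>z\<close> in \<open>K\<close>.
  Then \<open>z x - 1\<close> lies in \<open>K\<close> and in the maximal ideal, hence is
  zero.\<close>

lemma coeff_set_inv:
 assumes K: "coeff_set K" and x: "x\<in>K" "x\<noteq>\<zero>" shows "\<exists>y\<in>K. y\<otimes>x = \<one>"
proof -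
 have Ks: "subring K R" "K\<inter>\<mm> = {\<zero>}" using K by (auto simp: coeff_set_def)
 note Kc = subsetD[OF subringE(1)[OF Ks(1)]]
 have "x\<notin>\<mm>" using Ks(2) x by auto
 then obtain y where y: "y\<in>\<R>" "y\<otimes>x = \<one>" using unit_inv Kc[OF x(1)] by auto
 obtain z where z: "z\<in>K" "y\<ominus>z\<in>\<mm>" using K y(1) by (auto simp: coeff_set_def)
 have "\<ominus> ((y\<ominus>z)\<otimes>x)\<in>\<mm>" by (rule idl_neg[OF m_ideal idl_r[OF m_ideal z(2) Kc[OF x(1)]]])
 moreover have "\<ominus> ((y\<ominus>z)\<otimes>x) = z\<otimes>x\<ominus>y\<otimes>x" using y(1) Kc[OF x(1)] Kc[OF z(1)] by algebra
 moreover have "z\<otimes>x\<ominus>\<one>\<in>K" using subringE(3,5,6,7)[OF Ks(1)] z(1) x(1) by (simp add: a_minus_def)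
 ultimately have "z\<otimes>x\<ominus>\<one> = \<zero>" using Ks(2) y(2) by auto
 hence "z\<otimes>x = \<one>" using Kc[OF x(1)] Kc[OF z(1)] by simp
 thus ?thesis using z(1) by auto
qed

lemma coeff_set_field:
 assumes K: "coeff_set K" shows "coefficient_field K R"
proof -
 have Ks: "subring K R" "K\<inter>\<mm> = {\<zero>}" using K by (auto simp: coeff_set_def)
 note Kc = subsetD[OF subringE(1)[OF Ks(1)]]
 have "subfield K R"
 proof (rule subfieldI[OF subcringI'[OF Ks(1)]])
  have "\<one>\<noteq>\<zero>" using one_notin_m idl_zero[OF m_ideal] by metis
  hence "\<zero>\<notin>Units (R\<lparr>carrier := K\<rparr>)" using Kc by (auto simp: Units_def)
  moreover have "x\<in>Units (R\<lparr>carrier := K\<rparr>)" if x: "x\<in>K" "x\<noteq>\<zero>" for x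
  proof -
   obtain y where "y\<in>K" "y\<otimes>x = \<one>" using coeff_set_inv[OF K x] by auto
   thus ?thesis using x(1) Kc m_comm by (auto simp: Units_def intro!: bexI[of _ y])
  qed
  ultimately show "Units (R\<lparr>carrier := K\<rparr>) = K - {\<zero>}" by (auto simp: Units_def)
 qed
 moreover note h = ideal.rcos_ring_hom[OF m_ideal]
 have "(\<lambda>x. \<mm> +> x)\<in>ring_iso (R\<lparr>carrier := K\<rparr>) (R Quot \<mm>)"
 proof (rule ring_iso_memI)
  show "bij_betw ((+>) \<mm>) (carrier (R\<lparr>carrier := K\<rparr>)) (carrier (R Quot \<mm>))" unfolding bij_betw_def
  proof
   show "inj_on ((+>) \<mm>) (carrier (R\<lparr>carrier := K\<rparr>))"
   proof (rule inj_onI)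
    fix x y assume xy: "x\<in>carrier (R\<lparr>carrier := K\<rparr>)" "y\<in>carrier (R\<lparr>carrier := K\<rparr>)" "\<mm> +> x = \<mm> +> y"
    hence k: "x\<in>K" "y\<in>K" by auto
    have "x\<ominus>y\<in>\<mm>" using xy(3) quotient_eq_iff_same_a_r_cos[OF m_ideal Kc[OF k(1)] Kc[OF k(2)]] by simp
    moreover have "x\<ominus>y\<in>K" using subringE(5,7)[OF Ks(1)] k by (simp add: a_minus_def)
    ultimately have "x\<ominus>y = \<zero>" using Ks(2) by auto
    thus "x = y" using Kc k by simp
   qed
   have "\<exists>c\<in>K. \<mm> +> x = \<mm> +> c" if "x\<in>\<R>" for x
    using K that quotient_eq_iff_same_a_r_cos[OF m_ideal that Kc] unfolding coeff_set_def by blast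
   thus "(+>) \<mm> ` carrier (R\<lparr>carrier := K\<rparr>) = carrier (R Quot \<mm>)" using Kc by (fastforce simp: FactRing_def A_RCOSETS_def')
  qed
 qed (use ring_hom_closed[OF h] ring_hom_mult[OF h] ring_hom_add[OF h] ring_hom_one[OF h] Kc in auto)
 ultimately show ?thesis by (simp add: coefficient_field_def max_ideal_eq)
qed

lemma coeff_set_of_field:
 assumes "coefficient_field K R" shows "coeff_set K"
proof -
 have K: "subfield K R" and iso: "(\<lambda>x. \<mm> +> x)\<in>ring_iso (R\<lparr>carrier := K\<rparr>) (R Quot \<mm>)"
  using assms by (auto simp: coefficient_field_def max_ideal_eq)
 have Ks: "subring K R" by (rule subfieldE(1)[OF K])
 note Kc = subsetD[OF subringE(1)[OF Ks]]
 have bij: "bij_betw ((+>) \<mm>) K (carrier (R Quot \<mm>))" using ring_iso_memE(5)[OF iso] by simp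
 have eq: "x = y" if "x\<in>K" "y\<in>K" "x\<ominus>y\<in>\<mm>" for x y
  using bij quotient_eq_iff_same_a_r_cos[OF m_ideal Kc[OF that(1)] Kc[OF that(2)]] that unfolding bij_betw_def inj_on_def by auto
 have "x = \<zero>" if "x\<in>K" "x\<in>\<mm>" for x using eq subringE(2)[OF Ks] that Kc[OF that(1)] by (simp add: a_minus_def)
 moreover have "\<exists>c\<in>K. x\<ominus>c\<in>\<mm>" if x: "x\<in>\<R>" for x
 proof -
  have "\<mm> +> x\<in>carrier (R Quot \<mm>)" using ring_hom_closed[OF ideal.rcos_ring_hom[OF m_ideal] x] .
  then obtain c where c: "c\<in>K" "\<mm> +> x = \<mm> +> c" using bij unfolding bij_betw_def by auto
  thus ?thesis using quotient_eq_iff_same_a_r_cos[OF m_ideal x Kc[OF c(1)]] by auto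
 qed
 moreover have "\<zero>\<in>K\<inter>\<mm>" using subringE(2)[OF Ks] idl_zero[OF m_ideal] by simp
 ultimately show ?thesis unfolding coeff_set_def using Ks by blast
qed

end

section \<open>Lifting the residue field through the powers of the maximal ideal\<close>

locale complete_local_p = noeth_local_p +
 assumes complete: "(\<And>k. s k\<in>carrier R) ==> (\<And>k. s (Suc k)\<ominus>s k\<in>ipow \<mm> k) ==> \<exists>z\<in>carrier R. \<forall>n. z\<ominus>s n\<in>ipow \<mm> n"
begin

abbreviation mp where "mp\<equiv>ipow \<mm>"
lemma mp_ideal: "ideal (mp n) R" by (rule ipow_ideal[OF m_ideal])

text \<open>The full preimage in \<open>R\<close> of a coefficient field of the ring modulo
  \<open>mp n\<close>.\<close>

definition partial_coeff where
 "partial_coeff n C \<longleftrightarrow> subring C R \<and> mp n\<subseteq>C \<and> C\<inter>\<mm>\<subseteq>mp n \<and> (\<forall>x\<in>\<R>. \<exists>c\<in>C. x\<ominus>c\<in>\<mm>)"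

text \<open>Adjoin to \<open>D\<close> a root \<open>b\<close>, modulo the power \<open>mp n\<close>, of a monic polynomial that is minimal modulo the maximal ideal.\<close>
lemma adjoin:
 assumes D: "subring D R" "mp n\<subseteq>D" "D\<inter>\<mm>\<subseteq>mp n" and n: "n\<ge>1" and b: "b\<in>\<R>" and g: "\<And>i. g i\<in>D"
  and root: "ev j g b\<oplus>b[^]j\<in>mp n" and j: "j > 0"
  and min: "\<And>c i. (\<And>i. c i\<in>D) ==> ev j c b\<in>\<mm> ==> i < j ==> c i\<in>\<mm>" and C: "subring C R" "D\<subseteq>C" "b\<in>C"
 shows "\<exists>V. subring V R \<and> D\<subseteq>V \<and> b\<in>V \<and> V\<subseteq>C \<and> V\<inter>\<mm>\<subseteq>mp n"
proof -
 define V where "V = {ev j c b\<oplus>m | c m. (\<forall>i. c i\<in>D) \<and> m\<in>mp n}"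
 note Dc = subringE(1)[OF D(1)]
 note mc = idl_carr[OF mp_ideal]
 have VI: "ev j c b\<oplus>m\<in>V" if "\<And>i. c i\<in>D" "m\<in>mp n" for c m using that unfolding V_def by blast
 have VE: "\<exists>c m. (\<forall>i. c i\<in>D) \<and> (\<forall>i. c i\<in>\<R>) \<and> m\<in>mp n \<and> x = ev j c b\<oplus>m" if "x\<in>V" for x using that Dc unfolding V_def by blast
 have Vc: "x\<in>\<R>" if "x\<in>V" for x using VE[OF that] ev_carr b mc by auto
 have add: "x\<oplus>y\<in>V" if xy: "x\<in>V" "y\<in>V" for x y
 proof -
  obtain c m where x: "\<And>i. c i\<in>D" "\<And>i. c i\<in>\<R>" "m\<in>mp n" "x = ev j c b\<oplus>m" using VE[OF xy(1)] by auto
  obtain d l where y: "\<And>i. d i\<in>D" "\<And>i. d i\<in>\<R>" "l\<in>mp n" "y = ev j d b\<oplus>l" using VE[OF xy(2)] by auto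
  have "x\<oplus>y = (ev j c b\<oplus>ev j d b)\<oplus>(m\<oplus>l)"
   unfolding x(4) y(4) using ev_carr[OF x(2) b, of j] ev_carr[OF y(2) b, of j] mc[OF x(3)] mc[OF y(3)] by algebra
  thus ?thesis unfolding ev_add[OF x(2) y(2) b] using VI x(1) y(1) subringE(7)[OF D(1)] idl_add[OF mp_ideal x(3) y(3)] by simp
 qed
 have smult: "d\<otimes>x\<in>V" if dx: "d\<in>D" "x\<in>V" for d x
 proof -
  obtain c m where x: "\<And>i. c i\<in>D" "\<And>i. c i\<in>\<R>" "m\<in>mp n" "x = ev j c b\<oplus>m" using VE[OF dx(2)] by auto
  have dc: "d\<in>\<R>" using dx(1) Dc by auto
  have "d\<otimes>x = ev j (\<lambda>i. d\<otimes>c i) b\<oplus>d\<otimes>m"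
   unfolding x(4) ev_smult[OF x(2) dc b, symmetric] using ev_carr[OF x(2) b, of j] mc[OF x(3)] dc by algebra
  thus ?thesis using VI x(1) dx(1) subringE(6)[OF D(1)] idl_l[OF mp_ideal x(3) dc] by simp
 qed
 have DV: "d\<in>V" if "d\<in>D" for d
 proof -
  have dc: "d\<in>\<R>" using that Dc by auto
  obtain k where "j = Suc k" using j gr0_implies_Suc by auto
  hence "ev j (\<lambda>i. if i = 0 then d else \<zero>) b = d" using ev_const[OF dc b] by simp
  thus ?thesis using VI[of "\<lambda>i. if i = 0 then d else \<zero>" \<zero>] that subringE(2)[OF D(1)] idl_zero[OF mp_ideal] dc by auto
 qed
 have mV: "m\<in>V" if "m\<in>mp n" for m using DV D(2) that by auto
 \<comment> \<open>Multiplication by \<open>b\<close> shifts the coefficients. The new top term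
   \<open>s j\<close> times \<open>b^j\<close> is traded for lower terms by the monic relation, with
   an error in \<open>mp n\<close>.\<close>
 have bmult: "b\<otimes>x\<in>V" if xV: "x\<in>V" for x
 proof -
  obtain c m where x: "\<And>i. c i\<in>D" "\<And>i. c i\<in>\<R>" "m\<in>mp n" "x = ev j c b\<oplus>m" using VE[OF xV] by auto
  define s where "s = (\<lambda>i. case i of 0\<Rightarrow>\<zero> | Suc k\<Rightarrow>c k)"
  have s: "s i\<in>D" "s i\<in>\<R>" for i using x subringE(2)[OF D(1)] by (auto simp: s_def split: nat.split)
  have gc: "\<And>i. g i\<in>\<R>" using g Dc by auto
  define r where "r = ev j g b\<oplus>b[^]j"
  have sc: "(\<ominus> s j)\<in>D" "(\<ominus> s j)\<in>\<R>" using subringE(5)[OF D(1)] s by auto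
  have "b\<otimes>x = ev (Suc j) s b\<oplus>b\<otimes>m"
   unfolding x(4) s_def ev_shift[OF x(2) b, symmetric] using ev_carr[OF x(2) b, of j] mc[OF x(3)] b by algebra
  also have "\<dots> = (ev j s b\<oplus>(s j\<otimes>r\<oplus>b\<otimes>m))\<oplus>(\<ominus> s j)\<otimes>ev j g b"
   unfolding ev.simps r_def using ev_carr[OF s(2) b, of j] ev_carr[OF gc b, of j] s(2)[of j] mc[OF x(3)] b nat_pow_closed by algebra
  finally have e: "b\<otimes>x = (ev j s b\<oplus>(s j\<otimes>r\<oplus>b\<otimes>m))\<oplus>(\<ominus> s j)\<otimes>ev j g b" .
  have "ev j g b\<oplus>\<zero>\<in>V" by (rule VI[OF g idl_zero[OF mp_ideal]])
  hence "(\<ominus> s j)\<otimes>ev j g b\<in>V" using smult[OF sc(1)] ev_carr[OF gc b] by simp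
  moreover have "s j\<otimes>r\<oplus>b\<otimes>m\<in>mp n" using root idl_add[OF mp_ideal idl_l[OF mp_ideal] idl_l[OF mp_ideal x(3) b]] s(2) by (simp add: r_def)
  ultimately show ?thesis unfolding e by (intro add VI s(1))
 qed
 have bpow: "b[^]k\<otimes>x\<in>V" if "x\<in>V" for x and k :: nat
 proof (induction k)
  case 0 show ?case using that Vc by simp
 next
  case (Suc k)
  have "b[^]Suc k\<otimes>x = b\<otimes>(b[^]k\<otimes>x)" using b Vc[OF that] nat_pow_closed[OF b, of k] unfolding nat_pow_Suc by algebra
  thus ?case using bmult[OF Suc] by simp
 qed
 have evmult: "ev k c b\<otimes>y\<in>V" if y: "y\<in>V" and c: "\<And>i. c i\<in>D" for k c y
 proof (induction k)
  case 0 show ?case using mV[OF idl_zero[OF mp_ideal]] Vc[OF y] by simp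
 next
  case (Suc k)
  have cc: "\<And>i. c i\<in>\<R>" using c Dc by auto
  have "ev (Suc k) c b\<otimes>y = ev k c b\<otimes>y\<oplus>c k\<otimes>(b[^]k\<otimes>y)"
   unfolding ev.simps using ev_carr[OF cc b, of k] cc Vc[OF y] nat_pow_closed[OF b, of k] by algebra
  thus ?case using add[OF Suc smult[OF c bpow[OF y]]] by simp
 qed
 have mult: "x\<otimes>y\<in>V" if xy: "x\<in>V" "y\<in>V" for x y
 proof -
  obtain c m where x: "\<And>i. c i\<in>D" "\<And>i. c i\<in>\<R>" "m\<in>mp n" "x = ev j c b\<oplus>m" using VE[OF xy(1)] by auto
  have "x\<otimes>y = ev j c b\<otimes>y\<oplus>m\<otimes>y" unfolding x(4) using ev_carr[OF x(2) b, of j] mc[OF x(3)] Vc[OF xy(2)] by algebra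
  thus ?thesis using add[OF evmult[OF xy(2) x(1)] mV[OF idl_r[OF mp_ideal x(3) Vc[OF xy(2)]]]] by simp
 qed
 have oneD: "\<one>\<in>D" "\<ominus> \<one>\<in>D" using subringE(3,5)[OF D(1)] by auto
 have "subring V R"
 proof (rule subringI)
  show "\<ominus> h\<in>V" if "h\<in>V" for h using smult[OF oneD(2) that] Vc[OF that] by (simp add: l_minus)
 qed (use Vc add mult DV oneD in auto)
 moreover have "b\<in>V" using bmult[OF DV[OF oneD(1)]] b by simp
 moreover have "V\<subseteq>C"
 proof
  fix x assume "x\<in>V"
  then obtain c m where x: "\<And>i. c i\<in>D" "m\<in>mp n" "x = ev j c b\<oplus>m" using VE by blast
  have "c i\<in>C" for i using x(1) C(2) by auto
  hence "ev j c b\<in>C" by (rule ev_mem[OF C(1) _ C(3)])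
  thus "x\<in>C" unfolding x(3) using x(2) D(2) C(2) subringE(7)[OF C(1)] by auto
 qed
 \<comment> \<open>Minimality forces all coefficients of such a value into the maximal ideal, and
   coefficients in \<open>D\<close> are then in \<open>mp n\<close>.\<close>
 moreover have "V\<inter>\<mm>\<subseteq>mp n"
 proof
  fix x assume xm: "x\<in>V\<inter>\<mm>"
  then obtain c m where x: "\<And>i. c i\<in>D" "\<And>i. c i\<in>\<R>" "m\<in>mp n" "x = ev j c b\<oplus>m" using VE by blast
  have "m\<in>\<mm>" using x(3) ipow_antimono[OF m_ideal n] ipow_1[OF m_ideal] by auto
  hence "ev j c b\<in>\<mm>" using idl_cancel[OF m_ideal, of "ev j c b" m] xm x(4) ev_carr[OF x(2) b] by auto
  hence "c i\<in>\<mm>" if "i < j" for i using min x(1) that by simp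
  hence "c i\<in>mp n" if "i < j" for i using D(3) x(1) that by auto
  hence "ev j c b\<in>mp n" by (rule ev_ideal[OF mp_ideal _ b])
  thus "x\<in>mp n" unfolding x(4) using idl_add[OF mp_ideal] x(3) by simp
 qed
 ultimately show ?thesis using DV by blast
qed

text \<open>All \<open>p\<close>-th powers of \<open>C\<close> lie in \<open>D\<close>, so a minimal monic relation modulo \<open>\<mm>\<close> satisfied by \<open>b\<close> has degree
 at most \<open>p\<close>. If the degree is \<open>p\<close>, the relation \<open>X\<^sup>p = b\<^sup>p\<close> holds exactly; otherwise it is
 separable, and Newton's correction turns \<open>b\<close> into a root modulo \<open>mp (Suc n)\<close>.\<close>
lemma extend_coeff:
 assumes C: "partial_coeff n C" and n: "n\<ge>1"
  and D: "subring D R" "D\<subseteq>C" "mp (Suc n)\<subseteq>D" "D\<inter>\<mm>\<subseteq>mp (Suc n)" and Dp: "\<And>c. c\<in>C ==> c[^]p\<in>D"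
  and b: "b\<in>C" "\<And>d. d\<in>D ==> b\<ominus>d\<notin>\<mm>"
 shows "\<exists>V b'. subring V R \<and> D\<subseteq>V \<and> b'\<in>V \<and> b\<ominus>b'\<in>\<mm> \<and> V\<subseteq>C \<and> V\<inter>\<mm>\<subseteq>mp (Suc n)"
proof -
 have Cs: "subring C R" "mp n\<subseteq>C" "C\<inter>\<mm>\<subseteq>mp n" and Cm: "\<And>x. x\<in>\<R> ==> \<exists>c\<in>C. x\<ominus>c\<in>\<mm>"
  using C by (auto simp: partial_coeff_def)
 note Cc = subsetD[OF subringE(1)[OF Cs(1)]] and Dc = subsetD[OF subringE(1)[OF D(1)]]
 note bc = Cc[OF b(1)]
 \<comment> \<open>An approximate inverse \<open>c\<close> exists in \<open>C\<close> but maybe not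
   in \<open>D\<close>. Since \<open>(c d)^p\<close> is congruent to one, \<open>c^p d^(p-1)\<close>
   is an approximate inverse as well, and it is in \<open>D\<close>.\<close>
 have inv: "\<exists>e\<in>D. e\<otimes>d\<ominus>\<one>\<in>\<mm>" if d: "d\<in>D" "d\<notin>\<mm>" for d
 proof -
  obtain y where y: "y\<in>\<R>" "y\<otimes>d = \<one>" using unit_inv[OF Dc[OF d(1)] d(2)] by auto
  obtain c where c: "c\<in>C" "y\<ominus>c\<in>\<mm>" using Cm[OF y(1)] by auto
  note cc = Cc[OF c(1)] and dc = Dc[OF d(1)]
  have "\<ominus> ((y\<ominus>c)\<otimes>d)\<in>\<mm>" using idl_neg[OF m_ideal idl_r[OF m_ideal c(2) dc]] .
  moreover have "\<ominus> ((y\<ominus>c)\<otimes>d) = c\<otimes>d\<ominus>y\<otimes>d" using y(1) cc dc by algebra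
  ultimately have "(c\<otimes>d\<ominus>\<one>)[^]p\<in>\<mm>" using idl_pow[OF m_ideal _ p_gt_0] y(2) by simp
  hence "(c\<otimes>d)[^]p\<ominus>\<one>\<in>\<mm>" using minus_pow cc dc by simp
  moreover have "(c\<otimes>d)[^]p = (c[^]p\<otimes>d[^](p - 1))\<otimes>d"
  proof -
   have "d[^]p = d[^](p - 1)\<otimes>d" using p_gt_0 by (simp flip: nat_pow_Suc)
   thus ?thesis using cc dc by (simp add: nat_pow_distrib m_assoc)
  qed
  moreover have "d[^]k\<in>D" for k :: nat by (induction k) (use d(1) subringE[OF D(1)] in auto)
  hence "c[^]p\<otimes>d[^](p - 1)\<in>D" using Dp[OF c(1)] subringE(6)[OF D(1)] by simp
  ultimately show ?thesis by auto
 qed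
 define rel where "rel j \<longleftrightarrow> (\<exists>c. (\<forall>i. c i\<in>D) \<and> ev j c b\<oplus>b[^]j\<in>\<mm>)" for j :: nat
 define c0 where "c0 = (\<lambda>i::nat. if i = 0 then\<ominus>(b[^]p) else \<zero>)"
 have c0: "c0 i\<in>D" for i using Dp[OF b(1)] subringE(2,5)[OF D(1)] by (simp add: c0_def)
 have ep: "ev p c0 b\<oplus>b[^]p = \<zero>"
 proof -
  obtain k where "p = Suc k" using p_gt_0 gr0_implies_Suc by auto
  thus ?thesis using ev_const bc by (simp add: c0_def l_neg)
 qed
 have relp: "rel p" unfolding rel_def by (rule exI[of _ c0]) (simp add: c0 ep idl_zero[OF m_ideal])
 define j where "j = (LEAST j. rel j)"
 have relj: "rel j" unfolding j_def by (rule LeastI[of rel, OF relp])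
 have jp: "j\<le>p" unfolding j_def by (rule Least_le[of rel, OF relp])
 have jmin: "\<not> rel k" if "k < j" for k using that not_less_Least unfolding j_def by blast
 \<comment> \<open>A leading coefficient outside the maximal ideal could be normalised by
   \<open>inv\<close>, which would give a monic relation of degree below \<open>j\<close>.\<close>
 have min: "c i\<in>\<mm>" if "\<And>i. c i\<in>D" "ev k c b\<in>\<mm>" "k\<le>j" "i < k" for c k i using that
 proof (induction k)
  case (Suc k)
  have cc: "c i\<in>\<R>" for i using Suc.prems(1) Dc by auto
  note ec = ev_carr[OF cc bc, of k]
  have bk: "b[^]k\<in>\<R>" using bc by simp
  have ck: "c k\<in>\<mm>"
  proof (rule ccontr)
   assume "c k\<notin>\<mm>"
   then obtain e where e: "e\<in>D" "e\<otimes>c k\<ominus>\<one>\<in>\<mm>" using inv Suc.prems(1) by blast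
   note edc = Dc[OF e(1)]
   have "e\<otimes>ev (Suc k) c b\<ominus>(e\<otimes>c k\<ominus>\<one>)\<otimes>b[^]k\<in>\<mm>"
    by (rule idl_minus[OF m_ideal idl_l[OF m_ideal Suc.prems(2) edc] idl_r[OF m_ideal e(2) bk]])
   moreover have "e\<otimes>ev (Suc k) c b\<ominus>(e\<otimes>c k\<ominus>\<one>)\<otimes>b[^]k = e\<otimes>ev k c b\<oplus>b[^]k"
    unfolding ev.simps using ec cc bk edc by algebra
   ultimately have "ev k (\<lambda>i. e\<otimes>c i) b\<oplus>b[^]k\<in>\<mm>" using ev_smult[OF cc edc bc] by simp
   moreover have "e\<otimes>c i\<in>D" for i using subringE(6)[OF D(1) e(1) Suc.prems(1)] .
   ultimately have "rel k" unfolding rel_def by (intro exI[of _ "\<lambda>i. e\<otimes>c i"]) simp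
   thus False using jmin Suc.prems(3) by simp
  qed
  have "ev k c b\<in>\<mm>" using idl_cancel[OF m_ideal _ idl_r[OF m_ideal ck bk] ec] Suc.prems(2) by simp
  thus ?case using Suc.IH[OF Suc.prems(1)] Suc.prems(3,4) ck by (cases "i = k") auto
 qed simp
 have j1: "j > 1"
 proof (rule ccontr)
  obtain c where c: "\<And>i. c i\<in>D" "ev j c b\<oplus>b[^]j\<in>\<mm>" using relj by (auto simp: rel_def)
  assume "\<not> j > 1"
  hence "j = 0 \<or> j = 1" by auto
  thus False
  proof
   assume "j = 0" thus False using c(2) one_notin_m by simp
  next
   assume "j = 1"
   hence "c 0\<oplus>b\<in>\<mm>" using c(2) Dc[OF c(1)] bc by simp
   moreover have "c 0\<oplus>b = b\<ominus>\<ominus> c 0" using Dc[OF c(1)[of 0]] bc by algebra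
   ultimately show False using b(2) subringE(5)[OF D(1) c(1)] by simp
  qed
 qed
 have claim: "\<exists>b' g. b'\<in>C \<and> b\<ominus>b'\<in>\<mm> \<and> (\<forall>i. g i\<in>D) \<and> ev j g b'\<oplus>b'[^]j\<in>mp (Suc n)"
 proof (cases "j = p")
  case True
  have "b\<ominus>b\<in>\<mm>" using bc idl_zero[OF m_ideal] by (simp add: a_minus_def r_neg)
  thus ?thesis using b(1) c0 ep True idl_zero[OF mp_ideal] by metis
 next
  case False
  obtain c where c: "\<And>i. c i\<in>D" "ev j c b\<oplus>b[^]j\<in>\<mm>" using relj by (auto simp: rel_def)
  have cc: "c i\<in>\<R>" for i using c(1) Dc by auto
  define g where "g = c(j := \<one>)"
  have gD: "g i\<in>D" for i using c(1) subringE(3)[OF D(1)] by (simp add: g_def)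
  have gc: "g i\<in>\<R>" for i using gD Dc by auto
  have evg: "ev k g x = ev k c x" if "k\<le>j" for k x using that by (induction k) (simp_all add: g_def)
  have evg': "ev (Suc j) g x = ev j c x\<oplus>x[^]j" if "x\<in>\<R>" for x using evg that by (simp add: g_def)
  define u where "u = ev (Suc j) g b"
  define v where "v = dv (Suc j) g b"
  have uc: "u\<in>\<R>" unfolding u_def by (rule ev_carr[OF gc bc])
  have "u\<in>C" unfolding u_def by (rule ev_mem[OF Cs(1) _ b(1)]) (use gD D(2) in auto)
  moreover have "u\<in>\<mm>" using c(2) evg'[OF bc] by (simp add: u_def)
  ultimately have un: "u\<in>mp n" using Cs(3) by auto
  have vc: "v\<in>\<R>" unfolding v_def by (rule ev_taylor[OF gc bc zero_closed, THEN conjunct1])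
  \<comment> \<open>The derivative has degree below \<open>j\<close> and leading coefficient
    \<open>j\<close>. If its value were in the maximal ideal, \<open>min\<close> would put
    \<open>j\<close> there, but \<open>j\<close> is prime to \<open>p\<close>.\<close>
  have vm: "v\<notin>\<mm>"
  proof
   assume "v\<in>\<mm>"
   hence em: "ev j (\<lambda>i. [Suc i] \<cdot> g (Suc i)) b\<in>\<mm>" unfolding v_def dv_ev[OF gc bc] .
   have kD: "[k] \<cdot> d\<in>D" if "d\<in>D" for d and k :: nat by (induction k) (use that subringE(2,7)[OF D(1)] in auto)
   have "[Suc (j - 1)] \<cdot> g (Suc (j - 1))\<in>\<mm>" by (rule min[of "\<lambda>i. [Suc i] \<cdot> g (Suc i)" j "j - 1", OF kD[OF gD] em]) (use j1 in simp_all)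
   hence jm: "[j] \<cdot> \<one>\<in>\<mm>" using j1 by (simp add: g_def)
   have "coprime j p" using False jp j1 p_prime
    by (metis coprime_commute dvd_imp_le le_antisym less_imp_le_nat not_less_iff_gr_or_eq not_one_less_zero prime_imp_coprime zero_less_iff_neq_zero)
   then obtain x y where xy: "j * x = p * y + 1" using j1 by (metis Suc_eq_plus1 One_nat_def add.commute bezout_nat coprime_imp_gcd_eq_1 gr_implies_not0)
   have "[(j * x)] \<cdot> \<one> = \<one>" unfolding xy using p_add_pow[OF one_closed, of y] by simp
   moreover have "[(j * x)] \<cdot> \<one> = [x] \<cdot> \<one>\<otimes>[j] \<cdot> \<one>" using add.nat_pow_pow[of \<one> x j] add_pow_ldistr by simp
   ultimately show False using idl_l[OF m_ideal jm, of "[x] \<cdot> \<one>"] one_notin_m by simp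
  qed
  obtain y where y: "y\<in>\<R>" "y\<otimes>v = \<one>" using unit_inv[OF vc vm] by auto
  define t where "t =\<ominus>(u\<otimes>y)"
  have tn: "t\<in>mp n" unfolding t_def by (rule idl_neg[OF mp_ideal idl_r[OF mp_ideal un y(1)]])
  note tc = idl_carr[OF mp_ideal tn]
  obtain w where w: "w\<in>\<R>" "ev (Suc j) g (b\<oplus>t) = u\<oplus>t\<otimes>v\<oplus>t\<otimes>t\<otimes>w"
   by (rule bexE[OF ev_taylor[of g b t "Suc j", OF gc bc tc, THEN conjunct2, folded u_def v_def]]) (rule that)
  have "t\<otimes>v =\<ominus>(u\<otimes>(y\<otimes>v))" unfolding t_def using uc y(1) vc by algebra
  hence "u\<oplus>t\<otimes>v\<oplus>t\<otimes>t\<otimes>w = t\<otimes>t\<otimes>w" using uc tc w(1) y(2) by (simp add: r_neg)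
  moreover have "t\<otimes>t\<otimes>w\<in>mp (Suc n)"
   using idl_r[OF mp_ideal ipow_mult[OF m_ideal tn tn] w(1)] ipow_antimono[OF m_ideal, of "Suc n" "n + n"] n by auto
  ultimately have "ev j c (b\<oplus>t)\<oplus>(b\<oplus>t)[^]j\<in>mp (Suc n)" using w(2) evg' bc tc by simp
  moreover have "b\<oplus>t\<in>C" using b(1) tn Cs(2) subringE(7)[OF Cs(1)] by auto
  moreover have "t\<in>\<mm>" using tn ipow_antimono[OF m_ideal n] ipow_1[OF m_ideal] by auto
  hence "\<ominus> t\<in>\<mm>" by (rule idl_neg[OF m_ideal])
  moreover have "b\<ominus>(b\<oplus>t) =\<ominus>t" using bc tc by algebra
  ultimately show ?thesis using c(1) by metis
 qed
 then obtain b' g where b': "b'\<in>C" "b\<ominus>b'\<in>\<mm>" "\<And>i. g i\<in>D" "ev j g b'\<oplus>b'[^]j\<in>mp (Suc n)" by blast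
 note bc' = Cc[OF b'(1)]
 have "\<exists>V. subring V R \<and> D\<subseteq>V \<and> b'\<in>V \<and> V\<subseteq>C \<and> V\<inter>\<mm>\<subseteq>mp (Suc n)"
 proof (rule adjoin[OF D(1,3,4) _ bc' b'(3,4) _ _ Cs(1) D(2) b'(1)])
  \<comment> \<open>Minimality is known for \<open>b\<close> and carries over to \<open>b'\<close>,
    as values at elements congruent modulo the maximal ideal are congruent.\<close>
  fix c i assume c: "\<And>i. c i\<in>D" "ev j c b'\<in>\<mm>" "i < j"
  have cc: "c i\<in>\<R>" for i using c(1) Dc by auto
  define t where "t = b\<ominus>b'"
  have t: "t\<in>\<mm>" using b'(2) by (simp add: t_def)
  obtain w where w: "w\<in>\<R>" "ev j c (b'\<oplus>t) = ev j c b'\<oplus>t\<otimes>dv j c b'\<oplus>t\<otimes>t\<otimes>w"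
   by (rule bexE[OF ev_taylor[of c b' t j, OF cc bc' m_carr[OF t], THEN conjunct2]]) (rule that)
  have d: "dv j c b'\<in>\<R>" by (rule ev_taylor[OF cc bc' m_carr[OF t], THEN conjunct1])
  have "b'\<oplus>t = b" unfolding t_def using bc bc' by algebra
  moreover have "t\<otimes>t\<otimes>w\<in>\<mm>" by (rule idl_r[OF m_ideal idl_r[OF m_ideal t m_carr[OF t]] w(1)])
  ultimately have "ev j c b\<in>\<mm>" using w(2) idl_add[OF m_ideal idl_add[OF m_ideal c(2) idl_r[OF m_ideal t d]]] by simp
  thus "c i\<in>\<mm>" using min c(1,3) by simp
 qed (use j1 in simp_all)
 thus ?thesis using b'(2) by blast
qed

text \<open>Zorn's lemma for subrings of \<open>C\<close> that contain all \<open>p\<close>-th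
  powers of \<open>C\<close> and \<open>mp (Suc n)\<close>. The smallest candidate \<open>D0\<close>
  qualifies because an element of \<open>C\<close> in the maximal ideal is in \<open>mp n\<close>,
  and its \<open>p\<close>-th power in \<open>mp (p * n)\<close>. A maximal one fills the residue
  field by \<open>extend_coeff\<close>.\<close>

lemma coeff_step:
 assumes C: "partial_coeff n C" and n: "n\<ge>1" shows "\<exists>C'. partial_coeff (Suc n) C' \<and> C'\<subseteq>C"
proof -
 have Cs: "subring C R" "mp n\<subseteq>C" "C\<inter>\<mm>\<subseteq>mp n" and Cm: "\<And>x. x\<in>\<R> ==> \<exists>c\<in>C. x\<ominus>c\<in>\<mm>"
  using C by (auto simp: partial_coeff_def)
 note Cc = subsetD[OF subringE(1)[OF Cs(1)]] and mc = idl_carr[OF mp_ideal]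
 have mS: "mp (Suc n)\<subseteq>\<mm>" "mp (Suc n)\<subseteq>C"
  using ipow_antimono[OF m_ideal, of 1 "Suc n"] ipow_1[OF m_ideal] ipow_Suc_sub[OF m_ideal, of n] Cs(2) by auto
 define T where "T D \<longleftrightarrow> subring D R \<and> D\<subseteq>C \<and> mp (Suc n)\<subseteq>D \<and> D\<inter>\<mm>\<subseteq>mp (Suc n) \<and> (\<forall>c\<in>C. c[^]p\<in>D)" for D
 define D0 where "D0 = {c[^]p\<oplus>m | c m. c\<in>C \<and> m\<in>mp (Suc n)}"
 have D0I: "c[^]p\<oplus>m\<in>D0" if "c\<in>C" "m\<in>mp (Suc n)" for c m using that by (auto simp: D0_def)
 have zero: "\<zero>[^]p = \<zero>" using p_gt_0 by (simp add: nat_pow_zero)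
 have "T D0" unfolding T_def
 proof (intro conjI ballI subsetI)
  show "c[^]p\<in>D0" if "c\<in>C" for c using D0I[OF that idl_zero[OF mp_ideal]] Cc[OF that] by simp
  show m0: "m\<in>D0" if "m\<in>mp (Suc n)" for m using D0I[OF subringE(2)[OF Cs(1)] that] zero mc[OF that] by simp
  have pw: "c[^]k\<in>C" if "c\<in>C" for c and k :: nat by (induction k) (use that subringE[OF Cs(1)] in auto)
  show "x\<in>C" if "x\<in>D0" for x using that pw mS(2) subringE(7)[OF Cs(1)] by (auto simp: D0_def)
  show "subring D0 R"
  proof (rule subringI)
   show "D0\<subseteq>\<R>" using Cc mc by (auto simp: D0_def)
   show "\<one>\<in>D0" using D0I[OF subringE(3)[OF Cs(1)] idl_zero[OF mp_ideal]] by simp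
   fix x assume "x\<in>D0"
   then obtain c m where x: "c\<in>C" "m\<in>mp (Suc n)" "x = c[^]p\<oplus>m" by (auto simp: D0_def)
   have c: "c\<in>\<R>" "m\<in>\<R>" "c[^]p\<in>\<R>" using Cc x mc by auto
   have "\<ominus> x = (\<ominus> c)[^]p\<oplus>\<ominus> m" unfolding x(3) neg_pow[OF c(1)] using c(2,3) by algebra
   thus "\<ominus> x\<in>D0" using D0I[OF subringE(5)[OF Cs(1) x(1)] idl_neg[OF mp_ideal x(2)]] by simp
   fix y assume "y\<in>D0"
   then obtain d l where y: "d\<in>C" "l\<in>mp (Suc n)" "y = d[^]p\<oplus>l" by (auto simp: D0_def)
   have d: "d\<in>\<R>" "l\<in>\<R>" "d[^]p\<in>\<R>" using Cc y mc by auto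
   have "x\<oplus>y = (c\<oplus>d)[^]p\<oplus>(m\<oplus>l)" unfolding x(3) y(3) freshman[OF c(1) d(1)] using c(2,3) d(2,3) by algebra
   thus "x\<oplus>y\<in>D0" using D0I[OF subringE(7)[OF Cs(1) x(1) y(1)] idl_add[OF mp_ideal x(2) y(2)]] by simp
   have "x\<otimes>y = c[^]p\<otimes>d[^]p\<oplus>(c[^]p\<otimes>l\<oplus>(d[^]p\<oplus>l)\<otimes>m)" unfolding x(3) y(3) using c(2,3) d(2,3) by algebra
   hence "x\<otimes>y = (c\<otimes>d)[^]p\<oplus>(c[^]p\<otimes>l\<oplus>(d[^]p\<oplus>l)\<otimes>m)" using nat_pow_distrib[OF c(1) d(1)] by simp
   thus "x\<otimes>y\<in>D0" using D0I[OF subringE(6)[OF Cs(1) x(1) y(1)] idl_add[OF mp_ideal idl_l[OF mp_ideal y(2) c(3)] idl_l[OF mp_ideal x(2)]]] d by simp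
  qed
  fix x assume xm: "x\<in>D0\<inter>\<mm>"
  then obtain c m where x: "c\<in>C" "m\<in>mp (Suc n)" "x = c[^]p\<oplus>m" by (auto simp: D0_def)
  have "c[^]p\<in>\<mm>" using idl_cancel[OF m_ideal, of "c[^]p" m] xm x mS(1) Cc by auto
  hence cn: "c\<in>mp n" using prime_pow[OF m_prime Cc[OF x(1)]] Cs(3) x(1) by auto
  have "c[^]k\<in>mp (k * n)" for k :: nat
  proof (induction k)
   case (Suc k) thus ?case using ipow_mult[OF m_ideal Suc cn] by (simp add: add.commute)
  qed simp
  hence cp: "c[^]p\<in>mp (p * n)" .
  have "2 * n\<le>p * n" by (rule mult_le_mono1) (use p_gt_1 in simp)
  hence "Suc n\<le>p * n" using n by linarith
  hence "c[^]p\<in>mp (Suc n)" using ipow_antimono[OF m_ideal] cp by blast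
  thus "x\<in>mp (Suc n)" unfolding x(3) using idl_add[OF mp_ideal] x(2) by simp
 qed
 hence ne: "{D. T D}\<noteq>{}" by auto
 have "\<exists>D\<in>{D. T D}. \<forall>X\<in>{D. T D}. D\<subseteq>X \<longrightarrow> X = D"
 proof (rule subset_Zorn_nonempty[OF ne])
  fix Ch assume Ch: "Ch\<noteq>{}" "subset.chain {D. T D} Ch"
  have TD: "T D" if "D\<in>Ch" for D using Ch(2) that by (auto simp: subset.chain_def)
  have sD: "subring D R" if "D\<in>Ch" for D using TD[OF that] by (simp add: T_def)
  have two: "\<exists>D\<in>Ch. x\<in>D \<and> y\<in>D" if xy: "x\<in>\<Union>Ch" "y\<in>\<Union>Ch" for x y
  proof -
   obtain D E where D: "D\<in>Ch" "x\<in>D" "E\<in>Ch" "y\<in>E" using xy by auto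
   moreover have "D\<subseteq>E \<or> E\<subseteq>D" using Ch(2) D unfolding subset_chain_def by metis
   ultimately show ?thesis by auto
  qed
  obtain D where D: "D\<in>Ch" using Ch(1) by auto
  have "subring (\<Union>Ch) R"
  proof (rule subringI)
   show "\<Union>Ch\<subseteq>\<R>" using subringE(1)[OF sD] by auto
   show "\<one>\<in>\<Union>Ch" using subringE(3)[OF sD[OF D]] D by auto
   show "\<ominus> h\<in>\<Union>Ch" if "h\<in>\<Union>Ch" for h using that subringE(5)[OF sD] by auto
   show "h\<otimes>h'\<in>\<Union>Ch" if "h\<in>\<Union>Ch" "h'\<in>\<Union>Ch" for h h' using two[OF that] subringE(6)[OF sD] by auto
   show "h\<oplus>h'\<in>\<Union>Ch" if "h\<in>\<Union>Ch" "h'\<in>\<Union>Ch" for h h' using two[OF that] subringE(7)[OF sD] by auto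
  qed
  moreover have "\<Union>Ch\<subseteq>C" "\<Union>Ch\<inter>\<mm>\<subseteq>mp (Suc n)" using TD unfolding T_def by blast+
  moreover have "D\<subseteq>\<Union>Ch" using D by auto
  ultimately have "T (\<Union>Ch)" using TD[OF D] unfolding T_def by (meson subsetD subset_trans)
  thus "\<Union>Ch\<in>{D. T D}" by simp
 qed
 then obtain D where D: "T D" "\<And>X. T X ==> D\<subseteq>X ==> X = D" by auto
 have Ds: "subring D R" "D\<subseteq>C" "mp (Suc n)\<subseteq>D" "D\<inter>\<mm>\<subseteq>mp (Suc n)" and Dp: "\<And>c. c\<in>C ==> c[^]p\<in>D" using D(1) by (auto simp: T_def)
 have CD: "\<exists>d\<in>D. b\<ominus>d\<in>\<mm>" if b: "b\<in>C" for b
 proof (rule ccontr)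
  assume "\<not> (\<exists>d\<in>D. b\<ominus>d\<in>\<mm>)"
  then obtain V b' where V: "subring V R" "D\<subseteq>V" "b'\<in>V" "b\<ominus>b'\<in>\<mm>" "V\<subseteq>C" "V\<inter>\<mm>\<subseteq>mp (Suc n)"
   using extend_coeff[OF C n Ds Dp b] by blast
  have "T V" unfolding T_def using V Ds(3) Dp by blast
  hence "V = D" using D(2) V(2) by simp
  thus False using V(3,4) \<open>\<not> (\<exists>d\<in>D. b \<ominus> d \<in> \<mm>)\<close> by auto
 qed
 have "\<exists>d\<in>D. x\<ominus>d\<in>\<mm>" if x: "x\<in>\<R>" for x
 proof -
  obtain c where c: "c\<in>C" "x\<ominus>c\<in>\<mm>" using Cm[OF x] by auto
  obtain d where d: "d\<in>D" "c\<ominus>d\<in>\<mm>" using CD[OF c(1)] by auto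
  have "(x\<ominus>c)\<oplus>(c\<ominus>d) = x\<ominus>d" using x Cc[OF c(1)] Cc[OF subsetD[OF Ds(2) d(1)]] by algebra
  thus ?thesis using idl_add[OF m_ideal c(2) d(2)] d(1) by auto
 qed
 thus ?thesis using Ds by (intro exI[of _ D]) (simp add: partial_coeff_def)
qed

text \<open>Intersect a descending sequence of partial coefficient rings \<open>C n\<close> of level
  \<open>Suc n\<close>, starting with the whole ring. Representatives of one residue class in the
  \<open>C n\<close> form a Cauchy sequence, whose limit is in the intersection.\<close>

theorem coeff_set_exists: "\<exists>K. coeff_set K"
proof -
 have "partial_coeff (Suc 0) (\<R>)"
  unfolding partial_coeff_def using carrier_is_subring idl_carr[OF mp_ideal] ipow_1[OF m_ideal] idl_zero[OF m_ideal]
  by (auto intro!: bexI simp: a_minus_def r_neg)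
 hence "\<exists>C. \<forall>n. partial_coeff (Suc n) (C n) \<and> C (Suc n)\<subseteq>C n"
  using dependent_nat_choice[of "\<lambda>n. partial_coeff (Suc n)" "\<lambda>n C C'. C'\<subseteq>C"] coeff_step by auto
 then obtain C where pc: "\<And>n. partial_coeff (Suc n) (C n)" and dec: "\<And>n. C (Suc n)\<subseteq>C n" by auto
 have C: "subring (C n) R" "mp (Suc n)\<subseteq>C n" "C n\<inter>\<mm>\<subseteq>mp (Suc n)" "\<And>x. x\<in>\<R> ==> \<exists>c\<in>C n. x\<ominus>c\<in>\<mm>" for n
  using pc by (auto simp: partial_coeff_def)
 note Cc = subsetD[OF subringE(1)[OF C(1)]]
 define K where "K = (\<Inter>n. C n)"
 have "subring K R" by (rule subringI) (use Cc subringE(3,5-7)[OF C(1)] in \<open>auto simp: K_def\<close>)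
 moreover have "x = \<zero>" if x: "x\<in>K\<inter>\<mm>" for x
 proof -
  have xn: "x\<in>mp n" for n using x C(3) ipow_Suc_sub[OF m_ideal, of n] by (auto simp: K_def)
  have "x\<in>{\<zero>}"
  proof (rule krull_intersection[OF zeroideal])
   fix n
   have "x = \<zero>\<oplus>x" using xn idl_carr[OF mp_ideal] by simp
   thus "x\<in>{\<zero>} <+> mp n" unfolding set_add_def' using xn by blast
  qed
  thus ?thesis by simp
 qed
 moreover have "\<exists>c\<in>K. x\<ominus>c\<in>\<mm>" if x: "x\<in>\<R>" for x
 proof -
  obtain c where c: "\<And>n. c n\<in>C n" "\<And>n. x\<ominus>c n\<in>\<mm>" using C(4)[OF x] by metis
  have cc: "c n\<in>\<R>" for n by (rule Cc[OF c(1)])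
  have "c (Suc n)\<ominus>c n\<in>mp (Suc n)" for n
  proof -
   have "(x\<ominus>c n)\<ominus>(x\<ominus>c (Suc n))\<in>\<mm>" by (rule idl_minus[OF m_ideal c(2) c(2)])
   moreover have "(x\<ominus>c n)\<ominus>(x\<ominus>c (Suc n)) = c (Suc n)\<ominus>c n" using x cc[of n] cc by algebra
   moreover have "c (Suc n)\<ominus>c n\<in>C n" unfolding a_minus_def using subringE(5,7)[OF C(1)] c(1)[of n] c(1)[of "Suc n"] dec[of n] by auto
   ultimately show ?thesis using C(3) by auto
  qed
  hence "c (Suc n)\<ominus>c n\<in>mp n" for n using ipow_Suc_sub[OF m_ideal, of n] by auto
  hence "\<exists>z\<in>\<R>. \<forall>n. z\<ominus>c n\<in>mp n" by (rule complete[of c, OF cc])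
  then obtain z where z: "z\<in>\<R>" "\<And>n. z\<ominus>c n\<in>mp n" by auto
  have "z\<in>C n" for n
  proof -
   have "z\<ominus>c (Suc n)\<in>C n" using C(2) z(2) by auto
   moreover have "c (Suc n)\<in>C n" using c(1) dec by auto
   moreover have "z = (z\<ominus>c (Suc n))\<oplus>c (Suc n)" using z(1) cc by algebra
   ultimately show ?thesis using subringE(7)[OF C(1)] by metis
  qed
  hence "z\<in>K" by (simp add: K_def)
  moreover have "(x\<ominus>c 1)\<ominus>(z\<ominus>c 1)\<in>\<mm>" using idl_minus[OF m_ideal c(2)[of 1]] z(2)[of 1] ipow_1[OF m_ideal] by simp
  moreover have "(x\<ominus>c 1)\<ominus>(z\<ominus>c 1) = x\<ominus>z" using x z(1) cc by algebra
  ultimately show ?thesis by auto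
 qed
 moreover have "\<zero>\<in>K\<inter>\<mm>" using subringE(2)[OF C(1)] idl_zero[OF m_ideal] by (auto simp: K_def)
 ultimately have "coeff_set K" unfolding coeff_set_def by blast
 thus ?thesis by blast
qed

end

section \<open>Torsion modules with an injective Frobenius action\<close>

locale frob_module = frobenius_module R \<mm> p M F for R (structure) and \<mm> and p :: nat and M (structure) and F +
 fixes K
 assumes K: "coeff_set K" and torsion: "x\<in>carrier M ==> \<exists>n. \<forall>r\<in>ipow \<mm> n. r *. x = \<zero>\<^sub>M"
begin

lemma Ks: "subring K R" using K by (simp add: coeff_set_def)
lemmas Kc = subsetD[OF subringE(1)[OF Ks]]
lemma K_pow: "c\<in>K ==> c[^](n::nat)\<in>K" by (induction n) (use subringE[OF Ks] in auto)
lemma K_inv: "c\<in>K ==> c\<noteq>\<zero> ==> \<exists>e\<in>K. e\<otimes>c = \<one>" by (rule coeff_set_inv[OF K])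

definition ksub where
 "ksub V \<longleftrightarrow> V\<subseteq>carrier M \<and> \<zero>\<^sub>M\<in>V \<and> (\<forall>x\<in>V. \<forall>y\<in>V. x +. y\<in>V) \<and> (\<forall>c\<in>K. \<forall>x\<in>V. c *. x\<in>V)"
definition kspan where "kspan S = \<Inter>{V. ksub V \<and> S\<subseteq>V}"

lemma ksubD: assumes "ksub V"
 shows "x\<in>V ==> x\<in>carrier M" "\<zero>\<^sub>M\<in>V" "x\<in>V ==> y\<in>V ==> x +. y\<in>V" "c\<in>K ==> x\<in>V ==> c *. x\<in>V"
 using assms by (auto simp: ksub_def)
lemma ksub_carrier: "ksub (carrier M)" using Kc by (simp add: ksub_def)
lemma ksub_kspan: "S\<subseteq>carrier M ==> ksub (kspan S)" unfolding kspan_def ksub_def using ksub_carrier by (auto simp: ksub_def)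
lemma kspan_self: "x\<in>S ==> x\<in>kspan S" by (auto simp: kspan_def)
lemma kspan_least: "ksub V ==> S\<subseteq>V ==> kspan S\<subseteq>V" by (auto simp: kspan_def)
lemma kspan_mono: "S\<subseteq>T ==> kspan S\<subseteq>kspan T" by (auto simp: kspan_def)

text \<open>The map may be semilinear, with \<open>g\<close> as twist of the scalars; this covers
  powers of \<open>F\<close> as well as multiplication by ring elements.\<close>

lemma kspan_map:
 assumes W: "ksub W" and S: "\<And>s. s\<in>S ==> s\<in>carrier M \<and> \<phi> s\<in>W"
  and add: "\<And>x y. x\<in>carrier M ==> y\<in>carrier M ==> \<phi> (x +. y) = \<phi> x +. \<phi> y"
  and sm: "\<And>c x. c\<in>K ==> x\<in>carrier M ==> g c\<in>K \<and> \<phi> (c *. x) = g c *. \<phi> x" and z: "\<phi> \<zero>\<^sub>M = \<zero>\<^sub>M"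
  and x: "x\<in>kspan S" shows "\<phi> x\<in>W"
proof -
 have "ksub {x\<in>carrier M. \<phi> x\<in>W}" unfolding ksub_def using ksubD[OF W] add sm z Kc by auto
 hence "kspan S\<subseteq>{x\<in>carrier M. \<phi> x\<in>W}" by (rule kspan_least) (use S in auto)
 thus ?thesis using x by auto
qed

definition kadd where "kadd V z = {h +. c *. z | h c. h\<in>V \<and> c\<in>K}"

lemma kadd_ksub: assumes V: "ksub V" and z: "z\<in>carrier M" shows "ksub (kadd V z)" "V\<subseteq>kadd V z" "z\<in>kadd V z"
proof -
 note Vc = ksubD(1)[OF V]
 have mem: "h +. c *. z\<in>kadd V z" if "h\<in>V" "c\<in>K" for h c using that by (auto simp: kadd_def)
 show sub: "V\<subseteq>kadd V z"
 proof
  fix v assume "v\<in>V" thus "v\<in>kadd V z" using mem[of v \<zero>] subringE(2)[OF Ks] Vc z by simp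
 qed
 show "z\<in>kadd V z" using mem[OF ksubD(2)[OF V] subringE(3)[OF Ks]] z by simp
 show "ksub (kadd V z)" unfolding ksub_def
 proof (intro conjI ballI)
  show "kadd V z\<subseteq>carrier M" using Vc Kc z by (auto simp: kadd_def)
  show "\<zero>\<^sub>M\<in>kadd V z" using sub ksubD(2)[OF V] by auto
  fix x assume "x\<in>kadd V z"
  then obtain h c where x: "h\<in>V" "c\<in>K" "x = h +. c *. z" by (auto simp: kadd_def)
  { fix y assume "y\<in>kadd V z"
   then obtain h' c' where y: "h'\<in>V" "c'\<in>K" "y = h' +. c' *. z" by (auto simp: kadd_def)
   have "x +. y = (h +. h') +. (c\<oplus>c') *. z" unfolding x(3) y(3) using x y Vc Kc z by (simp add: smult_l_distr M.a_ac)
   thus "x +. y\<in>kadd V z" using mem ksubD(3)[OF V x(1) y(1)] subringE(7)[OF Ks x(2) y(2)] by simp }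
  { fix d assume d: "d\<in>K"
   have "d *. x = d *. h +. (d\<otimes>c) *. z" unfolding x(3) using x Vc Kc z d by (simp add: smult_r_distr smult_assoc1)
   thus "d *. x\<in>kadd V z" using mem ksubD(4)[OF V d x(1)] subringE(6)[OF Ks d x(2)] by simp }
 qed
qed

lemma kadd_least: "ksub W ==> V\<subseteq>W ==> z\<in>W ==> kadd V z\<subseteq>W" unfolding kadd_def by (auto intro!: ksubD(3,4))

lemma kadd_exchange:
 assumes V: "ksub V" and y: "y\<in>carrier M" and x: "x\<in>kadd V y" "x\<notin>V" shows "y\<in>kadd V x"
proof -
 obtain h d where h: "h\<in>V" "d\<in>K" "x = h +. d *. y" using x(1) by (auto simp: kadd_def)
 note hc = ksubD(1)[OF V h(1)]
 have "d\<noteq>\<zero>" using x(2) h hc y by auto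
 then obtain e where e: "e\<in>K" "e\<otimes>d = \<one>" using K_inv h(2) by blast
 have "\<ominus> e *. h +. e *. x =\<ominus>e *. h +. e *. h +. (e\<otimes>d) *. y" unfolding h(3)
  using hc y Kc[OF e(1)] Kc[OF h(2)] by (simp add: smult_r_distr smult_assoc1 M.a_assoc)
 also have "\<dots> = y" using hc y Kc[OF e(1)] by (simp add: e(2) smult_l_minus M.l_neg)
 finally show ?thesis unfolding kadd_def using ksubD(4)[OF V subringE(5)[OF Ks e(1)] h(1)] e(1) by force
qed

text \<open>Subspaces of codimension at most one. They take the place of linear functionals, so that
  no dual space is formed.\<close>

definition hyper where "hyper H \<longleftrightarrow> ksub H \<and> (\<forall>z\<in>carrier M - H. carrier M\<subseteq>kadd H z)"

text \<open>A subspace maximal among those without \<open>x\<close> has this property by the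
  exchange lemma.\<close>

lemma hyper_exists:
 assumes x: "x\<in>carrier M" "x\<noteq>\<zero>\<^sub>M" shows "\<exists>H. hyper H \<and> x\<notin>H"
proof -
 let ?A = "{V. ksub V \<and> x\<notin>V}"
 have "ksub {\<zero>\<^sub>M}" using Kc by (simp add: ksub_def)
 hence "?A\<noteq>{}" using x(2) by auto
 hence "\<exists>H\<in>?A. \<forall>X\<in>?A. H\<subseteq>X \<longrightarrow> X = H"
 proof (rule subset_Zorn_nonempty)
  fix Ch assume Ch: "Ch\<noteq>{}" "subset.chain ?A Ch"
  have ks: "ksub V" if "V\<in>Ch" for V using that Ch(2) by (auto simp: subset.chain_def)
  have "ksub (\<Union>Ch)" unfolding ksub_def
  proof (intro conjI ballI)
   show "\<Union>Ch\<subseteq>carrier M" using ksubD(1)[OF ks] by auto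
   show "\<zero>\<^sub>M\<in>\<Union>Ch" using ksubD(2)[OF ks] Ch(1) by auto
   show "c *. v\<in>\<Union>Ch" if "c\<in>K" "v\<in>\<Union>Ch" for c v using ksubD(4)[OF ks that(1)] that(2) by auto
   fix v w assume "v\<in>\<Union>Ch" "w\<in>\<Union>Ch"
   then obtain V W where VW: "V\<in>Ch" "v\<in>V" "W\<in>Ch" "w\<in>W" by auto
   moreover have "V\<subseteq>W \<or> W\<subseteq>V" using Ch(2) VW unfolding subset_chain_def by metis
   ultimately show "v +. w\<in>\<Union>Ch" using ksubD(3)[OF ks[OF VW(1)], of v w] ksubD(3)[OF ks[OF VW(3)], of v w] by auto
  qed
  thus "\<Union>Ch\<in>?A" using Ch(2) by (auto simp: subset.chain_def)
 qed
 then obtain H where H: "ksub H" "x\<notin>H" "\<And>V. ksub V ==> x\<notin>V ==> H\<subseteq>V ==> V = H" by auto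
 have xk: "x\<in>kadd H z" if z: "z\<in>carrier M" "z\<notin>H" for z
  using H(3)[OF kadd_ksub(1)[OF H(1) z(1)]] kadd_ksub(2,3)[OF H(1) z(1)] z(2) by auto
 have "y\<in>kadd H z" if z: "z\<in>carrier M" "z\<notin>H" and y: "y\<in>carrier M" for y z
  using kadd_exchange[OF H(1) y xk[OF y] H(2)] kadd_least[OF kadd_ksub(1,2)[OF H(1) z(1)] xk[OF z]] kadd_ksub(2)[OF H(1) z(1)] by blast
 hence "hyper H" unfolding hyper_def using H(1) by auto
 thus ?thesis using H(2) by auto
qed

lemma soc_ksub: "ksub soc" unfolding ksub_def soc_def
proof (intro conjI ballI, goal_cases)
 case (3 x y) thus ?case using m_carr by (auto simp: smult_r_distr)
next
 case (4 c x)
 have "r *. (c *. x) = c *. (r *. x)" if "r\<in>\<mm>" for r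
  using 4 Kc[OF 4(1)] m_carr[OF that] smult_assoc1[of r c x] smult_assoc1 m_comm[of r c] by simp
 thus ?case using 4 Kc by auto
qed (use m_carr in auto)

end

text \<open>The chain condition on subspaces of the socle stands for its finite dimension.\<close>

locale frob_module_dcc = frob_module +
 assumes socle_dcc: "(\<And>n. ksub (T n)) ==> (\<And>n. T n\<subseteq>soc) ==> (\<And>n. T (Suc n)\<subseteq>T n) ==> \<exists>n. \<forall>k\<ge>n. T k = T (n::nat)"
begin

text \<open>As long as the hyperplanes chosen so far have a nonzero common element in the socle, one
  more cuts it away; the chain condition ends this.\<close>

lemma hypers:
 assumes "z\<in>carrier M" "z\<noteq>\<zero>\<^sub>M"
 shows "\<exists>H s. s > (0::nat) \<and> (\<forall>l. hyper (H l)) \<and> (\<forall>x\<in>soc. (\<forall>l<s. x\<in>H l) \<longrightarrow> x = \<zero>\<^sub>M)"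
proof (rule ccontr)
 assume neg: "\<not> ?thesis"
 obtain H0 where H0: "hyper H0" using hyper_exists[OF assms] by auto
 define T where "T Hs = {x\<in>soc. \<forall>H\<in>set Hs. x\<in>H}" for Hs
 have "\<exists>f. \<forall>n. (f n\<noteq>[] \<and> (\<forall>H\<in>set (f n). hyper H)) \<and> T (f (Suc n))\<subset>T (f n)"
 proof (rule dependent_nat_choice)
  show "\<exists>Hs. Hs\<noteq>[] \<and> (\<forall>H\<in>set Hs. hyper H)" using H0 by (intro exI[of _ "[H0]"]) simp
  fix Hs assume Hs: "Hs\<noteq>[] \<and> (\<forall>H\<in>set Hs. hyper H)"
  \<comment> \<open>The list is padded with \<open>H0\<close> to a total sequence of hyperplanes;
    only the first \<open>length Hs\<close> of them matter.\<close>
  define H where "H l = (if l < length Hs then Hs ! l else H0)" for l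
  have "\<forall>l. hyper (H l)" using Hs H0 by (simp add: H_def)
  moreover have "length Hs > 0" using Hs by simp
  ultimately obtain x where x: "x\<in>soc" "\<And>l. l < length Hs ==> x\<in>H l" "x\<noteq>\<zero>\<^sub>M" using neg by metis
  have xT: "x\<in>T Hs" using x unfolding T_def H_def by (auto simp: in_set_conv_nth)
  obtain H' where H': "hyper H'" "x\<notin>H'" using hyper_exists[of x] x by (auto simp: soc_def)
  have "T (H' # Hs)\<subset>T Hs" using xT H'(2) by (auto simp: T_def)
  thus "\<exists>Hs'. (Hs'\<noteq>[] \<and> (\<forall>H\<in>set Hs'. hyper H)) \<and> T Hs'\<subset>T Hs" using Hs H'(1) by (intro exI[of _ "H' # Hs"]) simp
 qed
 then obtain f where f: "\<And>n. \<forall>H\<in>set (f n). hyper H" "\<And>n. T (f (Suc n))\<subset>T (f n)" by metis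
 have "ksub (T (f n))" for n unfolding ksub_def T_def using f(1)[of n] ksubD[OF soc_ksub] unfolding hyper_def by (auto simp: ksub_def)
 moreover have "T (f n)\<subseteq>soc" for n by (auto simp: T_def)
 ultimately have "\<exists>n. \<forall>k\<ge>n. T (f k) = T (f n)" using socle_dcc[of "\<lambda>n. T (f n)"] f(2) by blast
 then obtain n where "T (f (Suc n)) = T (f n)" using le_Suc_eq by blast
 thus False using f(2) by blast
qed

end

subsection \<open>Monomials encoded by natural numbers\<close>

lemma nat_monotone_subseq: "\<exists>r :: nat\<Rightarrow>nat. strict_mono r \<and> (\<forall>i j. i\<le>j \<longrightarrow> f (r i)\<le>(f (r j) :: nat))"
proof -
 have step: "\<exists>y\<ge>a. \<forall>j\<ge>y. f y\<le>f j" for a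
 proof -
  obtain y where "a\<le>y" "\<And>j. a\<le>j ==> f y\<le>f j" using ex_has_least_nat[of "\<lambda>j. a\<le>j" a f] by auto
  thus ?thesis by (intro exI[of _ y]) auto
 qed
 have "\<exists>r. \<forall>n. (\<forall>j\<ge>r n. f (r n)\<le>f j) \<and> r n < r (Suc n)"
 proof (rule dependent_nat_choice)
  show "\<exists>x. \<forall>j\<ge>x. f x\<le>f j" using step by auto
  fix x show "\<exists>y. (\<forall>j\<ge>y. f y\<le>f j) \<and> x < y" using step[of "Suc x"] by auto
 qed
 then obtain r where r: "\<And>n. \<forall>j\<ge>r n. f (r n)\<le>f j" "\<And>n. r n < r (Suc n)" by auto
 have "strict_mono r" using r(2) by (simp add: strict_mono_Suc_iff)
 thus ?thesis using r(1) strict_mono_less_eq by blast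
qed

text \<open>A monotone subsequence is extracted for one coordinate after the other.\<close>

lemma dickson:
 assumes "finite Q"
 shows "\<exists>r :: nat\<Rightarrow>nat. strict_mono r \<and> (\<forall>q\<in>Q. \<forall>i j. i\<le>j \<longrightarrow> f (r i) q\<le>(f (r j) q :: nat))"
 using assms
proof (induction Q)
 case empty show ?case by (intro exI[of _ id]) (simp add: strict_mono_def)
next
 case (insert q Q)
 then obtain r :: "nat\<Rightarrow>nat" where r: "strict_mono r" "\<forall>q\<in>Q. \<forall>i j. i\<le>j \<longrightarrow> f (r i) q\<le>f (r j) q" by metis
 obtain t :: "nat\<Rightarrow>nat" where t: "strict_mono t" "\<forall>i j. i\<le>j \<longrightarrow> f (r (t i)) q\<le>f (r (t j)) q" using nat_monotone_subseq[of "\<lambda>i. f (r i) q"] by auto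
 have "strict_mono (r\<circ>t)" using r(1) t(1) by (simp add: strict_mono_def)
 moreover have "t i\<le>t j" if "i\<le>j" for i j using t(1) that by (simp add: strict_mono_less_eq)
 ultimately show ?case using r(2) t(2) by (intro exI[of _ "r\<circ>t"]) (auto simp: comp_def)
qed

text \<open>Monomials in the generators \<open>g q\<close> are encoded by numbers, with one prime
  \<open>q\<close> for each generator. Products and divisibility of monomials become those of
  numbers, and the usual order of numbers is a monomial order.\<close>

locale monomial_code = cring +
 fixes Q :: "nat set" and g
 assumes Q_fin: "finite Q" and Q_prime: "q\<in>Q ==> Factorial_Ring.prime q" and g_carr: "q\<in>Q ==> g q\<in>carrier R"
begin

definition mu where "mu n = (\<Otimes>q\<in>Q. g q[^](multiplicity q n :: nat))"
definition smooth where "smooth n \<longleftrightarrow> n = (\<Prod>q\<in>Q. q ^ multiplicity q n)"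

lemma mu_fun: "(\<lambda>q. g q[^](e q :: nat))\<in>Q\<rightarrow>\<R>" using g_carr by auto
lemma mu_carr: "mu n\<in>\<R>" unfolding mu_def by (rule finprod_closed[OF mu_fun])

lemma mult_split: "q\<in>Q ==> m > 0 ==> n > 0 ==> multiplicity q (m * n) = multiplicity q m + multiplicity q n"
 using Q_prime by (intro prime_elem_multiplicity_mult_distrib) auto

lemma mu_mult:
 assumes "m > 0" "n > 0" shows "mu (m * n) = mu m\<otimes>mu n"
proof -
 have "mu (m * n) = (\<Otimes>q\<in>Q. g q[^]multiplicity q m\<otimes>g q[^]multiplicity q n)"
  unfolding mu_def by (rule finprod_cong') (use assms g_carr mult_split in \<open>auto simp: nat_pow_mult\<close>)
 also have "\<dots> = mu m\<otimes>mu n" unfolding mu_def by (rule finprod_multf[OF mu_fun mu_fun])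
 finally show ?thesis .
qed

lemma mult_self: "q\<in>Q ==> r\<in>Q ==> multiplicity r q = (if q = r then 1 else 0)"
 using Q_prime by (auto simp: prime_multiplicity_other prime_gt_0_nat)

lemma mu_q: assumes q: "q\<in>Q" shows "mu q = g q"
proof -
 have "mu q = (\<Otimes>r\<in>Q. if q = r then g r else \<one>)" unfolding mu_def by (rule finprod_cong') (use q g_carr mult_self in auto)
 also have "\<dots> = g q" by (rule finprod_singleton[OF q Q_fin]) (use g_carr in auto)
 finally show ?thesis .
qed

lemma mu_1: "mu 1 = \<one>" unfolding mu_def by simp

lemma Q_pos: "q\<in>Q ==> q > 0" using Q_prime prime_gt_0_nat by auto
lemma smooth_pos:
 assumes "smooth n" shows "n > 0"
proof -
 have "(\<Prod>q\<in>Q. q ^ multiplicity q n) > 0" using Q_pos by (intro prod_pos) auto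
 thus ?thesis using assms by (simp add: smooth_def)
qed

lemma smooth_1: "smooth 1" by (simp add: smooth_def)

lemma smooth_Q:
 assumes q: "q\<in>Q" shows "smooth q"
proof -
 have "(\<Prod>r\<in>Q. r ^ multiplicity r q) = (\<Prod>r\<in>Q. if r = q then r else 1)" by (rule prod.cong) (use q mult_self in auto)
 thus ?thesis using Q_fin q by (simp add: smooth_def prod.delta)
qed

lemma smooth_mult_iff:
 assumes m: "smooth m" and n: "n > 0" shows "smooth (m * n) \<longleftrightarrow> smooth n"
proof -
 have "(\<Prod>r\<in>Q. r ^ multiplicity r (m * n)) = (\<Prod>r\<in>Q. r ^ multiplicity r m) * (\<Prod>r\<in>Q. r ^ multiplicity r n)"
  unfolding prod.distrib[symmetric] by (rule prod.cong) (use mult_split smooth_pos[OF m] n in \<open>auto simp: power_add\<close>)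
 thus ?thesis using m smooth_pos[OF m] by (simp add: smooth_def)
qed

lemma smooth_step:
 assumes n: "smooth n" "n\<noteq>1" shows "\<exists>q\<in>Q. \<exists>m. n = q * m \<and> smooth m"
proof -
 have "\<exists>q\<in>Q. multiplicity q n\<noteq>0"
 proof (rule ccontr)
  assume "\<not> ?thesis"
  hence "(\<Prod>q\<in>Q. q ^ multiplicity q n) = 1" by (intro prod.neutral) simp
  thus False using n by (simp add: smooth_def)
 qed
 then obtain q where q: "q\<in>Q" "multiplicity q n\<noteq>0" by auto
 hence "q dvd n" using not_dvd_imp_multiplicity_0 by metis
 then obtain m where m: "n = q * m" by auto
 hence "m > 0" using smooth_pos[OF n(1)] by simp
 thus ?thesis using smooth_mult_iff[OF smooth_Q[OF q(1)]] n(1) m q(1) by auto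
qed

lemma smooth_dvd:
 assumes a: "smooth m" "smooth n" "\<And>q. q\<in>Q ==> multiplicity q m\<le>multiplicity q n" shows "m dvd n"
proof -
 have "(\<Prod>q\<in>Q. q ^ multiplicity q m) dvd (\<Prod>q\<in>Q. q ^ multiplicity q n)"
  by (rule prod_dvd_prod) (use a(3) in \<open>auto intro: le_imp_power_dvd\<close>)
 thus ?thesis using a(1,2) unfolding smooth_def by metis
qed

text \<open>Dickson's lemma for the exponent vectors of smooth numbers.\<close>

lemma antichain_finite:
 assumes X: "\<And>n. n\<in>X ==> smooth n" "\<And>m n. m\<in>X ==> n\<in>X ==> m dvd n ==> m = n" shows "finite X"
proof (rule ccontr)
 assume "infinite X"
 then obtain f :: "nat\<Rightarrow>nat" where f: "inj f" "range f\<subseteq>X" using infinite_countable_subset by auto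
 obtain r :: "nat\<Rightarrow>nat" where r: "strict_mono r" "\<forall>q\<in>Q. \<forall>i j. i\<le>j \<longrightarrow> multiplicity q (f (r i))\<le>multiplicity q (f (r j))"
  using dickson[OF Q_fin, of "\<lambda>i q. multiplicity q (f i)"] by auto
 have fX: "f i\<in>X" for i using f(2) by auto
 have "f (r 0) dvd f (r 1)" using smooth_dvd[OF X(1)[OF fX[of "r 0"]] X(1)[OF fX[of "r 1"]]] r(2) by simp
 hence "r 0 = r 1" using X(2)[OF fX fX] f(1) by (simp add: inj_eq)
 thus False using r(1) by (simp add: strict_mono_eq)
qed

lemma smooth_bound:
 assumes n: "smooth n" "\<And>q. q\<in>Q ==> multiplicity q n\<le>k" shows "n\<le>(\<Prod>q\<in>Q. q ^ k)"
proof -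
 have "(\<Prod>q\<in>Q. q ^ multiplicity q n)\<le>(\<Prod>q\<in>Q. q ^ k)"
  by (rule prod_mono) (use n(2) Q_pos in \<open>auto intro!: power_increasing simp: Suc_le_eq\<close>)
 thus ?thesis using n(1) by (simp add: smooth_def)
qed

end

lemma (in noeth_local) monomial_code_exists: "\<exists>Q g. monomial_code R Q g \<and> (\<forall>q\<in>Q. g q\<in>\<mm>) \<and> Idl (g ` Q) = \<mm>"
proof -
 obtain S where S: "S\<subseteq>carrier R" "finite S" "\<mm> = Idl S" using finetely_gen[OF m_ideal] by metis
 obtain Q :: "nat set" where Q: "finite Q" "card Q = card S" "Q\<subseteq>{q. Factorial_Ring.prime q}"
  using infinite_arbitrarily_large[OF primes_infinite, of "card S"] by auto
 obtain g where "bij_betw g Q S" using finite_same_card_bij[OF Q(1) S(2) Q(2)] by auto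
 hence g: "g ` Q = S" by (simp add: bij_betw_def)
 have "monomial_code R Q g" by unfold_locales (use Q g S(1) in auto)
 moreover have "\<forall>q\<in>Q. g q\<in>\<mm>" using g genideal_self[OF S(1)] S(3) by auto
 ultimately show ?thesis using g S(3) by blast
qed

subsection \<open>A vector in the socle with all its Frobenius images in the socle\<close>

locale frob_flag = frob_module_dcc R \<mm> p M F K + monomial_code R Q g for R (structure) and \<mm> and p :: nat and M (structure) and F K Q g +
 fixes H :: "nat\<Rightarrow>_ set" and s :: nat
 assumes s_pos: "s > 0" and H: "hyper (H l)" and H_soc: "x\<in>soc ==> (\<And>l. l < s ==> x\<in>H l) ==> x = \<zero>\<^bsub>M\<^esub>"
  and g_m: "q\<in>Q ==> g q\<in>\<mm>" and g_gen: "Idl (g ` Q) = \<mm>"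
begin

text \<open>The pair of a monomial and a hyperplane is encoded by \<open>n * s + l\<close>, an order in which multiplication
 by a variable is strictly increasing. The subspaces \<open>U b\<close> form an exhaustive flag with steps of dimension at most one.\<close>
definition U where "U b = {x\<in>carrier M. \<forall>n l. smooth n \<longrightarrow> l < s \<longrightarrow> b\<le>n * s + l \<longrightarrow> mu n *. x\<in>H l}"
text \<open>Formally, undoing \<open>F ^^ J\<close> turns this into the span of \<open>U b\<close>
  over the \<open>p^J\<close>-th roots of the elements of \<open>K\<close>.\<close>

definition S where "S J b = kspan ((F ^^ J) ` U b)"

lemma H_ksub: "ksub (H l)" using H by (simp add: hyper_def)

lemma smult_comm: "r\<in>\<R> ==> t\<in>\<R> ==> x\<in>carrier M ==> r *. (t *. x) = t *. (r *. x)"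
 using smult_assoc1[of r t x] smult_assoc1 m_comm[of r t] by simp

lemma U_ksub: "ksub (U b)" unfolding ksub_def U_def
proof (intro conjI ballI, goal_cases)
 case (2) show ?case using ksubD(2)[OF H_ksub] mu_carr by simp
next
 case (3 x y) thus ?case using mu_carr ksubD(3)[OF H_ksub] by (simp add: smult_r_distr)
next
 case (4 c x) thus ?case using smult_comm[OF mu_carr Kc[OF 4(1)]] ksubD(4)[OF H_ksub 4(1)] Kc by simp
qed auto
lemmas U_carr = ksubD(1)[OF U_ksub]

lemma U_mono: "b\<le>b' ==> U b\<subseteq>U b'" by (auto simp: U_def)

lemma mu_pow: "q\<in>Q ==> mu (q ^ k) = g q[^]k" using g_carr Q_pos by (induction k) (simp_all add: mu_1[unfolded One_nat_def] mu_mult mu_q m_comm)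

lemma torsion_mu:
 assumes x: "x\<in>carrier M" shows "\<exists>N. \<forall>n\<ge>N. smooth n \<longrightarrow> mu n *. x = \<zero>\<^sub>M"
proof -
 obtain k where k: "\<And>r. r\<in>ipow \<mm> k ==> r *. x = \<zero>\<^sub>M" using torsion[OF x] by auto
 have "mu n *. x = \<zero>\<^sub>M" if n: "smooth n" "n\<ge>Suc (\<Prod>q\<in>Q. q ^ k)" for n
 proof -
  have "\<exists>q\<in>Q. \<not> multiplicity q n\<le>k" using smooth_bound[OF n(1), of k] n(2) by fastforce
  then obtain q where q: "q\<in>Q" "k\<le>multiplicity q n" by auto
  then obtain m where m: "n = q ^ k * m" using multiplicity_dvd'[of k q n] by auto
  have pos: "q ^ k > 0" "m > 0" using smooth_pos[OF n(1)] m by auto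
  have "mu n = mu m\<otimes>g q[^]k" unfolding m mu_mult[OF pos] mu_pow[OF q(1)] using mu_carr g_carr[OF q(1)] by (simp add: m_comm)
  also have "\<dots>\<in>ipow \<mm> k" by (rule idl_l[OF ipow_ideal[OF m_ideal] ipow_pow[OF m_ideal g_m[OF q(1)]] mu_carr])
  finally show ?thesis by (rule k)
 qed
 thus ?thesis by blast
qed

text \<open>For nonzero \<open>x\<close> take the largest code of a monomial that does not kill it.
  The product is in the socle and in all hyperplanes, hence zero.\<close>

lemma U_0: "U 0\<subseteq>{\<zero>\<^sub>M}"
proof (rule subsetI, rule ccontr)
 fix x assume x: "x\<in>U 0" and nz: "x\<notin>{\<zero>\<^sub>M}"
 have xc: "x\<in>carrier M" by (rule U_carr[OF x])
 define X where "X = {n. smooth n \<and> mu n *. x\<noteq>\<zero>\<^sub>M}"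
 obtain N where N: "\<And>n. n\<ge>N ==> smooth n ==> mu n *. x = \<zero>\<^sub>M" using torsion_mu[OF xc] by auto
 have "X\<subseteq>{..<N}" using N by (auto simp: X_def not_le[symmetric])
 hence fX: "finite X" by (rule finite_subset) simp
 have "1\<in>X" using smooth_1 mu_1 xc nz by (simp add: X_def)
 hence nX: "Max X\<in>X" using fX by (intro Max_in) auto
 define n where "n = Max X"
 define y where "y = mu n *. x"
 have n: "smooth n" and y0: "y\<noteq>\<zero>\<^sub>M" using nX by (auto simp: X_def n_def y_def)
 have yc: "y\<in>carrier M" using xc mu_carr by (simp add: y_def)
 have gy: "g q *. y = \<zero>\<^sub>M" if q: "q\<in>Q" for q
 proof -
  have np: "n > 0" by (rule smooth_pos[OF n])
  have "q * n > n" using np prime_gt_1_nat[OF Q_prime[OF q]] by simp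
  hence "q * n\<notin>X" using Max_ge[OF fX, of "q * n"] unfolding n_def by auto
  moreover have "smooth (q * n)" using smooth_mult_iff[OF smooth_Q[OF q] np] n by simp
  ultimately have "mu (q * n) *. x = \<zero>\<^sub>M" by (simp add: X_def)
  thus ?thesis unfolding mu_mult[OF Q_pos[OF q] np] mu_q[OF q] y_def using smult_assoc1[OF g_carr[OF q] mu_carr xc] by simp
 qed
 have "ideal {r\<in>\<R>. r *. y = \<zero>\<^sub>M} R" by (rule idealI') (use yc in \<open>auto simp: smult_l_distr smult_assoc1\<close>)
 hence "Idl (g ` Q)\<subseteq>{r\<in>\<R>. r *. y = \<zero>\<^sub>M}" by (rule genideal_minimal) (use gy g_carr in auto)
 hence "y\<in>soc" using yc by (auto simp: soc_def g_gen)
 moreover have "y\<in>H l" if "l < s" for l using x n that unfolding U_def y_def by auto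
 ultimately show False using H_soc y0 by blast
qed

lemma U_ex:
 assumes x: "x\<in>carrier M" shows "\<exists>b. x\<in>U b"
proof -
 obtain N where N: "\<And>n. n\<ge>N ==> smooth n ==> mu n *. x = \<zero>\<^sub>M" using torsion_mu[OF x] by auto
 have "mu n *. x\<in>H l" if "smooth n" "l < s" "N * s\<le>n * s + l" for n l
 proof -
  have "N * s < Suc n * s" using that(2,3) by simp
  hence "N < Suc n" using mult_less_cancel2 by blast
  thus ?thesis using N that(1) ksubD(2)[OF H_ksub] by simp
 qed
 thus ?thesis using x unfolding U_def by blast
qed

lemma code_le: "l < s ==> l' < s ==> n * s + l\<le>m * s + l' \<longleftrightarrow> n < m \<or> n = m \<and> l\<le>l'" for n m l l' :: nat
proof -
 have a: "n * s + l < m * s + l'" if "n < m" "l < s" for n m l l' :: nat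
 proof -
  have "Suc n * s\<le>m * s" using that(1) by (intro mult_le_mono1) simp
  thus ?thesis using that(2) by simp
 qed
 assume "l < s" "l' < s"
 thus ?thesis using a[of n m l l'] a[of m n l' l] by (cases n m rule: linorder_cases) auto
qed

lemma U_step:
 assumes x: "x\<in>U (Suc b)" shows "x\<in>U b \<longleftrightarrow> (smooth (b div s) \<longrightarrow> mu (b div s) *. x\<in>H (b mod s))"
proof
 have b: "b = (b div s) * s + b mod s" "b mod s < s" using s_pos by auto
 show "smooth (b div s) \<longrightarrow> mu (b div s) *. x\<in>H (b mod s)" if "x\<in>U b" using that b unfolding U_def by auto
 assume h: "smooth (b div s) \<longrightarrow> mu (b div s) *. x\<in>H (b mod s)"
 have "mu n *. x\<in>H l" if n: "smooth n" "l < s" "b\<le>n * s + l" for n l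
 proof (cases "b = n * s + l")
  case True
  hence "b div s = n" "b mod s = l" using n(2) by auto
  thus ?thesis using h n by simp
 next
  case False
  hence "Suc b\<le>n * s + l" using n(3) by simp
  thus ?thesis using x n(1,2) unfolding U_def by blast
 qed
 thus "x\<in>U b" using U_carr[OF x] by (simp add: U_def)
qed

text \<open>Membership in \<open>U b\<close> adds one hyperplane condition to
  \<open>U (Suc b)\<close>, so the step has dimension at most one.\<close>

lemma U_diff:
 assumes w: "w\<in>U (Suc b)" "w\<notin>U b" shows "U (Suc b)\<subseteq>kadd (U b) w"
proof
 fix x assume x: "x\<in>U (Suc b)"
 let ?n = "b div s" and ?l = "b mod s"
 have n: "smooth ?n" "mu ?n *. w\<notin>H ?l" using w U_step by auto
 note xc = U_carr[OF x] and wc = U_carr[OF w(1)]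
 have "mu ?n *. w\<in>carrier M - H ?l" "mu ?n *. x\<in>carrier M" using n(2) mu_carr xc wc by auto
 hence "mu ?n *. x\<in>kadd (H ?l) (mu ?n *. w)" using H[of ?l] unfolding hyper_def by blast
 then obtain h c where h: "h\<in>H ?l" "c\<in>K" "mu ?n *. x = h +. c *. (mu ?n *. w)" by (auto simp: kadd_def)
 note cc = Kc[OF h(2)] and hc = ksubD(1)[OF H_ksub h(1)]
 have c: "\<ominus> c\<in>K" by (rule subringE(5)[OF Ks h(2)])
 have canc: "v +. c *. z +. (\<ominus> c) *. z = v" "v +. (\<ominus> c) *. z +. c *. z = v" if "v\<in>carrier M" "z\<in>carrier M" for v z
  using that cc by (simp_all add: smult_l_minus M.a_assoc M.r_neg M.l_neg)
 define y where "y = x +. (\<ominus> c) *. w"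
 have y: "y\<in>U (Suc b)" unfolding y_def by (rule ksubD(3)[OF U_ksub x ksubD(4)[OF U_ksub c w(1)]])
 have "mu ?n *. y = mu ?n *. x +. (\<ominus> c) *. (mu ?n *. w)" unfolding y_def using xc wc mu_carr cc smult_comm by (simp add: smult_r_distr)
 also have "\<dots> = h" unfolding h(3) using canc(1) hc wc mu_carr by simp
 finally have "y\<in>U b" using U_step[OF y] h(1) by simp
 moreover have "x = y +. c *. w" unfolding y_def using canc(2)[OF xc wc] by simp
 ultimately show "x\<in>kadd (U b) w" unfolding kadd_def using h(2) by blast
qed

text \<open>The monomial of code \<open>m\<close> acting on \<open>g q *. x\<close> is that of code
  \<open>q * m\<close> acting on \<open>x\<close>; thus \<open>g q\<close> carries the step of
  \<open>q * n\<close> to the step of \<open>n\<close>.\<close>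

lemma U_var:
 assumes q: "q\<in>Q" and n: "n > 0" and l: "l < s" shows "x\<in>U (q * n * s + l) ==> g q *. x\<in>U (n * s + l)"
  and "x\<in>U (Suc (q * n * s + l)) ==> g q *. x\<in>U (Suc (n * s + l))"
  and "x\<in>U (Suc (q * n * s + l)) ==> x\<notin>U (q * n * s + l) ==> smooth n \<and> g q *. x\<notin>U (n * s + l)"
proof -
 have e: "mu m *. (g q *. x) = mu (q * m) *. x" if "m > 0" "x\<in>carrier M" for m x
  unfolding mu_mult[OF Q_pos[OF q] that(1)] mu_q[OF q] using smult_assoc1[OF mu_carr g_carr[OF q] that(2)] m_comm[OF mu_carr g_carr[OF q]] by simp
 have lt: "q * a < q * b \<longleftrightarrow> a < b" for a b using Q_pos[OF q] by simp
 show "x\<in>U (q * n * s + l) ==> g q *. x\<in>U (n * s + l)"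
 proof -
  assume x: "x\<in>U (q * n * s + l)"
  have "mu m *. (g q *. x)\<in>H l'" if m: "smooth m" "l' < s" "n * s + l\<le>m * s + l'" for m l'
  proof -
   have mp: "m > 0" by (rule smooth_pos[OF m(1)])
   have "q * n * s + l\<le>q * m * s + l'" using m(3) lt unfolding code_le[OF l m(2)] by auto
   thus ?thesis using x m smooth_mult_iff[OF smooth_Q[OF q] mp] unfolding e[OF mp U_carr[OF x]] U_def by blast
  qed
  thus ?thesis using U_carr[OF x] g_carr[OF q] by (simp add: U_def)
 qed
 show "x\<in>U (Suc (q * n * s + l)) ==> g q *. x\<in>U (Suc (n * s + l))"
 proof -
  assume x: "x\<in>U (Suc (q * n * s + l))"
  have "mu m *. (g q *. x)\<in>H l'" if m: "smooth m" "l' < s" "Suc (n * s + l)\<le>m * s + l'" for m l'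
  proof -
   have mp: "m > 0" by (rule smooth_pos[OF m(1)])
   have "\<not> m * s + l'\<le>n * s + l" using m(3) by simp
   hence "\<not> q * m * s + l'\<le>q * n * s + l" using lt Q_pos[OF q] unfolding code_le[OF m(2) l] by auto
   hence "Suc (q * n * s + l)\<le>q * m * s + l'" by simp
   thus ?thesis using x m smooth_mult_iff[OF smooth_Q[OF q] mp] unfolding e[OF mp U_carr[OF x]] U_def by blast
  qed
  thus ?thesis using U_carr[OF x] g_carr[OF q] by (simp add: U_def)
 qed
 assume x: "x\<in>U (Suc (q * n * s + l))" "x\<notin>U (q * n * s + l)"
 have "(q * n * s + l) div s = q * n" "(q * n * s + l) mod s = l" using l by auto
 hence sm: "smooth (q * n)" "mu (q * n) *. x\<notin>H l" using U_step[OF x(1)] x(2) by auto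
 hence sn: "smooth n" using smooth_mult_iff[OF smooth_Q[OF q] n] by simp
 moreover have "mu n *. (g q *. x)\<notin>H l" unfolding e[OF n U_carr[OF x(1)]] by (rule sm(2))
 ultimately show "smooth n \<and> g q *. x\<notin>U (n * s + l)" using l unfolding U_def by blast
qed

section \<open>Frobenius spans of the flag\<close>

lemma FU_carr: "(F ^^ J) ` U b\<subseteq>carrier M" using U_carr Fp_closed by auto
lemma S_ksub: "ksub (S J b)" unfolding S_def by (rule ksub_kspan[OF FU_carr])
lemmas S_carr = ksubD(1)[OF S_ksub]
lemma S_mono: "b\<le>b' ==> S J b\<subseteq>S J b'" unfolding S_def by (intro kspan_mono image_mono U_mono)
lemma S_self: "x\<in>U b ==> (F ^^ J) x\<in>S J b" unfolding S_def by (rule kspan_self) simp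

lemma S_0: "S J 0\<subseteq>{\<zero>\<^sub>M}" unfolding S_def by (rule kspan_least) (use U_0 Fp_zero Kc in \<open>auto simp: ksub_def\<close>)

lemma S_F: "x\<in>S J b ==> (F ^^ i) x\<in>S (i + J) b" unfolding S_def[of J]
proof (erule kspan_map[OF S_ksub, where g = "\<lambda>c. c[^](p ^ i)", rotated 4])
 fix y assume "y\<in>(F ^^ J) ` U b"
 then obtain x where x: "x\<in>U b" "y = (F ^^ J) x" by auto
 show "y\<in>carrier M \<and> (F ^^ i) y\<in>S (i + J) b" unfolding x(2) Fp_comp using S_self[OF x(1)] Fp_closed U_carr[OF x(1)] by blast
qed (use Fp_add Fp_smult Fp_zero Kc K_pow in auto)

lemma S_le:
 assumes h: "S J (Suc b)\<subseteq>S J b" shows "S (i + J) (Suc b)\<subseteq>S (i + J) b"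
proof -
 have "(F ^^ (i + J)) x\<in>S (i + J) b" if "x\<in>U (Suc b)" for x using S_F[OF subsetD[OF h S_self[OF that]], of i] by (simp add: Fp_comp)
 thus ?thesis unfolding S_def[of "i + J" "Suc b"] by (intro kspan_least[OF S_ksub]) auto
qed

lemma S_diff:
 assumes w: "w\<in>U (Suc b)" "w\<notin>U b" shows "S J (Suc b)\<subseteq>kadd (S J b) ((F ^^ J) w)" unfolding S_def[of J "Suc b"]
proof (rule kspan_least)
 note k = kadd_ksub[OF S_ksub Fp_closed[OF U_carr[OF w(1)]]]
 show "ksub (kadd (S J b) ((F ^^ J) w))" by (rule k(1))
 show "(F ^^ J) ` U (Suc b)\<subseteq>kadd (S J b) ((F ^^ J) w)"
 proof
  fix y assume "y\<in>(F ^^ J) ` U (Suc b)"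
  then obtain x where x: "x\<in>U (Suc b)" "y = (F ^^ J) x" by auto
  then obtain h c where h: "h\<in>U b" "c\<in>K" "x = h +. c *. w" using U_diff[OF w] unfolding kadd_def by blast
  have "y = (F ^^ J) h +. c[^](p ^ J) *. (F ^^ J) w" unfolding x(2) h(3) using Fp_add Fp_smult U_carr[OF h(1)] U_carr[OF w(1)] Kc[OF h(2)] by simp
  thus "y\<in>kadd (S J b) ((F ^^ J) w)" unfolding kadd_def using S_self[OF h(1)] K_pow[OF h(2)] by blast
 qed
qed

lemma S_all:
 assumes "x\<in>kspan ((F ^^ J) ` carrier M)" shows "\<exists>b. x\<in>S J b"
proof -
 have "ksub (\<Union>b. S J b)" unfolding ksub_def
 proof (intro conjI ballI)
  show "(\<Union>b. S J b)\<subseteq>carrier M" using S_carr by auto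
  show "\<zero>\<^sub>M\<in>(\<Union>b. S J b)" using ksubD(2)[OF S_ksub] by auto
  show "c *. v\<in>(\<Union>b. S J b)" if "c\<in>K" "v\<in>(\<Union>b. S J b)" for c v using ksubD(4)[OF S_ksub that(1)] that(2) by auto
  fix v w assume "v\<in>(\<Union>b. S J b)" "w\<in>(\<Union>b. S J b)"
  then obtain b b' where "v\<in>S J b" "w\<in>S J b'" by auto
  hence "v\<in>S J (max b b')" "w\<in>S J (max b b')" using S_mono[of b "max b b'" J] S_mono[of b' "max b b'" J] by auto
  thus "v +. w\<in>(\<Union>b. S J b)" using ksubD(3)[OF S_ksub] by blast
 qed
 moreover have "(F ^^ J) x\<in>(\<Union>b. S J b)" if "x\<in>carrier M" for x using U_ex[OF that] S_self by auto
 hence "(F ^^ J) ` carrier M\<subseteq>(\<Union>b. S J b)" by auto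
 ultimately have "kspan ((F ^^ J) ` carrier M)\<subseteq>(\<Union>b. S J b)" by (rule kspan_least)
 thus ?thesis using assms by auto
qed

lemma S_var:
 assumes q: "q\<in>Q" and n: "n > 0" and l: "l < s" and x: "x\<in>S J (q * n * s + l)" shows "g q[^](p ^ J) *. x\<in>S J (n * s + l)"
proof (rule kspan_map[OF S_ksub, where g = "\<lambda>c. c" and \<phi> = "\<lambda>x. g q[^](p ^ J) *. x"])
 show "x\<in>kspan ((F ^^ J) ` U (q * n * s + l))" using x by (simp add: S_def)
 fix y assume "y\<in>(F ^^ J) ` U (q * n * s + l)"
 then obtain z where z: "z\<in>U (q * n * s + l)" "y = (F ^^ J) z" by auto
 have "g q[^](p ^ J) *. y = (F ^^ J) (g q *. z)" unfolding z(2) using Fp_smult[OF g_carr[OF q] U_carr[OF z(1)]] by simp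
 thus "y\<in>carrier M \<and> g q[^](p ^ J) *. y\<in>S J (n * s + l)"
  using S_self[OF U_var(1)[OF q n l z(1)]] Fp_closed[OF U_carr[OF z(1)]] z(2) by simp
qed (use g_carr[OF q] smult_comm Kc in \<open>auto simp: smult_r_distr\<close>)

text \<open>The steps of the flag that stay strict in every span. By \<open>S_le\<close> a step that
  collapses for one \<open>J\<close> collapses for all larger ones.\<close>

definition L where "L b \<longleftrightarrow> (\<forall>J. \<not> S J (Suc b)\<subseteq>S J b)"

lemma L_gen: "L b ==> \<exists>w. w\<in>U (Suc b) \<and> w\<notin>U b" unfolding L_def S_def using kspan_mono image_mono by (metis subsetI)

text \<open>Multiplication by a variable maps a generator of a step of the flag to a generator of an earlier step.\<close>
lemma L_up:
 assumes q: "q\<in>Q" and n: "n > 0" and l: "l < s" and w: "w\<in>U (Suc (q * n * s + l))" "w\<notin>U (q * n * s + l)"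
  and Fw: "(F ^^ J) w\<in>S J (q * n * s + l) \<or> (F ^^ J) (g q *. w)\<in>S J (n * s + l)" shows "\<not> L (n * s + l)"
proof -
 define w' where "w' = g q *. w"
 have w': "w'\<in>U (Suc (n * s + l))" "w'\<notin>U (n * s + l)" using U_var(2,3)[OF q n l] w by (auto simp: w'_def)
 have "(F ^^ J) w' = g q[^](p ^ J) *. (F ^^ J) w" unfolding w'_def by (rule Fp_smult[OF g_carr[OF q] U_carr[OF w(1)]])
 hence "(F ^^ J) w'\<in>S J (n * s + l)" using Fw S_var[OF q n l] unfolding w'_def[symmetric] by auto
 hence "kadd (S J (n * s + l)) ((F ^^ J) w')\<subseteq>S J (n * s + l)" by (rule kadd_least[OF S_ksub order_refl])
 thus ?thesis using S_diff[OF w', of J] unfolding L_def by blast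
qed

text \<open>The members of \<open>L\<close> that are minimal under removal of one variable from the
  monomial.\<close>

definition X where "X = {b. L b \<and> (\<forall>q\<in>Q. \<forall>n>0. b div s = q * n \<longrightarrow> \<not> L (n * s + b mod s))}"

lemma L_smooth: "L b ==> smooth (b div s)" using L_gen U_step by blast

text \<open>Among the nontrivial steps of the flag, \<open>L\<close> is closed under multiples of
  the monomial: the variables of \<open>t\<close> are stripped off one by one with
  \<open>L_up\<close>.\<close>

lemma L_mult:
 assumes l: "l < s" and "smooth t" and "m > 0" and "L (m * s + l)" and "w\<in>U (Suc (t * m * s + l))" "w\<notin>U (t * m * s + l)"
 shows "L (t * m * s + l)" using assms(2,5,6)
proof (induction t arbitrary: w rule: less_induct)
 case (less t)
 show ?case
 proof (cases "t = 1")
  case True thus ?thesis using assms(4) by simp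
 next
  case False
  then obtain q u where q: "q\<in>Q" "t = q * u" "smooth u" using smooth_step[OF less.prems(1)] by auto
  have u: "u > 0" by (rule smooth_pos[OF q(3)])
  have "u < t" unfolding q(2) using u prime_gt_1_nat[OF Q_prime[OF q(1)]] by simp
  have um: "u * m > 0" using u assms(3) by simp
  have e: "t * m * s + l = q * (u * m) * s + l" by (simp add: q(2) mult.assoc)
  note w = less.prems(2,3)[unfolded e]
  have "L (u * m * s + l)" using less.IH[OF \<open>u < t\<close> q(3)] U_var(2,3)[OF q(1) um l] w by blast
  hence "(F ^^ J) w\<notin>S J (q * (u * m) * s + l)" for J using L_up[OF q(1) um l w] by blast
  hence "\<not> S J (Suc (q * (u * m) * s + l))\<subseteq>S J (q * (u * m) * s + l)" for J using S_self[OF w(1)] by blast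
  thus ?thesis unfolding e L_def by blast
 qed
qed

text \<open>For a fixed hyperplane index the monomials of \<open>X\<close> form an antichain under
  divisibility, since \<open>L\<close> is closed under multiples.\<close>

lemma X_finite: "finite X"
proof -
 have "finite {n. n * s + l\<in>X}" if l: "l < s" for l
 proof (rule antichain_finite)
  have d: "(n * s + l) div s = n" "(n * s + l) mod s = l" for n using l by auto
  have LX: "L (n * s + l)" if "n * s + l\<in>X" for n using that by (simp add: X_def)
  show sm: "smooth n" if "n\<in>{n. n * s + l\<in>X}" for n using L_smooth[OF LX] d that by simp
  fix m n assume m: "m\<in>{n. n * s + l\<in>X}" and n: "n\<in>{n. n * s + l\<in>X}" and dv: "m dvd n"
  show "m = n"
  proof (rule ccontr)
   assume "m\<noteq>n"
   obtain t where t: "n = m * t" using dv by auto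
   have pos: "m > 0" "n > 0" using smooth_pos sm m n by auto
   have "smooth t" using smooth_mult_iff[OF sm[OF m], of t] sm[OF n] pos(2) unfolding t by simp
   moreover have "t\<noteq>1" using t \<open>m \<noteq> n\<close> by auto
   ultimately obtain q u where q: "q\<in>Q" "t = q * u" "smooth u" using smooth_step by blast
   have u: "u > 0" by (rule smooth_pos[OF q(3)])
   have um: "u * m > 0" using u pos by simp
   have nq: "n = q * (u * m)" using t q(2) by simp
   obtain w where w: "w\<in>U (Suc (n * s + l))" "w\<notin>U (n * s + l)" using L_gen[OF LX] n by auto
   have "L (u * m * s + l)" by (rule L_mult[OF l q(3) pos(1)]) (use U_var(2,3)[OF q(1) um l] w[unfolded nq] LX m in auto)
   moreover have "\<not> L (u * m * s + l)" using n d nq q(1) um unfolding X_def by auto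
   ultimately show False by simp
  qed
 qed
 hence "finite (\<Union>l\<in>{..<s}. (\<lambda>n. n * s + l) ` {n. n * s + l\<in>X})" by blast
 moreover have "X\<subseteq>(\<Union>l\<in>{..<s}. (\<lambda>n. n * s + l) ` {n. n * s + l\<in>X})"
 proof
  fix b assume b: "b\<in>X"
  have "b mod s\<in>{..<s}" "b = (\<lambda>n. n * s + b mod s) (b div s)" "b div s\<in>{n. n * s + b mod s\<in>X}" using s_pos b by auto
  thus "b\<in>(\<Union>l\<in>{..<s}. (\<lambda>n. n * s + l) ` {n. n * s + l\<in>X})" by (intro UN_I image_eqI)
 qed
 ultimately show ?thesis by (rule finite_subset[rotated])
qed

text \<open>The pair \<open>(J, u)\<close> stands for the formal preimage of \<open>u\<close> under
  \<open>F ^^ J\<close>. The condition says that this preimage and its first \<open>e\<close>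
  Frobenius images are in the socle, and is written after applying \<open>F ^^ J\<close>.\<close>

definition V where
 "V e J u \<longleftrightarrow> u\<in>carrier M \<and> u\<noteq>\<zero>\<^sub>M \<and> (\<forall>i\<le>e. \<forall>r\<in>\<mm>. r[^](p ^ J) *. (F ^^ i) u = \<zero>\<^sub>M)"
definition lead where "lead e = (LEAST b. \<exists>J u. V e J u \<and> u\<in>S J (Suc b))"

text \<open>The pairs \<open>(J, u)\<close> and \<open>(k + J, (F ^^ k) u)\<close> stand for the
  same formal element, so the condition must not distinguish them.\<close>

lemma V_F:
 assumes uc: "u\<in>carrier M" shows "V e (k + J) ((F ^^ k) u) \<longleftrightarrow> V e J u"
proof -
 have "r[^](p ^ (k + J)) *. (F ^^ i) ((F ^^ k) u) = \<zero>\<^sub>M \<longleftrightarrow> r[^](p ^ J) *. (F ^^ i) u = \<zero>\<^sub>M" if r: "r\<in>\<mm>" for i r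
 proof -
  have c: "r[^](p ^ J)\<in>\<R>" "(F ^^ i) u\<in>carrier M" using m_carr[OF r] Fp_closed[OF uc] by auto
  have "r[^](p ^ (k + J)) *. (F ^^ i) ((F ^^ k) u) = (F ^^ k) (r[^](p ^ J) *. (F ^^ i) u)"
   unfolding Fp_smult[OF c] by (simp add: Fp_comp add.commute nat_pow_pow[OF m_carr[OF r]] power_add mult.commute)
  thus ?thesis using Fp_inj c Fp_zero by auto
 qed
 thus ?thesis using Fp_inj[OF uc] Fp_closed[OF uc] Fp_zero uc unfolding V_def by blast
qed

lemma lead_le: "V e J u ==> u\<in>S J (Suc b) ==> lead e\<le>b" unfolding lead_def by (intro Least_le exI conjI)

lemma lead_notin: "V e J u ==> u\<notin>S J (lead e)"
proof
 assume V: "V e J u" "u\<in>S J (lead e)"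
 show False
 proof (cases "lead e")
  case 0 thus False using V S_0 by (auto simp: V_def)
 next
  case (Suc b) thus False using lead_le[OF V(1), of b] V(2) by simp
 qed
qed

lemma lead_ex: "V e J u ==> u\<in>S J b ==> \<exists>J u. V e J u \<and> u\<in>S J (Suc (lead e))" unfolding lead_def
proof (rule LeastI_ex)
 assume "V e J u" "u\<in>S J b"
 moreover have "S J b\<subseteq>S J (Suc b)" by (rule S_mono) simp
 ultimately show "\<exists>b J u. V e J u \<and> u\<in>S J (Suc b)" by (intro exI[of _ b] exI[of _ J] exI[of _ u]) auto
qed

text \<open>If the leading step collapsed for some exponent, \<open>u\<close> would move to a lower
  step after enough Frobenius. It is minimal in \<open>L\<close> because a generator of the step is
  a scalar multiple of \<open>u\<close> up to lower terms, and a variable kills the multiple of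
  \<open>u\<close>.\<close>

lemma lead_X:
 assumes V: "V e J u" and u: "u\<in>S J (Suc (lead e))" shows "lead e\<in>X"
proof -
 let ?b = "lead e"
 have L: "L ?b" unfolding L_def
 proof (intro allI notI)
  fix J' assume J': "S J' (Suc ?b)\<subseteq>S J' ?b"
  define k where "k = max J J'"
  have k: "(k - J) + J = k" "(k - J') + J' = k" by (simp_all add: k_def)
  have "(F ^^ (k - J)) u\<in>S k (Suc ?b)" using S_F[OF u, of "k - J"] k(1) by simp
  moreover have "S k (Suc ?b)\<subseteq>S k ?b" using S_le[OF J', of "k - J'"] k(2) by simp
  ultimately show False using lead_notin V_F[of u e "k - J" J] V V_def k(1) by auto
 qed
 obtain w where w: "w\<in>U (Suc ?b)" "w\<notin>U ?b" using L_gen[OF L] by auto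
 have wc: "w\<in>carrier M" by (rule U_carr[OF w(1)])
 obtain h d where d: "h\<in>S J ?b" "d\<in>K" "(F ^^ J) w = h +. d *. u"
  using kadd_exchange[OF S_ksub Fp_closed[OF wc] _ lead_notin[OF V]] S_diff[OF w, of J] u unfolding kadd_def by blast
 note hc = S_carr[OF d(1)] and dc = Kc[OF d(2)]
 have "\<not> L (n * s + ?b mod s)" if q: "q\<in>Q" and n: "n > 0" "?b div s = q * n" for q n
 proof -
  have l: "?b mod s < s" using s_pos by simp
  have b: "?b = q * n * s + ?b mod s" using n(2) by (metis div_mult_mod_eq)
  have uc: "u\<in>carrier M" using V by (simp add: V_def)
  have gc: "g q[^](p ^ J)\<in>\<R>" using g_carr[OF q] by simp
  have "g q[^](p ^ J) *. u = \<zero>\<^sub>M" using V g_m[OF q] unfolding V_def by force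
  hence du: "g q[^](p ^ J) *. (d *. u) = \<zero>\<^sub>M" using smult_comm[OF gc dc uc] dc by simp
  have "(F ^^ J) (g q *. w) = g q[^](p ^ J) *. (F ^^ J) w" by (rule Fp_smult[OF g_carr[OF q] wc])
  also have "\<dots> = g q[^](p ^ J) *. h" unfolding d(3) using gc du hc dc uc by (simp add: smult_r_distr)
  also have "\<dots>\<in>S J (n * s + ?b mod s)" by (rule S_var[OF q n(1) l]) (use d(1) b in simp)
  finally show ?thesis using L_up[OF q n(1) l, of w J] w b by simp
 qed
 thus ?thesis using L by (simp add: X_def)
qed

text \<open>The leads of the \<open>V e\<close> are eventually constant, and an element realizing the final lead is,
 up to scalars and Frobenius, the same for all \<open>e\<close>.\<close>
lemma common_element:
 assumes ne: "\<And>e. \<exists>J u b. V e J u \<and> u\<in>S J b" shows "\<exists>J u. \<forall>e. V e J u"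
proof -
 have "\<exists>J u. V e J u \<and> u\<in>S J (Suc (lead e))" for e using ne lead_ex by blast
 then obtain J u where Ju: "\<And>e. V e (J e) (u e)" "\<And>e. u e\<in>S (J e) (Suc (lead e))" by metis
 have V_mono: "V e J u" if "V e' J u" "e\<le>e'" for e e' J u using that by (auto simp: V_def)
 have mono: "lead e\<le>lead e'" if "e\<le>e'" for e e' using lead_le[OF V_mono[OF Ju(1)[of e'] that] Ju(2)] .
 have fin: "finite (range lead)" by (rule finite_subset[OF _ X_finite]) (use lead_X[OF Ju] in auto)
 obtain e0 where e0: "lead e0 = Max (range lead)" using Max_in[OF fin] by auto
 define b where "b = lead e0"
 have const: "lead e = b" if "e\<ge>e0" for e using mono[OF that] Max_ge[OF fin, of "lead e"] e0 by (simp add: b_def)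
 have "V e (J e0) (u e0)" if e: "e\<ge>e0" for e
 proof -
  \<comment> \<open>Both formal elements are brought to a common exponent, where they can be
    compared inside one space.\<close>
  define k where "k = max (J e0) (J e)"
  have k: "(k - J e0) + J e0 = k" "(k - J e) + J e = k" by (simp_all add: k_def)
  define x y where "x = (F ^^ (k - J e0)) (u e0)" and "y = (F ^^ (k - J e)) (u e)"
  have uc: "u e0\<in>carrier M" "u e\<in>carrier M" using Ju(1) Ju(1)[of e] by (auto simp: V_def)
  have x: "V e0 k x" "x\<in>S k (Suc b)" unfolding x_def using V_F[OF uc(1), of e0 "k - J e0" "J e0"] Ju(1) S_F[OF Ju(2)[of e0], of "k - J e0"] k(1) by (auto simp: b_def)
  have y: "V e k y" "y\<in>S k (Suc b)" unfolding y_def using V_F[OF uc(2), of e "k - J e" "J e"] Ju(1) S_F[OF Ju(2)[of e], of "k - J e"] k(2) const[OF e] by auto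
  have xc: "x\<in>carrier M" "y\<in>carrier M" using x y by (auto simp: V_def)
  have yn: "y\<notin>S k b" using lead_notin[OF y(1)] const[OF e] by simp
  have "lead e0\<in>X" by (rule lead_X[OF Ju])
  hence "L b" by (simp add: X_def b_def)
  then obtain w where w: "w\<in>U (Suc b)" "w\<notin>U b" using L_gen by blast
  let ?w = "(F ^^ k) w"
  have wc: "?w\<in>carrier M" by (rule Fp_closed[OF U_carr[OF w(1)]])
  note ky = kadd_ksub[OF S_ksub[of k b] xc(2)]
  have "?w\<in>kadd (S k b) y" using kadd_exchange[OF S_ksub wc _ yn] S_diff[OF w, of k] y(2) by blast
  hence "kadd (S k b) ?w\<subseteq>kadd (S k b) y" by (rule kadd_least[OF ky(1,2)])
  hence "x\<in>kadd (S k b) y" using S_diff[OF w, of k] x(2) by blast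
  then obtain v a where v: "v\<in>S k b" "a\<in>K" "x = v +. a *. y" by (auto simp: kadd_def)
  note vc = S_carr[OF v(1)] and ac = Kc[OF v(2)]
  have rF: "r[^](p ^ k) *. (F ^^ i) x = r[^](p ^ k) *. (F ^^ i) v" if "r\<in>\<mm>" "i\<le>e" for r i
  proof -
   have rc: "r[^](p ^ k)\<in>\<R>" using m_carr[OF that(1)] by simp
   have "r[^](p ^ k) *. (F ^^ i) (a *. y) = a[^](p ^ i) *. (r[^](p ^ k) *. (F ^^ i) y)"
    unfolding Fp_smult[OF ac xc(2)] by (rule smult_comm[OF rc nat_pow_closed[OF ac] Fp_closed[OF xc(2)]])
   also have "\<dots> = \<zero>\<^sub>M" using y(1) that ac by (simp add: V_def)
   finally show ?thesis unfolding v(3) using Fp_add rc Fp_closed vc xc(2) ac by (simp add: smult_r_distr)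
  qed
  \<comment> \<open>For the Frobenius images up to \<open>e\<close>, the element \<open>v\<close>
    meets the same vanishing conditions as \<open>x\<close>, but it lies below the leading step
    \<open>b\<close>.\<close>
  have "v = \<zero>\<^sub>M"
  proof (rule ccontr)
   assume "v\<noteq>\<zero>\<^sub>M"
   hence "V e0 k v" unfolding V_def using vc x(1) rF e by (auto simp: V_def)
   thus False using lead_notin v(1) by (auto simp: b_def)
  qed
  hence "V e k x" using rF Fp_zero x(1) m_carr by (simp add: V_def)
  thus ?thesis unfolding x_def using V_F[OF uc(1), of e "k - J e0" "J e0"] k(1) by simp
 qed
 hence "V e (J e0) (u e0)" for e using V_mono[of "max e e0" "J e0" "u e0" e] by simp
 thus ?thesis by blast
qed

end

context frob_module_dcc
begin

definition stable where "stable = (\<Inter>j\<in>{1..}. kspan ((F ^^ j) ` carrier M))"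

text \<open>For every \<open>e\<close> the element \<open>z\<close> itself, taken with a large
  exponent \<open>J\<close>, satisfies \<open>V e J z\<close>, and it lies in the span for that
  exponent. So \<open>common_element\<close> applies, and injectivity of \<open>F ^^ J\<close> turns
  its result into socle conditions on the Frobenius images of \<open>u\<close>.\<close>

lemma stable_to_socle:
 assumes z: "z\<in>stable" "z\<noteq>\<zero>\<^sub>M" shows "\<exists>u\<in>carrier M. u\<noteq>\<zero>\<^sub>M \<and> (\<forall>i. (F ^^ i) u\<in>soc)"
proof -
 have FM: "(F ^^ j) ` carrier M\<subseteq>carrier M" for j using Fp_closed by auto
 have zj: "z\<in>kspan ((F ^^ j) ` carrier M)" if "j\<ge>1" for j using z(1) that by (simp add: stable_def)
 have zc: "z\<in>carrier M" using ksubD(1)[OF ksub_kspan[OF FM] zj[of 1]] by simp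
 obtain H s where Hs: "s > (0::nat)" "\<And>l. hyper (H l)" "\<And>x. x\<in>soc ==> (\<And>l. l < s ==> x\<in>H l) ==> x = \<zero>\<^sub>M"
  using hypers[OF zc z(2)] by metis
 obtain Q g where Qg: "monomial_code R Q g" "\<And>q. q\<in>Q ==> g q\<in>\<mm>" "Idl (g ` Q) = \<mm>" using monomial_code_exists by metis
 interpret frob_flag R \<mm> p M F K Q g H s by (intro frob_flag.intro frob_flag_axioms.intro Hs Qg frob_module_dcc_axioms)
 obtain n where n: "\<And>r. r\<in>ipow \<mm> n ==> r *. z = \<zero>\<^sub>M" using torsion[OF zc] by auto
 have "V e (Suc (n + e)) z" for e unfolding V_def
 proof (intro conjI allI impI ballI zc z(2))
  fix i r assume i: "i\<le>e" and r: "r\<in>\<mm>"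
  \<comment> \<open>Of the exponent \<open>n + e + 1\<close>, moving \<open>i\<close> Frobenius
    steps outside leaves at least \<open>n + 1\<close>; then \<open>r^(p^k)\<close> is in the power
    that kills \<open>z\<close>.\<close>
  define k where "k = Suc (n + e) - i"
  have k: "p ^ k * p ^ i = p ^ Suc (n + e)" using i by (simp add: k_def flip: power_add)
  have "k\<ge>n" using i by (simp add: k_def)
  also have "k < p ^ k" by (rule power_gt_expt) (use p_gt_1 in simp)
  finally have "r[^](p ^ k)\<in>ipow \<mm> n" using ipow_pow[OF m_ideal r] ipow_antimono[OF m_ideal] by (meson less_imp_le_nat subsetD)
  hence "(F ^^ i) (r[^](p ^ k) *. z) = \<zero>\<^sub>M" using n Fp_zero by simp
  thus "r[^](p ^ Suc (n + e)) *. (F ^^ i) z = \<zero>\<^sub>M"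
   using Fp_smult[OF nat_pow_closed[OF m_carr[OF r]] zc] by (simp only: nat_pow_pow[OF m_carr[OF r]] k)
 qed
 moreover have "\<exists>b. z\<in>S (Suc (n + e)) b" for e by (rule S_all[OF zj]) simp
 ultimately obtain J u where u: "\<And>e. V e J u" using common_element by metis
 have uc: "u\<in>carrier M" "u\<noteq>\<zero>\<^sub>M" using u by (auto simp: V_def)
 have "(F ^^ i) u\<in>soc" for i unfolding soc_def
 proof (intro CollectI conjI ballI)
  show "(F ^^ i) u\<in>carrier M" by (rule Fp_closed[OF uc(1)])
  fix r assume r: "r\<in>\<mm>"
  show "r *. (F ^^ i) u = \<zero>\<^sub>M"
  proof (rule Fp_inj[of _ J])
   show "r *. (F ^^ i) u\<in>carrier M" using m_carr[OF r] Fp_closed[OF uc(1)] by simp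
   show "(F ^^ J) (r *. (F ^^ i) u) = \<zero>\<^sub>M"
    unfolding Fp_smult[OF m_carr[OF r] Fp_closed[OF uc(1)]] Fp_comp using u[of "J + i"] r by (simp add: V_def)
  qed
 qed
 thus ?thesis using uc by auto
qed

text \<open>The spaces \<open>W e\<close> of socle elements with \<open>e\<close> further images in
  the socle stabilise, and the final one is mapped into itself by \<open>F\<close>. The spans of its
  Frobenius images descend inside the socle and stabilise too; an element of the last span is in all
  spans of the module.\<close>

lemma socle_to_stable:
 assumes ne: "\<And>e. \<exists>u\<in>soc. u\<noteq>\<zero>\<^sub>M \<and> (F ^^ e) u\<in>soc" shows "\<exists>z\<in>stable. z\<noteq>\<zero>\<^sub>M"
proof -
 define W where "W e = {u\<in>soc. \<forall>i\<le>e. (F ^^ i) u\<in>soc}" for e :: nat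
 have "ksub (W e)" for e unfolding ksub_def
 proof (intro conjI ballI)
  show "W e\<subseteq>carrier M" by (auto simp: W_def soc_def)
  show "\<zero>\<^sub>M\<in>W e" using ksubD(2)[OF soc_ksub] Fp_zero by (simp add: W_def)
  show "x +. y\<in>W e" if "x\<in>W e" "y\<in>W e" for x y using that ksubD(3)[OF soc_ksub] Fp_add socD(1) by (simp add: W_def)
  show "c *. x\<in>W e" if "c\<in>K" "x\<in>W e" for c x using that ksubD(4)[OF soc_ksub] Fp_smult socD(1) Kc K_pow by (simp add: W_def)
 qed
 moreover have "W e\<subseteq>soc" "W (Suc e)\<subseteq>W e" for e by (auto simp: W_def)
 ultimately obtain n where n: "\<And>k. k\<ge>n ==> W k = W n" using socle_dcc by blast
 have WF: "F u\<in>W n" if "u\<in>W n" for u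
 proof -
  have "u\<in>W (Suc n)" using n[of "Suc n"] that by simp
  hence h: "(F ^^ i) u\<in>soc" if "i\<le>Suc n" for i using that by (simp add: W_def)
  have "(F ^^ i) (F u)\<in>soc" if "i\<le>n" for i using h[of "Suc i"] that by (simp add: funpow_swap1)
  thus ?thesis using h[of 1] by (simp add: W_def)
 qed
 have WFj: "(F ^^ j) u\<in>W n" if "u\<in>W n" for j u using that by (induction j) (auto intro: WF)
 define T where "T j = kspan ((F ^^ j) ` W n)" for j
 have Wc: "W n\<subseteq>carrier M" by (auto simp: W_def soc_def)
 have "ksub (T j)" for j unfolding T_def by (rule ksub_kspan) (use Wc Fp_closed in auto)
 moreover have "T j\<subseteq>soc" for j unfolding T_def by (rule kspan_least[OF soc_ksub]) (use WFj in \<open>auto simp: W_def\<close>)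
 moreover have "T (Suc j)\<subseteq>T j" for j unfolding T_def by (rule kspan_mono) (use WF in \<open>auto simp: funpow_swap1 image_iff\<close>)
 ultimately obtain m where m: "\<And>k. k\<ge>m ==> T k = T m" using socle_dcc by blast
 obtain u where u: "u\<in>soc" "u\<noteq>\<zero>\<^sub>M" "(F ^^ n) u\<in>soc" using ne by auto
 have "u\<in>W n" unfolding W_def using u soc_desc[OF socD(1)[OF u(1)] u(3)] by auto
 hence zT: "(F ^^ m) u\<in>T m" unfolding T_def by (intro kspan_self) auto
 have "(F ^^ m) u\<in>kspan ((F ^^ j) ` carrier M)" for j
 proof -
  have "T m\<subseteq>T j" using m[of j] lift_Suc_antimono_le[of T j m] \<open>\<And>j. T (Suc j) \<subseteq> T j\<close> by (cases "m\<le>j") auto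
  also have "\<dots>\<subseteq>kspan ((F ^^ j) ` carrier M)" unfolding T_def by (intro kspan_mono image_mono Wc)
  finally show ?thesis using zT by auto
 qed
 hence "(F ^^ m) u\<in>stable" by (simp add: stable_def)
 moreover have "(F ^^ m) u\<noteq>\<zero>\<^sub>M" using Fp_inj[OF socD(1)[OF u(1)]] u(2) by auto
 ultimately show ?thesis by auto
qed

lemma unstable_iff: "F_unstable_module R M F \<longleftrightarrow> stable = {\<zero>\<^sub>M}"
proof -
 have "(F ^^ j) ` carrier M\<subseteq>carrier M" for j using Fp_closed by auto
 hence z: "\<zero>\<^sub>M\<in>stable" using ksubD(2)[OF ksub_kspan] by (simp add: stable_def)
 have "u = \<zero>\<^sub>M" if "F_unstable_module R M F" "u\<in>carrier M" "\<forall>i. (F ^^ i) u\<in>soc" for u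
  using that unfolding unstable_iff_socle by (metis funpow_0)
 thus ?thesis using z stable_to_socle socle_to_stable unfolding unstable_iff_socle by blast
qed

end

section \<open>Return to the cohomology of the ring\<close>

context frob_module
begin

lemma ksub_submodule: "ksub V \<longleftrightarrow> submodule V (R\<lparr>carrier := K\<rparr>) M"
proof
 assume V: "ksub V"
 have "inv\<^bsub>add_monoid M\<^esub> x\<in>V" if x: "x\<in>V" for x
 proof -
  have xc: "x\<in>carrier M" by (rule ksubD(1)[OF V x])
  have "\<ominus>\<^bsub>M\<^esub> x = (\<ominus> \<one>) *. x" using smult_l_minus xc by simp
  thus ?thesis using ksubD(4)[OF V subringE(5)[OF Ks subringE(3)[OF Ks]] x] by (simp add: a_inv_def)
 qed
 thus "submodule V (R\<lparr>carrier := K\<rparr>) M" by (intro submodule.intro subgroup.intro submodule_axioms.intro) (use ksubD[OF V] in auto)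
next
 assume V: "submodule V (R\<lparr>carrier := K\<rparr>) M"
 note s = submodule.axioms(1)[OF V]
 show "ksub V" unfolding ksub_def using subgroup.subset[OF s] subgroup.one_closed[OF s] subgroup.m_closed[OF s] submodule.smult_closed[OF V] by auto
qed

lemma stable_part_eq: "stable_part R K M F = (\<Inter>j\<in>{1..}. kspan ((F ^^ j) ` carrier M))"
 unfolding stable_part_def field_span_def kspan_def ksub_submodule ..

end

context noeth_local_p
begin

text \<open>The socle of \<open>R / (x\<^sub>1\<^sup>N, \<dots>, x\<^sub>d\<^sup>N)\<close> comes from that of \<open>R / (x\<^sub>1, \<dots>, x\<^sub>d)\<close> through multiplication by the
 power \<open>N - 1\<close> of the product of the parameters.\<close>
lemma socle_lift:
 assumes reg: "regseq xs" and "finite A" "A\<subseteq>{..<length xs}" "\<And>j. e j > 0" "a\<in>\<R>" "\<And>j. j\<in>A ==> xs ! j\<otimes>a\<in>pI xs e"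
 shows "\<exists>b\<in>\<R>. a\<ominus>(\<Otimes>j\<in>A. xs ! j[^](e j - 1))\<otimes>b\<in>pI xs e" using assms(2-)
proof (induction A arbitrary: e a)
 case (empty e a)
 thus ?case using idl_zero[OF pI_ideal[OF reg]] by (intro bexI[of _ a]) (simp_all add: a_minus_def r_neg)
next
 case (insert i A e a)
 note prems = insert.prems and xc = regseq_carr[OF reg] and I = pI_ideal[OF reg]
 have i: "i < length xs" "A\<subseteq>{..<length xs}" using prems(1) by auto
 define m where "m = e i - 1"
 \<comment> \<open>The exponent is split in two ways, to cancel either \<open>x_i\<close> or its
   power \<open>m\<close>. For exponent one, \<open>m\<close> is zero and the ideal with that
   exponent is the whole ring.\<close>
 have em: "e(i := 1 + m) = e" "e(i := m + 1) = e" using prems(2) by (auto simp: m_def)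
 let ?y = "xs ! i[^]m"
 define P where "P = (\<Otimes>j\<in>A. xs ! j[^](e j - 1))"
 have yc: "?y\<in>\<R>" using xc[OF i(1)] by simp
 have f: "(\<lambda>j. xs ! j[^](e j - 1))\<in>A\<rightarrow>\<R>" using xc i(2) by auto
 note Pc = finprod_closed[OF f, folded P_def]
 have up: "?y\<otimes>c\<in>pI xs e \<longleftrightarrow> c\<in>pI xs (e(i := 1))" if "c\<in>\<R>" for c
  using var_iff[of xs i e c m 1, OF reg i(1) prems(2) that] unfolding em .
 have "xs ! i[^](1::nat)\<otimes>a\<in>pI xs (e(i := 1 + m))" unfolding em using prems(4) xc[OF i(1)] by simp
 hence "a\<in>pI xs (e(i := m))" using var_iff[of xs i e a 1 m, OF reg i(1) prems(2,3)] by blast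
 moreover have "pI xs (e(i := m))\<subseteq>adj (pI xs e) ?y"
 proof (rule genideal_minimal[OF adj_ideal[OF I yc] image_subsetI])
  fix j assume "j\<in>{..<length xs}"
  thus "xs ! j[^]((e(i := m)) j)\<in>adj (pI xs e) ?y"
   using adj_self[OF I yc] subsetD[OF adjm_sub[OF I oneideal yc] pI_self[OF reg]] by (cases "j = i") auto
 qed
 ultimately obtain w b where w: "w\<in>pI xs e" "b\<in>\<R>" "a = w\<oplus>b\<otimes>?y" using adjD by blast
 note wc = idl_carr[OF I w(1)]
 have "xs ! j\<otimes>b\<in>pI xs (e(i := 1))" if j: "j\<in>A" for j
 proof -
  have jc: "xs ! j\<in>\<R>" using xc i(2) j by auto
  have "xs ! j\<otimes>a\<ominus>xs ! j\<otimes>w\<in>pI xs e" using idl_minus[OF I _ idl_l[OF I w(1) jc]] prems(4) j by simp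
  moreover have "xs ! j\<otimes>a\<ominus>xs ! j\<otimes>w = ?y\<otimes>(xs ! j\<otimes>b)" unfolding w(3) using wc w(2) jc yc by algebra
  ultimately show ?thesis using up jc w(2) by simp
 qed
 hence "\<exists>c\<in>\<R>. b\<ominus>(\<Otimes>j\<in>A. xs ! j[^]((e(i := 1)) j - 1))\<otimes>c\<in>pI xs (e(i := 1))"
  by (intro insert.IH i(2) w(2)) (use prems(2) in auto)
 moreover have "(\<Otimes>j\<in>A. xs ! j[^]((e(i := 1)) j - 1)) = P" unfolding P_def by (rule finprod_cong') (use f insert.hyps(2) in auto)
 ultimately obtain c where c: "c\<in>\<R>" "b\<ominus>P\<otimes>c\<in>pI xs (e(i := 1))" by auto
 have "w\<oplus>?y\<otimes>(b\<ominus>P\<otimes>c)\<in>pI xs e" using idl_add[OF I w(1)] up c Pc w(2) by simp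
 moreover have "w\<oplus>?y\<otimes>(b\<ominus>P\<otimes>c) = a\<ominus>(?y\<otimes>P)\<otimes>c" unfolding w(3) using wc w(2) c(1) Pc yc by algebra
 moreover have "(\<Otimes>j\<in>insert i A. xs ! j[^](e j - 1)) = ?y\<otimes>P" unfolding m_def P_def
  by (rule finprod_insert[OF insert.hyps f]) (use xc[OF i(1)] in simp)
 ultimately show ?case using c(1) by auto
qed

end

context sop_cech
begin

lemma soc_level_1:
 assumes x: "x\<in>carrier Htop" "\<And>r. r\<in>\<mm> ==> r\<odot>\<^bsub>Htop\<^esub>x = \<zero>\<^bsub>Htop\<^esub>" shows "\<exists>b\<in>\<R>. x = zeta 1 b"
proof -
 interpret M: module R Htop by (rule Htop_module)
 obtain N a where a: "N > 0" "a\<in>\<R>" "x = zeta N a" using zeta_common[OF x(1,1)] by metis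
 have "xs ! j\<otimes>a\<in>pI xs (\<lambda>_. N)" if "j\<in>{..<d}" for j
 proof -
  have "xs ! j\<in>\<mm>" using sp that by (auto simp: sop_def)
  thus ?thesis using zeta_zero_iff x(2)[of "xs ! j"] a that by (simp add: zeta_smult set_pw)
 qed
 then obtain b where b: "b\<in>\<R>" "a\<ominus>mpow top (N - 1)\<otimes>b\<in>Idl (set (pw N xs))"
  using socle_lift[of xs "{..<d}" "\<lambda>_. N" a, OF reg] a(1,2) by (auto simp: set_pw mpow_def top_def)
 let ?b = "mpow top (N - 1)\<otimes>b"
 have bc: "?b\<in>\<R>" using b(1) mpow_carr[OF top_sub] by simp
 have "zeta N (a\<ominus>?b) = \<zero>\<^bsub>Htop\<^esub>" using zeta_zero_iff[OF a(1)] b(2) a(2) bc by simp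
 moreover have "a = (a\<ominus>?b)\<oplus>?b" using a(2) bc by algebra
 hence "zeta N a = zeta N (a\<ominus>?b)\<oplus>\<^bsub>Htop\<^esub>zeta N ?b" using zeta_add a(2) bc by simp
 ultimately have "x = zeta N ?b" using a(3) zeta_carr[OF bc] by simp
 also have "\<dots> = zeta 1 b" using zeta_lift[OF b(1), of 1 "N - 1"] a(1) by simp
 finally show ?thesis using b(1) by auto
qed

text \<open>Subspaces of the socle are submodules, as a ring element acts on the socle through its
  residue in \<open>K\<close>. Since the socle lives at level one, they correspond to ideals above
  the parameter ideal, for which \<open>dcc_primary\<close> gives the chain condition.\<close>

lemma Htop_frob_module_dcc:
 assumes FI: FI and K: "coeff_set K" shows "frob_module_dcc R \<mm> p Htop (Ftop p) K"
proof -
 interpret M: module R Htop by (rule Htop_module)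
 interpret frob_module R \<mm> p Htop "Ftop p" K
 proof (intro frob_module.intro frob_module_axioms.intro K Htop_frobenius_module[OF FI])
  show "\<exists>n. \<forall>r\<in>ipow \<mm> n. r\<odot>\<^bsub>Htop\<^esub>x = \<zero>\<^bsub>Htop\<^esub>" if x: "x\<in>carrier Htop" for x
  proof -
   obtain N a where a: "N > 0" "a\<in>\<R>" "x = zeta N a" using zeta_common[OF x x] by metis
   have s: "sop (pw N xs)" by (rule sop_ispow[OF pw_ispow[OF a(1)] sp])
   obtain n where n: "ipow \<mm> n\<subseteq>Idl (set (pw N xs))" using sop_power[OF s] by auto
   have I: "ideal (Idl (set (pw N xs))) R" by (rule genideal_ideal) (use s m_sub in \<open>auto simp: sop_def\<close>)
   have "r\<odot>\<^bsub>Htop\<^esub>x = \<zero>\<^bsub>Htop\<^esub>" if r: "r\<in>ipow \<mm> n" for r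
    using zeta_zero_iff idl_r[OF I subsetD[OF n r] a(2)] idl_carr[OF ipow_ideal[OF m_ideal] r] a by (simp add: zeta_smult)
   thus ?thesis by auto
  qed
 qed
 show ?thesis
 proof (intro frob_module_dcc.intro frob_module_dcc_axioms.intro frob_module_axioms)
  fix T :: "nat\<Rightarrow>_" assume T: "\<And>n. ksub (T n)" "\<And>n. T n\<subseteq>soc" "\<And>n. T (Suc n)\<subseteq>T n"
  define J where "J n = {a\<in>\<R>. zeta 1 a\<in>T n}" for n
  have p1: "pw 1 xs = xs" unfolding pw_def using xs_carr by (intro map_idI) auto
  have J: "ideal (J n) R" for n
  proof (rule idealI')
   show "\<zero>\<in>J n" using ksubD(2)[OF T(1)] zeta_zero by (simp add: J_def)
   show "a\<oplus>b\<in>J n" if "a\<in>J n" "b\<in>J n" for a b using that ksubD(3)[OF T(1), of "zeta 1 a" n "zeta 1 b"] by (simp add: J_def zeta_add)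
   show "r\<otimes>a\<in>J n" if ar: "a\<in>J n" "r\<in>\<R>" for a r
   proof -
    have a: "a\<in>\<R>" "zeta 1 a\<in>T n" using ar by (auto simp: J_def)
    obtain c where c: "c\<in>K" "r\<ominus>c\<in>\<mm>" using K ar(2) by (auto simp: coeff_set_def)
    note cc = Kc[OF c(1)]
    have "zeta 1 ((r\<ominus>c)\<otimes>a) = \<zero>\<^bsub>Htop\<^esub>" using T(2) a c(2) ar(2) cc by (auto simp: soc_def simp flip: zeta_smult)
    moreover have "r\<otimes>a = (r\<ominus>c)\<otimes>a\<oplus>c\<otimes>a" using ar(2) cc a(1) by algebra
    ultimately have "zeta 1 (r\<otimes>a) = zeta 1 (c\<otimes>a)"
     using zeta_add[of "(r\<ominus>c)\<otimes>a" "c\<otimes>a" 1] ar(2) cc a(1) zeta_carr by simp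
    thus ?thesis using ksubD(4)[OF T(1) c(1) a(2)] a(1) ar(2) cc by (simp add: J_def zeta_smult)
   qed
  qed (auto simp: J_def)
  have "Idl (set xs)\<subseteq>J n" for n
  proof
   fix a assume a: "a\<in>Idl (set xs)"
   show "a\<in>J n" using zeta_zero_iff[of 1 a, unfolded p1] idl_carr[OF genideal_ideal[OF xs_carr] a] a ksubD(2)[OF T(1), of n] by (simp add: J_def)
  qed
  moreover have "Q = \<mm>" if "primeideal Q R" "Idl (set xs)\<subseteq>Q" for Q
   using sp that order_trans[OF genideal_self[OF xs_carr] that(2)] by (auto simp: sop_def)
  moreover have "J (Suc n)\<subseteq>J n" for n using T(3) by (auto simp: J_def)
  ultimately obtain n0 where n0: "\<And>n. n\<ge>n0 ==> J n = J n0" using dcc_primary[OF genideal_ideal[OF xs_carr], of J] J by metis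
  have "T n = zeta 1 ` J n" for n
  proof
   show "T n\<subseteq>zeta 1 ` J n"
   proof
    fix x assume x: "x\<in>T n"
    then obtain b where "b\<in>\<R>" "x = zeta 1 b" using soc_level_1 socD T(2) by blast
    thus "x\<in>zeta 1 ` J n" using x by (auto simp: J_def)
   qed
  qed (auto simp: J_def)
  thus "\<exists>n. \<forall>k\<ge>n. T k = T n" using n0 by metis
 qed
qed

lemma stable_part_trivial:
 assumes i: "i\<noteq>d" and K: "coeff_set K" shows "stable_part R K (H i) (cech_cohomology_frobenius p R xs i) = {\<zero>\<^bsub>H i\<^esub>}"
proof -
 note c = H_trivial_regseq[OF i]
 have Kc: "K\<subseteq>\<R>" using K subringE(1) by (auto simp: coeff_set_def)
 have "subgroup {\<zero>\<^bsub>H i\<^esub>} (add_monoid (H i))"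
 proof (rule subgroup.intro)
  have "(THE y. y = \<zero>\<^bsub>H i\<^esub> \<and> \<zero>\<^bsub>H i\<^esub> \<oplus>\<^bsub>H i\<^esub> y = \<zero>\<^bsub>H i\<^esub> \<and> y \<oplus>\<^bsub>H i\<^esub> \<zero>\<^bsub>H i\<^esub> = \<zero>\<^bsub>H i\<^esub>) = \<zero>\<^bsub>H i\<^esub>"
   by (rule the_equality) (simp_all add: H_zero_ops(2))
  thus "inv\<^bsub>add_monoid (H i)\<^esub> x\<in>{\<zero>\<^bsub>H i\<^esub>}" if "x\<in>{\<zero>\<^bsub>H i\<^esub>}" for x
   using that c by (simp add: m_inv_def)
 qed (use c H_zero_ops(2) in auto)
 hence sub: "submodule {\<zero>\<^bsub>H i\<^esub>} (R\<lparr>carrier := K\<rparr>) (H i)"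
  using H_zero_ops(1) Kc by (intro submodule.intro submodule_axioms.intro) auto
 have "field_span R K (H i) {\<zero>\<^bsub>H i\<^esub>} = {\<zero>\<^bsub>H i\<^esub>}" unfolding field_span_def using sub by auto
 thus ?thesis unfolding stable_part_def c by (simp add: F_zero_pow)
qed

end

context complete_local_p
begin

text \<open>The equivalence holds for each coefficient field separately; since one exists,
  quantifying over them changes nothing.\<close>

theorem stable_part_iff_Fstable:
 assumes CM FI
 shows "(\<exists>K. coefficient_field K R \<and> (\<exists>h. stable_part R K (local_cohomology R h) (local_cohomology_frobenius p R h)\<noteq>{\<zero>\<^bsub>local_cohomology R h\<^esub>}))
  \<longleftrightarrow> F_stable p R"
proof -
 let ?xs = "chosen_parameters R"
 interpret X: sop_cech R \<mm> p ?xs by (rule sop_cech[OF assms(1) chosen_sop[OF assms(1)]])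
 have "(\<exists>h. stable_part R K (X.H h) (cech_cohomology_frobenius p R ?xs h)\<noteq>{\<zero>\<^bsub>X.H h\<^esub>}) \<longleftrightarrow> F_stable p R" if K: "coeff_set K" for K
 proof -
  interpret frob_module_dcc R \<mm> p X.Htop "X.Ftop p" K by (rule X.Htop_frob_module_dcc[OF assms(2) K])
  have "stable_part R K X.Htop (X.Ftop p)\<noteq>{\<zero>\<^bsub>X.Htop\<^esub>} \<longleftrightarrow> F_stable p R"
   unfolding Fstable_top[OF assms(1) refl] unstable_iff stable_part_eq stable_def ..
  thus ?thesis using X.stable_part_trivial[OF _ K] by metis
 qed
 thus ?thesis unfolding local_cohomology_def local_cohomology_frobenius_def using coeff_set_exists coeff_set_field coeff_set_of_field by metis
qed

end

section \<open>The two loci\<close>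

context local_completion_p
begin

lemma B_complete_local: "complete_local_p B (M 1) p"
proof (intro complete_local_p.intro complete_local_p_axioms.intro)
 show "noeth_local_p B (M 1) p" ..
 show "\<exists>z\<in>carrier B. \<forall>n. z\<ominus>\<^bsub>B\<^esub>s n\<in>BL.ipow (M 1) n"
  if "\<And>k. s k\<in>carrier B" "\<And>k. s (Suc k)\<ominus>\<^bsub>B\<^esub>s k\<in>BL.ipow (M 1) k" for s
  using cauchy[of s] that unfolding M_ipow[symmetric] by simp
qed

lemma Fstable_completion:
 assumes CM FI
 shows "F_stable p R \<longleftrightarrow> (\<exists>K. coefficient_field K B \<and> (\<exists>h. stable_part B K (local_cohomology B h) (local_cohomology_frobenius p B h)\<noteq>{\<zero>\<^bsub>local_cohomology B h\<^esub>}))"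
proof -
 interpret C: complete_local_p B "M 1" p by (rule B_complete_local)
 obtain ys where ys: "sop ys" using CM_sop_exists[OF assms(1)] by auto
 have B: "BL.CM" "BL.sop (map io ys)" using io_sop[OF assms(1) ys] by auto
 have "F_stable p R \<longleftrightarrow> (\<forall>e. BL.sigma e (io ` set ys))" using Fstable_iff[OF assms ys] sigma_completion[OF ys] by simp
 also have "\<dots> \<longleftrightarrow> F_stable p B" using BL.Fstable_iff[OF B(1) B_FI[OF assms] B(2)] by simp
 finally show ?thesis using C.stable_part_iff_Fstable[OF B(1) B_FI[OF assms]] by simp
qed

end

theorem proposition3p11:
  fixes R :: "('a, 'm) ring_scheme" and p :: nat
  assumes "Factorial_Ring.prime p"
    and "has_characteristic R p"
    and "cohen_macaulay_local_ring R"
    and "F_injective p R"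
  shows "F_stable_locus p R = nonzero_stable_part_locus p R"
proof -
 have nl: "noeth_local R (max_ideal R)" using assms(3) by (intro noeth_local_of) (simp add: cohen_macaulay_local_ring_def)
 interpret N: noeth_local R "max_ideal R" by (rule nl)
 have "[p] \<cdot>\<^bsub>R\<^esub> \<one>\<^bsub>R\<^esub> = \<zero>\<^bsub>R\<^esub>" using assms(2) by (simp add: has_characteristic_def)
 then interpret noeth_local_p R "max_ideal R" p by (intro noeth_local_p.intro nl char_p_cring.intro char_p_cring_axioms.intro assms(1) N.is_cring)
 have CM: N.CM using assms(3) N.CM_iff by simp
 have FI: FI using assms(4) Finj_iff[OF CM] by simp
 have "F_stable p (localization_at_prime R P) \<longleftrightarrow> (let A = completion (localization_at_prime R P) in
   \<exists>K. coefficient_field K A \<and> (\<exists>h. stable_part A K (local_cohomology A h) (local_cohomology_frobenius p A h)\<noteq>{\<zero>\<^bsub>local_cohomology A h\<^esub>}))"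
  if P: "primeideal P R" for P
 proof -
  interpret L: loc_prime R "max_ideal R" p P by (intro loc_prime.intro loc_prime_axioms.intro P) unfold_locales
  interpret C: local_completion_p L.A L.mA p by (intro local_completion_p.intro local_completion.intro L.A_noeth_local) unfold_locales
  have "max_ideal L.A = L.mA" by (rule L.AL.max_ideal_eq)
  hence "completion (localization_at_prime R P) = C.B" by (simp add: completion_def localization_at_prime_def)
  moreover have "L.AL.CM" "L.AL.FI" using L.A_CM_FI[OF CM FI] by auto
  ultimately show ?thesis using C.Fstable_completion by (simp add: Let_def localization_at_prime_def)
 qed
 thus ?thesis unfolding F_stable_locus_def nonzero_stable_part_locus_def by blast
qed

end
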